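(* Let $\varphi\colon G\times M\to M$ be a left action of a Lie group $G$ on an analytic manifold $M$ (continuous in $G$) that is sated and analytic in $M$. Let $I\subseteq\mathbb{R}$ be an open interval and $\gamma\colon I\to M$ an analytic immersion that is free but not itself a free segment. Then exactly one of the following holds: (i) $\gamma$ admits a unique $\tau$-decomposition; (ii) $\gamma$ admits a compact maximal interval. In case (ii), $\gamma$ is either positive or negative (exactly one of the two), and $\gamma$ admits a unique $A$-decomposition for each compact maximal interval $A\subseteq I$.
   Context: Intervals are connected subsets of $\mathbb{R}$ with non-empty interior. $M$ is a finite-dimensional Hausdorff real-analytic manifold without boundary (second countability not assumed); $G$ is a Lie group (same conventions); $\varphi$, $(g,x)\mapsto g\cdot x$, is a left action with $g\mapsto g\cdot x$ continuous for each $x\in M$. $\varphi$ is analytic in $M$ if $x\mapsto g\cdot x$ is analytic for each $g\in G$. $\varphi$ is sated if for mutually different $x,y,z\in M$ there is no sequence $\{g_n\}\subseteq G$ with $\lim_n g_n\cdot y=x=\lim_n g_n\cdot z$. A curve $\gamma\colon D\to M$ on an interval is analytic (an analytic immersion; an analytic embedding) if it is the restriction of an analytic map (analytic immersion; analytic immersion that is a homeomorphism onto its image) on an open interval containing $D$. An analytic diffeomorphism $\rho\colon D\to D'$ between intervals is a bijection that extends to an analytic diffeomorphism between open intervals; it is positive (negative) if it is strictly increasing (decreasing). $\overline\rho$ denotes the unique maximal analytic immersive extension of $\rho$ to an open interval. $(g\cdot\gamma)(t)=g\cdot\gamma(t)$, $G_\gamma=\{g\in G: g\cdot\gamma=\gamma\}$,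 and $[g]=gG_\gamma\in G/G_\gamma$. For analytic immersions write $\gamma\sim_\circ\gamma'$ if $\gamma(J)=\gamma'(J')$ for non-empty open intervals $J\subseteq\mathrm{dom}[\gamma]$, $J'\subseteq\mathrm{dom}[\gamma']$ on which $\gamma,\gamma'$ are embeddings. An analytic immersion $\delta$ is a free segment if for all $g\in G$: $g\cdot\delta\sim_\circ\delta$ implies $g\in G_\delta$. An analytic curve is free if its restriction to some interval is a free segment. For $\gamma\colon I\to M$ an analytic immersion, an interval $A\subseteq I$ is free if $\gamma|_A$ is a free segment, and maximal if it is free and not properly contained in a free interval $A'\subseteq I$. Relation $\leadsto$: let $\tilde\gamma\colon\tilde D\to M$, $\gamma\colon D\to M$ be analytic immersions and $\mu\colon\tilde D\supseteq\mathrm{dom}[\mu]\to\mathrm{im}[\mu]\subseteq D$ an analytic diffeomorphism between intervals. $\tilde\gamma\leadsto\gamma$ w.r.t. $\mu$ means $\tilde\gamma|_{\mathrm{dom}[\mu]}=\gamma\circ\mu$ and one of: (a) $\tilde D=(i',\tau]$, $D=[\tau,i)$, $\mu(\tau)=\tau$, and $\mathrm{dom}[\mu]=\tilde D$ or $\mathrm{im}[\mu]=D$; (b) $\tilde D=\mathrm{dom}[\mu]$ and $D=\mathrm{im}[\mu]$ are compact; (c) $\tilde D$ is compact, $\mathrm{dom}[\mu]\subset\tilde D$ and $D=\mathrm{im}[\mu]$ are half-open, and $\mathrm{dom}[\mu]$ contains an endpoint of $\tilde D$. In cases (b),(c) write $\leadsto_+$ ($\leadsto_-$) if $\mu$ is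 positive (negative). ($\mu$ is uniquely determined by these conditions.) Let $I=(i',i)$. A $\tau$-decomposition of $\gamma$ consists of $\tau\in I$ such that $(i',\tau]$ and $[\tau,i)$ are maximal intervals and the only ones, together with a class $[g]\neq[e]$ in $G/G_\gamma$ with $g\cdot\gamma|_{(i',\tau]}\leadsto\gamma|_{[\tau,i)}$ w.r.t. some $\mu$, such that: whenever $g'\cdot\gamma|_J=\gamma\circ\rho$ for $g'\in G$ and an analytic diffeomorphism $\rho\colon(i',\tau]\supseteq J\to J'\subseteq I$ ($J,J'$ open intervals), then either $[g']=[e]$ and $\overline\rho|_{(i',\tau]}=\mathrm{id}$, or $[g']=[g]$ and $\overline\rho|_{\mathrm{dom}[\mu]}=\mu$. Let $A\subseteq I$ be a compact maximal interval. An $A$-decomposition of $\gamma$ is a pair $(\{a_n\}_{n\in\mathfrak n},\{[g_n]\}_{n\in\mathfrak n})$ with $\mathfrak n=\{n\in\mathbb{Z}_{\neq0}:\mathfrak n_-\le n\le\mathfrak n_+\}$ for some $-\infty\le\mathfrak n_-<0<\mathfrak n_+\le\infty$, $a_n\in I$ strictly increasing in $n$, $g_n\in G$, $A=[a_{-1},a_1]$, $[g_{\pm1}]\ne[e]$, such that, with $A_0=[a_{-1},a_1]$, $A_n=[a_{n-1},a_n]$ for $\mathfrak n_-<n\le-1$, $A_n=[a_n,a_{n+1}]$ for $1\le n<\mathfrak n_+$, $A_{\mathfrak n_-}=(i',a_{\mathfrak n_-}]$ if $\mathfrak n_-\ne-\infty$, $A_{\mathfrak n_+}=[a_{\mathfrak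 n_+},i)$ if $\mathfrak n_+\neq\infty$, one has $I=\bigcup_{n\in\mathfrak n\cup\{0\}}A_n$, $g_n\cdot\gamma|_A\leadsto\gamma|_{A_n}$ w.r.t. some $\mu_n$ for all $n\in\mathfrak n$, and (with $\mu_0=\mathrm{id}_A$, $g_0=e$): whenever $g\cdot\gamma|_J=\gamma\circ\rho$ for $g\in G$ and an analytic diffeomorphism $\rho\colon A\supseteq J\to J'\subseteq I$ ($J,J'$ open intervals), then there is a unique $n\in\mathfrak n\cup\{0\}$ with $[g]=[g_n]$ and $\overline\rho|_{\mathrm{dom}[\mu_n]}=\mu_n$. A compact maximal interval $A$ is positive (negative) if in its $A$-decomposition $g_{1}\cdot\gamma|_A\leadsto_+\gamma|_{A_{1}}$ and $g_{-1}\cdot\gamma|_A\leadsto_+\gamma|_{A_{-1}}$ (resp. both with $\leadsto_-$). $\gamma$ is positive (negative) if it admits a positive (negative) compact maximal interval. *)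

theory Defs
  imports "HOL-Analysis.Analysis" "HOL-Algebra.Group_Action" "HOL-Library.Extended"
begin

section \<open>Real-analytic manifolds and Lie groups\<close>

text \<open>
  The model space of dimension \<open>n\<close> is \<^term>\<open>Euclidean_space n\<close>, the sequences \<open>nat \<Rightarrow> real\<close> that
  vanish from index \<open>n\<close> on. The dimension is a natural number rather than a type, so that
  dimension 0 (discrete Lie groups) is included.

  A map into the model space is analytic if each coordinate has a local expansion into an
  (unconditionally convergent) power series; the sum runs over the multi-indices supported on
  \<open>{..<n}\<close>. The set \<open>S\<close> is meant to be open in \<^term>\<open>Euclidean_space n\<close>.
\<close>

definition real_analytic_on ::
    "nat \<Rightarrow> nat \<Rightarrow> (nat \<Rightarrow> real) set \<Rightarrow> ((nat \<Rightarrow> real) \<Rightarrow> (nat \<Rightarrow> real)) \<Rightarrow> bool" where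
  "real_analytic_on n m S f \<longleftrightarrow>
    (\<forall>p\<in>S. \<forall>j<m. \<exists>r>0. \<exists>c :: (nat \<Rightarrow> nat) \<Rightarrow> real. \<forall>x\<in>S. (\<forall>i<n. \<bar>x i - p i\<bar> < r) \<longrightarrow>
      ((\<lambda>\<alpha>. c \<alpha> * (\<Prod>i<n. (x i - p i) ^ \<alpha> i)) has_sum f x j) {\<alpha>. \<forall>i\<ge>n. \<alpha> i = 0})"

type_synonym 'a chart = "'a set \<times> ('a \<Rightarrow> nat \<Rightarrow> real)"

definition analytic_atlas :: "nat \<Rightarrow> 'a::topological_space chart set \<Rightarrow> bool" where
  "analytic_atlas n A \<longleftrightarrow>
    (\<forall>(U, u)\<in>A. open U \<and> openin (Euclidean_space n) (u ` U) \<and>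
       homeomorphic_map (top_of_set U) (subtopology (Euclidean_space n) (u ` U)) u) \<and>
    (\<Union>(U, u)\<in>A. U) = UNIV \<and>
    (\<forall>(U, u)\<in>A. \<forall>(V, v)\<in>A.
       real_analytic_on n n (u ` (U \<inter> V)) (\<lambda>p. v (inv_into U u p)))"

text \<open>
  The manifold is the whole type carrying the atlas; \<open>S\<close> is meant to be an open subset of it.
  The atlas need not be maximal: compatible atlases yield the same analytic maps.
\<close>

definition analytic_map ::
    "nat \<Rightarrow> 'a::topological_space chart set \<Rightarrow> nat \<Rightarrow> 'b::topological_space chart set \<Rightarrow>
      'a set \<Rightarrow> ('a \<Rightarrow> 'b) \<Rightarrow> bool" where
  "analytic_map n A m B S f \<longleftrightarrow> continuous_on S f \<and>
    (\<forall>(U, u)\<in>A. \<forall>(V, v)\<in>B.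
       real_analytic_on n m (u ` (U \<inter> S \<inter> f -` V)) (\<lambda>p. v (f (inv_into U u p))))"

definition real_atlas :: "real chart set" where
  "real_atlas = {(UNIV, \<lambda>t i. if i = 0 then t else 0)}"

definition prod_atlas :: "nat \<Rightarrow> 'a chart set \<Rightarrow> 'b chart set \<Rightarrow> ('a \<times> 'b) chart set" where
  "prod_atlas n A B =
    {(U \<times> V, \<lambda>(x, y) i. if i < n then u x i else v y (i - n)) |U u V v. (U, u) \<in> A \<and> (V, v) \<in> B}"

definition lie_group ::
    "('g::t2_space, 'r) monoid_scheme \<Rightarrow> nat \<Rightarrow> 'g chart set \<Rightarrow> bool" where
  "lie_group G n A \<longleftrightarrow> group G \<and> carrier G = UNIV \<and> analytic_atlas n A \<and>
    analytic_map (n + n) (prod_atlas n A A) n A UNIV (\<lambda>(x, y). x \<otimes>\<^bsub>G\<^esub> y) \<and>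
    analytic_map n A n A UNIV (\<lambda>x. inv\<^bsub>G\<^esub> x)"

definition sated ::
    "('g, 'r) monoid_scheme \<Rightarrow> ('g \<Rightarrow> 'm \<Rightarrow> 'm::topological_space) \<Rightarrow> bool" where
  "sated G act \<longleftrightarrow> (\<forall>x y z. x \<noteq> y \<and> y \<noteq> z \<and> x \<noteq> z \<longrightarrow>
    \<not> (\<exists>g :: nat \<Rightarrow> 'g. range g \<subseteq> carrier G \<and>
          (\<lambda>n. act (g n) y) \<longlonglongrightarrow> x \<and> (\<lambda>n. act (g n) z) \<longlonglongrightarrow> x))"

section \<open>Intervals and analytic curves\<close>

definition interval :: "real set \<Rightarrow> bool" where
  "interval D \<longleftrightarrow> connected D \<and> interior D \<noteq> {}"

definition open_interval :: "real set \<Rightarrow> bool" where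
  "open_interval D \<longleftrightarrow> interval D \<and> open D"

text \<open>Half-open intervals may be unbounded on their open side: \<open>[a, \<infinity>)\<close> is half-open.\<close>

definition half_open_interval :: "real set \<Rightarrow> bool" where
  "half_open_interval D \<longleftrightarrow>
    (\<exists>I a. open_interval I \<and> a \<in> I \<and> (D = I \<inter> {a..} \<or> D = I \<inter> {..a}))"

text \<open>
  A curve on an interval \<open>D\<close> is given by \<open>D\<close> and a function \<open>real \<Rightarrow> 'm\<close>, whose values outside of
  \<open>D\<close> are irrelevant.
\<close>

definition open_immersion ::
    "nat \<Rightarrow> 'm::topological_space chart set \<Rightarrow> real set \<Rightarrow> (real \<Rightarrow> 'm) \<Rightarrow> bool" where
  "open_immersion n A J \<gamma> \<longleftrightarrow> open_interval J \<and> analytic_map 1 real_atlas n A J \<gamma> \<and>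
    (\<forall>t\<in>J. \<forall>(V, v)\<in>A. \<gamma> t \<in> V \<longrightarrow> (\<exists>j<n. deriv (\<lambda>s. v (\<gamma> s) j) t \<noteq> 0))"

definition analytic_immersion ::
    "nat \<Rightarrow> 'm::topological_space chart set \<Rightarrow> real set \<Rightarrow> (real \<Rightarrow> 'm) \<Rightarrow> bool" where
  "analytic_immersion n A D \<gamma> \<longleftrightarrow> interval D \<and>
    (\<exists>J \<delta>. D \<subseteq> J \<and> open_immersion n A J \<delta> \<and> (\<forall>t\<in>D. \<delta> t = \<gamma> t))"

definition analytic_embedding ::
    "nat \<Rightarrow> 'm::topological_space chart set \<Rightarrow> real set \<Rightarrow> (real \<Rightarrow> 'm) \<Rightarrow> bool" where
  "analytic_embedding n A D \<gamma> \<longleftrightarrow> interval D \<and>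
    (\<exists>J \<delta>. D \<subseteq> J \<and> open_immersion n A J \<delta> \<and> (\<exists>h. homeomorphism J (\<delta> ` J) \<delta> h) \<and>
       (\<forall>t\<in>D. \<delta> t = \<gamma> t))"

definition analytic_diffeo :: "(real \<Rightarrow> real) \<Rightarrow> real set \<Rightarrow> real set \<Rightarrow> bool" where
  "analytic_diffeo \<rho> D D' \<longleftrightarrow> interval D \<and> interval D' \<and> bij_betw \<rho> D D' \<and>
    (\<exists>J J' \<sigma>. open_interval J \<and> open_interval J' \<and> D \<subseteq> J \<and> D' \<subseteq> J' \<and> bij_betw \<sigma> J J' \<and>
       analytic_map 1 real_atlas 1 real_atlas J \<sigma> \<and>
       analytic_map 1 real_atlas 1 real_atlas J' (inv_into J \<sigma>) \<and>
       (\<forall>t\<in>D. \<sigma> t = \<rho> t))"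

definition immersive_extension ::
    "real set \<Rightarrow> (real \<Rightarrow> real) \<Rightarrow> real set \<Rightarrow> (real \<Rightarrow> real) \<Rightarrow> bool" where
  "immersive_extension J \<rho> K \<sigma> \<longleftrightarrow>
    J \<subseteq> K \<and> open_immersion 1 real_atlas K \<sigma> \<and> (\<forall>t\<in>J. \<sigma> t = \<rho> t)"

definition maximal_extension ::
    "real set \<Rightarrow> (real \<Rightarrow> real) \<Rightarrow> real set \<Rightarrow> (real \<Rightarrow> real) \<Rightarrow> bool" where
  "maximal_extension J \<rho> K \<sigma> \<longleftrightarrow> immersive_extension J \<rho> K \<sigma> \<and>
    (\<forall>K' \<sigma>'. immersive_extension K \<sigma> K' \<sigma>' \<longrightarrow> K' = K)"

text \<open>
  With \<open>\<rho>\<close> given on \<open>J\<close> and \<open>\<mu>\<close> on \<open>X\<close>: the maximal immersive extension of \<open>\<rho>\<close> is defined on all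
  of \<open>X\<close>, and its restriction to \<open>X\<close> is \<open>\<mu>\<close>.
\<close>

definition extends_to ::
    "real set \<Rightarrow> (real \<Rightarrow> real) \<Rightarrow> real set \<Rightarrow> (real \<Rightarrow> real) \<Rightarrow> bool" where
  "extends_to J \<rho> X \<mu> \<longleftrightarrow>
    (\<exists>K \<sigma>. maximal_extension J \<rho> K \<sigma> \<and> X \<subseteq> K \<and> (\<forall>t\<in>X. \<sigma> t = \<mu> t))"

section \<open>Free segments\<close>

definition curve_stabilizer ::
    "('g, 'r) monoid_scheme \<Rightarrow> ('g \<Rightarrow> 'm \<Rightarrow> 'm) \<Rightarrow> real set \<Rightarrow> (real \<Rightarrow> 'm) \<Rightarrow> 'g set" where
  "curve_stabilizer G act D \<gamma> = {g \<in> carrier G. \<forall>t\<in>D. act g (\<gamma> t) = \<gamma> t}"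

text \<open>The class \<open>[g] \<in> G/G\<^sub>\<gamma>\<close>.\<close>

definition stab_class ::
    "('g, 'r) monoid_scheme \<Rightarrow> ('g \<Rightarrow> 'm \<Rightarrow> 'm) \<Rightarrow> real set \<Rightarrow> (real \<Rightarrow> 'm) \<Rightarrow> 'g \<Rightarrow> 'g set" where
  "stab_class G act D \<gamma> g = g <#\<^bsub>G\<^esub> curve_stabilizer G act D \<gamma>"

definition overlap ::
    "nat \<Rightarrow> 'm::topological_space chart set \<Rightarrow>
      real set \<Rightarrow> (real \<Rightarrow> 'm) \<Rightarrow> real set \<Rightarrow> (real \<Rightarrow> 'm) \<Rightarrow> bool" where
  "overlap n A D \<gamma> D' \<gamma>' \<longleftrightarrow>
    (\<exists>J J'. open_interval J \<and> J \<subseteq> D \<and> open_interval J' \<and> J' \<subseteq> D' \<and>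
       analytic_embedding n A J \<gamma> \<and> analytic_embedding n A J' \<gamma>' \<and> \<gamma> ` J = \<gamma>' ` J')"

definition free_segment ::
    "nat \<Rightarrow> 'm::topological_space chart set \<Rightarrow> ('g, 'r) monoid_scheme \<Rightarrow> ('g \<Rightarrow> 'm \<Rightarrow> 'm) \<Rightarrow>
      real set \<Rightarrow> (real \<Rightarrow> 'm) \<Rightarrow> bool" where
  "free_segment n A G act D \<delta> \<longleftrightarrow> analytic_immersion n A D \<delta> \<and>
    (\<forall>g\<in>carrier G. overlap n A D (\<lambda>t. act g (\<delta> t)) D \<delta> \<longrightarrow> g \<in> curve_stabilizer G act D \<delta>)"

definition free_curve ::
    "nat \<Rightarrow> 'm::topological_space chart set \<Rightarrow> ('g, 'r) monoid_scheme \<Rightarrow> ('g \<Rightarrow> 'm \<Rightarrow> 'm) \<Rightarrow>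
      real set \<Rightarrow> (real \<Rightarrow> 'm) \<Rightarrow> bool" where
  "free_curve n A G act D \<gamma> \<longleftrightarrow> (\<exists>D'. interval D' \<and> D' \<subseteq> D \<and> free_segment n A G act D' \<gamma>)"

definition free_interval ::
    "nat \<Rightarrow> 'm::topological_space chart set \<Rightarrow> ('g, 'r) monoid_scheme \<Rightarrow> ('g \<Rightarrow> 'm \<Rightarrow> 'm) \<Rightarrow>
      real set \<Rightarrow> (real \<Rightarrow> 'm) \<Rightarrow> real set \<Rightarrow> bool" where
  "free_interval n A G act I \<gamma> B \<longleftrightarrow> interval B \<and> B \<subseteq> I \<and> free_segment n A G act B \<gamma>"

definition maximal_interval ::
    "nat \<Rightarrow> 'm::topological_space chart set \<Rightarrow> ('g, 'r) monoid_scheme \<Rightarrow> ('g \<Rightarrow> 'm \<Rightarrow> 'm) \<Rightarrow>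
      real set \<Rightarrow> (real \<Rightarrow> 'm) \<Rightarrow> real set \<Rightarrow> bool" where
  "maximal_interval n A G act I \<gamma> B \<longleftrightarrow> free_interval n A G act I \<gamma> B \<and>
    \<not> (\<exists>B'. free_interval n A G act I \<gamma> B' \<and> B \<subset> B')"

section \<open>The relation \<open>\<leadsto>\<close>\<close>

text \<open>In the following definitions \<open>K\<close> is the domain of \<open>\<mu>\<close>, and its image is \<open>\<mu> ` K\<close>.\<close>

definition matching ::
    "nat \<Rightarrow> 'm::topological_space chart set \<Rightarrow>
      real set \<Rightarrow> (real \<Rightarrow> 'm) \<Rightarrow> real set \<Rightarrow> (real \<Rightarrow> 'm) \<Rightarrow> real set \<Rightarrow> (real \<Rightarrow> real) \<Rightarrow> bool" where
  "matching n A D' \<gamma>' D \<gamma> K \<mu> \<longleftrightarrow>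
    analytic_immersion n A D' \<gamma>' \<and> analytic_immersion n A D \<gamma> \<and>
    K \<subseteq> D' \<and> \<mu> ` K \<subseteq> D \<and> analytic_diffeo \<mu> K (\<mu> ` K) \<and> (\<forall>t\<in>K. \<gamma>' t = \<gamma> (\<mu> t))"

definition leads_to_at_boundary ::
    "nat \<Rightarrow> 'm::topological_space chart set \<Rightarrow>
      real set \<Rightarrow> (real \<Rightarrow> 'm) \<Rightarrow> real set \<Rightarrow> (real \<Rightarrow> 'm) \<Rightarrow> real set \<Rightarrow> (real \<Rightarrow> real) \<Rightarrow> bool" where
  "leads_to_at_boundary n A D' \<gamma>' D \<gamma> K \<mu> \<longleftrightarrow> matching n A D' \<gamma>' D \<gamma> K \<mu> \<and>
    (\<exists>I \<tau>. open_interval I \<and> \<tau> \<in> I \<and> D' = I \<inter> {..\<tau>} \<and> D = I \<inter> {\<tau>..} \<and>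
       \<tau> \<in> K \<and> \<mu> \<tau> = \<tau> \<and> (K = D' \<or> \<mu> ` K = D))"

definition leads_to_from_compact ::
    "nat \<Rightarrow> 'm::topological_space chart set \<Rightarrow>
      real set \<Rightarrow> (real \<Rightarrow> 'm) \<Rightarrow> real set \<Rightarrow> (real \<Rightarrow> 'm) \<Rightarrow> real set \<Rightarrow> (real \<Rightarrow> real) \<Rightarrow> bool" where
  "leads_to_from_compact n A D' \<gamma>' D \<gamma> K \<mu> \<longleftrightarrow> matching n A D' \<gamma>' D \<gamma> K \<mu> \<and>
    (compact D' \<and> D' = K \<and> compact D \<and> D = \<mu> ` K \<or>
     compact D' \<and> K \<subset> D' \<and> half_open_interval K \<and> half_open_interval D \<and> D = \<mu> ` K \<and>
       (Inf D' \<in> K \<or> Sup D' \<in> K))"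

definition leads_to ::
    "nat \<Rightarrow> 'm::topological_space chart set \<Rightarrow>
      real set \<Rightarrow> (real \<Rightarrow> 'm) \<Rightarrow> real set \<Rightarrow> (real \<Rightarrow> 'm) \<Rightarrow> real set \<Rightarrow> (real \<Rightarrow> real) \<Rightarrow> bool" where
  "leads_to n A D' \<gamma>' D \<gamma> K \<mu> \<longleftrightarrow>
    leads_to_at_boundary n A D' \<gamma>' D \<gamma> K \<mu> \<or> leads_to_from_compact n A D' \<gamma>' D \<gamma> K \<mu>"

definition leads_to_pos ::
    "nat \<Rightarrow> 'm::topological_space chart set \<Rightarrow>
      real set \<Rightarrow> (real \<Rightarrow> 'm) \<Rightarrow> real set \<Rightarrow> (real \<Rightarrow> 'm) \<Rightarrow> bool" where
  "leads_to_pos n A D' \<gamma>' D \<gamma> \<longleftrightarrow>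
    (\<exists>K \<mu>. leads_to_from_compact n A D' \<gamma>' D \<gamma> K \<mu> \<and> strict_mono_on K \<mu>)"

definition leads_to_neg ::
    "nat \<Rightarrow> 'm::topological_space chart set \<Rightarrow>
      real set \<Rightarrow> (real \<Rightarrow> 'm) \<Rightarrow> real set \<Rightarrow> (real \<Rightarrow> 'm) \<Rightarrow> bool" where
  "leads_to_neg n A D' \<gamma>' D \<gamma> \<longleftrightarrow>
    (\<exists>K \<mu>. leads_to_from_compact n A D' \<gamma>' D \<gamma> K \<mu> \<and> strict_antimono_on K \<mu>)"

section \<open>Decompositions\<close>

text \<open>Here \<open>c\<close> is the class \<open>[g]\<close>.\<close>

definition tau_decomposition ::
    "nat \<Rightarrow> 'm::topological_space chart set \<Rightarrow> ('g, 'r) monoid_scheme \<Rightarrow> ('g \<Rightarrow> 'm \<Rightarrow> 'm) \<Rightarrow>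
      real set \<Rightarrow> (real \<Rightarrow> 'm) \<Rightarrow> real \<Rightarrow> 'g set \<Rightarrow> bool" where
  "tau_decomposition n A G act I \<gamma> \<tau> c \<longleftrightarrow>
    \<tau> \<in> I \<and>
    (\<forall>B. maximal_interval n A G act I \<gamma> B \<longleftrightarrow> B = I \<inter> {..\<tau>} \<or> B = I \<inter> {\<tau>..}) \<and>
    (\<exists>g\<in>carrier G. c = stab_class G act I \<gamma> g \<and> c \<noteq> stab_class G act I \<gamma> \<one>\<^bsub>G\<^esub> \<and>
      (\<exists>K \<mu>. leads_to n A (I \<inter> {..\<tau>}) (\<lambda>t. act g (\<gamma> t)) (I \<inter> {\<tau>..}) \<gamma> K \<mu> \<and>
        (\<forall>g'\<in>carrier G. \<forall>J J' \<rho>.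
          open_interval J \<and> J \<subseteq> I \<inter> {..\<tau>} \<and> open_interval J' \<and> J' \<subseteq> I \<and>
          analytic_diffeo \<rho> J J' \<and> (\<forall>t\<in>J. act g' (\<gamma> t) = \<gamma> (\<rho> t)) \<longrightarrow>
          stab_class G act I \<gamma> g' = stab_class G act I \<gamma> \<one>\<^bsub>G\<^esub> \<and> extends_to J \<rho> (I \<inter> {..\<tau>}) id \<or>
          stab_class G act I \<gamma> g' = c \<and> extends_to J \<rho> K \<mu>)))"

definition index_set :: "int extended \<Rightarrow> int extended \<Rightarrow> int set" where
  "index_set lo hi = {k. k \<noteq> 0 \<and> lo \<le> Fin k \<and> Fin k \<le> hi}"

definition piece :: "real set \<Rightarrow> int extended \<Rightarrow> int extended \<Rightarrow> (int \<Rightarrow> real) \<Rightarrow> int \<Rightarrow> real set" where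
  "piece I lo hi a k =
    (if k = 0 then {a (-1)..a 1}
     else if k < 0 then (if lo = Fin k then I \<inter> {..a k} else {a (k - 1)..a k})
     else (if hi = Fin k then I \<inter> {a k..} else {a k..a (k + 1)}))"

text \<open>
  The bounds \<open>lo\<close>, \<open>hi\<close> determine the index set and \<open>c k\<close> is the class \<open>[g\<^sub>k]\<close>. Both families are
  \<^const>\<open>extensional\<close> on the index set, so that equality of the tuples \<open>(lo, hi, a, c)\<close> is equality
  of the families. Index 0 of the witnesses \<open>g\<close>, \<open>K\<close>, \<open>\<mu>\<close> carries \<open>g\<^sub>0 = e\<close> and \<open>\<mu>\<^sub>0 = id\<close> on \<open>B\<close>.
\<close>

definition A_decomposition ::
    "nat \<Rightarrow> 'm::topological_space chart set \<Rightarrow> ('g, 'r) monoid_scheme \<Rightarrow> ('g \<Rightarrow> 'm \<Rightarrow> 'm) \<Rightarrow>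
      real set \<Rightarrow> (real \<Rightarrow> 'm) \<Rightarrow> real set \<Rightarrow>
      int extended \<Rightarrow> int extended \<Rightarrow> (int \<Rightarrow> real) \<Rightarrow> (int \<Rightarrow> 'g set) \<Rightarrow> bool" where
  "A_decomposition n A G act I \<gamma> B lo hi a c \<longleftrightarrow>
    lo < 0 \<and> 0 < hi \<and>
    a \<in> extensional (index_set lo hi) \<and> c \<in> extensional (index_set lo hi) \<and>
    a ` index_set lo hi \<subseteq> I \<and> strict_mono_on (index_set lo hi) a \<and>
    B = {a (-1)..a 1} \<and>
    c (-1) \<noteq> stab_class G act I \<gamma> \<one>\<^bsub>G\<^esub> \<and> c 1 \<noteq> stab_class G act I \<gamma> \<one>\<^bsub>G\<^esub> \<and>
    I = (\<Union>k\<in>insert 0 (index_set lo hi). piece I lo hi a k) \<and>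
    (\<exists>g K \<mu>.
      g 0 = \<one>\<^bsub>G\<^esub> \<and> K 0 = B \<and> \<mu> 0 = id \<and>
      (\<forall>k\<in>index_set lo hi. g k \<in> carrier G \<and> c k = stab_class G act I \<gamma> (g k) \<and>
        leads_to n A B (\<lambda>t. act (g k) (\<gamma> t)) (piece I lo hi a k) \<gamma> (K k) (\<mu> k)) \<and>
      (\<forall>g'\<in>carrier G. \<forall>J J' \<rho>.
        open_interval J \<and> J \<subseteq> B \<and> open_interval J' \<and> J' \<subseteq> I \<and>
        analytic_diffeo \<rho> J J' \<and> (\<forall>t\<in>J. act g' (\<gamma> t) = \<gamma> (\<rho> t)) \<longrightarrow>
        (\<exists>!k. k \<in> insert 0 (index_set lo hi) \<and>
           stab_class G act I \<gamma> g' = stab_class G act I \<gamma> (g k) \<and> extends_to J \<rho> (K k) (\<mu> k))))"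

definition compact_maximal_interval ::
    "nat \<Rightarrow> 'm::topological_space chart set \<Rightarrow> ('g, 'r) monoid_scheme \<Rightarrow> ('g \<Rightarrow> 'm \<Rightarrow> 'm) \<Rightarrow>
      real set \<Rightarrow> (real \<Rightarrow> 'm) \<Rightarrow> real set \<Rightarrow> bool" where
  "compact_maximal_interval n A G act I \<gamma> B \<longleftrightarrow> compact B \<and> maximal_interval n A G act I \<gamma> B"

definition positive_interval ::
    "nat \<Rightarrow> 'm::topological_space chart set \<Rightarrow> ('g, 'r) monoid_scheme \<Rightarrow> ('g \<Rightarrow> 'm \<Rightarrow> 'm) \<Rightarrow>
      real set \<Rightarrow> (real \<Rightarrow> 'm) \<Rightarrow> real set \<Rightarrow> bool" where
  "positive_interval n A G act I \<gamma> B \<longleftrightarrow> compact_maximal_interval n A G act I \<gamma> B \<and>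
    (\<exists>lo hi a c. A_decomposition n A G act I \<gamma> B lo hi a c \<and>
      (\<forall>k\<in>{-1, 1}. \<exists>g\<in>carrier G. c k = stab_class G act I \<gamma> g \<and>
         leads_to_pos n A B (\<lambda>t. act g (\<gamma> t)) (piece I lo hi a k) \<gamma>))"

definition negative_interval ::
    "nat \<Rightarrow> 'm::topological_space chart set \<Rightarrow> ('g, 'r) monoid_scheme \<Rightarrow> ('g \<Rightarrow> 'm \<Rightarrow> 'm) \<Rightarrow>
      real set \<Rightarrow> (real \<Rightarrow> 'm) \<Rightarrow> real set \<Rightarrow> bool" where
  "negative_interval n A G act I \<gamma> B \<longleftrightarrow> compact_maximal_interval n A G act I \<gamma> B \<and>
    (\<exists>lo hi a c. A_decomposition n A G act I \<gamma> B lo hi a c \<and>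
      (\<forall>k\<in>{-1, 1}. \<exists>g\<in>carrier G. c k = stab_class G act I \<gamma> g \<and>
         leads_to_neg n A B (\<lambda>t. act g (\<gamma> t)) (piece I lo hi a k) \<gamma>))"

definition positive_curve ::
    "nat \<Rightarrow> 'm::topological_space chart set \<Rightarrow> ('g, 'r) monoid_scheme \<Rightarrow> ('g \<Rightarrow> 'm \<Rightarrow> 'm) \<Rightarrow>
      real set \<Rightarrow> (real \<Rightarrow> 'm) \<Rightarrow> bool" where
  "positive_curve n A G act I \<gamma> \<longleftrightarrow> (\<exists>B. positive_interval n A G act I \<gamma> B)"

definition negative_curve ::
    "nat \<Rightarrow> 'm::topological_space chart set \<Rightarrow> ('g, 'r) monoid_scheme \<Rightarrow> ('g \<Rightarrow> 'm \<Rightarrow> 'm) \<Rightarrow>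
      real set \<Rightarrow> (real \<Rightarrow> 'm) \<Rightarrow> bool" where
  "negative_curve n A G act I \<gamma> \<longleftrightarrow> (\<exists>B. negative_interval n A G act I \<gamma> B)"

end

theory Submission
  imports Defs "HOL-Complex_Analysis.Complex_Analysis"
begin

text \<open>
  A local symmetry of \<open>\<gamma>\<close> is an element \<open>g\<close> together with a monotone map \<open>\<rho>\<close> between open
  subintervals of \<open>I\<close> satisfying \<open>g \<cdot> \<gamma> = \<gamma> \<circ> \<rho>\<close>. By analyticity, a local symmetry is determined by
  \<open>g\<close>, its sign and one value, and it extends along \<open>I\<close> as long as its values stay in a compact
  subset of \<open>I\<close>; satedness excludes that such symmetries accumulate at the boundary of a free
  interval. An interval \<open>A\<close> is free iff no nontrivial symmetry maps an interior point of \<open>A\<close> to one, so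
  the translates of a maximal interval under symmetries do not overlap. At every end of a compact
  maximal interval maximality provides a symmetry, a shift or a reflection, that continues it by an
  adjacent translate; iterating this exhausts \<open>I\<close>. If no maximal interval is compact, the only
  possibility is a reflection at a single point \<open>\<tau>\<close>.
\<close>

section \<open>Monotone maps and limits on the real line\<close>

text \<open>Two obstacles shape the proof. A free segment is defined by \<open>g\<close> lying in
  the stabilizer, not by the reparametrization being trivial: on a periodic curve a stabilizer
  element can carry one parameter to a different one. \<open>stab_shift_free\<close> shows that such
  a shift inside a free interval spreads freeness to all of \<open>I\<close>; since
  \<open>\<gamma>\<close> is not a free segment, freeness may be replaced by the condition
  \<open>SF\<close> on parameters. The other obstacle is that the failure to enlarge a maximal
  interval yields, for each \<open>\<delta>\<close>, some symmetry reaching less than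
  \<open>\<delta>\<close> beyond the end, a priori a new one each time. Satedness makes increasing
  symmetries near the end trivial and leaves the end as the only possible reflection centre nearby,
  so that a single symmetry serves all \<open>\<delta>\<close>. In the study of maximal intervals
  analyticity enters only through the assumptions of the locale \<open>local_symmetries\<close>; the
  arguments are one-dimensional, and since the assumptions survive replacing \<open>t\<close> by
  \<open>-t\<close>, left ends follow from right ends.\<close>

lemma open_interval_iff: "open_interval J \<longleftrightarrow> open J \<and> connected J \<and> J \<noteq> {}"
  by (auto simp: open_interval_def interval_def interior_open)

lemma connected_real_between:
  fixes J :: "real set"
  assumes "connected J" "a \<in> J" "b \<in> J" "a \<le> t" "t \<le> b"
  shows "t \<in> J"
  using assms by (meson connectedD_interval)

lemma connected_real_segment:
  fixes J :: "real set"
  assumes "connected J" "a \<in> J" "b \<in> J"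
  shows "closed_segment a b \<subseteq> J"
  using connected_real_between[OF assms(1,2,3)] connected_real_between[OF assms(1,3,2)]
  by (auto simp: closed_segment_eq_real_ivl)

lemma connected_realI:
  fixes J :: "real set"
  assumes "\<And>a b t. a \<in> J \<Longrightarrow> b \<in> J \<Longrightarrow> a < t \<Longrightarrow> t < b \<Longrightarrow> t \<in> J"
  shows "connected J"
  unfolding is_interval_connected_1[symmetric] is_interval_1
  using assms by (metis order_le_less)

lemma in_interior_connected_real_iff:
  fixes A :: "real set"
  assumes "connected A"
  shows "s \<in> interior A \<longleftrightarrow> (\<exists>a\<in>A. \<exists>b\<in>A. a < s \<and> s < b)"
proof
  assume "s \<in> interior A"
  then obtain r where r: "r > 0" "ball s r \<subseteq> A" by (meson mem_interior)
  have "s - r/2 \<in> A" "s + r/2 \<in> A"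
    using r by (auto simp: subset_iff dist_real_def)
  then show "\<exists>a\<in>A. \<exists>b\<in>A. a < s \<and> s < b"
    using r(1) by (intro bexI[of _ "s - r/2"] bexI[of _ "s + r/2"]) auto
next
  assume "\<exists>a\<in>A. \<exists>b\<in>A. a < s \<and> s < b"
  then obtain a b where ab: "a \<in> A" "b \<in> A" "a < s" "s < b" by blast
  then have "{a<..<b} \<subseteq> A" using connected_real_between[OF assms ab(1,2)] by auto
  then show "s \<in> interior A"
    using ab by (meson interiorI open_greaterThanLessThan greaterThanLessThan_iff)
qed

text \<open>The factor \<open>\<sigma>\<close> turns \<open>f\<close> into a function increasing
  towards \<open>c\<close>, whichever side \<open>c\<close> lies on and whichever sign
  \<open>e\<close> is; its limit is the supremum over the part of \<open>J\<close> between
  \<open>t\<close> and \<open>c\<close>. Continuation arguments can therefore start from bounded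
  values alone.\<close>

lemma monotone_limit_at_end:
  fixes f :: "real \<Rightarrow> real"
  assumes J: "connected J" "t \<in> J" "c \<notin> J"
    and e: "e = 1 \<or> e = -1"
    and mono: "\<And>s u. s \<in> J \<Longrightarrow> u \<in> J \<Longrightarrow> s < u \<Longrightarrow> e * f s < e * f u"
    and bd: "\<And>s. s \<in> J \<Longrightarrow> s \<in> closed_segment t c \<Longrightarrow> p \<le> f s \<and> f s \<le> q"
  obtains d where "p \<le> d" "d \<le> q" "(f \<longlongrightarrow> d) (at c within J)"
proof -
  have tc: "t \<noteq> c" using J by auto
  define \<sigma> where "\<sigma> = (if t < c then e else -e)"
  have \<sigma>: "\<sigma> = 1 \<or> \<sigma> = -1" and ss: "\<And>x. \<sigma> * (\<sigma> * x) = x"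
    using e by (auto simp: \<sigma>_def)
  define F where "F = (\<lambda>s. \<sigma> * f s)"
  let ?T = "J \<inter> closed_segment t c"
  define D where "D = Sup (F ` ?T)"
  have tT: "t \<in> ?T" using J by auto
  have Fb: "\<bar>F s\<bar> \<le> \<bar>p\<bar> + \<bar>q\<bar>" if "s \<in> ?T" for s
    using bd[of s] that \<sigma> by (auto simp: F_def)
  have bdd: "bdd_above (F ` ?T)"
    by (rule bdd_aboveI2[of _ _ "\<bar>p\<bar> + \<bar>q\<bar>"]) (use Fb in force)
  have side: "u < c" if "u \<in> J" "t < c" for u
    using that J connected_real_between[OF J(1) J(2), of u c] by force
  have side': "c < u" if "u \<in> J" "c < t" for u
    using that J connected_real_between[OF J(1) _ J(2), of u c] by force
  have ident: "((\<lambda>x. x) \<longlongrightarrow> c) (at c within J)" by (rule tendsto_ident_at)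
  have inJ: "eventually (\<lambda>u. u \<in> J) (at c within J)"
    by (auto simp: eventually_at_filter)
  have closer: "eventually (\<lambda>u. u \<in> ?T \<and> F s \<le> F u) (at c within J)" if s: "s \<in> ?T" for s
  proof (cases "t < c")
    case True
    have "s < c" using side s True by auto
    then have "eventually (\<lambda>u. s < u) (at c within J)" using order_tendstoD(1)[OF ident] by simp
    with inJ show ?thesis
    proof eventually_elim
      case (elim u)
      have "u < c" using side elim True by auto
      then show ?case using elim s mono[of s u] True
        by (auto simp: F_def \<sigma>_def closed_segment_eq_real_ivl)
    qed
  next
    case False
    then have ct: "c < t" using tc by auto
    have "c < s" using side' s ct by auto
    then have "eventually (\<lambda>u. u < s) (at c within J)" using order_tendstoD(2)[OF ident] by simp
    with inJ show ?thesis
    proof eventually_elim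
      case (elim u)
      have "c < u" using side' elim ct by auto
      then show ?case using elim s mono[of u s] ct
        by (auto simp: F_def \<sigma>_def closed_segment_eq_real_ivl)
    qed
  qed
  have lim: "(F \<longlongrightarrow> D) (at c within J)"
  proof (rule order_tendstoI)
    fix a assume "a < D"
    then obtain s where s: "s \<in> ?T" "a < F s"
      unfolding D_def using less_cSup_iff[OF _ bdd] tT by blast
    show "eventually (\<lambda>u. a < F u) (at c within J)"
      using closer[OF s(1)] by eventually_elim (use s in auto)
  next
    fix a assume a: "D < a"
    show "eventually (\<lambda>u. F u < a) (at c within J)"
      using closer[OF tT]
    proof eventually_elim
      case (elim u)
      then have "F u \<le> D" unfolding D_def by (intro cSup_upper bdd) auto
      then show ?case using a by simp
    qed
  qed
  have DF: "F t \<le> D" unfolding D_def by (intro cSup_upper bdd) (use tT in auto)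
  have "((\<lambda>s. \<sigma> * F s) \<longlongrightarrow> \<sigma> * D) (at c within J)" by (intro tendsto_intros lim)
  then have 1: "(f \<longlongrightarrow> \<sigma> * D) (at c within J)" by (simp add: F_def ss)
  have "p \<le> \<sigma> * D \<and> \<sigma> * D \<le> q"
  proof (cases "\<sigma> = 1")
    case True
    have "D \<le> q" unfolding D_def by (rule cSup_least) (use tT bd True in \<open>auto simp: F_def\<close>)
    moreover have "p \<le> D" using DF bd[of t] tT True by (auto simp: F_def)
    ultimately show ?thesis using True by simp
  next
    case False
    then have \<sigma>: "\<sigma> = -1" using \<sigma> by auto
    have "D \<le> - p" unfolding D_def by (rule cSup_least) (use tT bd \<sigma> in \<open>auto simp: F_def\<close>)
    moreover have "-q \<le> D" using DF bd[of t] tT \<sigma> by (auto simp: F_def)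
    ultimately show ?thesis using \<sigma> by simp
  qed
  with 1 show thesis using that by blast
qed

section \<open>Local symmetries\<close>

text \<open>The sign \<open>e\<close> records whether \<open>\<rho>\<close> is increasing or decreasing.\<close>

definition local_symmetry ::
    "('g, 'r) monoid_scheme \<Rightarrow> ('g \<Rightarrow> 'm \<Rightarrow> 'm) \<Rightarrow> real set \<Rightarrow> (real \<Rightarrow> 'm) \<Rightarrow>
      'g \<Rightarrow> real \<Rightarrow> real set \<Rightarrow> (real \<Rightarrow> real) \<Rightarrow> bool" where
  "local_symmetry G act I \<gamma> g e J \<rho> \<longleftrightarrow>
    g \<in> carrier G \<and> (e = 1 \<or> e = -1) \<and> open_interval J \<and> J \<subseteq> I \<and> \<rho> ` J \<subseteq> I \<and>
    continuous_on J \<rho> \<and> (\<forall>s\<in>J. \<forall>t\<in>J. s < t \<longrightarrow> e * \<rho> s < e * \<rho> t) \<and>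
    (\<forall>t\<in>J. act g (\<gamma> t) = \<gamma> (\<rho> t))"

text \<open>The assumptions collect what the study of maximal intervals takes from analyticity and
  satedness. \<open>fix_extend\<close> is the identity theorem for \<open>g \<cdot> \<gamma>\<close>
  and \<open>\<gamma>\<close>, \<open>locally_injective\<close> comes from \<open>\<gamma>\<close>
  being an immersion, and \<open>symmetry_extend\<close> continues a reparametrization across an end
  of its domain at which it has a limit inside \<open>I\<close>.\<close>

locale local_symmetries = group_action G UNIV act
  for G :: "('g, 'r) monoid_scheme" (structure) and act :: "'g \<Rightarrow> 'm::t2_space \<Rightarrow> 'm" +
  fixes I :: "real set" and \<gamma> :: "real \<Rightarrow> 'm"
  assumes open_interval_I: "open_interval I"
    and continuous_curve: "continuous_on I \<gamma>"
    and locally_injective: "t \<in> I \<Longrightarrow> \<exists>r>0. inj_on \<gamma> (ball t r \<inter> I)"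
    and fix_extend: "g \<in> carrier G \<Longrightarrow> open_interval J \<Longrightarrow> J \<subseteq> I \<Longrightarrow>
      (\<And>t. t \<in> J \<Longrightarrow> act g (\<gamma> t) = \<gamma> t) \<Longrightarrow> u \<in> I \<Longrightarrow> act g (\<gamma> u) = \<gamma> u"
    and symmetry_extend: "local_symmetry G act I \<gamma> g e J \<rho> \<Longrightarrow> c \<in> I \<Longrightarrow> c \<in> closure J \<Longrightarrow> c \<notin> J \<Longrightarrow>
      d \<in> I \<Longrightarrow> (\<rho> \<longlongrightarrow> d) (at c within J) \<Longrightarrow>
      \<exists>J' \<rho>'. local_symmetry G act I \<gamma> g e J' \<rho>' \<and> c \<in> J' \<and> (\<forall>t\<in>J \<inter> J'. \<rho>' t = \<rho> t)"
    and sated_action: "sated G act"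
begin

abbreviation S where "S \<equiv> local_symmetry G act I \<gamma>"

text \<open>Remembers only that some symmetry sends \<open>s\<close> to \<open>t\<close>, so that
  composition and inversion become rules on parameters without bookkeeping of domains. Element and
  sign stay visible: the element for its class, the sign to tell shifts from reflections.\<close>

definition rel where "rel g e s t \<longleftrightarrow> (\<exists>J \<rho>. S g e J \<rho> \<and> s \<in> J \<and> \<rho> s = t)"

abbreviation stab where "stab \<equiv> curve_stabilizer G act I \<gamma>"

text \<open>A local symmetry is maximal if its domain ends, inside \<open>I\<close>, only where its values leave every
  compact subset of \<open>I\<close>.\<close>

definition max_symmetry where
  "max_symmetry g e J \<rho> \<longleftrightarrow> S g e J \<rho> \<and>
    (\<forall>t\<in>J. \<forall>c\<in>I. \<forall>p\<in>I. \<forall>q\<in>I.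
      (\<forall>s\<in>J \<inter> closed_segment t c. p \<le> \<rho> s \<and> \<rho> s \<le> q) \<longrightarrow> c \<in> J)"

lemma group_G: "group G"
  using group_hom group_hom.axioms(1) by blast

sublocale group G by (rule group_G)

lemma connected_I: "connected I" and open_I: "open I"
  using open_interval_I by (auto simp: open_interval_iff)

lemma I_between: "a \<in> I \<Longrightarrow> b \<in> I \<Longrightarrow> a \<le> t \<Longrightarrow> t \<le> b \<Longrightarrow> t \<in> I"
  using connected_real_between[OF connected_I] by blast

lemma symD:
  assumes "S g e J \<rho>"
  shows "g \<in> carrier G" "e = 1 \<or> e = -1" "open J" "connected J" "J \<noteq> {}" "J \<subseteq> I" "\<rho> ` J \<subseteq> I"
    "continuous_on J \<rho>" "\<And>s t. s \<in> J \<Longrightarrow> t \<in> J \<Longrightarrow> s < t \<Longrightarrow> e * \<rho> s < e * \<rho> t"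
    "\<And>t. t \<in> J \<Longrightarrow> act g (\<gamma> t) = \<gamma> (\<rho> t)" "open_interval J" "\<And>t. t \<in> J \<Longrightarrow> t \<in> I"
    "\<And>t. t \<in> J \<Longrightarrow> \<rho> t \<in> I"
  using assms by (auto simp: local_symmetry_def open_interval_iff)

lemma symI:
  assumes "g \<in> carrier G" "e = 1 \<or> e = -1" "open J" "connected J" "J \<noteq> {}" "J \<subseteq> I"
    "\<And>t. t \<in> J \<Longrightarrow> \<rho> t \<in> I" "continuous_on J \<rho>"
    "\<And>s t. s \<in> J \<Longrightarrow> t \<in> J \<Longrightarrow> s < t \<Longrightarrow> e * \<rho> s < e * \<rho> t"
    "\<And>t. t \<in> J \<Longrightarrow> act g (\<gamma> t) = \<gamma> (\<rho> t)"
  shows "S g e J \<rho>"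
  unfolding local_symmetry_def open_interval_iff image_subset_iff using assms by blast

lemma sym_between:
  assumes "S g e J \<rho>" "a \<in> J" "b \<in> J" "a \<le> t" "t \<le> b"
  shows "t \<in> J"
  using connected_real_between[OF symD(4)[OF assms(1)]] assms by blast

lemma sym_inj: "S g e J \<rho> \<Longrightarrow> inj_on \<rho> J"
  by (rule linorder_inj_onI) (use symD(9) in fastforce)+

lemma sym_less_iff:
  assumes "S g e J \<rho>" "s \<in> J" "t \<in> J"
  shows "e * \<rho> s < e * \<rho> t \<longleftrightarrow> s < t"
  using symD(9)[OF assms(1)] assms(2,3) by (metis less_irrefl less_trans linorder_neqE)

lemma sym_le_iff:
  assumes "S g e J \<rho>" "s \<in> J" "t \<in> J"
  shows "e * \<rho> s \<le> e * \<rho> t \<longleftrightarrow> s \<le> t"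
  using sym_less_iff[OF assms(1) assms(3) assms(2)] by linarith

lemma act_one: "act \<one> x = x"
  by (metis id_eq_one restrict_apply UNIV_I)

lemma sym_id: "S \<one> 1 I id"
  using open_interval_I by (auto simp: local_symmetry_def act_one)

lemma sym_restrict:
  assumes "S g e J \<rho>" "open_interval J'" "J' \<subseteq> J"
  shows "S g e J' \<rho>"
proof -
  note D = symD[OF assms(1)]
  have "J' \<noteq> {}" "open J'" "connected J'" using assms(2) by (auto simp: open_interval_iff)
  then show ?thesis
    using D(1,2) assms(3) D(6) continuous_on_subset[OF D(8) assms(3)]
    by (intro symI) (use D(9,10,13) in \<open>blast+\<close>)
qed

lemma act_inv: "g \<in> carrier G \<Longrightarrow> act g x = y \<Longrightarrow> act (inv g) y = x"
  using orbit_sym_aux by blast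

lemma act_mult: "g \<in> carrier G \<Longrightarrow> h \<in> carrier G \<Longrightarrow> act (h \<otimes> g) x = act h (act g x)"
  using composition_rule by blast

lemma sym_open_image:
  assumes "S g e J \<rho>" shows "open_interval (\<rho> ` J)"
  using invariance_of_domain[OF symD(8)[OF assms] symD(3)[OF assms] sym_inj[OF assms]]
    connected_continuous_image[OF symD(8)[OF assms] symD(4)[OF assms]] symD(5)[OF assms]
  by (auto simp: open_interval_iff)

lemma sym_inverse:
  assumes S: "S g e J \<rho>"
  shows "S (inv g) e (\<rho> ` J) (inv_into J \<rho>)"
proof -
  note D = symD[OF S] and inj = sym_inj[OF S]
  obtain k where k: "homeomorphism J (\<rho> ` J) \<rho> k"
    using invariance_of_domain_homeomorphism[OF D(3) D(8) _ inj] by auto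
  have "k t = inv_into J \<rho> t" if "t \<in> \<rho> ` J" for t
    using that k inj by (auto simp: homeomorphism_def inv_into_f_f)
  moreover have "continuous_on (\<rho> ` J) k" using k by (simp add: homeomorphism_def)
  ultimately have cont: "continuous_on (\<rho> ` J) (inv_into J \<rho>)"
    by (simp cong: continuous_on_cong)
  have inv: "inv_into J \<rho> ` \<rho> ` J = J" by (simp add: inj)
  have mono: "e * inv_into J \<rho> s < e * inv_into J \<rho> t" if st: "s \<in> \<rho> ` J" "t \<in> \<rho> ` J" "s < t" for s t
  proof -
    obtain a where a: "a \<in> J" "s = \<rho> a" using st(1) by blast
    obtain b where b: "b \<in> J" "t = \<rho> b" using st(2) by blast
    note ab = a(1) b(1) a(2) b(2)
    show ?thesis using ab st(3) inj sym_less_iff[OF S ab(1,2)] sym_less_iff[OF S ab(2,1)] D(2)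
      by auto
  qed
  have op: "open (\<rho> ` J)" "connected (\<rho> ` J)" "\<rho> ` J \<noteq> {}"
    using sym_open_image[OF S] by (auto simp: open_interval_iff)
  have "act (inv g) (\<gamma> t) = \<gamma> (inv_into J \<rho> t)" if "t \<in> \<rho> ` J" for t
    using that act_inv[OF D(1) D(10)] inj by (auto simp: inv_into_f_f)
  moreover have "inv_into J \<rho> t \<in> I" if "t \<in> \<rho> ` J" for t
    using that D(6) inv_into_into by (metis subsetD)
  ultimately show ?thesis
    using D(1,2,7) op cont by (intro symI) (simp_all add: mono)
qed

lemma sym_compose:
  assumes S: "S g e J \<rho>" and T: "S h f J' \<sigma>" and s: "s \<in> J" "\<rho> s \<in> J'"
  shows "S (h \<otimes> g) (e * f) {u \<in> J. \<rho> u \<in> J'} (\<lambda>u. \<sigma> (\<rho> u))"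
proof -
  note D = symD[OF S] and E = symD[OF T]
  let ?W = "{u \<in> J. \<rho> u \<in> J'}"
  have "?W = J \<inter> \<rho> -` J'" by auto
  then have op: "open ?W" using continuous_open_preimage[OF D(8) D(3) E(3)] by simp
  \<comment> \<open>A monotone \<open>\<rho>\<close> keeps \<open>\<rho> t\<close> between
    \<open>\<rho> a\<close> and \<open>\<rho> b\<close>, so connectedness of \<open>J'\<close> pulls
    back.\<close>
  have conn: "connected ?W"
  proof (rule connected_realI)
    fix a b t assume *: "a \<in> ?W" "b \<in> ?W" "a < t" "t < b"
    then have t: "t \<in> J" using sym_between[OF S, of a b t] by auto
    then have "e * \<rho> a < e * \<rho> t" "e * \<rho> t < e * \<rho> b" using * D(9) by auto
    then have "\<rho> t \<in> closed_segment (\<rho> a) (\<rho> b)"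
      using D(2) by (auto simp: closed_segment_eq_real_ivl)
    then show "t \<in> ?W" using connected_real_segment[OF E(4), of "\<rho> a" "\<rho> b"] * t by auto
  qed
  have mono: "e * f * \<sigma> (\<rho> u) < e * f * \<sigma> (\<rho> v)" if "u \<in> ?W" "v \<in> ?W" "u < v" for u v
  proof -
    have "e * \<rho> u < e * \<rho> v" using that D(9) by auto
    then show ?thesis
      using that E(9)[of "\<rho> u" "\<rho> v"] E(9)[of "\<rho> v" "\<rho> u"] D(2) by (auto simp: algebra_simps)
  qed
  have "continuous_on ?W (\<lambda>u. \<sigma> (\<rho> u))"
    by (rule continuous_on_compose2[OF E(8)]) (use D(8) in \<open>auto intro: continuous_on_subset\<close>)
  moreover have "?W \<noteq> {}" using s by auto
  moreover have "act (h \<otimes> g) (\<gamma> u) = \<gamma> (\<sigma> (\<rho> u))" if "u \<in> ?W" for u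
    using that D(10) E(10) act_mult[OF D(1) E(1)] by simp
  moreover have "h \<otimes> g \<in> carrier G" "e * f = 1 \<or> e * f = -1" using D(1,2) E(1,2) by auto
  moreover have "?W \<subseteq> I" "\<And>u. u \<in> ?W \<Longrightarrow> \<sigma> (\<rho> u) \<in> I" using D(6) E(13) by auto
  ultimately show ?thesis
    using op conn by (intro symI) (blast intro: mono)+
qed

text \<open>The set of agreement is closed by continuity and open because \<open>\<gamma>\<close> is
  injective near the common value: both \<open>\<gamma> (\<rho> u)\<close> and
  \<open>\<gamma> (\<sigma> u)\<close> equal \<open>act g (\<gamma> u)\<close>. The signs may differ
  a priori, which lets \<open>stab_fix\<close> compare an arbitrary symmetry with the
  identity.\<close>

lemma germ_unique:
  assumes S: "S g e J \<rho>" and T: "S g f J' \<sigma>" and t0: "t0 \<in> J" "t0 \<in> J'" "\<rho> t0 = \<sigma> t0"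
    and t: "t \<in> J" "t \<in> J'"
  shows "\<rho> t = \<sigma> t"
proof -
  note D = symD[OF S] and E = symD[OF T]
  let ?W = "J \<inter> J'"
  let ?Z = "{t \<in> ?W. \<rho> t = \<sigma> t}"
  have c\<rho>: "continuous_on ?W \<rho>" "continuous_on ?W \<sigma>" using continuous_on_subset[OF D(8)] continuous_on_subset[OF E(8)] by blast+
  have opW: "open ?W" using D(3) E(3) by auto
  have conn: "connected ?W"
    by (rule connected_realI) (meson IntE IntI less_imp_le sym_between[OF S] sym_between[OF T])
  have "continuous_on ?W (\<lambda>t. \<rho> t - \<sigma> t)" using c\<rho> by (intro continuous_intros)
  then have "closedin (top_of_set ?W) (?W \<inter> (\<lambda>t. \<rho> t - \<sigma> t) -` {0})"
    by (rule continuous_closedin_preimage) auto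
  moreover have "?W \<inter> (\<lambda>t. \<rho> t - \<sigma> t) -` {0} = ?Z" by auto
  ultimately have cl: "closedin (top_of_set ?W) ?Z" by simp
  have "open ?Z"
  proof (rule Topological_Spaces.openI)
    fix z assume z: "z \<in> ?Z"
    then have "\<rho> z \<in> I" using D(7) by auto
    then obtain r where r: "r > 0" "inj_on \<gamma> (ball (\<rho> z) r \<inter> I)" using locally_injective by blast
    let ?U = "(?W \<inter> \<rho> -` ball (\<rho> z) r) \<inter> (?W \<inter> \<sigma> -` ball (\<rho> z) r)"
    have "open ?U" using continuous_open_preimage[OF c\<rho>(1) opW] continuous_open_preimage[OF c\<rho>(2) opW]
      by blast
    moreover have "z \<in> ?U" using z r by auto
    moreover have "?U \<subseteq> ?Z"
    proof
      fix u assume u: "u \<in> ?U"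
      then have "\<gamma> (\<rho> u) = \<gamma> (\<sigma> u)" using D(10)[of u] E(10)[of u] by auto
      then have "\<rho> u = \<sigma> u" using inj_onD[OF r(2)] u D(7) E(7) by blast
      then show "u \<in> ?Z" using u by auto
    qed
    ultimately show "\<exists>T. open T \<and> z \<in> T \<and> T \<subseteq> ?Z" by blast
  qed
  then have "openin (top_of_set ?W) ?Z" by (rule open_subset[rotated]) auto
  then have "?Z = {} \<or> ?Z = ?W" using cl conn connected_clopen by blast
  then show ?thesis using t0 t by auto
qed

lemma sym_glue:
  assumes S: "S g e J \<rho>" and T: "S g e J' \<sigma>" and t0: "t0 \<in> J" "t0 \<in> J'" "\<rho> t0 = \<sigma> t0"
  shows "S g e (J \<union> J') (\<lambda>t. if t \<in> J then \<rho> t else \<sigma> t)"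
proof -
  note D = symD[OF S] and E = symD[OF T]
  let ?h = "\<lambda>t. if t \<in> J then \<rho> t else \<sigma> t"
  have agree: "?h t = \<sigma> t" if "t \<in> J'" for t using germ_unique[OF S T t0] that by auto
  have "continuous_on J ?h" using D(8) by (simp cong: continuous_on_cong)
  moreover have "continuous_on J' ?h" using E(8) agree by (simp cong: continuous_on_cong)
  ultimately have "continuous_on (J \<union> J') ?h" using D(3) E(3) continuous_on_open_Un by blast
  moreover have "open (J \<union> J')" "connected (J \<union> J')" "J \<union> J' \<noteq> {}"
    using D(3,4) E(3,4) t0 by (auto intro!: connected_Un)
  moreover have "e * ?h s < e * ?h t" if st: "s \<in> J \<union> J'" "t \<in> J \<union> J'" "s < t" for s t
  proof -
    have "e * ?h s < e * ?h t" if "s \<in> J" "t \<in> J" using that st(3) D(9) by auto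
    moreover have "e * ?h s < e * ?h t" if "s \<in> J'" "t \<in> J'" using that st(3) E(9) agree by auto
    \<comment> \<open>Points from different domains are separated by the common point
      \<open>t0\<close>, through which the inequality is chained.\<close>
    moreover have "e * ?h s < e * ?h t" if "s \<in> J" "t \<notin> J" "s \<notin> J'" "t \<in> J'"
    proof -
      have "s < t0 \<and> t0 < t"
        using that st(3) t0 sym_between[OF S, of s t0 t] sym_between[OF T, of t0 t s] by force
      then show ?thesis using that D(9)[of s t0] E(9)[of t0 t] t0 by auto
    qed
    moreover have "e * ?h s < e * ?h t" if "s \<in> J'" "t \<notin> J'" "s \<notin> J" "t \<in> J"
    proof -
      have "s < t0 \<and> t0 < t"
        using that st(3) t0 sym_between[OF T, of s t0 t] sym_between[OF S, of t0 t s] by force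
      then show ?thesis using that E(9)[of s t0] D(9)[of t0 t] t0 by auto
    qed
    ultimately show ?thesis using st by blast
  qed
  moreover have "J \<union> J' \<subseteq> I" using D(6) E(6) by auto
  moreover have "?h t \<in> I" "act g (\<gamma> t) = \<gamma> (?h t)" if "t \<in> J \<union> J'" for t
    using that D(10,13) E(10,13) by auto
  ultimately show ?thesis
    using D(1,2) by (intro symI) blast+
qed

text \<open>All symmetries with the given \<open>g\<close>, \<open>e\<close> and value at
  \<open>t0\<close> fit together by \<open>germ_unique\<close>, and their union is maximal: where
  its values stay in \<open>[p, q]\<close> they have a limit at the end of the domain by
  monotonicity, and \<open>symmetry_extend\<close> would enlarge the union.\<close>

lemma max_symmetry_exists:
  assumes S: "S g e J0 \<rho>0" and t0: "t0 \<in> J0"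
  obtains J \<rho> where "max_symmetry g e J \<rho>" "J0 \<subseteq> J" "\<And>t. t \<in> J0 \<Longrightarrow> \<rho> t = \<rho>0 t"
proof -
  define F where "F = {(J, \<rho>). S g e J \<rho> \<and> t0 \<in> J \<and> \<rho> t0 = \<rho>0 t0}"
  define J where "J = (\<Union>(J', \<rho>')\<in>F. J')"
  define \<rho> where "\<rho> = (\<lambda>t. SOME v. \<exists>(J', \<rho>')\<in>F. t \<in> J' \<and> v = \<rho>' t)"
  have F0: "(J0, \<rho>0) \<in> F" using assms by (auto simp: F_def)
  have FD: "S g e J' \<rho>'" "t0 \<in> J'" "\<rho>' t0 = \<rho>0 t0" "J' \<subseteq> J" if "(J', \<rho>') \<in> F" for J' \<rho>'
    using that by (auto simp: F_def J_def)
  have \<rho>: "\<rho> t = \<rho>' t" if "(J', \<rho>') \<in> F" "t \<in> J'" for J' \<rho>' t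
  proof -
    have "\<exists>v. \<exists>(J', \<rho>')\<in>F. t \<in> J' \<and> v = \<rho>' t" using that by auto
    then have "\<exists>(J', \<rho>')\<in>F. t \<in> J' \<and> \<rho> t = \<rho>' t" unfolding \<rho>_def by (rule someI_ex)
    then obtain J2 \<rho>2 where 2: "(J2, \<rho>2) \<in> F" "t \<in> J2" "\<rho> t = \<rho>2 t" by auto
    show ?thesis
      using germ_unique[OF FD(1)[OF 2(1)] FD(1)[OF that(1)] FD(2)[OF 2(1)] FD(2)[OF that(1)]]
        FD(3)[OF 2(1)] FD(3)[OF that(1)] 2 that by auto
  qed
  have ex: "\<exists>J' \<rho>'. (J', \<rho>') \<in> F \<and> t \<in> J'" if "t \<in> J" for t using that by (auto simp: J_def)
  have opJ: "open J" unfolding J_def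
    by (intro open_UN ballI) (use symD(3)[OF FD(1)] in auto)
  have "J = \<Union>(fst ` F)" by (auto simp: J_def)
  moreover have "connected (\<Union>(fst ` F))"
  proof (rule connected_Union)
    show "connected s" if "s \<in> fst ` F" for s using that FD(1) symD(4) by fastforce
    show "\<Inter>(fst ` F) \<noteq> {}" using FD(2) by fastforce
  qed
  ultimately have connJ: "connected J" by simp
  have contJ: "continuous_on J \<rho>"
  proof -
    have "continuous (at t) \<rho>" if t: "t \<in> J" for t
    proof -
      obtain J' \<rho>' where F': "(J', \<rho>') \<in> F" "t \<in> J'" using ex[OF t] by blast
      have "continuous_on J' \<rho>" using symD(8)[OF FD(1)[OF F'(1)]] \<rho>[OF F'(1)]
        by (simp cong: continuous_on_cong)
      then show ?thesis using symD(3)[OF FD(1)[OF F'(1)]] F'(2) continuous_on_eq_continuous_at by blast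
    qed
    then show ?thesis using continuous_at_imp_continuous_on by blast
  qed
  have mono: "e * \<rho> s < e * \<rho> t" if st: "s \<in> J" "t \<in> J" "s < t" for s t
  proof -
    obtain J1 \<rho>1 where 1: "(J1, \<rho>1) \<in> F" "s \<in> J1" using ex[OF st(1)] by blast
    obtain J2 \<rho>2 where 2: "(J2, \<rho>2) \<in> F" "t \<in> J2" using ex[OF st(2)] by blast
    note S1 = FD[OF 1(1)] and S2 = FD[OF 2(1)]
    have eq: "\<rho>1 t0 = \<rho>2 t0" using S1 S2 by simp
    have h: "(if u \<in> J1 then \<rho>1 u else \<rho>2 u) = \<rho> u" if "u \<in> J1 \<union> J2" for u
      using \<rho>[OF 1(1), of u] \<rho>[OF 2(1), of u] that by auto
    show ?thesis
      using symD(9)[OF sym_glue[OF S1(1) S2(1) S1(2) S2(2) eq], of s t] h[of s] h[of t] 1 2 st(3)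
      by auto
  qed
  have SJ: "S g e J \<rho>"
  proof -
    have JI: "J \<subseteq> I"
    proof
      fix t assume "t \<in> J"
      then obtain J' \<rho>' where "(J', \<rho>') \<in> F" "t \<in> J'" using ex by blast
      then show "t \<in> I" using symD(12)[OF FD(1)] by blast
    qed
    have vals: "\<rho> t \<in> I" "act g (\<gamma> t) = \<gamma> (\<rho> t)" if t: "t \<in> J" for t
    proof -
      obtain J' \<rho>' where F': "(J', \<rho>') \<in> F" "t \<in> J'" using ex[OF t] by blast
      show "\<rho> t \<in> I" "act g (\<gamma> t) = \<gamma> (\<rho> t)"
        unfolding \<rho>[OF F'] by (rule symD(13)[OF FD(1)[OF F'(1)] F'(2)], rule symD(10)[OF FD(1)[OF F'(1)] F'(2)])
    qed
    have "J \<noteq> {}" using FD(4)[OF F0] t0 by blast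
    show ?thesis
      by (rule symI[OF symD(1,2)[OF S] opJ connJ \<open>J \<noteq> {}\<close> JI vals(1) contJ mono vals(2)])
  qed
  have "max_symmetry g e J \<rho>"
    unfolding max_symmetry_def
  proof (intro conjI SJ ballI impI)
    fix t c p q assume t: "t \<in> J" and c: "c \<in> I" and pq: "p \<in> I" "q \<in> I"
      and bd: "\<forall>s\<in>J \<inter> closed_segment t c. p \<le> \<rho> s \<and> \<rho> s \<le> q"
    show "c \<in> J"
    proof (rule ccontr)
      assume cJ: "c \<notin> J"
      \<comment> \<open>The end of the domain on the way from \<open>t\<close> to \<open>c\<close>.
        The continuation takes place there and not at \<open>c\<close>, which may lie beyond the
        closure of \<open>J\<close>.\<close>
      define c' where "c' = (if t < c then Sup J else Inf J)"
      have tc: "t \<noteq> c" using t cJ by auto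
      have up: "u < c" if "u \<in> J" "t < c" for u
        using that sym_between[OF SJ t, of u c] cJ by force
      have dn: "c < u" if "u \<in> J" "c < t" for u
        using that sym_between[OF SJ _ t, of u c] cJ by force
      have c': "c' \<in> closure J \<and> c' \<in> closed_segment t c"
      proof (cases "t < c")
        case True
        have bdd: "bdd_above J" using up True by (meson bdd_aboveI less_imp_le)
        have "Sup J \<in> closure J" using closure_contains_Sup bdd t by blast
        moreover have "t \<le> Sup J" using t bdd by (rule cSup_upper)
        moreover have "Sup J \<le> c" using t up True by (intro cSup_least) (auto simp: less_imp_le)
        ultimately show ?thesis using True by (auto simp: c'_def closed_segment_eq_real_ivl)
      next
        case False
        then have ct: "c < t" using tc by auto
        have bdd: "bdd_below J" using dn ct by (meson bdd_belowI less_imp_le)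
        have "Inf J \<in> closure J" using closure_contains_Inf bdd t by blast
        moreover have "Inf J \<le> t" using t bdd by (rule cInf_lower)
        moreover have "c \<le> Inf J" using t dn ct by (intro cInf_greatest) (auto simp: less_imp_le)
        ultimately show ?thesis using ct by (auto simp: c'_def closed_segment_eq_real_ivl)
      qed
      have c'J: "c' \<notin> J"
      proof
        assume "c' \<in> J"
        then obtain r where r: "r > 0" "ball c' r \<subseteq> J" using opJ openE by blast
        then have "c' + r/2 \<in> J" "c' - r/2 \<in> J" by (auto simp: subset_iff dist_real_def)
        moreover have "u \<le> c'" if "u \<in> J" "t < c" for u
          using cSup_upper[OF that(1)] bdd_aboveI[of J c] up[OF _ that(2)] that(2)
          by (simp add: c'_def less_imp_le)
        moreover have "c' \<le> u" if "u \<in> J" "c < t" for u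
          using cInf_lower[OF that(1)] bdd_belowI[of J c] dn[OF _ that(2)] that(2)
          by (simp add: c'_def less_imp_le)
        ultimately show False using tc r(1) by (smt (verit) field_sum_of_halves)
      qed
      have c'I: "c' \<in> I"
        using c' connected_real_segment[OF connected_I _ c, of t] t symD(6)[OF SJ] by blast
      have seg: "closed_segment t c' \<subseteq> closed_segment t c"
        using c' by (simp add: subset_closed_segment)
      obtain d where d: "p \<le> d" "d \<le> q" "(\<rho> \<longlongrightarrow> d) (at c' within J)"
        by (rule monotone_limit_at_end[OF symD(4)[OF SJ] t c'J symD(2)[OF SJ] symD(9)[OF SJ],
              where p = p and q = q]) (use bd seg in blast)+
      have "d \<in> I" using I_between pq d by blast
      then obtain J' \<rho>' where J': "S g e J' \<rho>'" "c' \<in> J'" "\<forall>t\<in>J \<inter> J'. \<rho>' t = \<rho> t"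
        using symmetry_extend[OF SJ c'I _ c'J _ d(3)] c' by blast
      obtain u where u: "u \<in> J" "u \<in> J'"
        using c' J'(2) symD(3)[OF J'(1)] by (meson closure_iff_nhds_not_empty disjoint_iff subset_refl)
      have "S g e (J \<union> J') (\<lambda>t. if t \<in> J then \<rho> t else \<rho>' t)"
        using sym_glue[OF SJ J'(1) u] J'(3) u by auto
      moreover have "t0 \<in> J" "\<rho> t0 = \<rho>0 t0" using FD[OF F0] t0 \<rho>[OF F0 t0] by auto
      ultimately have "(J \<union> J', \<lambda>t. if t \<in> J then \<rho> t else \<rho>' t) \<in> F" by (auto simp: F_def)
      then show False using FD(4) c'J J'(2) by blast
    qed
  qed
  then show thesis using that FD(4)[OF F0] \<rho>[OF F0] by blast
qed

end

section \<open>Maximal symmetries and the relation between parameters\<close>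

context local_symmetries begin

lemma max_symmetryD: "max_symmetry g e J \<rho> \<Longrightarrow> S g e J \<rho>"
  by (simp add: max_symmetry_def)

lemma max_symmetry_walk:
  assumes "max_symmetry g e J \<rho>" "t \<in> J" "c \<in> I" "p \<in> I" "q \<in> I"
    and "\<And>s. s \<in> J \<Longrightarrow> s \<in> closed_segment t c \<Longrightarrow> p \<le> \<rho> s \<and> \<rho> s \<le> q"
  shows "c \<in> J"
  using assms unfolding max_symmetry_def by blast

lemma relI: "S g e J \<rho> \<Longrightarrow> s \<in> J \<Longrightarrow> rel g e s (\<rho> s)"
  by (auto simp: rel_def)

lemma relD:
  assumes "rel g e s t"
  shows "g \<in> carrier G" "e = 1 \<or> e = -1" "s \<in> I" "t \<in> I" "act g (\<gamma> s) = \<gamma> t"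
  using assms by (auto simp: rel_def dest: symD)

lemma rel_max:
  assumes "rel g e s t"
  obtains J \<rho> where "max_symmetry g e J \<rho>" "s \<in> J" "\<rho> s = t"
proof -
  obtain J0 \<rho>0 where S: "S g e J0 \<rho>0" "s \<in> J0" "\<rho>0 s = t" using assms by (auto simp: rel_def)
  obtain J \<rho> where "max_symmetry g e J \<rho>" "J0 \<subseteq> J" "\<And>t. t \<in> J0 \<Longrightarrow> \<rho> t = \<rho>0 t"
    using max_symmetry_exists[OF S(1,2)] by blast
  then show thesis using S that[of J \<rho>] by auto
qed

lemma rel_id: "s \<in> I \<Longrightarrow> rel \<one> 1 s s"
  using relI[OF sym_id] by fastforce

lemma rel_inverse:
  assumes "rel g e s t" shows "rel (inv g) e t s"
proof -
  obtain J \<rho> where S: "S g e J \<rho>" "s \<in> J" "\<rho> s = t" using assms by (auto simp: rel_def)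
  show ?thesis
    using relI[OF sym_inverse[OF S(1)], of t] S inv_into_f_f[OF sym_inj[OF S(1)] S(2)] by auto
qed

lemma rel_compose:
  assumes "rel g e s t" "rel h f t u" shows "rel (h \<otimes> g) (e * f) s u"
proof -
  obtain J \<rho> where S: "S g e J \<rho>" "s \<in> J" "\<rho> s = t" using assms(1) by (auto simp: rel_def)
  obtain J' \<sigma> where T: "S h f J' \<sigma>" "t \<in> J'" "\<sigma> t = u" using assms(2) by (auto simp: rel_def)
  show ?thesis
    using relI[OF sym_compose[OF S(1) T(1) S(2)], of s] S T by auto
qed

lemma rel_near:
  assumes "rel g e s t" "\<epsilon> > 0"
  obtains \<delta> where "\<delta> > 0" "\<delta> \<le> \<epsilon>"
    "\<And>s'. \<bar>s' - s\<bar> < \<delta> \<Longrightarrow> \<exists>t'. rel g e s' t' \<and> \<bar>t' - t\<bar> < \<epsilon> \<and>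
       (s' < s \<longrightarrow> e * t' < e * t) \<and> (s < s' \<longrightarrow> e * t < e * t')"
proof -
  obtain J \<rho> where S: "S g e J \<rho>" "s \<in> J" "\<rho> s = t" using assms(1) by (auto simp: rel_def)
  have "isCont \<rho> s" using symD(3,8)[OF S(1)] S(2) continuous_on_eq_continuous_at by blast
  then obtain d where d: "d > 0" "\<And>s'. \<bar>s' - s\<bar> < d \<Longrightarrow> \<bar>\<rho> s' - \<rho> s\<bar> < \<epsilon>"
    using assms(2) by (auto simp: continuous_at_eps_delta dist_real_def)
  obtain r where r: "r > 0" "ball s r \<subseteq> J" using symD(3)[OF S(1)] S(2) openE by blast
  show thesis
  proof (rule that[of "min \<epsilon> (min d r)"])
    fix s' assume *: "\<bar>s' - s\<bar> < min \<epsilon> (min d r)"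
    then have "s' \<in> J" using r by (auto simp: dist_real_def abs_minus_commute)
    then show "\<exists>t'. rel g e s' t' \<and> \<bar>t' - t\<bar> < \<epsilon> \<and>
       (s' < s \<longrightarrow> e * t' < e * t) \<and> (s < s' \<longrightarrow> e * t < e * t')"
      using * d(2)[of s'] S relI[OF S(1), of s'] symD(9)[OF S(1)] by (intro exI[of _ "\<rho> s'"]) auto
  qed (use assms d r in auto)
qed

lemma sym_on_segment:
  assumes S: "S g e J \<rho>" and ab: "a \<in> J" "b \<in> J"
  shows "closed_segment a b \<subseteq> J" "\<rho> ` closed_segment a b = closed_segment (\<rho> a) (\<rho> b)"
proof -
  show 1: "closed_segment a b \<subseteq> J" using connected_real_segment[OF symD(4)[OF S] ab] .
  show "\<rho> ` closed_segment a b = closed_segment (\<rho> a) (\<rho> b)"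
    by (rule continuous_injective_image_segment_1)
      (use 1 symD(8)[OF S] sym_inj[OF S] in \<open>auto intro: continuous_on_subset inj_on_subset\<close>)
qed

text \<open>The pieces of a decomposition are intersections of \<open>I\<close> with such images.\<close>

lemma max_symmetry_image:
  assumes M: "max_symmetry g e J \<rho>" and a: "a \<in> J" and b: "b \<in> I" "b \<notin> J"
    and \<sigma>: "\<sigma> = e * (if a < b then 1 else -1)"
  shows "\<rho> ` (J \<inter> closed_segment a b) = {v \<in> I. \<sigma> * \<rho> a \<le> \<sigma> * v}"
proof -
  note S = max_symmetryD[OF M] and D = symD[OF max_symmetryD[OF M]]
  \<comment> \<open>\<open>\<sigma>\<close> is the direction in which the values move while the
    argument runs from \<open>a\<close> towards \<open>b\<close>.\<close>
  have \<sigma>1: "\<sigma> = 1 \<or> \<sigma> = -1" using \<sigma> D(2) by auto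
  have le: "\<sigma> * \<rho> a \<le> \<sigma> * \<rho> u" if "u \<in> J" "u \<in> closed_segment a b" for u
    using that sym_le_iff[OF S a, of u] sym_le_iff[OF S _ a, of u] \<sigma>
    by (cases "a < b") (auto simp: closed_segment_eq_real_ivl split: if_splits)
  show ?thesis
  proof (intro subset_antisym subsetI)
    fix v assume v: "v \<in> {v \<in> I. \<sigma> * \<rho> a \<le> \<sigma> * v}"
    show "v \<in> \<rho> ` (J \<inter> closed_segment a b)"
    proof (rule ccontr)
      assume nv: "v \<notin> \<rho> ` (J \<inter> closed_segment a b)"
      \<comment> \<open>By the intermediate value property, skipping \<open>v\<close> confines all
        values to the segment between \<open>\<rho> a\<close> and \<open>v\<close>, and then
        maximality puts \<open>b\<close> into the domain.\<close>
      have "min (\<rho> a) v \<le> \<rho> u \<and> \<rho> u \<le> max (\<rho> a) v" if u: "u \<in> J" "u \<in> closed_segment a b" for u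
      proof (rule ccontr)
        assume "\<not> ?thesis"
        then have "v \<in> closed_segment (\<rho> a) (\<rho> u)"
          using v le[OF u] \<sigma>1 by (auto simp: closed_segment_eq_real_ivl min_def max_def split: if_splits)
        then have "v \<in> \<rho> ` closed_segment a u" using sym_on_segment(2)[OF S a u(1)] by simp
        moreover have "closed_segment a u \<subseteq> closed_segment a b"
          using u(2) by (simp add: subset_closed_segment)
        ultimately show False using nv sym_on_segment(1)[OF S a u(1)] by blast
      qed
      then have "b \<in> J"
        using D(13)[OF a] v by (intro max_symmetry_walk[OF M a b(1), of "min (\<rho> a) v" "max (\<rho> a) v"])
          (auto simp: min_def max_def)
      then show False using b by simp
    qed
  qed (use le D(13) in auto)
qed

section \<open>Stabilizer and classes\<close>

lemma stab_subset: "stab \<subseteq> carrier G" by (auto simp: curve_stabilizer_def)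

lemma stabD: "g \<in> stab \<Longrightarrow> t \<in> I \<Longrightarrow> act g (\<gamma> t) = \<gamma> t" by (auto simp: curve_stabilizer_def)

lemma stab_subgroup: "subgroup stab G"
  by (rule subgroupI)
    (auto simp: curve_stabilizer_def act_one act_mult intro!: act_inv exI[of _ \<one>])

lemma stab_class_eq_iff:
  assumes "g \<in> carrier G" "h \<in> carrier G"
  shows "stab_class G act I \<gamma> h = stab_class G act I \<gamma> g \<longleftrightarrow> inv g \<otimes> h \<in> stab"
proof
  assume "stab_class G act I \<gamma> h = stab_class G act I \<gamma> g"
  then have "h <# stab = g <# stab" by (simp add: stab_class_def)
  moreover have "h \<in> h <# stab"
    using subgroup.one_closed[OF stab_subgroup] assms by (force simp: l_coset_def)
  ultimately obtain k where "k \<in> stab" "h = g \<otimes> k" by (auto simp: l_coset_def)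
  then show "inv g \<otimes> h \<in> stab" using assms stab_subset by (auto simp: m_assoc[symmetric])
next
  assume *: "inv g \<otimes> h \<in> stab"
  have "h \<in> g <# stab"
    using * assms by (auto simp: l_coset_def m_assoc[symmetric] intro!: bexI[of _ "inv g \<otimes> h"])
  then have "g <# stab = h <# stab" using l_repr_independence[OF _ assms(1) stab_subgroup] by blast
  then show "stab_class G act I \<gamma> h = stab_class G act I \<gamma> g" by (simp add: stab_class_def)
qed

lemma stab_class_one_iff:
  "g \<in> carrier G \<Longrightarrow> stab_class G act I \<gamma> g = stab_class G act I \<gamma> \<one> \<longleftrightarrow> g \<in> stab"
  using stab_class_eq_iff[of \<one> g] by simp

lemma act_stab_quotient:
  assumes "g \<in> carrier G" "h \<in> carrier G" "inv g \<otimes> h \<in> stab" "t \<in> I"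
  shows "act h (\<gamma> t) = act g (\<gamma> t)"
proof -
  have "act g (act (inv g \<otimes> h) (\<gamma> t)) = act g (\<gamma> t)" using stabD assms(3,4) by simp
  moreover have "act g (act (inv g \<otimes> h) (\<gamma> t)) = act h (\<gamma> t)"
    using assms by (simp flip: act_mult add: m_assoc[symmetric])
  ultimately show ?thesis by simp
qed

text \<open>Elements of one class act alike on the curve, so a symmetry belongs to a class rather
  than to an element. Decompositions name only classes, and this allows any representative to be
  used.\<close>

lemma sym_stab_cong:
  assumes "S h e J \<rho>" "g \<in> carrier G" "inv g \<otimes> h \<in> stab"
  shows "S g e J \<rho>"
proof -
  note D = symD[OF assms(1)]
  show ?thesis
    using D assms(2) act_stab_quotient[OF assms(2) D(1) assms(3) D(12)] by (intro symI) auto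
qed

text \<open>Modulo the stabilizer the symmetry belongs to \<open>\<one>\<close>, and a symmetry for
  \<open>\<one>\<close> with a fixed point has the germ of the identity. The fixed point is
  essential: on a periodic curve \<open>\<one>\<close> also admits shifts.\<close>

lemma stab_fix:
  assumes "S g e J \<rho>" "g \<in> stab" "s \<in> J" "\<rho> s = s" "t \<in> J"
  shows "\<rho> t = t"
proof -
  have "S \<one> e J \<rho>"
    by (rule sym_stab_cong[OF assms(1)]) (use assms(2) symD(1)[OF assms(1)] in auto)
  then show ?thesis
    using germ_unique[OF _ sym_id, of e J \<rho> s t] assms symD(12)[OF assms(1)] by auto
qed

lemma stab_fix_increasing:
  assumes "rel g e s s" "g \<in> stab" shows "e = 1"
proof -
  obtain J \<rho> where S: "S g e J \<rho>" "s \<in> J" "\<rho> s = s" using assms(1) by (auto simp: rel_def)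
  obtain r where r: "r > 0" "ball s r \<subseteq> J" using symD(3)[OF S(1)] S(2) openE by blast
  have J: "s + r/2 \<in> J" using r by (auto simp: subset_iff dist_real_def)
  have "e * s < e * (s + r/2)"
    using symD(9)[OF S(1) S(2) J] stab_fix[OF S(1) assms(2) S(2,3) J] S(3) r by simp
  then show ?thesis using symD(2)[OF S(1)] r by auto
qed

text \<open>On the way from \<open>t0\<close> to a point \<open>c\<close> of \<open>J'\<close> the
  values of \<open>\<rho>\<close> coincide with those of \<open>\<sigma>\<close>, hence stay between
  \<open>\<sigma> t0\<close> and \<open>\<sigma> c\<close>, so the domain of a maximal symmetry
  cannot end before \<open>c\<close>. One common value thus decides everything.\<close>

lemma max_symmetry_mono:
  assumes M: "max_symmetry g e J \<rho>" and S: "S h f J' \<sigma>" and st: "inv g \<otimes> h \<in> stab"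
    and t0: "t0 \<in> J" "t0 \<in> J'" "\<rho> t0 = \<sigma> t0"
  shows "J' \<subseteq> J" "\<And>t. t \<in> J' \<Longrightarrow> \<rho> t = \<sigma> t"
proof -
  note D = symD[OF max_symmetryD[OF M]]
  have S': "S g f J' \<sigma>" by (rule sym_stab_cong[OF S D(1) st])
  have eq: "\<rho> t = \<sigma> t" if "t \<in> J" "t \<in> J'" for t
    using germ_unique[OF max_symmetryD[OF M] S' t0] that by blast
  show J: "J' \<subseteq> J"
  proof
    fix c assume c: "c \<in> J'"
    show "c \<in> J"
    proof (rule max_symmetry_walk[OF M t0(1), of c "min (\<sigma> t0) (\<sigma> c)" "max (\<sigma> t0) (\<sigma> c)"])
      fix s assume s: "s \<in> J" "s \<in> closed_segment t0 c"
      have "\<sigma> s \<in> closed_segment (\<sigma> t0) (\<sigma> c)" "s \<in> J'"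
        using sym_on_segment[OF S t0(2) c] s by blast+
      then show "min (\<sigma> t0) (\<sigma> c) \<le> \<rho> s \<and> \<rho> s \<le> max (\<sigma> t0) (\<sigma> c)"
        using eq[of s] s by (auto simp: closed_segment_eq_real_ivl split: if_splits)
    qed (use symD(12,13)[OF S] c t0 in \<open>auto simp: min_def max_def\<close>)
  qed
  show "\<rho> t = \<sigma> t" if "t \<in> J'" for t using eq J that by blast
qed

section \<open>Free intervals in terms of parameters\<close>

text \<open>The pointwise form of the free segment condition for \<open>\<gamma>\<close> restricted
  to an interval; \<open>free_segment_iff\<close> proves the agreement. Interiors appear because an
  overlap takes place along open intervals.\<close>

definition free where
  "free A \<longleftrightarrow> (\<forall>g e s t. rel g e s t \<and> s \<in> interior A \<and> t \<in> interior A \<longrightarrow> g \<in> stab)"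

text \<open>\<open>SF\<close>: no local symmetry but the identity maps a point of the interior to another such point.\<close>

definition SF where
  "SF A \<longleftrightarrow> (\<forall>g e s t. rel g e s t \<and> s \<in> interior A \<and> t \<in> interior A \<longrightarrow> s = t)"

lemma SF_subset: "SF A \<Longrightarrow> interior B \<subseteq> interior A \<Longrightarrow> SF B"
  unfolding SF_def by blast

lemma free_subset: "free A \<Longrightarrow> interior B \<subseteq> interior A \<Longrightarrow> free B"
  unfolding free_def by blast

lemma SF_D: "SF A \<Longrightarrow> rel g e s t \<Longrightarrow> s \<in> interior A \<Longrightarrow> t \<in> interior A \<Longrightarrow> s = t"
  unfolding SF_def by blast

lemma rel_open_nbhd:
  assumes "rel g e s t" "open U" "open V" "s \<in> U" "t \<in> V"
  obtains \<delta> where "\<delta> > 0" "\<And>s'. \<bar>s' - s\<bar> < \<delta> \<Longrightarrow> s' \<in> U \<and> (\<exists>t'. t' \<in> V \<and> rel g e s' t' \<and>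
       (s' < s \<longrightarrow> e * t' < e * t) \<and> (s < s' \<longrightarrow> e * t < e * t'))"
proof -
  obtain r where r: "r > 0" "ball s r \<subseteq> U" using assms openE by blast
  obtain q where q: "q > 0" "ball t q \<subseteq> V" using assms openE by blast
  have V: "t' \<in> V" if "\<bar>t' - t\<bar> < min r q" for t'
    using that q by (auto simp: subset_iff dist_real_def)
  obtain \<delta> where d: "\<delta> > 0" "\<delta> \<le> min r q" "\<And>s'. \<bar>s' - s\<bar> < \<delta> \<Longrightarrow> \<exists>t'. rel g e s' t' \<and> \<bar>t' - t\<bar> < min r q \<and>
       (s' < s \<longrightarrow> e * t' < e * t) \<and> (s < s' \<longrightarrow> e * t < e * t')"
    using rel_near[OF assms(1), of "min r q"] r(1) q(1) by auto
  show thesis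
  proof (rule that[OF d(1)])
    fix s' assume *: "\<bar>s' - s\<bar> < \<delta>"
    have "s' \<in> U" using * d(2) r by (auto simp: subset_iff dist_real_def)
    then show "s' \<in> U \<and> (\<exists>t'. t' \<in> V \<and> rel g e s' t' \<and>
       (s' < s \<longrightarrow> e * t' < e * t) \<and> (s < s' \<longrightarrow> e * t < e * t'))"
      using d(3)[OF *] V by blast
  qed
qed

text \<open>By continuity points near \<open>s\<close> go to interior points of \<open>A\<close>, so
  \<open>SF\<close> makes them all fixed. Hence \<open>g\<close> fixes a whole arc of the curve, and
  \<open>fix_extend\<close> carries this to all of \<open>I\<close>.\<close>

lemma SF_fix_stab:
  assumes "SF A" "rel g e s s" "s \<in> interior A"
  shows "g \<in> stab" "e = 1"
proof -
  obtain \<delta> where d: "\<delta> > 0" "\<And>s'. \<bar>s' - s\<bar> < \<delta> \<Longrightarrow>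
      s' \<in> interior A \<inter> I \<and> (\<exists>t'. t' \<in> interior A \<inter> I \<and> rel g e s' t' \<and>
       (s' < s \<longrightarrow> e * t' < e * s) \<and> (s < s' \<longrightarrow> e * s < e * t'))"
    by (rule rel_open_nbhd[OF assms(2), of "interior A \<inter> I" "interior A \<inter> I"])
      (use assms relD[OF assms(2)] open_I in auto)
  have "open_interval (ball s \<delta>)" using d(1) by (auto simp: open_interval_iff)
  moreover have "ball s \<delta> \<subseteq> I" using d(2) by (auto simp: dist_real_def abs_minus_commute)
  moreover have "act g (\<gamma> t) = \<gamma> t" if "t \<in> ball s \<delta>" for t
    using d(2)[of t] that SF_D[OF assms(1), of g e t] relD(5)[of g e t]
    by (auto simp: dist_real_def abs_minus_commute)
  ultimately have "act g (\<gamma> t) = \<gamma> t" if "t \<in> I" for t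
    using fix_extend[OF relD(1)[OF assms(2)]] that by blast
  then show g: "g \<in> stab" using relD(1)[OF assms(2)] by (auto simp: curve_stabilizer_def)
  show "e = 1" using stab_fix_increasing[OF assms(2) g] .
qed

lemma SF_imp_free: "SF A \<Longrightarrow> free A"
  unfolding free_def using SF_D SF_fix_stab(1) by metis

text \<open>An intermediate value argument, except that the domain need not contain
  \<open>t\<close>. For \<open>s < t\<close>, if the values stayed above the diagonal between
  \<open>s\<close> and \<open>t\<close>, they would lie in \<open>[s, t]\<close>, so a maximal
  symmetry would be defined up to \<open>t\<close>, where its value is below
  \<open>t\<close>.\<close>

lemma decreasing_fixed_point:
  assumes "rel g (-1) s t"
  obtains f where "f \<in> closed_segment s t" "rel g (-1) f f"
proof -
  have main: "\<exists>f\<in>closed_segment s t. rel g (-1) f f" if R: "rel g (-1) s t" and st: "s < t" for g s t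
  proof -
    obtain J \<rho> where M: "max_symmetry g (-1) J \<rho>" "s \<in> J" "\<rho> s = t" using rel_max[OF R] by blast
    note S = max_symmetryD[OF M(1)]
    have ex: "\<exists>u\<in>J. s \<le> u \<and> u \<le> t \<and> \<rho> u \<le> u"
    proof (rule ccontr)
      assume neg: "\<not> ?thesis"
      have "t \<in> J"
      proof (rule max_symmetry_walk[OF M(1,2), of t s t])
        fix u assume "u \<in> J" "u \<in> closed_segment s t"
        then show "s \<le> \<rho> u \<and> \<rho> u \<le> t"
          using neg st sym_le_iff[OF S M(2), of u] M(3) by (force simp: closed_segment_eq_real_ivl)
      qed (use relD(3,4)[OF R] in auto)
      then show False using neg st symD(9)[OF S M(2), of t] M(3) by force
    qed
    then obtain u where u: "u \<in> J" "s \<le> u" "u \<le> t" "\<rho> u \<le> u" by blast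
    have "{s..u} \<subseteq> J" using sym_between[OF S M(2) u(1)] by auto
    then have "continuous_on {s..u} (\<lambda>x. \<rho> x - x)"
      by (intro continuous_intros continuous_on_subset[OF symD(8)[OF S]])
    then obtain f where f: "s \<le> f" "f \<le> u" "\<rho> f - f = 0"
      using IVT2'[of "\<lambda>x. \<rho> x - x" u 0 s] u st M(3) by auto
    have "f \<in> J" using sym_between[OF S M(2) u(1)] f by auto
    then have "rel g (-1) f f" using relI[OF S, of f] f(3) by simp
    then show ?thesis using f u st by (intro bexI[of _ f]) (auto simp: closed_segment_eq_real_ivl)
  qed
  consider "s < t" | "s = t" | "t < s" by linarith
  then show thesis
  proof cases
    case 1 then show ?thesis using main[OF assms] that by blast
  next
    case 2 then show ?thesis using assms that by auto
  next
    case 3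
    then obtain f where f: "f \<in> closed_segment t s" "rel (inv g) (-1) f f"
      using main[OF rel_inverse[OF assms]] by blast
    then have "rel g (-1) f f" using rel_inverse[OF f(2)] relD(1)[OF assms] by simp
    then show ?thesis using that f(1) by (simp add: closed_segment_commute)
  qed
qed

end

section \<open>Consequences of satedness near a point\<close>

context local_symmetries begin

text \<open>Satedness speaks about three different points of the manifold. Local injectivity near
  the midpoint provides three different values, and at most one of them is \<open>x\<close>.\<close>

lemma three_values:
  assumes "a < b" "{a..b} \<subseteq> I"
  obtains s1 s2 where "a < s1" "s1 < s2" "s2 < b" "\<gamma> s1 \<noteq> \<gamma> s2" "\<gamma> s1 \<noteq> x" "\<gamma> s2 \<noteq> x"
proof -
  let ?m = "(a + b) / 2"
  have "?m \<in> I" using assms by auto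
  then obtain r where r: "r > 0" "inj_on \<gamma> (ball ?m r \<inter> I)" using locally_injective by blast
  define d where "d = min r ((b - a) / 2) / 4"
  have d: "d > 0" "4 * d \<le> r" "4 * d \<le> (b - a) / 2" using r assms by (auto simp: d_def min_def)
  have neq: "\<gamma> p \<noteq> \<gamma> q" if "?m \<le> p" "p < q" "q \<le> ?m + 2 * d" for p q
  proof -
    have "a \<le> p" using that assms(1) by argo
    moreover have "q \<le> b" using that d assms(1) by argo
    moreover have "\<bar>p - ?m\<bar> < r" using that d by argo
    moreover have "\<bar>q - ?m\<bar> < r" using that d by argo
    ultimately have "p \<in> ball ?m r \<inter> I" "q \<in> ball ?m r \<inter> I"
      using subsetD[OF assms(2), of p] subsetD[OF assms(2), of q] that
      by (auto simp: dist_real_def abs_minus_commute)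
    then show ?thesis using inj_onD[OF r(2)] that by fastforce
  qed
  have n: "\<gamma> ?m \<noteq> \<gamma> (?m + d)" "\<gamma> ?m \<noteq> \<gamma> (?m + 2 * d)" "\<gamma> (?m + d) \<noteq> \<gamma> (?m + 2 * d)"
    using neq[of ?m "?m + d"] neq[of ?m "?m + 2 * d"] neq[of "?m + d" "?m + 2 * d"] d by auto
  have "a < ?m" using assms(1) by argo
  have "?m + 2 * d < b" using d by argo
  consider "\<gamma> ?m = x" | "\<gamma> ?m \<noteq> x" "\<gamma> (?m + d) = x" | "\<gamma> ?m \<noteq> x" "\<gamma> (?m + d) \<noteq> x" by blast
  then show thesis
  proof cases
    case 1 then show ?thesis using that[of "?m + d" "?m + 2 * d"] n d(1) \<open>a < ?m\<close> \<open>?m + 2 * d < b\<close> by force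
  next
    case 2 then show ?thesis using that[of ?m "?m + 2 * d"] n d(1) \<open>a < ?m\<close> \<open>?m + 2 * d < b\<close> by force
  next
    case 3 then show ?thesis using that[of ?m "?m + d"] n d(1) \<open>a < ?m\<close> \<open>?m + 2 * d < b\<close> by force
  qed
qed

text \<open>Satedness in quantitative form: near \<open>c\<close> there is no room for the images of
  two fixed parameters under one group element. Counterexamples for the radii \<open>1/(n+1)\<close>
  would form a sequence carrying both \<open>\<gamma> s1\<close> and \<open>\<gamma> s2\<close> to
  \<open>\<gamma> c\<close>.\<close>

lemma sated_bound:
  assumes c: "c \<in> I" and neq: "\<gamma> s1 \<noteq> \<gamma> s2" "\<gamma> s1 \<noteq> \<gamma> c" "\<gamma> s2 \<noteq> \<gamma> c"
  obtains \<epsilon> where "\<epsilon> > 0"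
    "\<And>g u v. g \<in> carrier G \<Longrightarrow> u \<in> I \<Longrightarrow> v \<in> I \<Longrightarrow> \<bar>u - c\<bar> < \<epsilon> \<Longrightarrow> \<bar>v - c\<bar> < \<epsilon> \<Longrightarrow>
      act g (\<gamma> s1) = \<gamma> u \<Longrightarrow> act g (\<gamma> s2) = \<gamma> v \<Longrightarrow> False"
proof (rule ccontr)
  assume "\<not> thesis"
  then have "\<exists>g u v. g \<in> carrier G \<and> u \<in> I \<and> v \<in> I \<and> \<bar>u - c\<bar> < inverse (real (Suc n)) \<and>
      \<bar>v - c\<bar> < inverse (real (Suc n)) \<and> act g (\<gamma> s1) = \<gamma> u \<and> act g (\<gamma> s2) = \<gamma> v" for n
    using that[of "inverse (real (Suc n))"] by (metis inverse_positive_iff_positive of_nat_0_less_iff zero_less_Suc)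
  then obtain g u v where *: "\<And>n. g n \<in> carrier G \<and> u n \<in> I \<and> v n \<in> I \<and> \<bar>u n - c\<bar> < inverse (real (Suc n)) \<and>
      \<bar>v n - c\<bar> < inverse (real (Suc n)) \<and> act (g n) (\<gamma> s1) = \<gamma> (u n) \<and> act (g n) (\<gamma> s2) = \<gamma> (v n)"
    by metis
  have lim: "w \<longlonglongrightarrow> c" if "\<And>n. \<bar>w n - c\<bar> < inverse (real (Suc n))" for w :: "nat \<Rightarrow> real"
  proof -
    have "(\<lambda>n. w n - c) \<longlonglongrightarrow> 0"
      by (rule Lim_null_comparison[OF always_eventually LIMSEQ_inverse_real_of_nat])
        (simp add: that less_imp_le del: of_nat_Suc)
    then show ?thesis using LIM_zero_iff by blast
  qed
  have "isCont \<gamma> c" using continuous_curve open_I c continuous_on_eq_continuous_at by blast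
  then have "(\<lambda>n. \<gamma> (u n)) \<longlonglongrightarrow> \<gamma> c" "(\<lambda>n. \<gamma> (v n)) \<longlonglongrightarrow> \<gamma> c"
    using lim[of u] lim[of v] * isCont_tendsto_compose by blast+
  then have "(\<lambda>n. act (g n) (\<gamma> s1)) \<longlonglongrightarrow> \<gamma> c" "(\<lambda>n. act (g n) (\<gamma> s2)) \<longlonglongrightarrow> \<gamma> c"
    using * by simp_all
  moreover have "range g \<subseteq> carrier G" using * by auto
  ultimately show False using sated_action neq unfolding sated_def by metis
qed

text \<open>Going left from \<open>s\<close>, the values of \<open>\<rho>\<close> cannot drop below
  \<open>\<tau>\<close>: by continuity a value between \<open>s\<close> and \<open>\<tau>\<close>
  would then be taken at a point \<open>w \<le> s\<close>, and both would be interior to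
  \<open>A\<close>, against \<open>SF\<close>. So the values remain in
  \<open>[\<tau>, \<rho> s]\<close>, and maximality extends the domain down to
  \<open>m\<close>.\<close>

lemma increasing_stays_outside:
  assumes SF: "SF A" and M: "max_symmetry g 1 J \<rho>" and s: "s \<in> J" "s < \<tau>" "\<tau> \<le> \<rho> s"
    and A: "\<And>x. m \<le> x \<Longrightarrow> x < \<tau> \<Longrightarrow> x \<in> interior A" and m: "m \<le> s" "m \<in> I" and \<tau>: "\<tau> \<in> I"
  shows "m \<in> J" "\<tau> \<le> \<rho> m" "\<rho> m \<le> \<rho> s"
proof -
  note S = max_symmetryD[OF M]
  have out: "\<tau> \<le> \<rho> u \<and> \<rho> u \<le> \<rho> s" if u: "u \<in> J" "m \<le> u" "u \<le> s" for u
  proof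
    show "\<rho> u \<le> \<rho> s" using sym_le_iff[OF S u(1) s(1)] u by simp
    show "\<tau> \<le> \<rho> u"
    proof (rule ccontr)
      assume "\<not> ?thesis"
      then obtain v where v: "max s (\<rho> u) < v" "v < \<tau>" using s dense[of "max s (\<rho> u)" \<tau>] by auto
      then have "v \<in> \<rho> ` closed_segment u s"
        using sym_on_segment(2)[OF S u(1) s(1)] s by (auto simp: closed_segment_eq_real_ivl)
      then obtain w where w: "w \<in> closed_segment u s" "v = \<rho> w" by blast
      then have "w \<in> J" "m \<le> w" "w \<le> s"
        using sym_on_segment(1)[OF S u(1) s(1)] u by (auto simp: closed_segment_eq_real_ivl split: if_splits)
      then have "w = v" using SF_D[OF SF relI[OF S, of w]] w v A s by auto
      then show False using \<open>w \<le> s\<close> v by auto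
    qed
  qed
  show mJ: "m \<in> J"
    by (rule max_symmetry_walk[OF M s(1) m(2) \<tau>, of "\<rho> s"])
      (use out m symD(13)[OF S s(1)] in \<open>auto simp: closed_segment_eq_real_ivl split: if_splits\<close>)
  show "\<tau> \<le> \<rho> m" "\<rho> m \<le> \<rho> s" using out[OF mJ] m by auto
qed

text \<open>If \<open>s < \<tau>\<close>, then \<open>SF\<close> forces
  \<open>t \<ge> \<tau>\<close>, and \<open>increasing_stays_outside\<close> sweeps the fixed
  parameters \<open>s1\<close> and \<open>s2\<close> into \<open>[\<tau>, t]\<close>, which
  satedness forbids for \<open>t\<close> close to \<open>\<tau>\<close>. If neither point is left of
  \<open>\<tau>\<close>, the symmetry is followed back to a point \<open>b\<close> slightly left of
  \<open>\<tau>\<close>, which reduces to the former case.\<close>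

lemma small_increasing_trivial:
  assumes \<tau>: "\<tau> \<in> I" and a: "a < \<tau>" "a \<in> I" and SF: "SF {a<..<\<tau>}"
  obtains \<epsilon> where "\<epsilon> > 0" "\<And>g s t. rel g 1 s t \<Longrightarrow> \<bar>s - \<tau>\<bar> < \<epsilon> \<Longrightarrow> \<bar>t - \<tau>\<bar> < \<epsilon> \<Longrightarrow> s = t"
proof -
  have int: "interior {a<..<\<tau>} = {a<..<\<tau>}" by (simp add: interior_open)
  have "{(a + \<tau>)/2..(a + 3 * \<tau>)/4} \<subseteq> I" using I_between[OF a(2) \<tau>] a by auto
  then obtain s1 s2 where s12: "(a + \<tau>)/2 < s1" "s1 < s2" "s2 < (a + 3 * \<tau>)/4"
      and neq: "\<gamma> s1 \<noteq> \<gamma> s2" "\<gamma> s1 \<noteq> \<gamma> \<tau>" "\<gamma> s2 \<noteq> \<gamma> \<tau>"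
    using three_values[of "(a + \<tau>)/2" "(a + 3 * \<tau>)/4" "\<gamma> \<tau>"] a by auto
  have as: "a < s1" "s2 < \<tau>" using s12 a by auto
  have sI: "s1 \<in> I" using I_between[OF a(2) \<tau>] as s12 by auto
  obtain \<epsilon>0 where \<epsilon>0: "\<epsilon>0 > 0"
    "\<And>g u v. g \<in> carrier G \<Longrightarrow> u \<in> I \<Longrightarrow> v \<in> I \<Longrightarrow> \<bar>u - \<tau>\<bar> < \<epsilon>0 \<Longrightarrow> \<bar>v - \<tau>\<bar> < \<epsilon>0 \<Longrightarrow>
      act g (\<gamma> s1) = \<gamma> u \<Longrightarrow> act g (\<gamma> s2) = \<gamma> v \<Longrightarrow> False"
    using sated_bound[OF \<tau> neq] by blast
  \<comment> \<open>Points closer than \<open>\<epsilon>\<close> to \<open>\<tau>\<close> lie to the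
    right of \<open>s2\<close>, so both reference parameters are on the way when a symmetry is
    extended to the left.\<close>
  define \<epsilon> where "\<epsilon> = min \<epsilon>0 (\<tau> - s2)"
  have \<epsilon>: "\<epsilon> > 0" "\<epsilon> \<le> \<epsilon>0" "\<epsilon> \<le> \<tau> - s2" using \<epsilon>0 as by (auto simp: \<epsilon>_def)
  have A: False if R: "rel g 1 s t" and st: "\<bar>s - \<tau>\<bar> < \<epsilon>" "\<bar>t - \<tau>\<bar> < \<epsilon>" "s < \<tau>" "s \<noteq> t" for g s t
  proof -
    obtain J \<rho> where M: "max_symmetry g 1 J \<rho>" "s \<in> J" "\<rho> s = t" using rel_max[OF R] by blast
    note S = max_symmetryD[OF M(1)]
    have s2s: "s2 < s" "s2 < t" using st \<epsilon> by auto
    have t\<tau>: "\<tau> \<le> t" using SF_D[OF SF R] int st s2s as s12 by force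
    have s1: "s1 \<in> J" "\<tau> \<le> \<rho> s1" "\<rho> s1 \<le> t"
      using increasing_stays_outside[OF SF M(1,2) st(3), of s1] M(3) t\<tau> int s2s as s12 sI \<tau> by auto
    have s2J: "s2 \<in> J" using sym_between[OF S s1(1) M(2)] s2s s12 by auto
    have "\<rho> s1 \<le> \<rho> s2" "\<rho> s2 \<le> t"
      using sym_le_iff[OF S s1(1) s2J] sym_le_iff[OF S s2J M(2)] s12 s2s M(3) by auto
    then show False
      using \<epsilon>0(2)[of g "\<rho> s1" "\<rho> s2"] symD(1)[OF S] symD(13)[OF S s1(1)] symD(13)[OF S s2J]
        symD(10)[OF S s1(1)] symD(10)[OF S s2J] s1 st \<epsilon> t\<tau> by auto
  qed
  have "s = t" if R: "rel g 1 s t" and st: "\<bar>s - \<tau>\<bar> < \<epsilon>" "\<bar>t - \<tau>\<bar> < \<epsilon>" for g s t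
  proof (rule ccontr)
    assume neq: "s \<noteq> t"
    have ge: "\<tau> \<le> s" "\<tau> \<le> t"
      using A[OF R st _ neq] A[OF rel_inverse[OF R] st(2,1) _ neq[symmetric]] by force+
    obtain J \<rho> where M: "max_symmetry g 1 J \<rho>" "s \<in> J" "\<rho> s = t" using rel_max[OF R] by blast
    note S = max_symmetryD[OF M(1)]
    define b where "b = \<tau> - \<epsilon>/2"
    have b: "b < \<tau>" "s2 < b" "\<bar>b - \<tau>\<bar> < \<epsilon>" using \<epsilon> by (auto simp: b_def field_simps)
    have bI: "b \<in> I" "b \<in> {a<..<\<tau>}" using I_between[OF a(2) \<tau>] b as s12 by auto
    \<comment> \<open>A fixed \<open>b\<close> would make \<open>g\<close> a stabilizer element and,
      by \<open>stab_fix\<close>, the symmetry the identity.\<close>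
    have nofix: "\<rho> b \<noteq> b" if "b \<in> J"
    proof
      assume "\<rho> b = b"
      then have "rel g 1 b b" using relI[OF S that] by simp
      then have "g \<in> stab" using SF_fix_stab(1)[OF SF] bI int by blast
      then show False using stab_fix[OF S _ that \<open>\<rho> b = b\<close> M(2)] neq M(3) by auto
    qed
    show False
    \<comment> \<open>Either the values stay above \<open>b\<close> until the argument reaches
      \<open>b\<close>, and \<open>\<rho>\<close> moves \<open>b\<close>; or they cross
      \<open>b\<close> earlier, and the inverse symmetry moves \<open>b\<close>.\<close>
    proof (cases "\<forall>u\<in>J \<inter> closed_segment s b. b \<le> \<rho> u")
      case True
      have "b \<in> J"
      proof (rule max_symmetry_walk[OF M(1,2) bI(1) bI(1), of t])
        fix u assume "u \<in> J" "u \<in> closed_segment s b"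
        then show "b \<le> \<rho> u \<and> \<rho> u \<le> t"
          using True sym_le_iff[OF S _ M(2), of u] M(3) b ge by (auto simp: closed_segment_eq_real_ivl split: if_splits)
      qed (use relD[OF R] in auto)
      moreover have "b \<le> \<rho> b" "\<rho> b \<le> t"
        using True calculation sym_le_iff[OF S _ M(2), of b] M(3) b ge by auto
      moreover have "\<bar>\<rho> b - \<tau>\<bar> < \<epsilon>" using calculation b(3) st(2) by linarith
      ultimately show False
        using A[OF relI[OF S], of b] nofix b st by auto
    next
      case False
      then obtain u where u: "u \<in> J" "u \<in> closed_segment s b" "\<rho> u < b" by auto
      have "b \<in> \<rho> ` closed_segment u s"
        using sym_on_segment(2)[OF S u(1) M(2)] u M(3) ge b by (auto simp: closed_segment_eq_real_ivl)
      then obtain w where w: "w \<in> closed_segment u s" "b = \<rho> w" by blast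
      then have wJ: "w \<in> J" "b \<le> w" "w \<le> s"
        using sym_on_segment(1)[OF S u(1) M(2)] u b ge by (auto simp: closed_segment_eq_real_ivl split: if_splits)
      have "w \<noteq> b" using nofix w wJ by auto
      moreover have "\<bar>w - \<tau>\<bar> < \<epsilon>" using wJ b(3) st(1) by linarith
      ultimately show False
        using A[OF rel_inverse[OF relI[OF S wJ(1)]]] w wJ b st by auto
    qed
  qed
  with \<epsilon>(1) show thesis using that by blast
qed

text \<open>Centres slightly left of \<open>\<tau>\<close> contradict \<open>SF\<close>. If centres
  accumulated from the right, take two of them, \<open>f' < f\<close>, and follow the reflection in
  \<open>f'\<close> to the left. If its values do not exceed \<open>f\<close>, it carries
  \<open>s1\<close> and \<open>s2\<close> into \<open>[f', f]\<close>, against satedness; if they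
  pass \<open>f\<close>, composition with the reflection in \<open>f\<close> is a nontrivial
  increasing symmetry near \<open>\<tau>\<close>.\<close>

lemma small_reflection:
  assumes \<tau>: "\<tau> \<in> I" and a: "a < \<tau>" "a \<in> I" and SF: "SF {a<..<\<tau>}"
  obtains \<epsilon> where "\<epsilon> > 0" "\<And>g f. rel g (-1) f f \<Longrightarrow> \<bar>f - \<tau>\<bar> < \<epsilon> \<Longrightarrow> f = \<tau>"
proof (rule ccontr)
  assume neg: "\<not> thesis"
  note that2 = that
  have ex: "\<exists>g f. rel g (-1) f f \<and> \<tau> < f \<and> f < \<tau> + \<epsilon>" if "\<epsilon> > 0" for \<epsilon>
  proof -
    have "min \<epsilon> (\<tau> - a) > 0" using that a by auto
    then obtain g f where gf: "rel g (-1) f f" "\<bar>f - \<tau>\<bar> < min \<epsilon> (\<tau> - a)" "f \<noteq> \<tau>"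
      using neg that2 by metis
    have "\<not> f < \<tau>" using SF_fix_stab(2)[OF SF gf(1)] gf(2) by (auto simp: interior_open)
    then show ?thesis using gf by (intro exI[of _ g] exI[of _ f]) auto
  qed
  obtain \<epsilon>1 where \<epsilon>1: "\<epsilon>1 > 0" "\<And>g s t. rel g 1 s t \<Longrightarrow> \<bar>s - \<tau>\<bar> < \<epsilon>1 \<Longrightarrow> \<bar>t - \<tau>\<bar> < \<epsilon>1 \<Longrightarrow> s = t"
    using small_increasing_trivial[OF assms] by blast
  \<comment> \<open>Parameters between \<open>b\<close> and \<open>\<tau>\<close> are within
    \<open>\<epsilon>1\<close> of \<open>\<tau>\<close>, so \<open>small_increasing_trivial\<close>
    covers every argument met between \<open>s1\<close> and \<open>f'\<close>.\<close>
  define b where "b = max a (\<tau> - \<epsilon>1)"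
  have b: "b < \<tau>" "a \<le> b" "\<tau> - \<epsilon>1 \<le> b" using a \<epsilon>1 by (auto simp: b_def)
  have bI: "b \<in> I" using I_between[OF a(2) \<tau>] b by auto
  have "{b..(b + \<tau>)/2} \<subseteq> I" using I_between[OF bI \<tau>] b by auto
  then obtain s1 s2 where s12: "b < s1" "s1 < s2" "s2 < (b + \<tau>)/2"
      and neq: "\<gamma> s1 \<noteq> \<gamma> s2" "\<gamma> s1 \<noteq> \<gamma> \<tau>" "\<gamma> s2 \<noteq> \<gamma> \<tau>"
    using three_values[of b "(b + \<tau>)/2" "\<gamma> \<tau>"] b by auto
  have s2\<tau>: "s2 < \<tau>" using s12 b by auto
  have s1I: "s1 \<in> I" using I_between[OF bI \<tau>] s12 b by auto
  obtain \<epsilon>0 where \<epsilon>0: "\<epsilon>0 > 0"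
    "\<And>g u v. g \<in> carrier G \<Longrightarrow> u \<in> I \<Longrightarrow> v \<in> I \<Longrightarrow> \<bar>u - \<tau>\<bar> < \<epsilon>0 \<Longrightarrow> \<bar>v - \<tau>\<bar> < \<epsilon>0 \<Longrightarrow>
      act g (\<gamma> s1) = \<gamma> u \<Longrightarrow> act g (\<gamma> s2) = \<gamma> v \<Longrightarrow> False"
    using sated_bound[OF \<tau> neq] by blast
  obtain g f where f: "rel g (-1) f f" "\<tau> < f" "f < \<tau> + min \<epsilon>0 \<epsilon>1" using ex[of "min \<epsilon>0 \<epsilon>1"] \<epsilon>0 \<epsilon>1 by auto
  have fe: "f < \<tau> + \<epsilon>0" "f < \<tau> + \<epsilon>1" using f(3) by auto
  obtain g' f' where f': "rel g' (-1) f' f'" "\<tau> < f'" "f' < f" using ex[of "f - \<tau>"] f by auto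
  obtain J \<rho> where M: "max_symmetry g' (-1) J \<rho>" "f' \<in> J" "\<rho> f' = f'" using rel_max[OF f'(1)] by blast
  note S = max_symmetryD[OF M(1)]
  have lo: "f' \<le> \<rho> u" if "u \<in> J" "u \<le> f'" for u using sym_le_iff[OF S that(1) M(2)] that M(3) by auto
  show False
  proof (cases "\<forall>u\<in>J \<inter> closed_segment f' s1. \<rho> u \<le> f")
    case True
    have s1: "s1 \<in> J"
      by (rule max_symmetry_walk[OF M(1,2) s1I, of f' f])
        (use True lo relD[OF f(1)] relD[OF f'(1)] s12 s2\<tau> f' in \<open>auto simp: closed_segment_eq_real_ivl\<close>)
    have s2: "s2 \<in> J" using sym_between[OF S s1 M(2)] s12 s2\<tau> f' by auto
    have "f' \<le> \<rho> s1" "f' \<le> \<rho> s2" "\<rho> s1 \<le> f" "\<rho> s2 \<le> f"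
      using lo[OF s1] lo[OF s2] True s1 s2 s12 s2\<tau> f' by (auto simp: closed_segment_eq_real_ivl)
    then show False
      using \<epsilon>0(2)[of g' "\<rho> s1" "\<rho> s2"] symD(1)[OF S] symD(13)[OF S s1] symD(13)[OF S s2]
        symD(10)[OF S s1] symD(10)[OF S s2] f fe f' by auto
  next
    case False
    then obtain u where u: "u \<in> J" "u \<in> closed_segment f' s1" "f < \<rho> u" by auto
    have "f \<in> \<rho> ` closed_segment u f'"
      using sym_on_segment(2)[OF S u(1) M(2)] u M(3) f' by (auto simp: closed_segment_eq_real_ivl)
    then obtain w where w: "w \<in> closed_segment u f'" "f = \<rho> w" by blast
    then have wJ: "w \<in> J" "s1 \<le> w" "w \<le> f'"
      using sym_on_segment(1)[OF S u(1) M(2)] u s12 s2\<tau> f' by (auto simp: closed_segment_eq_real_ivl split: if_splits)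
    have "rel (inv g') (-1) f w" using rel_inverse[OF relI[OF S wJ(1)]] w by simp
    have "\<bar>w - \<tau>\<bar> < \<epsilon>1" "\<bar>f - \<tau>\<bar> < \<epsilon>1" using wJ f(2) f' b(3) s12(1) fe(2) by auto
    then have "f = w" using \<epsilon>1(2)[of "inv g' \<otimes> g" f w] rel_compose[OF f(1) \<open>rel (inv g') (-1) f w\<close>] by simp
    then show False using wJ f' by auto
  qed
qed

text \<open>Being moved is an open condition, so a nontrivial pair can be perturbed away from
  finitely many points. This serves to keep both points off a point \<open>\<tau>\<close> at which
  two parts of an interval meet.\<close>

lemma rel_generic:
  assumes R: "rel g e s t" and U: "open U" "s \<in> U" and V: "open V" "t \<in> V" and neq: "s \<noteq> t" and F: "finite F"
  obtains s' t' where "rel g e s' t'" "s' \<in> U" "t' \<in> V" "s' \<noteq> t'" "s' \<notin> F" "t' \<notin> F"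
proof -
  obtain J \<rho> where S: "S g e J \<rho>" "s \<in> J" "\<rho> s = t" using R by (auto simp: rel_def)
  have c: "continuous_on J (\<lambda>u. \<rho> u - u)" using symD(8)[OF S(1)] by (intro continuous_intros)
  let ?W = "(J \<inter> \<rho> -` V) \<inter> (J \<inter> (\<lambda>u. \<rho> u - u) -` (-{0})) \<inter> U"
  have "open (J \<inter> \<rho> -` V)" "open (J \<inter> (\<lambda>u. \<rho> u - u) -` (-{0}))"
    using continuous_open_preimage[OF symD(8)[OF S(1)] symD(3)[OF S(1)] V(1)]
      continuous_open_preimage[OF c symD(3)[OF S(1)], of "-{0}"] by (blast, simp add: open_Compl)
  then have "open ?W" using U(1) by (meson open_Int)
  moreover have "s \<in> ?W" using S U V neq by auto
  ultimately have "infinite ?W" using empty_interior_finite interior_open by fastforce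
  moreover have "finite (F \<union> (\<rho> -` F \<inter> J))" using F finite_vimage_IntI[OF F sym_inj[OF S(1)]] by auto
  ultimately obtain u where "u \<in> ?W" "u \<notin> F \<union> (\<rho> -` F \<inter> J)" by (meson rev_finite_subset subsetI)
  then show thesis using that[OF relI[OF S(1)], of u] by auto
qed

text \<open>Non-extendability gives a nontrivial pair inside
  \<open>A \<union> {\<tau>..<\<tau> + \<delta>}\<close> for every \<open>\<delta>\<close>. Pairs on
  one side of \<open>\<tau>\<close> are excluded by \<open>SF\<close>,
  \<open>small_increasing_trivial\<close> and \<open>small_reflection\<close>; a decreasing pair
  across \<open>\<tau>\<close> has a fixed point, which can only be \<open>\<tau>\<close>. Without a
  reflection at \<open>\<tau>\<close>, there remains for every \<open>\<delta>\<close> an increasing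
  symmetry across \<open>\<tau>\<close>, and these are identified with a single one.\<close>

lemma right_end:
  assumes A: "A \<subseteq> I" "SF A" "A \<subseteq> {..\<tau>}" and \<tau>: "\<tau> \<in> I" and lt: "\<And>x. x \<in> interior A \<Longrightarrow> x < \<tau>"
    and conv: "\<And>a x. a \<in> interior A \<Longrightarrow> a \<le> x \<Longrightarrow> x < \<tau> \<Longrightarrow> x \<in> interior A" and a0: "a0 \<in> interior A"
    and ext: "\<And>\<delta>. \<delta> > 0 \<Longrightarrow> \<not> SF (A \<union> {\<tau>..<\<tau> + \<delta>})"
  shows "(\<exists>g. rel g (-1) \<tau> \<tau>) \<or>
    (\<exists>g J \<rho>. max_symmetry g 1 J \<rho> \<and> (\<forall>\<delta>>0. \<exists>s\<in>J \<inter> interior A. \<tau> \<le> \<rho> s \<and> \<rho> s < \<tau> + \<delta>))"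
proof (cases "\<exists>g. rel g (-1) \<tau> \<tau>")
  case False
  then have noref: "\<nexists>g. rel g (-1) \<tau> \<tau>" .
  have a0': "a0 < \<tau>" "a0 \<in> I" using lt[OF a0] a0 A(1) interior_subset[of A] by auto
  have "{a0<..<\<tau>} \<subseteq> interior A" using conv[OF a0] by auto
  then have SF0: "SF {a0<..<\<tau>}" using SF_subset[OF A(2)] by (simp add: interior_open)
  obtain \<epsilon>1 where \<epsilon>1: "\<epsilon>1 > 0" "\<And>g s t. rel g 1 s t \<Longrightarrow> \<bar>s - \<tau>\<bar> < \<epsilon>1 \<Longrightarrow> \<bar>t - \<tau>\<bar> < \<epsilon>1 \<Longrightarrow> s = t"
    using small_increasing_trivial[OF \<tau> a0' SF0] by blast
  obtain \<epsilon>2 where \<epsilon>2: "\<epsilon>2 > 0" "\<And>g f. rel g (-1) f f \<Longrightarrow> \<bar>f - \<tau>\<bar> < \<epsilon>2 \<Longrightarrow> f = \<tau>"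
    using small_reflection[OF \<tau> a0' SF0] by blast
  define \<epsilon> where "\<epsilon> = min \<epsilon>1 \<epsilon>2"
  have \<epsilon>: "\<epsilon> > 0" "\<epsilon> \<le> \<epsilon>1" "\<epsilon> \<le> \<epsilon>2" using \<epsilon>1 \<epsilon>2 by (auto simp: \<epsilon>_def)
  have P: "\<exists>g s t. rel g 1 s t \<and> s \<in> interior A \<and> \<tau> < t \<and> t < \<tau> + \<delta>" if \<delta>: "0 < \<delta>" "\<delta> \<le> \<epsilon>" for \<delta>
  proof -
    let ?C = "A \<union> {\<tau>..<\<tau> + \<delta>}"
    have C: "x \<in> interior A \<or> \<tau> \<le> x \<and> x < \<tau> + \<delta>" if x: "x \<in> interior ?C" for x
    proof (cases "x < \<tau>")
      case True
      obtain r where r: "r > 0" "ball x r \<subseteq> ?C" using x mem_interior by blast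
      have "ball x (min r (\<tau> - x)) \<subseteq> A" using r(2) by (auto simp: subset_iff dist_real_def)
      moreover have "min r (\<tau> - x) > 0" using r(1) True by auto
      ultimately show ?thesis using mem_interior by blast
    next
      case False
      moreover have "x \<in> ?C" using x interior_subset by blast
      ultimately show ?thesis using A(3) \<delta>(1) by force
    qed
    obtain g0 e0 s0 t0 where 0: "rel g0 e0 s0 t0" "s0 \<in> interior ?C" "t0 \<in> interior ?C" "s0 \<noteq> t0"
      using ext[OF \<delta>(1)] unfolding SF_def by blast
    obtain s t where R: "rel g0 e0 s t" and st: "s \<in> interior ?C" "t \<in> interior ?C" "s \<noteq> t" "s \<noteq> \<tau>" "t \<noteq> \<tau>"
      by (rule rel_generic[OF 0(1) open_interior 0(2) open_interior 0(3,4), of "{\<tau>}"]) auto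
    have mixed: ?thesis if R: "rel g e s t" and st: "s \<in> interior A" "\<tau> < t" "t < \<tau> + \<delta>" for g e s t
    proof -
      have "e \<noteq> -1"
      proof
        assume "e = -1"
        then obtain f where f: "f \<in> closed_segment s t" "rel g (-1) f f"
          using decreasing_fixed_point R by blast
        have sf: "s \<le> f" "f \<le> t" using f(1) st lt[OF st(1)] by (auto simp: closed_segment_eq_real_ivl split: if_splits)
        have "\<not> f < \<tau>" using SF_fix_stab(2)[OF A(2) f(2)] conv[OF st(1) sf(1)] by auto
        then have "f = \<tau>" using \<epsilon>2(2)[OF f(2)] sf st \<delta> \<epsilon> by auto
        then show False using noref f(2) by blast
      qed
      then show ?thesis using R relD(2)[OF R] st by blast
    qed
    consider "s \<in> interior A" "t \<in> interior A" | "s \<in> interior A" "\<tau> < t" "t < \<tau> + \<delta>"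
      | "t \<in> interior A" "\<tau> < s" "s < \<tau> + \<delta>" | "\<tau> < t" "t < \<tau> + \<delta>" "\<tau> < s" "s < \<tau> + \<delta>"
      using C[OF st(1)] C[OF st(2)] st by fastforce
    then show ?thesis
    proof cases
      case 1 then show ?thesis using SF_D[OF A(2) R] st by blast
    next
      case 2 then show ?thesis using mixed[OF R] by blast
    next
      case 3 then show ?thesis using mixed[OF rel_inverse[OF R]] by blast
    next
      case 4
      have "e0 \<noteq> 1"
      proof
        assume "e0 = 1" then show False using \<epsilon>1(2)[of g0 s t] R st 4 \<delta> \<epsilon> by auto
      qed
      then have "rel g0 (-1) s t" using R relD(2)[OF R] by auto
      then obtain f where f: "f \<in> closed_segment s t" "rel g0 (-1) f f"
        using decreasing_fixed_point by blast
      have "\<tau> < f" "f < \<tau> + \<delta>" using f(1) 4 by (auto simp: closed_segment_eq_real_ivl split: if_splits)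
      then show ?thesis using \<epsilon>2(2)[OF f(2)] \<delta> \<epsilon> by auto
    qed
  qed
  obtain g0 s0 t0 where R0: "rel g0 1 s0 t0" "s0 \<in> interior A" "\<tau> < t0" "t0 < \<tau> + \<epsilon>"
    using P[OF \<epsilon>(1)] by auto
  obtain J0 \<rho>0 where M0: "max_symmetry g0 1 J0 \<rho>0" "s0 \<in> J0" "\<rho>0 s0 = t0" using rel_max[OF R0(1)] by blast
  have "\<exists>s\<in>J0 \<inter> interior A. \<tau> \<le> \<rho>0 s \<and> \<rho>0 s < \<tau> + \<delta>" if \<delta>: "\<delta> > 0" for \<delta>
  proof -
    obtain g s t where R: "rel g 1 s t" "s \<in> interior A" "\<tau> < t" "t < \<tau> + min \<delta> \<epsilon>"
      using P[of "min \<delta> \<epsilon>"] \<delta> \<epsilon> by auto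
    obtain J \<rho> where M: "max_symmetry g 1 J \<rho>" "s \<in> J" "\<rho> s = t" using rel_max[OF R(1)] by blast
    \<comment> \<open>Left of both \<open>s\<close> and \<open>s0\<close> the two symmetries are
      defined with values just above \<open>\<tau>\<close>. Composing one with the inverse of the
      other links these values by an increasing symmetry near \<open>\<tau>\<close>, so they
      coincide; hence the fixed \<open>\<rho>0\<close> comes as close to \<open>\<tau>\<close> as
      the symmetry found for \<open>\<delta>\<close>.\<close>
    define m where "m = min s s0"
    have m: "m \<le> s" "m \<le> s0" "m \<in> interior A" using R R0 by (auto simp: m_def min_def)
    have mI: "m \<in> I" using m(3) A(1) interior_subset[of A] by auto
    have 1: "m \<in> J" "\<tau> \<le> \<rho> m" "\<rho> m \<le> t"
      using increasing_stays_outside[OF A(2) M(1,2), of \<tau> m] lt[OF R(2)] M(3) R conv[OF m(3)] m(1) mI \<tau> by auto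
    have 2: "m \<in> J0" "\<tau> \<le> \<rho>0 m" "\<rho>0 m \<le> t0"
      using increasing_stays_outside[OF A(2) M0(1,2), of \<tau> m] lt[OF R0(2)] M0(3) R0 conv[OF m(3)] m(2) mI \<tau> by auto
    have "rel (g0 \<otimes> inv g) (1 * 1) (\<rho> m) (\<rho>0 m)"
      using rel_compose[OF rel_inverse[OF relI[OF max_symmetryD[OF M(1)] 1(1)]] relI[OF max_symmetryD[OF M0(1)] 2(1)]] .
    then have "\<rho> m = \<rho>0 m" using \<epsilon>1(2)[of _ "\<rho> m" "\<rho>0 m"] 1 2 R R0 \<epsilon> by auto
    then show ?thesis using 1 2 R m(3) by (intro bexI[of _ m]) auto
  qed
  then show ?thesis using M0(1) by blast
qed blast

end

section \<open>Maximal intervals\<close>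

lemma connected_Int_real:
  fixes A B :: "real set"
  shows "connected A \<Longrightarrow> connected B \<Longrightarrow> connected (A \<inter> B)"
  by (metis is_interval_connected_1 is_interval_Int)

context local_symmetries begin

text \<open>A point beyond \<open>[m, p]\<close> leaves room to perturb the pair
  \<open>(m, p)\<close>: with extra room on the left, \<open>m\<close> is moved left and its image
  enters \<open>(m, p)\<close>; with extra room on the right, \<open>m\<close> is moved right and
  its image passes \<open>p\<close>. Either way a nontrivial pair of interior points
  appears.\<close>

lemma not_SF_extend:
  assumes R: "rel g 1 m p" and mp: "m < p" and B: "connected B" "{m..p} \<subseteq> B" "B \<noteq> {m..p}"
  shows "\<not> SF B"
proof
  assume SF: "SF B"
  obtain z where z: "z \<in> B" "z < m \<or> p < z" using B(2,3) by force
  define \<eta> where "\<eta> = min (p - m) (if z < m then p - m else z - p)"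
  have \<eta>: "\<eta> > 0" "\<eta> \<le> p - m" "\<not> z < m \<Longrightarrow> \<eta> \<le> z - p" using mp z(2) by (auto simp: \<eta>_def)
  obtain \<delta> where d: "\<delta> > 0" "\<delta> \<le> \<eta>" "\<And>s'. \<bar>s' - m\<bar> < \<delta> \<Longrightarrow> \<exists>t'. rel g 1 s' t' \<and> \<bar>t' - p\<bar> < \<eta> \<and>
       (s' < m \<longrightarrow> 1 * t' < 1 * p) \<and> (m < s' \<longrightarrow> 1 * p < 1 * t')"
    using rel_near[OF R \<eta>(1)] by metis
  have mB: "m \<in> B" "p \<in> B" using B(2) mp by auto
  show False
  proof (cases "z < m")
    case True
    define s where "s = max ((z + m)/2) (m - \<delta>/2)"
    have s: "z < s" "s < m" "\<bar>s - m\<bar> < \<delta>" using True d(1) by (auto simp: s_def field_simps max_def)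
    obtain t where t: "rel g 1 s t" "m < t" "t < p" using d(3)[OF s(3)] s(2) \<eta>(2) by force
    have "s \<in> interior B" using in_interior_connected_real_iff[OF B(1)] z(1) mB(1) s by blast
    moreover have "t \<in> interior B" using in_interior_connected_real_iff[OF B(1), of t] mB t by auto
    ultimately show False using SF_D[OF SF t(1)] s t by auto
  next
    case False
    then have pz: "p < z" using z(2) by auto
    define s where "s = m + \<delta>/2"
    have s: "m < s" "s < p" "\<bar>s - m\<bar> < \<delta>" using d(1,2) \<eta>(2) mp by (auto simp: s_def)
    obtain t where t: "rel g 1 s t" "t < z" "p < t" using d(3)[OF s(3)] s(1) \<eta>(3)[OF False] by force
    have "s \<in> interior B" using in_interior_connected_real_iff[OF B(1)] mB s by blast
    moreover have "t \<in> interior B" using in_interior_connected_real_iff[OF B(1), of t] mB(2) z(1) t by auto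
    ultimately show False using SF_D[OF SF t(1)] s t by auto
  qed
qed

text \<open>Maximality with respect to \<open>SF\<close>. By \<open>maximal_interval_iff\<close>
  this is the notion of a maximal interval once \<open>I\<close> is known not to be free.\<close>

definition maxint where
  "maxint B \<longleftrightarrow> connected B \<and> interior B \<noteq> {} \<and> B \<subseteq> I \<and> SF B \<and>
    (\<forall>B'. connected B' \<and> B' \<subseteq> I \<and> SF B' \<and> B \<subseteq> B' \<longrightarrow> B' = B)"

lemma maxintD:
  assumes "maxint B"
  shows "connected B" "interior B \<noteq> {}" "B \<subseteq> I" "SF B"
    "\<And>B'. connected B' \<Longrightarrow> B' \<subseteq> I \<Longrightarrow> SF B' \<Longrightarrow> B \<subseteq> B' \<Longrightarrow> B' = B"
  using assms unfolding maxint_def by blast+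

text \<open>Zorn's lemma. The union of a chain inherits \<open>SF\<close>, because an interior point
  of the union lies strictly between two of its points, and these already belong to one member of
  the chain.\<close>

lemma maxint_exists:
  assumes A: "connected A" "interior A \<noteq> {}" "A \<subseteq> I" "SF A"
  obtains B where "maxint B" "A \<subseteq> B"
proof -
  define F where "F = {B. connected B \<and> A \<subseteq> B \<and> B \<subseteq> I \<and> SF B}"
  have "\<exists>M\<in>F. \<forall>X\<in>F. M \<subseteq> X \<longrightarrow> X = M"
  proof (rule subset_Zorn_nonempty)
    show "F \<noteq> {}" using A by (auto simp: F_def)
    fix C assume C: "C \<noteq> {}" "subset.chain F C"
    have CF: "B \<in> F" if "B \<in> C" for B using C(2) that by (auto simp: subset.chain_def)
    have tot: "X \<subseteq> Y \<or> Y \<subseteq> X" if "X \<in> C" "Y \<in> C" for X Y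
      using C(2) that by (auto simp: subset_chain_def)
    have conn: "connected (\<Union>C)"
      by (rule connected_Union) (use CF A(2) interior_subset C(1) in \<open>auto simp: F_def\<close>, blast)
    have inB: "\<exists>B\<in>C. x \<in> interior B" if x: "x \<in> interior (\<Union>C)" for x
    proof -
      obtain a b where ab: "a \<in> \<Union>C" "b \<in> \<Union>C" "a < x" "x < b"
        using x in_interior_connected_real_iff[OF conn] by blast
      then obtain X Y where "X \<in> C" "a \<in> X" "Y \<in> C" "b \<in> Y" by blast
      then obtain Z where Z: "Z \<in> C" "a \<in> Z" "b \<in> Z" using tot by blast
      then show ?thesis
        using in_interior_connected_real_iff[of Z x] CF[OF Z(1)] ab by (auto simp: F_def)
    qed
    have "SF (\<Union>C)"
      unfolding SF_def
    proof (intro allI impI)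
      fix g e s t assume *: "rel g e s t \<and> s \<in> interior (\<Union>C) \<and> t \<in> interior (\<Union>C)"
      then obtain X Y where XY: "X \<in> C" "s \<in> interior X" "Y \<in> C" "t \<in> interior Y" using inB by blast
      then obtain Z where "Z \<in> C" "s \<in> interior Z" "t \<in> interior Z"
        using tot[OF XY(1,3)] interior_mono by blast
      then show "s = t" using CF[of Z] * SF_D[of Z g e s t] by (auto simp: F_def)
    qed
    moreover have "A \<subseteq> \<Union>C" "\<Union>C \<subseteq> I" using CF C(1) by (auto simp: F_def)
    ultimately show "\<Union>C \<in> F" using conn by (auto simp: F_def)
  qed
  then obtain M where M: "M \<in> F" "\<And>X. X \<in> F \<Longrightarrow> M \<subseteq> X \<Longrightarrow> X = M" by blast
  have "B' = M" if "connected B'" "B' \<subseteq> I" "SF B'" "M \<subseteq> B'" for B'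
    using M(2)[of B'] M(1) that by (auto simp: F_def)
  moreover have "interior M \<noteq> {}" using M(1) A(2) interior_mono[of A M] by (auto simp: F_def)
  ultimately have "maxint M" using M(1) unfolding maxint_def F_def by blast
  then show thesis using that M(1) by (auto simp: F_def)
qed

text \<open>Adding to \<open>B\<close> those of its end points that lie in \<open>I\<close> does not
  change the interior, hence preserves \<open>SF\<close>; so a maximal interval contains them. If
  \<open>B\<close> is bounded by points of \<open>I\<close> on neither side, then \<open>I\<close>
  itself would be \<open>SF\<close>.\<close>

lemma maxint_shape:
  assumes B: "maxint B" and I: "\<not> SF I"
  shows "(\<exists>\<tau>\<in>I. B = I \<inter> {..\<tau>}) \<or> (\<exists>\<tau>\<in>I. B = I \<inter> {\<tau>..}) \<or> (\<exists>x\<in>I. \<exists>y\<in>I. x < y \<and> B = {x..y})"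
proof -
  note D = maxintD[OF B]
  \<comment> \<open>\<open>P\<close> and \<open>Q\<close> record whether \<open>B\<close> is bounded
    by points of \<open>I\<close>, in which case its supremum or infimum is itself a point of
    \<open>I\<close>.\<close>
  define P where "P \<longleftrightarrow> (\<exists>u\<in>I. \<forall>b\<in>B. b \<le> u)"
  define Q where "Q \<longleftrightarrow> (\<exists>u\<in>I. \<forall>b\<in>B. u \<le> b)"
  define C where "C = {t \<in> I. (P \<longrightarrow> t \<le> Sup B) \<and> (Q \<longrightarrow> Inf B \<le> t)}"
  obtain b0 where b0: "b0 \<in> interior B" using D(2) by blast
  then have b0B: "b0 \<in> B" using interior_subset by blast
  have PB: "bdd_above B" if P using that by (auto simp: P_def bdd_above_def)
  have QB: "bdd_below B" if Q using that by (auto simp: Q_def bdd_below_def)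
  have BC: "B \<subseteq> C" using D(3) cSup_upper[OF _ PB] cInf_lower[OF _ QB] by (auto simp: C_def)
  have conn: "connected C" by (rule connected_realI) (auto simp: C_def intro: I_between less_imp_le)
  have "interior C \<subseteq> interior B"
  proof
    fix x assume "x \<in> interior C"
    then obtain a b where ab: "a \<in> C" "b \<in> C" "a < x" "x < b"
      using in_interior_connected_real_iff[OF conn] by blast
    have "\<exists>b'\<in>B. x < b'"
    proof (cases P)
      case True
      then have "x < Sup B" using ab by (auto simp: C_def)
      then show ?thesis using less_cSup_iff[OF _ PB[OF True]] b0B by blast
    next
      case False
      moreover have "b \<in> I" using ab by (auto simp: C_def)
      ultimately obtain b' where "b' \<in> B" "b < b'" by (force simp: P_def)
      then show ?thesis using ab by (intro bexI[of _ b']) auto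
    qed
    moreover have "\<exists>a'\<in>B. a' < x"
    proof (cases Q)
      case True
      then have "Inf B < x" using ab by (auto simp: C_def)
      then show ?thesis using cInf_less_iff[OF _ QB[OF True]] b0B by blast
    next
      case False
      moreover have "a \<in> I" using ab by (auto simp: C_def)
      ultimately obtain b' where "b' \<in> B" "b' < a" by (force simp: Q_def)
      then show ?thesis using ab by (intro bexI[of _ b']) auto
    qed
    ultimately show "x \<in> interior B" using in_interior_connected_real_iff[OF D(1)] by blast
  qed
  then have SFC: "SF C" by (rule SF_subset[OF D(4)])
  have "C \<subseteq> I" by (auto simp: C_def)
  then have CB: "C = B" using D(5)[OF conn _ SFC BC] by blast
  have SI: "Sup B \<in> I" if hP: P
  proof -
    obtain u where u: "u \<in> I" "\<forall>b\<in>B. b \<le> u" using hP by (auto simp: P_def)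
    have "b0 \<le> Sup B" "Sup B \<le> u" using cSup_upper[OF b0B PB[OF hP]] cSup_least[of B u] u b0B by auto
    then show ?thesis using I_between[of b0 u] u b0B D(3) by auto
  qed
  have II: "Inf B \<in> I" if hQ: Q
  proof -
    obtain u where u: "u \<in> I" "\<forall>b\<in>B. u \<le> b" using hQ by (auto simp: Q_def)
    have "Inf B \<le> b0" "u \<le> Inf B" using cInf_lower[OF b0B QB[OF hQ]] cInf_greatest[of B u] u b0B by auto
    then show ?thesis using I_between[of u b0] u b0B D(3) by auto
  qed
  consider "P" "Q" | "P" "\<not> Q" | "\<not> P" "Q" | "\<not> P" "\<not> Q" by blast
  then show ?thesis
  proof cases
    case 1
    obtain a b where "a \<in> B" "b \<in> B" "a < b0" "b0 < b" using b0 in_interior_connected_real_iff[OF D(1)] by blast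
    then have "Inf B < Sup B" using cSup_upper[OF _ PB[OF 1(1)], of b] cInf_lower[OF _ QB[OF 1(2)], of a] by force
    moreover have "B = {Inf B..Sup B}" using CB 1 I_between[OF II[OF 1(2)] SI[OF 1(1)]] by (auto simp: C_def)
    ultimately show ?thesis using SI[OF 1(1)] II[OF 1(2)] by blast
  next
    case 2
    then have "B = I \<inter> {..Sup B}" using CB by (auto simp: C_def)
    then show ?thesis using SI[OF 2(1)] by blast
  next
    case 3
    then have "B = I \<inter> {Inf B..}" using CB by (auto simp: C_def)
    then show ?thesis using II[OF 3(2)] by blast
  next
    case 4
    then have "C = I" by (auto simp: C_def)
    then show ?thesis using SFC I by simp
  qed
qed

text \<open>The symmetry that approaches \<open>y\<close> from above can be followed left to
  \<open>x\<close>. Its value there cannot be above \<open>y\<close>, as smaller values occur to the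
  right of \<open>x\<close>, nor below \<open>y\<close>, as values to the right of \<open>x\<close>
  are at least \<open>y\<close>.\<close>

lemma increasing_limit_at_start:
  assumes SF: "SF {x..y}" and xy: "x < y" "x \<in> I" "y \<in> I" and M: "max_symmetry g 1 J \<rho>"
    and lim: "\<And>\<delta>. \<delta> > 0 \<Longrightarrow> \<exists>s\<in>J. x < s \<and> s < y \<and> y \<le> \<rho> s \<and> \<rho> s < y + \<delta>"
  shows "rel g 1 x y"
proof -
  note S = max_symmetryD[OF M]
  obtain s where s: "s \<in> J" "x < s" "s < y" "y \<le> \<rho> s" using lim[of 1] by auto
  have out: "m \<in> J \<and> y \<le> \<rho> m \<and> \<rho> m \<le> \<rho> s" if "x < m" "m \<le> s" for m
    using increasing_stays_outside[OF SF M s(1,3,4), of m] that xy s I_between[OF xy(2,3), of m] by auto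
  have xJ: "x \<in> J"
  proof (rule ccontr)
    assume n: "x \<notin> J"
    have "x \<in> J"
    proof (rule max_symmetry_walk[OF M s(1) xy(2,3), of "\<rho> s"])
      fix u assume u: "u \<in> J" "u \<in> closed_segment s x"
      then have "x < u" "u \<le> s" using n s by (auto simp: closed_segment_eq_real_ivl order_le_less split: if_splits)
      then show "y \<le> \<rho> u \<and> \<rho> u \<le> \<rho> s" using out by blast
    qed (use symD(13)[OF S s(1)] in auto)
    then show False using n by simp
  qed
  have "\<not> y < \<rho> x"
  proof
    assume "y < \<rho> x"
    then obtain s' where "s' \<in> J" "x < s'" "\<rho> s' < y + (\<rho> x - y)" using lim[of "\<rho> x - y"] by auto
    then show False using symD(9)[OF S xJ, of s'] by auto
  qed
  moreover have "\<not> \<rho> x < y"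
  proof
    assume "\<rho> x < y"
    then obtain v where v: "\<rho> x < v" "v < y" using dense by blast
    then have "v \<in> \<rho> ` closed_segment x s"
      using sym_on_segment(2)[OF S xJ s(1)] s by (auto simp: closed_segment_eq_real_ivl)
    then obtain w where w: "x \<le> w" "w \<le> s" "v = \<rho> w" using s by (auto simp: closed_segment_eq_real_ivl)
    then have "w \<noteq> x" using v by auto
    then show False using out[of w] w v by auto
  qed
  ultimately show ?thesis using relI[OF S xJ] by (auto simp: order_antisym_conv)
qed

text \<open>The symmetry acts as a shift along the ray, and \<open>[m, \<rho> m]\<close> with
  \<open>m < \<tau> < \<rho> m\<close> is a fundamental domain. Parameters between
  \<open>\<tau>\<close> and \<open>\<rho> m\<close> are images of parameters left of
  \<open>m\<close>, so any pair inside can be transported into the ray, where \<open>SF\<close>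
  applies; by \<open>not_SF_extend\<close> nothing larger works.\<close>

lemma increasing_limit_at_ray:
  assumes SF: "SF (I \<inter> {..\<tau>})" and \<tau>: "\<tau> \<in> I" and M: "max_symmetry g 1 J \<rho>"
    and lim: "\<And>\<delta>. \<delta> > 0 \<Longrightarrow> \<exists>s\<in>J. s < \<tau> \<and> \<tau> \<le> \<rho> s \<and> \<rho> s < \<tau> + \<delta>"
  obtains m p where "m \<in> I" "p \<in> I" "m < p" "maxint {m..p}"
proof -
  note S = max_symmetryD[OF M]
  have "interior (I \<inter> {..\<tau>}) = I \<inter> {..<\<tau>}" using open_I by (simp add: interior_open)
  then have int: "x \<in> interior (I \<inter> {..\<tau>})" if "x \<in> I" "x < \<tau>" for x using that by auto
  obtain s where s: "s \<in> J" "s < \<tau>" "\<tau> \<le> \<rho> s" using lim[of 1] by auto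
  obtain r where r: "r > 0" "ball s r \<subseteq> J" using symD(3)[OF S] s(1) openE by blast
  \<comment> \<open>A point left of \<open>s\<close>; the still smaller \<open>s - 3*r/4\<close> has
    a value at least \<open>\<tau>\<close>, which makes \<open>\<rho> m\<close> strictly larger than
    \<open>\<tau>\<close>.\<close>
  define m where "m = s - r/2"
  have m: "m \<in> J" "m < s" using r by (auto simp: m_def subset_iff dist_real_def)
  have "s - 3*r/4 \<in> J" using r by (auto simp: subset_iff dist_real_def)
  moreover have "\<tau> \<le> \<rho> (s - 3*r/4)"
    by (rule increasing_stays_outside(2)[OF SF M s])
      (use int I_between[OF symD(12)[OF S calculation] \<tau>] r symD(12)[OF S calculation] \<tau> in auto)
  ultimately have \<rho>m: "\<tau> < \<rho> m" using symD(9)[OF S _ m(1), of "s - 3*r/4"] r by (auto simp: m_def)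
  let ?p = "\<rho> m"
  have mI: "m \<in> I" "?p \<in> I" using symD(12,13)[OF S m(1)] by auto
  have mt: "m < \<tau>" using m s by auto
  have R: "rel g 1 m ?p" using relI[OF S m(1)] .
  have g: "g \<in> carrier G" using symD(1)[OF S] .
  have onto: "\<exists>u\<in>J. u < m \<and> \<rho> u = v" if v: "\<tau> < v" "v < ?p" for v
  proof -
    have "v - \<tau> > 0" using v by simp
    then obtain s' where s': "s' \<in> J" "\<rho> s' < v" using lim[of "v - \<tau>"] by auto
    then have "s' < m" using sym_less_iff[OF S s'(1) m(1)] v by auto
    have "v \<in> \<rho> ` closed_segment s' m"
      using sym_on_segment(2)[OF S s'(1) m(1)] s' v by (auto simp: closed_segment_eq_real_ivl)
    then obtain u where u: "u \<in> closed_segment s' m" "v = \<rho> u" by blast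
    then have "u \<in> J" using sym_on_segment(1)[OF S s'(1) m(1)] by blast
    moreover have "u \<noteq> m" using u v by auto
    ultimately show ?thesis using u \<open>s' < m\<close> by (intro bexI[of _ u]) (auto simp: closed_segment_eq_real_ivl)
  qed
  have inI: "x \<in> I" if "m < x" "x < ?p" for x using I_between[OF mI] that by auto
  \<comment> \<open>The transported pair consists of \<open>a > m\<close> and \<open>u < m\<close>,
    so it is nontrivial.\<close>
  have mixed: False if Q: "rel h e a b" "m < a" "a < \<tau>" "\<tau> < b" "b < ?p" for h e a b
  proof -
    obtain u where u: "u \<in> J" "u < m" "\<rho> u = b" using onto Q by blast
    have "rel (inv g) 1 b u" using rel_inverse[OF relI[OF S u(1)]] u by simp
    from rel_compose[OF Q(1) this] have "a = u"
      using SF_D[OF SF] int[of a] int[of u] symD(12)[OF S u(1)] inI[of a] Q u mt \<rho>m by auto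
    then show False using Q u by auto
  qed
  have SFm: "SF {m..?p}"
    unfolding SF_def
  proof (intro allI impI, rule ccontr)
    fix h e a0 b0
    assume 0: "rel h e a0 b0 \<and> a0 \<in> interior {m..?p} \<and> b0 \<in> interior {m..?p}" and ab0: "a0 \<noteq> b0"
    obtain a b where Q: "rel h e a b" and ab: "m < a" "a < ?p" "m < b" "b < ?p" "a \<noteq> b" "a \<noteq> \<tau>" "b \<noteq> \<tau>"
      by (rule rel_generic[of h e a0 b0 "{m<..<?p}" "{m<..<?p}" "{\<tau>}"]) (use 0 ab0 in auto)
    consider "a < \<tau>" "b < \<tau>" | "a < \<tau>" "\<tau> < b" | "\<tau> < a" "b < \<tau>" | "\<tau> < a" "\<tau> < b" using ab by linarith
    then show False
    proof cases
      case 1 then show False using SF_D[OF SF Q] int inI ab by auto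
    next
      case 2 then show False using mixed[OF Q] ab by blast
    next
      case 3 then show False using mixed[OF rel_inverse[OF Q]] ab by blast
    next
      case 4
      obtain u where u: "u \<in> J" "u < m" "\<rho> u = a" using onto 4 ab by blast
      obtain v where v: "v \<in> J" "v < m" "\<rho> v = b" using onto 4 ab by blast
      have "rel (inv g) 1 b v" using rel_inverse[OF relI[OF S v(1)]] v by simp
      from rel_compose[OF rel_compose[OF relI[OF S u(1)]] this, of h e] have "u = v"
        using SF_D[OF SF] int[of u] int[of v] symD(12)[OF S u(1)] symD(12)[OF S v(1)] u v Q mt by auto
      then show False using u v ab by auto
    qed
  qed
  have mp: "m < ?p" using mt \<rho>m by simp
  have "{m..?p} \<subseteq> I" using I_between[OF mI] by auto
  then have "maxint {m..?p}"
    using mp SFm not_SF_extend[OF R mp] by (auto simp: maxint_def)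
  then show thesis using that mI mp by blast
qed

text \<open>By maximality \<open>SF\<close> fails on every extension past \<open>y\<close>, which
  feeds \<open>right_end\<close>; the increasing symmetry it may return becomes a shift from
  \<open>x\<close> to \<open>y\<close>.\<close>

lemma maxint_compact_right:
  assumes B: "maxint {x..y}" and xy: "x < y"
  shows "(\<exists>g. rel g 1 x y) \<or> (\<exists>g. rel g (-1) y y)"
proof -
  note D = maxintD[OF B]
  have I: "x \<in> I" "y \<in> I" using D(3) xy by auto
  have int: "interior {x..y} = {x<..<y}" by simp
  have ext: "\<not> SF ({x..y} \<union> {y..<y + \<delta>})" if "\<delta> > 0" for \<delta>
  proof
    assume SF: "SF ({x..y} \<union> {y..<y + \<delta>})"
    obtain r where r: "r > 0" "ball y r \<subseteq> I" using open_I I(2) openE by blast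
    define z where "z = y + min \<delta> r / 2"
    have z: "y < z" "z < y + \<delta>" "z \<in> I" using r that by (auto simp: z_def subset_iff dist_real_def)
    have "{x..z} \<subseteq> {x..y} \<union> {y..<y + \<delta>}" using z by auto
    then have "SF {x..z}" using SF_subset[OF SF] interior_mono by blast
    moreover have "{x..z} \<subseteq> I" using I_between[OF I(1) z(3)] by auto
    ultimately have "{x..z} = {x..y}" using D(5)[of "{x..z}"] z by auto
    then show False using z xy by auto
  qed
  have "(\<exists>g. rel g (-1) y y) \<or>
    (\<exists>g J \<rho>. max_symmetry g 1 J \<rho> \<and> (\<forall>\<delta>>0. \<exists>s\<in>J \<inter> interior {x..y}. y \<le> \<rho> s \<and> \<rho> s < y + \<delta>))"
    by (rule right_end[OF D(3,4) _ I(2), of "(x+y)/2"]) (use ext xy in \<open>auto simp: int\<close>)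
  then show ?thesis
  proof
    assume "\<exists>g J \<rho>. max_symmetry g 1 J \<rho> \<and> (\<forall>\<delta>>0. \<exists>s\<in>J \<inter> interior {x..y}. y \<le> \<rho> s \<and> \<rho> s < y + \<delta>)"
    then obtain g J \<rho> where M: "max_symmetry g 1 J \<rho>"
      "\<And>\<delta>. \<delta> > 0 \<Longrightarrow> \<exists>s\<in>J \<inter> interior {x..y}. y \<le> \<rho> s \<and> \<rho> s < y + \<delta>" by blast
    have "rel g 1 x y"
      by (rule increasing_limit_at_start[OF D(4) xy I M(1)]) (use M(2) int in fastforce)
    then show ?thesis by blast
  qed blast
qed

text \<open>The same input to \<open>right_end\<close>, but in the absence of a left end the
  increasing alternative yields a compact maximal interval instead of a shift.\<close>

lemma maxint_ray_right:
  assumes B: "maxint (I \<inter> {..\<tau>})" and \<tau>: "\<tau> \<in> I"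
  shows "(\<exists>m p. m < p \<and> maxint {m..p}) \<or> (\<exists>g. rel g (-1) \<tau> \<tau>)"
proof -
  note D = maxintD[OF B]
  have int: "interior (I \<inter> {..\<tau>}) = I \<inter> {..<\<tau>}" using open_I by (simp add: interior_open)
  obtain r where r: "r > 0" "ball \<tau> r \<subseteq> I" using open_I \<tau> openE by blast
  have a0: "\<tau> - r/2 \<in> I" using r by (auto simp: subset_iff dist_real_def)
  have ext: "\<not> SF ((I \<inter> {..\<tau>}) \<union> {\<tau>..<\<tau> + \<delta>})" if "\<delta> > 0" for \<delta>
  proof
    assume SF: "SF ((I \<inter> {..\<tau>}) \<union> {\<tau>..<\<tau> + \<delta>})"
    define z where "z = \<tau> + min \<delta> r / 2"
    have z: "\<tau> < z" "z < \<tau> + \<delta>" "z \<in> I" using r that by (auto simp: z_def subset_iff dist_real_def)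
    have "I \<inter> {..z} \<subseteq> (I \<inter> {..\<tau>}) \<union> {\<tau>..<\<tau> + \<delta>}" using z by auto
    then have "SF (I \<inter> {..z})" using SF_subset[OF SF] interior_mono by blast
    moreover have "connected (I \<inter> {..z})"
      by (intro connected_Int_real connected_I) simp
    moreover have "I \<inter> {..\<tau>} \<subseteq> I \<inter> {..z}" using z by auto
    ultimately have "I \<inter> {..z} = I \<inter> {..\<tau>}" using D(5)[of "I \<inter> {..z}"] by blast
    then have "z \<in> I \<inter> {..\<tau>}" using z by blast
    then show False using z by auto
  qed
  have "(\<exists>g. rel g (-1) \<tau> \<tau>) \<or> (\<exists>g J \<rho>. max_symmetry g 1 J \<rho> \<and>
      (\<forall>\<delta>>0. \<exists>s\<in>J \<inter> interior (I \<inter> {..\<tau>}). \<tau> \<le> \<rho> s \<and> \<rho> s < \<tau> + \<delta>))"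
    by (rule right_end[OF D(3,4) _ \<tau>, of "\<tau> - r/2"])
      (use ext r a0 I_between[OF _ \<tau>] in \<open>auto simp: int interior_open[OF open_I]\<close>)
  then show ?thesis
  proof
    assume "\<exists>g J \<rho>. max_symmetry g 1 J \<rho> \<and>
      (\<forall>\<delta>>0. \<exists>s\<in>J \<inter> interior (I \<inter> {..\<tau>}). \<tau> \<le> \<rho> s \<and> \<rho> s < \<tau> + \<delta>)"
    then obtain g J \<rho> where M: "max_symmetry g 1 J \<rho>"
      "\<And>\<delta>. \<delta> > 0 \<Longrightarrow> \<exists>s\<in>J \<inter> interior (I \<inter> {..\<tau>}). \<tau> \<le> \<rho> s \<and> \<rho> s < \<tau> + \<delta>" by blast
    obtain m p where "m < p" "maxint {m..p}"
      by (rule increasing_limit_at_ray[OF D(4) \<tau> M(1)]) (use M(2) int in fastforce)+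
    then show ?thesis by blast
  qed blast
qed

end

section \<open>Shifts by stabilizer elements\<close>

context local_symmetries begin

lemma stab_decreasing: "g \<in> stab \<Longrightarrow> \<not> rel g (-1) s t"
proof
  assume g: "g \<in> stab" and "rel g (-1) s t"
  then obtain f where "rel g (-1) f f" using decreasing_fixed_point by blast
  from stab_fix_increasing[OF this g] show False by simp
qed

text \<open>A stabilizer element that moves a parameter behaves like a period of the curve. Its
  symmetry has no fixed points, hence shifts everything in one direction, and repeated shifts bring
  every parameter into \<open>[s, t)\<close>. A local symmetry anywhere can then be conjugated by
  stabilizer elements to one inside \<open>(s, t)\<close>, where freeness puts its group element
  into the stabilizer.\<close>

lemma stab_shift_free:
  assumes g: "g \<in> stab" and R: "rel g e s t" and neq: "s \<noteq> t" and fr: "free (closed_segment s t)"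
  shows "free I"
proof -
  have main: "free I" if g: "g \<in> stab" and R: "rel g 1 s t" and st: "s < t" and fr: "free {s..t}" for g s t
  proof -
    have gc: "g \<in> carrier G" and sI: "s \<in> I" and tI: "t \<in> I" using relD[OF R] by auto
    have ig: "inv g \<in> stab" using g subgroup.m_inv_closed[OF stab_subgroup] by blast
    obtain J \<rho> where M: "max_symmetry g 1 J \<rho>" "s \<in> J" "\<rho> s = t" using rel_max[OF R] by blast
    obtain J' \<sigma> where M': "max_symmetry (inv g) 1 J' \<sigma>" "t \<in> J'" "\<sigma> t = s"
      using rel_max[OF rel_inverse[OF R]] by blast
    note S = max_symmetryD[OF M(1)] and S' = max_symmetryD[OF M'(1)]
    have nofix: "\<rho> u \<noteq> u" if "u \<in> J" for u
      using stab_fix[OF S g that _ M(2)] M(3) st by auto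
    have nofix': "\<sigma> u \<noteq> u" if "u \<in> J'" for u
      using stab_fix[OF S' ig that _ M'(2)] M'(3) st by auto
    have up: "u < \<rho> u" if u: "u \<in> J" for u
    proof (rule ccontr)
      assume "\<not> ?thesis"
      have sub: "closed_segment s u \<subseteq> J" using sym_on_segment(1)[OF S M(2) u] .
      have "continuous_on (closed_segment s u) (\<lambda>x. \<rho> x - x)"
        by (intro continuous_intros continuous_on_subset[OF symD(8)[OF S] sub])
      then have "connected ((\<lambda>x. \<rho> x - x) ` closed_segment s u)" by (rule connected_continuous_image) simp
      then have "0 \<in> (\<lambda>x. \<rho> x - x) ` closed_segment s u"
        by (rule connected_real_between[of _ "\<rho> u - u" "\<rho> s - s"]) (use \<open>\<not> u < \<rho> u\<close> M(3) st in auto)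
      then obtain f where "f \<in> closed_segment s u" "\<rho> f = f" by auto
      then show False using nofix sub by auto
    qed
    have dn: "\<sigma> u < u" if u: "u \<in> J'" for u
    proof (rule ccontr)
      assume "\<not> ?thesis"
      have sub: "closed_segment t u \<subseteq> J'" using sym_on_segment(1)[OF S' M'(2) u] .
      have "continuous_on (closed_segment t u) (\<lambda>x. \<sigma> x - x)"
        by (intro continuous_intros continuous_on_subset[OF symD(8)[OF S'] sub])
      then have "connected ((\<lambda>x. \<sigma> x - x) ` closed_segment t u)" by (rule connected_continuous_image) simp
      then have "0 \<in> (\<lambda>x. \<sigma> x - x) ` closed_segment t u"
        by (rule connected_real_between[of _ "\<sigma> t - t" "\<sigma> u - u"]) (use \<open>\<not> \<sigma> u < u\<close> M'(3) st in auto)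
      then obtain f where "f \<in> closed_segment t u" "\<sigma> f = f" by auto
      then show False using nofix' sub by auto
    qed
    \<comment> \<open>\<open>Z w\<close> says that some stabilizer shift brings \<open>w\<close>
      into \<open>[s, t)\<close>. Iteration is avoided: an extremal point \<open>m\<close> of the
      exceptional set is ruled out, since one shift moves nearby exceptional points past
      \<open>m\<close>.\<close>
    define Z where "Z w \<longleftrightarrow> (\<exists>k v. k \<in> stab \<and> rel k 1 w v \<and> s \<le> v \<and> v < t)" for w
    have Z0: "Z w" if "s \<le> w" "w < t" for w
      unfolding Z_def using rel_id[of w] I_between[OF sI tI, of w] that subgroup.one_closed[OF stab_subgroup]
      by (intro exI[of _ \<one>] exI[of _ w]) auto
    have Zstep: "Z w" if R: "rel k 1 w w'" and k: "k \<in> stab" and Z: "Z w'" for w k w'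
    proof -
      obtain l v where "l \<in> stab" "rel l 1 w' v" "s \<le> v" "v < t" using Z by (auto simp: Z_def)
      then show ?thesis unfolding Z_def
        using rel_compose[OF R, of l 1 v] k subgroup.m_closed[OF stab_subgroup]
        by (intro exI[of _ "l \<otimes> k"] exI[of _ v]) auto
    qed
    have Zr: "Z w" if w: "w \<in> I" "s \<le> w" for w
    proof (rule ccontr)
      assume nZ: "\<not> Z w"
      define N where "N = {w \<in> I. s \<le> w \<and> \<not> Z w}"
      define m where "m = Inf N"
      have wN: "w \<in> N" using w nZ by (auto simp: N_def)
      have Nt: "t \<le> n" if "n \<in> N" for n using that Z0[of n] by (force simp: N_def)
      have bdd: "bdd_below N" using Nt by (meson bdd_belowI)
      have m: "t \<le> m" "m \<le> w" using cInf_greatest[of N t] cInf_lower[OF wN bdd] Nt wN by (auto simp: m_def)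
      have mI: "m \<in> I" using I_between[OF tI w(1)] m by auto
      have dom: "c \<in> J'" if c: "c \<in> I" "t \<le> c" for c
        by (rule max_symmetry_walk[OF M'(1,2) c(1) sI c(1)])
          (use dn sym_le_iff[OF S' M'(2)] M'(3) c in \<open>force simp: closed_segment_eq_real_ivl\<close>)
      have "isCont \<sigma> m" using symD(3,8)[OF S'] dom[OF mI m(1)] continuous_on_eq_continuous_at by blast
      moreover have "m - \<sigma> m > 0" using dn[OF dom[OF mI m(1)]] by simp
      ultimately obtain \<delta> where \<delta>: "\<delta> > 0" "\<And>u. \<bar>u - m\<bar> < \<delta> \<Longrightarrow> \<bar>\<sigma> u - \<sigma> m\<bar> < m - \<sigma> m"
        by (metis continuous_at_eps_delta dist_real_def)
      obtain n where n: "n \<in> N" "n < m + \<delta>"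
        using cInf_less_iff[of N "m + \<delta>"] bdd wN \<delta>(1) by (auto simp: m_def)
      have "m \<le> n" using cInf_lower[OF n(1) bdd] by (simp add: m_def)
      then have "\<sigma> n < m" using \<delta>(2)[of n] n(2) by auto
      have nI: "n \<in> I" using n(1) by (simp add: N_def)
      have nJ: "n \<in> J'" using dom[OF nI] Nt n(1) by blast
      have "s \<le> \<sigma> n" using sym_le_iff[OF S' M'(2) nJ] M'(3) Nt[OF n(1)] by simp
      moreover have "\<sigma> n \<notin> N" using cInf_lower[OF _ bdd, of "\<sigma> n"] \<open>\<sigma> n < m\<close> by (auto simp: m_def)
      ultimately have "Z (\<sigma> n)" using symD(13)[OF S' nJ] by (auto simp: N_def)
      then have "Z n" using Zstep[OF relI[OF S' nJ] ig] by blast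
      then show False using n(1) by (simp add: N_def)
    qed
    have Zall: "Z w" if w: "w \<in> I" for w
    proof (rule ccontr)
      assume nZ: "\<not> Z w"
      define N where "N = {w \<in> I. \<not> Z w}"
      define m where "m = Sup N"
      have wN: "w \<in> N" using w nZ by (auto simp: N_def)
      have Ns: "n \<le> s" if "n \<in> N" for n using that Zr[of n] by (force simp: N_def)
      have bdd: "bdd_above N" using Ns by (meson bdd_aboveI)
      have m: "m \<le> s" "w \<le> m" using cSup_least[of N s] cSup_upper[OF wN bdd] Ns wN by (auto simp: m_def)
      have mI: "m \<in> I" using I_between[OF w sI] m by auto
      have dom: "c \<in> J" if c: "c \<in> I" "c \<le> s" for c
        by (rule max_symmetry_walk[OF M(1,2) c(1) c(1) tI])
          (use up sym_le_iff[OF S _ M(2)] M(3) c in \<open>force simp: closed_segment_eq_real_ivl split: if_splits\<close>)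
      have "isCont \<rho> m" using symD(3,8)[OF S] dom[OF mI m(1)] continuous_on_eq_continuous_at by blast
      moreover have "\<rho> m - m > 0" using up[OF dom[OF mI m(1)]] by simp
      ultimately obtain \<delta> where \<delta>: "\<delta> > 0" "\<And>u. \<bar>u - m\<bar> < \<delta> \<Longrightarrow> \<bar>\<rho> u - \<rho> m\<bar> < \<rho> m - m"
        by (metis continuous_at_eps_delta dist_real_def)
      obtain n where n: "n \<in> N" "m - \<delta> < n"
        using less_cSup_iff[of N "m - \<delta>"] bdd wN \<delta>(1) by (auto simp: m_def)
      have "n \<le> m" using cSup_upper[OF n(1) bdd] by (simp add: m_def)
      then have "m < \<rho> n" using \<delta>(2)[of n] n(2) by auto
      have nJ: "n \<in> J" using dom Ns n(1) by (auto simp: N_def)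
      have "\<rho> n \<notin> N" using cSup_upper[OF _ bdd, of "\<rho> n"] \<open>m < \<rho> n\<close> by (auto simp: m_def)
      then have "Z (\<rho> n)" using symD(13)[OF S nJ] by (auto simp: N_def)
      then have "Z n" using Zstep[OF relI[OF S nJ] g] by blast
      then show False using n(1) by (simp add: N_def)
    qed
    \<comment> \<open>The open version of \<open>Z\<close>, needed because \<open>free\<close>
      speaks of interiors. It holds on an open dense set: a point carried to \<open>s\<close> itself
      becomes good after a small move to the right.\<close>
    define Z' where "Z' w \<longleftrightarrow> (\<exists>k v. k \<in> stab \<and> rel k 1 w v \<and> s < v \<and> v < t)" for w
    have Z'near: "\<exists>\<delta>>0. \<forall>u. \<bar>u - w\<bar> < \<delta> \<longrightarrow> Z' u" if Z': "Z' w" for w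
    proof -
      obtain k v where k: "k \<in> stab" "rel k 1 w v" "s < v" "v < t" using Z' by (auto simp: Z'_def)
      obtain \<delta> where "\<delta> > 0" "\<And>u. \<bar>u - w\<bar> < \<delta> \<Longrightarrow> u \<in> UNIV \<and> (\<exists>t'. t' \<in> {s<..<t} \<and> rel k 1 u t' \<and>
       (u < w \<longrightarrow> 1 * t' < 1 * v) \<and> (w < u \<longrightarrow> 1 * v < 1 * t'))"
        by (rule rel_open_nbhd[OF k(2), of UNIV "{s<..<t}"]) (use k in auto)
      then show ?thesis using k(1) unfolding Z'_def by (metis greaterThanLessThan_iff)
    qed
    have dense: "\<exists>u\<in>W. Z' u" if W: "open W" "W \<subseteq> I" "w \<in> W" for W w
    proof -
      obtain k v where k: "k \<in> stab" "rel k 1 w v" "s \<le> v" "v < t" using Zall W unfolding Z_def by blast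
      obtain \<delta> where d: "\<delta> > 0" "\<And>u. \<bar>u - w\<bar> < \<delta> \<Longrightarrow> u \<in> W \<and> (\<exists>t'. t' \<in> {..<t} \<and> rel k 1 u t' \<and>
       (u < w \<longrightarrow> 1 * t' < 1 * v) \<and> (w < u \<longrightarrow> 1 * v < 1 * t'))"
        by (rule rel_open_nbhd[OF k(2), of W "{..<t}"]) (use k W in auto)
      have "w + \<delta>/2 \<in> W \<and> Z' (w + \<delta>/2)"
        using d(2)[of "w + \<delta>/2"] d(1) k(1,3) unfolding Z'_def by fastforce
      then show ?thesis by blast
    qed
    show "free I"
      unfolding free_def
    proof (intro allI impI)
      fix h f a b assume "rel h f a b \<and> a \<in> interior I \<and> b \<in> interior I"
      then obtain J0 \<rho>0 where S0: "S h f J0 \<rho>0" "a \<in> J0" by (auto simp: rel_def)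
      obtain u where u: "u \<in> J0" "Z' u" using dense[OF symD(3)[OF S0(1)] symD(6)[OF S0(1)] S0(2)] by blast
      obtain \<delta> where \<delta>: "\<delta> > 0" "\<And>w. \<bar>w - u\<bar> < \<delta> \<Longrightarrow> Z' w" using Z'near[OF u(2)] by blast
      \<comment> \<open>A whole neighbourhood of \<open>u\<close> satisfies \<open>Z'\<close>;
        density then provides a point of it whose image under \<open>\<rho>0\<close> satisfies
        \<open>Z'\<close> too.\<close>
      let ?N = "J0 \<inter> ball u \<delta>"
      have N: "open_interval ?N"
        using symD(3,4)[OF S0(1)] u(1) \<delta>(1) by (auto simp: open_interval_iff intro: connected_Int_real)
      have SN: "S h f ?N \<rho>0" by (rule sym_restrict[OF S0(1) N]) auto
      have "\<rho>0 u \<in> \<rho>0 ` ?N" using u \<delta> by auto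
      moreover have "open (\<rho>0 ` ?N)" using sym_open_image[OF SN] by (simp add: open_interval_iff)
      ultimately obtain w where w: "w \<in> \<rho>0 ` ?N" "Z' w"
        using dense[OF _ symD(7)[OF SN]] by blast
      then obtain u2 where u2: "u2 \<in> ?N" "w = \<rho>0 u2" by blast
      then have "Z' u2" using \<delta>(2) by (auto simp: dist_real_def abs_minus_commute)
      then obtain k v where k: "k \<in> stab" "rel k 1 u2 v" "s < v" "v < t" by (auto simp: Z'_def)
      obtain l v2 where l: "l \<in> stab" "rel l 1 w v2" "s < v2" "v2 < t" using w(2) by (auto simp: Z'_def)
      have hc: "h \<in> carrier G" "k \<in> carrier G" "l \<in> carrier G" using symD(1)[OF SN] k l stab_subset by auto
      have "rel h f u2 w" using relI[OF SN u2(1)] u2(2) by simp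
      from rel_compose[OF rel_compose[OF rel_inverse[OF k(2)] this] l(2)]
      have "l \<otimes> (h \<otimes> inv k) \<in> stab" using fr k l unfolding free_def by force
      then have "inv l \<otimes> (l \<otimes> (h \<otimes> inv k)) \<otimes> k \<in> stab"
        using k(1) l(1) subgroup.m_closed[OF stab_subgroup] subgroup.m_inv_closed[OF stab_subgroup] by blast
      moreover have "inv l \<otimes> (l \<otimes> (h \<otimes> inv k)) \<otimes> k = h" using hc by (simp add: inv_solve_left' m_assoc)
      ultimately show "h \<in> stab" by simp
    qed
  qed
  have e: "e = 1" using relD(2)[OF R] R stab_decreasing[OF g] by auto
  show ?thesis
  proof (cases "s < t")
    case True
    then show ?thesis using main[OF g] R fr e by (auto simp: closed_segment_eq_real_ivl)
  next
    case False
    then show ?thesis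
      using main[of "inv g" t s] rel_inverse[OF R] neq fr e g subgroup.m_inv_closed[OF stab_subgroup]
      by (auto simp: closed_segment_eq_real_ivl)
  qed
qed

text \<open>Freeness puts \<open>g\<close> into the stabilizer; were \<open>s\<close> and
  \<open>t\<close> different, the shift would make all of \<open>I\<close> free. Here the curve not
  being a free segment allows passing from group elements to parameters.\<close>

lemma free_imp_SF:
  assumes A: "connected A" "free A" and I: "\<not> free I"
  shows "SF A"
  unfolding SF_def
proof (intro allI impI, rule ccontr)
  fix g e s t assume *: "rel g e s t \<and> s \<in> interior A \<and> t \<in> interior A" and neq: "s \<noteq> t"
  have "closed_segment s t \<subseteq> A"
    using connected_real_segment[OF A(1)] * interior_subset by blast
  then have "free (closed_segment s t)" using free_subset[OF A(2)] interior_mono by blast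
  then show False using stab_shift_free[OF _ _ neq] * A(2) I unfolding free_def by blast
qed

lemma reflection_outside:
  "SF A \<Longrightarrow> rel g (-1) \<tau> \<tau> \<Longrightarrow> \<tau> \<notin> interior A"
  using SF_fix_stab(2)[of A g "-1" \<tau>] by auto

section \<open>Reversing the parameter\<close>

lemma mirror_symmetry:
  "local_symmetry G act (uminus ` I) (\<lambda>t. \<gamma> (- t)) g e J \<rho> \<longleftrightarrow> S g e (uminus ` J) (\<lambda>t. - \<rho> (- t))"
proof -
  have 1: "local_symmetry G act (uminus ` I') (\<lambda>t. \<gamma>' (- t)) g e (uminus ` J') (\<lambda>t. - \<rho>' (- t))"
    if S: "local_symmetry G act I' \<gamma>' g e J' \<rho>'" for I' J' and \<rho>' :: "real \<Rightarrow> real" and \<gamma>' :: "real \<Rightarrow> 'm"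
  proof -
    have J: "open J'" "connected J'" "J' \<noteq> {}" and c: "continuous_on J' \<rho>'"
      using S by (auto simp: local_symmetry_def open_interval_iff)
    have "continuous_on (uminus ` J') (\<lambda>t. - \<rho>' (- t))"
      by (intro continuous_intros continuous_on_compose2[OF c]) auto
    moreover have "open_interval (uminus ` J')"
      using J by (auto simp: open_interval_iff open_negations intro!: connected_continuous_image continuous_intros)
    ultimately show ?thesis using S unfolding local_symmetry_def by (auto simp: image_subset_iff)
  qed
  have [simp]: "uminus ` uminus ` X = X" for X :: "real set" by (simp add: image_image)
  show ?thesis
  proof
    assume "local_symmetry G act (uminus ` I) (\<lambda>t. \<gamma> (- t)) g e J \<rho>"
    from 1[OF this] show "S g e (uminus ` J) (\<lambda>t. - \<rho> (- t))" by simp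
  next
    assume "S g e (uminus ` J) (\<lambda>t. - \<rho> (- t))"
    from 1[OF this] show "local_symmetry G act (uminus ` I) (\<lambda>t. \<gamma> (- t)) g e J \<rho>" by simp
  qed
qed

text \<open>The locale assumptions hold again for the curve run backwards. Conjugation by the
  reversal preserves the sign of a symmetry, so shifts and reflections keep their type and every
  result on right ends becomes one on left ends.\<close>

lemma mirror: "local_symmetries G act (uminus ` I) (\<lambda>t. \<gamma> (- t))"
proof (unfold_locales)
  have [simp]: "uminus ` uminus ` X = X" for X :: "real set" by (simp add: image_image)
  have inv: "x \<in> uminus ` X \<longleftrightarrow> - x \<in> X" for x :: real and X by force
  show "open_interval (uminus ` I)"
    using open_interval_I by (auto simp: open_interval_iff open_negations intro!: connected_continuous_image continuous_intros)
  show "continuous_on (uminus ` I) (\<lambda>t. \<gamma> (- t))"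
    by (intro continuous_on_compose2[OF continuous_curve] continuous_intros) auto
  show "\<exists>r>0. inj_on (\<lambda>t. \<gamma> (- t)) (ball t r \<inter> uminus ` I)" if "t \<in> uminus ` I" for t
  proof -
    obtain r where r: "r > 0" "inj_on \<gamma> (ball (- t) r \<inter> I)" using locally_injective[of "- t"] \<open>t \<in> uminus ` I\<close> inv by blast
    have "inj_on (\<lambda>t. \<gamma> (- t)) (ball t r \<inter> uminus ` I)"
    proof (rule inj_onI)
      fix a b assume "a \<in> ball t r \<inter> uminus ` I" "b \<in> ball t r \<inter> uminus ` I" "\<gamma> (- a) = \<gamma> (- b)"
      then have "- a = - b" by (intro inj_onD[OF r(2)]) (auto simp: dist_real_def)
      then show "a = b" by simp
    qed
    then show ?thesis using r(1) by blast
  qed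
  show "act g (\<gamma> (- u)) = \<gamma> (- u)"
    if "g \<in> carrier G" "open_interval J" "J \<subseteq> uminus ` I" "\<And>t. t \<in> J \<Longrightarrow> act g (\<gamma> (- t)) = \<gamma> (- t)" "u \<in> uminus ` I" for g J u
  proof (rule fix_extend[of g "uminus ` J"])
    show "open_interval (uminus ` J)"
      using that(2) by (auto simp: open_interval_iff open_negations intro!: connected_continuous_image continuous_intros)
  qed (use that inv in \<open>auto, metis add.inverse_inverse\<close>)
  show "\<exists>J' \<rho>'. local_symmetry G act (uminus ` I) (\<lambda>t. \<gamma> (- t)) g e J' \<rho>' \<and> c \<in> J' \<and> (\<forall>t\<in>J \<inter> J'. \<rho>' t = \<rho> t)"
    if S: "local_symmetry G act (uminus ` I) (\<lambda>t. \<gamma> (- t)) g e J \<rho>" and c: "c \<in> uminus ` I" "c \<in> closure J" "c \<notin> J"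
      and d: "d \<in> uminus ` I" and lim: "(\<rho> \<longlongrightarrow> d) (at c within J)" for g e J \<rho> c d
  proof -
    have cl: "- c \<in> closure (uminus ` J)" using image_closure_subset[of J uminus "closure (uminus ` J)"] c(2) closure_subset by (force intro: continuous_intros)
    have "((\<lambda>t. - \<rho> (- t)) \<longlongrightarrow> - d) (at (- c) within uminus ` J)"
    proof -
      have "filterlim uminus (at c within J) (at (- c) within uminus ` J)"
        unfolding filterlim_at
        by (auto simp: eventually_at_filter intro!: always_eventually tendsto_eq_intros)
      then show ?thesis using lim by (intro tendsto_minus) (rule filterlim_compose)
    qed
    then obtain J' \<rho>' where J': "S g e J' \<rho>'" "- c \<in> J'" "\<forall>t\<in>uminus ` J \<inter> J'. \<rho>' t = - \<rho> (- t)"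
      using symmetry_extend[OF S[unfolded mirror_symmetry], of "- c" "- d"] c d cl inv by auto
    have "local_symmetry G act (uminus ` I) (\<lambda>t. \<gamma> (- t)) g e (uminus ` J') (\<lambda>t. - \<rho>' (- t))"
      using J'(1) by (simp add: mirror_symmetry)
    then show ?thesis
      using J'(2,3) inv by (intro exI[of _ "uminus ` J'"] exI[of _ "\<lambda>t. - \<rho>' (- t)"]) auto
  qed
  show "sated G act" by (rule sated_action)
qed

lemma mirror_rel:
  "local_symmetries.rel G act (uminus ` I) (\<lambda>t. \<gamma> (- t)) g e s t \<longleftrightarrow> rel g e (- s) (- t)"
proof -
  have 2: "local_symmetry G act (uminus ` I) (\<lambda>t. \<gamma> (- t)) g e (uminus ` J) (\<lambda>t. - \<rho> (- t)) \<longleftrightarrow> S g e J \<rho>" for J \<rho>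
    by (simp add: mirror_symmetry image_image)
  show ?thesis
  proof
    assume "local_symmetries.rel G act (uminus ` I) (\<lambda>t. \<gamma> (- t)) g e s t"
    then obtain J \<rho> where "local_symmetry G act (uminus ` I) (\<lambda>t. \<gamma> (- t)) g e J \<rho>" "s \<in> J" "\<rho> s = t"
      unfolding local_symmetries.rel_def[OF mirror] by blast
    then show "rel g e (- s) (- t)"
      unfolding rel_def mirror_symmetry by (intro exI[of _ "uminus ` J"] exI[of _ "\<lambda>t. - \<rho> (- t)"]) auto
  next
    assume "rel g e (- s) (- t)"
    then obtain J \<rho> where "S g e J \<rho>" "- s \<in> J" "\<rho> (- s) = - t" unfolding rel_def by blast
    then show "local_symmetries.rel G act (uminus ` I) (\<lambda>t. \<gamma> (- t)) g e s t"
      unfolding local_symmetries.rel_def[OF mirror] using 2[of J \<rho>]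
      by (intro exI[of _ "uminus ` J"] exI[of _ "\<lambda>t. - \<rho> (- t)"]) force
  qed
qed

lemma mirror_SF:
  "local_symmetries.SF G act (uminus ` I) (\<lambda>t. \<gamma> (- t)) A \<longleftrightarrow> SF (uminus ` A)"
proof -
  have inv: "x \<in> uminus ` X \<longleftrightarrow> - x \<in> X" for x :: real and X by force
  have "x \<in> interior (uminus ` A) \<longleftrightarrow> - x \<in> interior A" for x
    using interior_negations[of A] inv by auto
  then show ?thesis
    unfolding local_symmetries.SF_def[OF mirror] SF_def mirror_rel
    by (metis add.inverse_inverse)
qed

lemma mirror_maxint:
  "local_symmetries.maxint G act (uminus ` I) (\<lambda>t. \<gamma> (- t)) B \<longleftrightarrow> maxint (uminus ` B)"
proof -
  have [simp]: "uminus ` uminus ` X = X" for X :: "real set" by (simp add: image_image)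
  have conn: "connected (uminus ` X) \<longleftrightarrow> connected X" for X :: "real set"
  proof -
    have "connected (uminus ` X)" if "connected X" for X :: "real set"
      using that by (intro connected_continuous_image continuous_intros)
    from this[of X] this[of "uminus ` X"] show ?thesis by auto
  qed
  have sub: "X \<subseteq> uminus ` Y \<longleftrightarrow> uminus ` X \<subseteq> Y" "uminus ` X \<subseteq> uminus ` Y \<longleftrightarrow> X \<subseteq> Y" for X Y :: "real set" by force+
  have eq: "uminus ` X = uminus ` Y \<longleftrightarrow> X = Y" for X Y :: "real set" by (metis \<open>\<And>X. uminus ` uminus ` X = X\<close>)
  have all: "(\<forall>X. P X) \<longleftrightarrow> (\<forall>X. P (uminus ` X))" for P :: "real set \<Rightarrow> bool"
    by (metis \<open>\<And>X. uminus ` uminus ` X = X\<close>)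
  show ?thesis
    unfolding local_symmetries.maxint_def[OF mirror] maxint_def mirror_SF
    by (subst all) (auto simp: conn sub eq interior_negations)
qed

lemma maxint_compact_left:
  assumes B: "maxint {x..y}" and xy: "x < y"
  shows "(\<exists>g. rel g 1 x y) \<or> (\<exists>g. rel g (-1) x x)"
proof -
  have "uminus ` {- y..- x} = {x..y}" by (simp add: image_uminus_atLeastAtMost)
  then have "(\<exists>g. rel g 1 y x) \<or> (\<exists>g. rel g (-1) x x)"
    using local_symmetries.maxint_compact_right[OF mirror, of "- y" "- x"] B xy
    by (simp add: mirror_maxint mirror_rel)
  then show ?thesis using rel_inverse by blast
qed

lemma maxint_ray_left:
  assumes B: "maxint (I \<inter> {\<tau>..})" and \<tau>: "\<tau> \<in> I"
  shows "(\<exists>m p. m < p \<and> maxint {m..p}) \<or> (\<exists>g. rel g (-1) \<tau> \<tau>)"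
proof -
  have "uminus ` (uminus ` I \<inter> {..- \<tau>}) = I \<inter> {\<tau>..}" by force
  then have "(\<exists>m p. m < p \<and> maxint (uminus ` {m..p})) \<or> (\<exists>g. rel g (-1) \<tau> \<tau>)"
    using local_symmetries.maxint_ray_right[OF mirror, of "- \<tau>"] B \<tau>
    by (simp add: mirror_maxint mirror_rel)
  then show ?thesis by (metis image_uminus_atLeastAtMost neg_less_iff_less)
qed

end

section \<open>Decomposing the parameter interval\<close>

context local_symmetries begin

lemma interior_I: "interior I = I" using open_I by (rule interior_open)

text \<open>A pair inside the segment, conjugated by the reflection, becomes a pair inside
  \<open>A\<close>, so \<open>SF\<close> is transported to the other side of
  \<open>\<tau>\<close>.\<close>

lemma reflected_SF:
  assumes M: "max_symmetry g (-1) J \<rho>" "\<tau> \<in> J" and SF: "SF A" and d: "d \<in> J"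
    and img: "\<And>u. u \<in> interior (closed_segment \<tau> d) \<Longrightarrow> \<rho> u \<in> interior A"
  shows "SF (closed_segment \<tau> d)"
  unfolding SF_def
proof (intro allI impI)
  note S = max_symmetryD[OF M(1)]
  fix h e s t assume *: "rel h e s t \<and> s \<in> interior (closed_segment \<tau> d) \<and> t \<in> interior (closed_segment \<tau> d)"
  have sub: "interior (closed_segment \<tau> d) \<subseteq> J"
    using sym_on_segment(1)[OF S M(2) d] interior_subset by blast
  have J: "s \<in> J" "t \<in> J" using * sub by blast+
  have "rel (g \<otimes> (h \<otimes> inv g)) (-1 * e * -1) (\<rho> s) (\<rho> t)"
    using rel_compose[OF rel_compose[OF rel_inverse[OF relI[OF S J(1)]], of h e t] relI[OF S J(2)]] *
    by simp
  then have "\<rho> s = \<rho> t" using SF_D[OF SF] img * by blast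
  then show "s = t" using sym_inj[OF S] J by (auto dest: inj_onD)
qed

text \<open>Without compact ones every maximal interval is a ray, and at the end
  \<open>\<tau>\<close> of one of them there is a reflection. It copies \<open>SF\<close> to a short
  segment on the other side; the maximal interval around that segment cannot contain
  \<open>\<tau>\<close> in its interior, so it is the opposite ray. Any further ray is nested with
  one of the two and thus equal to it.\<close>

lemma reflection_case:
  assumes I: "\<not> SF I" and B0: "maxint B0" and nc: "\<And>x y. x < y \<Longrightarrow> \<not> maxint {x..y}"
  obtains \<tau> g J \<rho> where "\<tau> \<in> I" "max_symmetry g (-1) J \<rho>" "\<tau> \<in> J" "\<rho> \<tau> = \<tau>"
    "\<And>B. maxint B \<longleftrightarrow> B = I \<inter> {..\<tau>} \<or> B = I \<inter> {\<tau>..}"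
proof -
  have ray: "(\<exists>\<tau>\<in>I. B = I \<inter> {..\<tau>}) \<or> (\<exists>\<tau>\<in>I. B = I \<inter> {\<tau>..})" if "maxint B" for B
    using maxint_shape[OF that I] nc that by blast
  obtain \<tau> where \<tau>: "\<tau> \<in> I" "B0 = I \<inter> {..\<tau>} \<or> B0 = I \<inter> {\<tau>..}" using ray[OF B0] by blast
  obtain g where R: "rel g (-1) \<tau> \<tau>"
    using \<tau>(2) maxint_ray_right[OF _ \<tau>(1)] maxint_ray_left[OF _ \<tau>(1)] B0 nc by metis
  obtain J \<rho> where M: "max_symmetry g (-1) J \<rho>" "\<tau> \<in> J" "\<rho> \<tau> = \<tau>" using rel_max[OF R] by blast
  note S = max_symmetryD[OF M(1)]
  obtain r where r: "r > 0" "ball \<tau> r \<subseteq> J" using symD(3)[OF S] M(2) openE by blast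
  define d d' where "d = \<tau> + r/2" and "d' = \<tau> - r/2"
  have d: "d \<in> J" "d' \<in> J" "\<tau> < d" "d' < \<tau>" using r by (auto simp: d_def d'_def subset_iff dist_real_def)
  have dI: "d \<in> I" "d' \<in> I" using d symD(12)[OF S] by auto
  have img: "\<rho> u \<in> I" "\<tau> < u \<Longrightarrow> \<rho> u < \<tau>" "u < \<tau> \<Longrightarrow> \<tau> < \<rho> u" if "u \<in> J" for u
    using symD(13)[OF S that] symD(9)[OF S that M(2)] symD(9)[OF S M(2) that] M(3) by auto
  have mem: "u \<in> J" if "d' \<le> u" "u \<le> d" for u using sym_between[OF S d(2,1)] that by blast
  have SF2: "SF {\<tau>..d} \<and> SF {d'..\<tau>}"
    using \<tau>(2)
  proof
    assume B: "B0 = I \<inter> {..\<tau>}"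
    have "SF (closed_segment \<tau> d)"
      by (rule reflected_SF[OF M(1,2) maxintD(4)[OF B0] d(1)])
        (use B d img mem in \<open>auto simp: interior_I closed_segment_eq_real_ivl\<close>)
    moreover have "interior {d'..\<tau>} \<subseteq> interior B0"
      using B I_between[OF dI(2) \<tau>(1)] by (auto simp: interior_I)
    ultimately show ?thesis using SF_subset[OF maxintD(4)[OF B0]] d by (auto simp: closed_segment_eq_real_ivl)
  next
    assume B: "B0 = I \<inter> {\<tau>..}"
    have "SF (closed_segment \<tau> d')"
      by (rule reflected_SF[OF M(1,2) maxintD(4)[OF B0] d(2)])
        (use B d img mem in \<open>auto simp: interior_I closed_segment_eq_real_ivl\<close>)
    moreover have "interior {\<tau>..d} \<subseteq> interior B0"
      using B I_between[OF \<tau>(1) dI(1)] by (auto simp: interior_I)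
    ultimately show ?thesis using SF_subset[OF maxintD(4)[OF B0]] d by (auto simp: closed_segment_eq_real_ivl)
  qed
  have out: "\<tau> \<notin> interior B" if "maxint B" for B using reflection_outside[OF maxintD(4)[OF that] R] .
  have right: "maxint (I \<inter> {\<tau>..})"
  proof -
    have "{\<tau>..d} \<subseteq> I" using I_between[OF \<tau>(1) dI(1)] by auto
    then obtain B where B: "maxint B" "{\<tau>..d} \<subseteq> B"
      using maxint_exists[of "{\<tau>..d}"] SF2 d by auto
    have B\<tau>: "\<tau> \<in> B" "d \<in> B" using B(2) d by auto
    obtain \<tau>' where \<tau>': "\<tau>' \<in> I" "B = I \<inter> {..\<tau>'} \<or> B = I \<inter> {\<tau>'..}" using ray[OF B(1)] by blast
    have "B = I \<inter> {\<tau>'..}" using \<tau>'(2) out[OF B(1)] B\<tau> d(3) \<tau>(1) by (auto simp: interior_I)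
    moreover have "\<tau>' = \<tau>" using calculation out[OF B(1)] B\<tau> \<tau>(1) by (auto simp: interior_I)
    ultimately show ?thesis using B(1) by simp
  qed
  have left: "maxint (I \<inter> {..\<tau>})"
  proof -
    have "{d'..\<tau>} \<subseteq> I" using I_between[OF dI(2) \<tau>(1)] by auto
    then obtain B where B: "maxint B" "{d'..\<tau>} \<subseteq> B"
      using maxint_exists[of "{d'..\<tau>}"] SF2 d by auto
    have B\<tau>: "\<tau> \<in> B" "d' \<in> B" using B(2) d by auto
    obtain \<tau>' where \<tau>': "\<tau>' \<in> I" "B = I \<inter> {..\<tau>'} \<or> B = I \<inter> {\<tau>'..}" using ray[OF B(1)] by blast
    have "B = I \<inter> {..\<tau>'}" using \<tau>'(2) out[OF B(1)] B\<tau> d(4) \<tau>(1) by (auto simp: interior_I)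
    moreover have "\<tau>' = \<tau>" using calculation out[OF B(1)] B\<tau> \<tau>(1) by (auto simp: interior_I)
    ultimately show ?thesis using B(1) by simp
  qed
  have "maxint B \<longleftrightarrow> B = I \<inter> {..\<tau>} \<or> B = I \<inter> {\<tau>..}" for B
  proof
    assume B: "maxint B"
    obtain \<tau>' where \<tau>': "\<tau>' \<in> I" "B = I \<inter> {..\<tau>'} \<or> B = I \<inter> {\<tau>'..}" using ray[OF B] by blast
    have uniq: "X = Y" if "maxint X" "maxint Y" "X \<subseteq> Y" for X Y
      using maxintD(5)[OF that(1) maxintD(1,3,4)[OF that(2)] that(3)] by simp
    show "B = I \<inter> {..\<tau>} \<or> B = I \<inter> {\<tau>..}"
      using \<tau>'(2)
    proof
      assume "B = I \<inter> {..\<tau>'}"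
      then have "B \<subseteq> I \<inter> {..\<tau>} \<or> I \<inter> {..\<tau>} \<subseteq> B" by auto
      then show ?thesis using uniq[OF B left] uniq[OF left B] by blast
    next
      assume "B = I \<inter> {\<tau>'..}"
      then have "B \<subseteq> I \<inter> {\<tau>..} \<or> I \<inter> {\<tau>..} \<subseteq> B" by auto
      then show ?thesis using uniq[OF B right] uniq[OF right B] by blast
    qed
  qed (use left right in auto)
  with \<tau>(1) M show thesis by (rule that)
qed

text \<open>At a suitable parameter \<open>t\<close> the symmetry lands left or right of
  \<open>\<tau>\<close>. On the left \<open>SF\<close> makes it trivial; on the right it is compared
  with the reflection by composing with an inverse, and \<open>SF\<close> on the rays forces a
  common value. One common value suffices by maximality of \<open>\<rho>\<close>.\<close>

lemma reflection_match:
  assumes \<tau>: "\<tau> \<in> I" and M: "max_symmetry g (-1) J \<rho>" "\<tau> \<in> J" "\<rho> \<tau> = \<tau>"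
    and SF: "SF (I \<inter> {..\<tau>})" "SF (I \<inter> {\<tau>..})"
    and S': "S g' e J' \<rho>'" "J' \<subseteq> I \<inter> {..\<tau>}"
  shows "g' \<in> stab \<and> (\<forall>t\<in>J'. \<rho>' t = t) \<or> inv g \<otimes> g' \<in> stab \<and> J' \<subseteq> J \<and> (\<forall>t\<in>J'. \<rho> t = \<rho>' t)"
proof -
  note S = max_symmetryD[OF M(1)]
  have lt: "t < \<tau>" if t: "t \<in> J'" for t
  proof -
    obtain r where "r > 0" "ball t r \<subseteq> J'" using symD(3)[OF S'(1)] t openE by blast
    then have "t + r/2 \<in> J'" by (auto simp: subset_iff dist_real_def)
    then show ?thesis using S'(2) \<open>r > 0\<close> by force
  qed
  \<comment> \<open>The value \<open>\<tau>\<close> lies in the interior of neither ray and gives no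
    information; by injectivity some parameter avoids it.\<close>
  obtain t where t: "t \<in> J'" "\<rho>' t \<noteq> \<tau>"
  proof -
    obtain u where u: "u \<in> J'" using symD(5)[OF S'(1)] by blast
    obtain r where r: "r > 0" "ball u r \<subseteq> J'" using symD(3)[OF S'(1)] u openE by blast
    then have v: "u + r/2 \<in> J'" by (auto simp: subset_iff dist_real_def)
    then have "\<rho>' u \<noteq> \<rho>' (u + r/2)" using sym_inj[OF S'(1)] u r(1) by (auto dest: inj_onD)
    then show thesis using that u v by metis
  qed
  have tI: "t \<in> I" "t < \<tau>" "\<rho>' t \<in> I" using symD(12,13)[OF S'(1) t(1)] lt[OF t(1)] by auto
  have R: "rel g' e t (\<rho>' t)" using relI[OF S'(1) t(1)] .
  show ?thesis
  proof (cases "\<rho>' t < \<tau>")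
    case True
    then have eq: "\<rho>' t = t" using SF_D[OF SF(1) R] tI by (auto simp: interior_I)
    then have "g' \<in> stab" using SF_fix_stab(1)[OF SF(1), of g' e t] R tI by (auto simp: interior_I)
    then show ?thesis using stab_fix[OF S'(1) _ t(1) eq] by blast
  next
    case False
    then have gt: "\<tau> < \<rho>' t" using t by auto
    have at: "u = t \<and> inv g \<otimes> g' \<in> stab" if u: "u \<in> J" "u < \<tau>" "\<rho> u = \<rho>' t" for u
    proof -
      have R2: "rel (inv g \<otimes> g') (e * -1) t u"
        using rel_compose[OF R, of "inv g" "-1" u] rel_inverse[OF relI[OF S u(1)]] u(3) by simp
      then have "u = t" using SF_D[OF SF(1) R2] tI u symD(12)[OF S u(1)] by (auto simp: interior_I)
      then show ?thesis using SF_fix_stab(1)[OF SF(1)] R2 tI by (auto simp: interior_I)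
    qed
    have tJ: "t \<in> J \<and> \<rho> t = \<rho>' t"
    proof (cases "t \<in> J")
      case True
      then have "\<tau> < \<rho> t" using symD(9)[OF S True M(2)] M(3) tI by auto
      moreover have "rel (g' \<otimes> inv g) (-1 * e) (\<rho> t) (\<rho>' t)"
        using rel_compose[OF rel_inverse[OF relI[OF S True]] R] .
      ultimately have "\<rho> t = \<rho>' t"
        using SF_D[OF SF(2)] gt tI symD(13)[OF S True] by (auto simp: interior_I)
      then show ?thesis using True by simp
    next
      \<comment> \<open>If the reflection stops before \<open>t\<close>, its values already fill the
        whole right ray, so \<open>\<rho>' t\<close> is among them.\<close>
      case False
      have "\<rho> ` (J \<inter> closed_segment \<tau> t) = {v \<in> I. 1 * \<rho> \<tau> \<le> 1 * v}"
        by (rule max_symmetry_image[OF M(1,2) tI(1) False]) (use tI in auto)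
      then have "\<rho>' t \<in> \<rho> ` (J \<inter> closed_segment \<tau> t)" using gt tI M(3) by auto
      then obtain u where u: "u \<in> J" "u \<in> closed_segment \<tau> t" "\<rho> u = \<rho>' t" by auto
      have "u \<noteq> \<tau>" using u(3) M(3) gt by auto
      then have "u < \<tau>" using u(2) tI by (auto simp: closed_segment_eq_real_ivl)
      then show ?thesis using at[OF u(1) _ u(3)] u by auto
    qed
    have st: "inv g \<otimes> g' \<in> stab" using at[of t] tJ tI by blast
    show ?thesis
      using max_symmetry_mono[OF M(1) S'(1) st _ t(1)] tJ st by blast
  qed
qed

text \<open>If the domain of a maximal reflection does not exhaust the left ray, its values must
  exhaust the right one by \<open>max_symmetry_image\<close>. This is the alternative demanded in
  \<open>leads_to_at_boundary\<close>.\<close>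

lemma reflection_domain:
  assumes \<tau>: "\<tau> \<in> I" and M: "max_symmetry g (-1) J \<rho>" "\<tau> \<in> J" "\<rho> \<tau> = \<tau>"
  shows "J \<inter> {..\<tau>} = I \<inter> {..\<tau>} \<or> \<rho> ` (J \<inter> {..\<tau>}) = I \<inter> {\<tau>..}"
    and "\<rho> ` (J \<inter> {..\<tau>}) \<subseteq> I \<inter> {\<tau>..}"
proof -
  note S = max_symmetryD[OF M(1)]
  show sub: "\<rho> ` (J \<inter> {..\<tau>}) \<subseteq> I \<inter> {\<tau>..}"
    using sym_le_iff[OF S _ M(2)] symD(13)[OF S] M(3) by force
  show "J \<inter> {..\<tau>} = I \<inter> {..\<tau>} \<or> \<rho> ` (J \<inter> {..\<tau>}) = I \<inter> {\<tau>..}"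
  proof (cases "I \<inter> {..\<tau>} \<subseteq> J")
    case True then show ?thesis using symD(6)[OF S] by blast
  next
    case False
    then obtain t where t: "t \<in> I" "t \<le> \<tau>" "t \<notin> J" by auto
    then have "t < \<tau>" using M(2) by (auto simp: order_le_less)
    then have "\<rho> ` (J \<inter> closed_segment \<tau> t) = {v \<in> I. 1 * \<rho> \<tau> \<le> 1 * v}"
      by (intro max_symmetry_image[OF M(1,2) t(1,3)]) auto
    moreover have "J \<inter> closed_segment \<tau> t \<subseteq> J \<inter> {..\<tau>}"
      using t by (auto simp: closed_segment_eq_real_ivl)
    ultimately have "I \<inter> {\<tau>..} \<subseteq> \<rho> ` (J \<inter> {..\<tau>})" using M(3) by auto
    then show ?thesis using sub by blast
  qed
qed

section \<open>Translates of a compact maximal interval\<close>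

text \<open>The orbit of the two end points under local symmetries. For a compact maximal interval
  these turn out to be the division points of its decomposition.\<close>

definition ends where "ends x y = {d. \<exists>g e. rel g e x d \<or> rel g e y d}"

lemma ends_in_I: "ends x y \<subseteq> I" by (auto simp: ends_def dest: relD)

context
  fixes x y :: real
  assumes B: "maxint {x..y}" and xy: "x < y"
begin

lemma xyI: "x \<in> I" "y \<in> I" "SF {x..y}" using maxintD(3,4)[OF B] xy by auto

lemma between_xy: "x \<le> u \<Longrightarrow> u \<le> y \<Longrightarrow> u \<in> I" using I_between[OF xyI(1,2)] .

lemma ends_xy: "x \<in> ends x y" "y \<in> ends x y"
  using rel_id xyI by (auto simp: ends_def)

text \<open>If \<open>s\<close> went to an end point, a nearby point could be sent to the interior;
  the midpoint \<open>?m\<close> keeps it apart from its image, so \<open>SF\<close> would be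
  violated.\<close>

lemma not_rel_interior_end:
  assumes "x < s" "s < y" shows "\<not> rel g e s x" "\<not> rel g e s y"
proof
  let ?m = "(x + s)/2"
  assume R: "rel g e s x"
  obtain \<delta> where d: "\<delta> > 0" "\<And>s'. \<bar>s' - s\<bar> < \<delta> \<Longrightarrow> s' \<in> {?m<..<y} \<and> (\<exists>t'. t' \<in> {..<?m} \<and> rel g e s' t' \<and>
       (s' < s \<longrightarrow> e * t' < e * x) \<and> (s < s' \<longrightarrow> e * x < e * t'))"
    by (rule rel_open_nbhd[OF R, of "{?m<..<y}" "{..<?m}"]) (use assms in auto)
  \<comment> \<open>The sign makes the image move to the right of \<open>x\<close>, into the
    interval.\<close>
  define s' where "s' = s + e * (\<delta>/2)"
  have e: "e = 1 \<or> e = -1" using relD(2)[OF R] .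
  then have "\<bar>s' - s\<bar> < \<delta>" using d(1) by (auto simp: s'_def)
  then obtain t' where t: "?m < s'" "s' < y" "t' < ?m" "rel g e s' t'"
      "s' < s \<Longrightarrow> e * t' < e * x" "s < s' \<Longrightarrow> e * x < e * t'" using d(2) by fastforce
  have "x < t'" using t(5,6) e d(1) by (auto simp: s'_def)
  then show False using SF_D[OF xyI(3) t(4)] t assms by auto
next
  let ?m = "(y + s)/2"
  show "\<not> rel g e s y"
  proof
  assume R: "rel g e s y"
  obtain \<delta> where d: "\<delta> > 0" "\<And>s'. \<bar>s' - s\<bar> < \<delta> \<Longrightarrow> s' \<in> {x<..<?m} \<and> (\<exists>t'. t' \<in> {?m<..} \<and> rel g e s' t' \<and>
       (s' < s \<longrightarrow> e * t' < e * y) \<and> (s < s' \<longrightarrow> e * y < e * t'))"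
    by (rule rel_open_nbhd[OF R, of "{x<..<?m}" "{?m<..}"]) (use assms in auto)
  define s' where "s' = s - e * (\<delta>/2)"
  have e: "e = 1 \<or> e = -1" using relD(2)[OF R] .
  then have "\<bar>s' - s\<bar> < \<delta>" using d(1) by (auto simp: s'_def)
  then obtain t' where t: "x < s'" "s' < ?m" "?m < t'" "rel g e s' t'"
      "s' < s \<Longrightarrow> e * t' < e * y" "s < s' \<Longrightarrow> e * y < e * t'" using d(2) by fastforce
  have "t' < y" using t(5,6) e d(1) by (auto simp: s'_def)
  then show False using SF_D[OF xyI(3) t(4)] t assms by auto
  qed
qed

lemma interior_not_end:
  assumes "rel g e s t" "x < s" "s < y" shows "t \<notin> ends x y"
proof
  assume "t \<in> ends x y"
  then obtain h f where "rel h f x t \<or> rel h f y t" by (auto simp: ends_def)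
  then show False
    using rel_compose[OF assms(1) rel_inverse] not_rel_interior_end[OF assms(2,3)] by blast
qed

text \<open>Such a symmetry would send points just right of \<open>x\<close> to points just left of
  \<open>y\<close>, and these are different interior points.\<close>

lemma not_decreasing_x_y: "\<not> rel g (-1) x y"
proof
  let ?m = "(x + y)/2"
  assume R: "rel g (-1) x y"
  obtain \<delta> where d: "\<delta> > 0" "\<And>s'. \<bar>s' - x\<bar> < \<delta> \<Longrightarrow> s' \<in> {..<?m} \<and> (\<exists>t'. t' \<in> {?m<..} \<and> rel g (-1) s' t' \<and>
       (s' < x \<longrightarrow> -1 * t' < -1 * y) \<and> (x < s' \<longrightarrow> -1 * y < -1 * t'))"
    by (rule rel_open_nbhd[OF R, of "{..<?m}" "{?m<..}"]) (use xy in auto)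
  obtain t' where t: "x + \<delta>/2 < ?m" "?m < t'" "rel g (-1) (x + \<delta>/2) t'" "t' < y"
    using d(2)[of "x + \<delta>/2"] d(1) by auto
  then show False using SF_D[OF xyI(3) t(3)] d(1) xy by auto
qed

lemma shift_excludes_reflection:
  assumes "rel h 1 x y" shows "\<not> rel g (-1) x x" "\<not> rel g (-1) y y"
proof
  assume "rel g (-1) x x"
  from rel_compose[OF this assms] show False using not_decreasing_x_y by simp
next
  show "\<not> rel g (-1) y y"
  proof
    assume "rel g (-1) y y"
    from rel_compose[OF assms this] show False using not_decreasing_x_y by simp
  qed
qed

text \<open>For \<open>d\<close> to be the left end of a translate, \<open>x\<close> must be sent to
  it increasingly or \<open>y\<close> decreasingly. In the other cases the shift or reflection
  granted by maximality at \<open>x\<close> or \<open>y\<close> is applied beforehand to switch the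
  roles.\<close>

lemma ends_right:
  assumes "d \<in> ends x y"
  shows "(\<exists>g. rel g 1 x d) \<or> (\<exists>g. rel g (-1) y d)"
proof -
  obtain g f where gf: "rel g f x d \<or> rel g f y d" using assms by (auto simp: ends_def)
  then have f: "f = 1 \<or> f = -1" using relD(2) by blast
  show ?thesis
    using gf
  proof
    assume R: "rel g f x d"
    show ?thesis
    proof (cases "f = 1")
      case True then show ?thesis using R by blast
    next
      case False
      then have f: "f = -1" using f by simp
      consider h where "rel h 1 y x" | h where "rel h (-1) x x"
        using maxint_compact_left[OF B xy] rel_inverse by blast
      then show ?thesis using rel_compose R f by cases fastforce+
    qed
  next
    assume R: "rel g f y d"
    show ?thesis
    proof (cases "f = -1")
      case True then show ?thesis using R by blast
    next
      case False
      then have f: "f = 1" using f by simp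
      consider h where "rel h 1 x y" | h where "rel h (-1) y y"
        using maxint_compact_right[OF B xy] by blast
      then show ?thesis using rel_compose R f by cases fastforce+
    qed
  qed
qed

lemma ends_left:
  assumes "d \<in> ends x y"
  shows "(\<exists>g. rel g 1 y d) \<or> (\<exists>g. rel g (-1) x d)"
proof -
  consider g where "rel g 1 x d" | g where "rel g (-1) y d" using ends_right[OF assms] by blast
  then show ?thesis
  proof cases
    case (1 g)
    consider h where "rel h 1 y x" | h where "rel h (-1) x x"
      using maxint_compact_left[OF B xy] rel_inverse by blast
    then show ?thesis using rel_compose[OF _ 1] by cases fastforce+
  next
    case (2 g)
    consider h where "rel h 1 x y" | h where "rel h (-1) y y"
      using maxint_compact_right[OF B xy] by blast
    then show ?thesis using rel_compose[OF _ 2] by cases fastforce+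
  qed
qed

text \<open>A point strictly between two values of a translate comes from a parameter strictly
  between \<open>x\<close> and \<open>y\<close>, and such parameters are never related to ends.
  Hence no end cuts a translate.\<close>

lemma translate_interior:
  assumes S: "S g f J \<rho>" and p: "p1 \<in> \<rho> ` (J \<inter> {x..y})" "p2 \<in> \<rho> ` (J \<inter> {x..y})" "p1 < p" "p < p2"
  shows "p \<notin> ends x y"
proof -
  obtain u1 u2 where u: "u1 \<in> J" "u1 \<in> {x..y}" "p1 = \<rho> u1" "u2 \<in> J" "u2 \<in> {x..y}" "p2 = \<rho> u2"
    using p(1,2) by blast
  have "p \<in> \<rho> ` closed_segment u1 u2"
    using sym_on_segment(2)[OF S u(1,4)] u p by (auto simp: closed_segment_eq_real_ivl)
  then obtain v where v: "v \<in> closed_segment u1 u2" "p = \<rho> v" by blast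
  have "v \<noteq> u1" "v \<noteq> u2" using v u p by auto
  then have "x < v" "v < y" using v u by (auto simp: closed_segment_eq_real_ivl split: if_splits)
  moreover have "v \<in> J" using v sym_on_segment(1)[OF S u(1,4)] by blast
  ultimately show ?thesis using interior_not_end[OF relI[OF S]] v by blast
qed

lemma segment_xy: "closed_segment x y = {x..y}" "closed_segment y x = {x..y}"
  using xy by (auto simp: closed_segment_eq_real_ivl)

text \<open>Starting at \<open>d\<close>, the maximal symmetry either reaches the other end of
  \<open>[x, y]\<close>, and the translate stops at a further end \<open>d'\<close>, or its domain
  stops short, and by \<open>max_symmetry_image\<close> its values run through the rest of
  \<open>I\<close>.\<close>

lemma right_translate:
  assumes "d \<in> ends x y"
  obtains g f J \<rho> where "max_symmetry g f J \<rho>"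
    "f = 1 \<and> x \<in> J \<and> \<rho> x = d \<or> f = -1 \<and> y \<in> J \<and> \<rho> y = d"
    "x \<in> J \<and> y \<in> J \<and> (\<exists>d'\<in>ends x y. d < d' \<and> \<rho> ` (J \<inter> {x..y}) = {d..d'}) \<or>
      \<not> (x \<in> J \<and> y \<in> J) \<and> \<rho> ` (J \<inter> {x..y}) = I \<inter> {d..}"
proof -
  consider g where "rel g 1 x d" | g where "rel g (-1) y d" using ends_right[OF assms] by blast
  then show thesis
  proof cases
    case (1 g)
    obtain J \<rho> where M: "max_symmetry g 1 J \<rho>" "x \<in> J" "\<rho> x = d" using rel_max[OF 1] by blast
    note S = max_symmetryD[OF M(1)]
    show thesis
    proof (cases "y \<in> J")
      case True
      have "d < \<rho> y" using symD(9)[OF S M(2) True xy] M(3) by simp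
      moreover have "\<rho> y \<in> ends x y" using relI[OF S True] by (auto simp: ends_def)
      moreover have "\<rho> ` (J \<inter> {x..y}) = {d..\<rho> y}"
        using sym_on_segment[OF S M(2) True] calculation M(3) xy
        by (simp add: Int_absorb1 closed_segment_eq_real_ivl)
      ultimately show ?thesis using that[OF M(1)] M True by blast
    next
      case False
      have "\<rho> ` (J \<inter> closed_segment x y) = {v \<in> I. 1 * \<rho> x \<le> 1 * v}"
        by (rule max_symmetry_image[OF M(1,2) xyI(2) False]) (use xy in auto)
      then have "\<rho> ` (J \<inter> {x..y}) = I \<inter> {d..}" using M(3) by (auto simp: segment_xy)
      then show ?thesis using that[OF M(1)] M False by blast
    qed
  next
    case (2 g)
    obtain J \<rho> where M: "max_symmetry g (-1) J \<rho>" "y \<in> J" "\<rho> y = d" using rel_max[OF 2] by blast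
    note S = max_symmetryD[OF M(1)]
    show thesis
    proof (cases "x \<in> J")
      case True
      have "d < \<rho> x" using symD(9)[OF S True M(2) xy] M(3) by simp
      moreover have "\<rho> x \<in> ends x y" using relI[OF S True] by (auto simp: ends_def)
      moreover have "\<rho> ` (J \<inter> {x..y}) = {d..\<rho> x}"
        using sym_on_segment[OF S M(2) True] calculation M(3) xy
        by (simp add: Int_absorb1 closed_segment_eq_real_ivl)
      ultimately show ?thesis using that[OF M(1)] M True by blast
    next
      case False
      have "\<rho> ` (J \<inter> closed_segment y x) = {v \<in> I. 1 * \<rho> y \<le> 1 * v}"
        by (rule max_symmetry_image[OF M(1,2) xyI(1) False]) (use xy in auto)
      then have "\<rho> ` (J \<inter> {x..y}) = I \<inter> {d..}" using M(3) by (auto simp: segment_xy)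
      then show ?thesis using that[OF M(1)] M False by blast
    qed
  qed
qed

lemma left_translate:
  assumes "d \<in> ends x y"
  obtains g f J \<rho> where "max_symmetry g f J \<rho>"
    "f = 1 \<and> y \<in> J \<and> \<rho> y = d \<or> f = -1 \<and> x \<in> J \<and> \<rho> x = d"
    "x \<in> J \<and> y \<in> J \<and> (\<exists>d'\<in>ends x y. d' < d \<and> \<rho> ` (J \<inter> {x..y}) = {d'..d}) \<or>
      \<not> (x \<in> J \<and> y \<in> J) \<and> \<rho> ` (J \<inter> {x..y}) = I \<inter> {..d}"
proof -
  consider g where "rel g 1 y d" | g where "rel g (-1) x d" using ends_left[OF assms] by blast
  then show thesis
  proof cases
    case (1 g)
    obtain J \<rho> where M: "max_symmetry g 1 J \<rho>" "y \<in> J" "\<rho> y = d" using rel_max[OF 1] by blast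
    note S = max_symmetryD[OF M(1)]
    show thesis
    proof (cases "x \<in> J")
      case True
      have "\<rho> x < d" using symD(9)[OF S True M(2) xy] M(3) by simp
      moreover have "\<rho> x \<in> ends x y" using relI[OF S True] by (auto simp: ends_def)
      moreover have "\<rho> ` (J \<inter> {x..y}) = {\<rho> x..d}"
        using sym_on_segment[OF S M(2) True] calculation M(3) xy
        by (simp add: Int_absorb1 closed_segment_eq_real_ivl)
      ultimately show ?thesis using that[OF M(1)] M True by blast
    next
      case False
      have "\<rho> ` (J \<inter> closed_segment y x) = {v \<in> I. -1 * \<rho> y \<le> -1 * v}"
        by (rule max_symmetry_image[OF M(1,2) xyI(1) False]) (use xy in auto)
      then have "\<rho> ` (J \<inter> {x..y}) = I \<inter> {..d}" using M(3) by (auto simp: segment_xy)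
      then show ?thesis using that[OF M(1)] M False by blast
    qed
  next
    case (2 g)
    obtain J \<rho> where M: "max_symmetry g (-1) J \<rho>" "x \<in> J" "\<rho> x = d" using rel_max[OF 2] by blast
    note S = max_symmetryD[OF M(1)]
    show thesis
    proof (cases "y \<in> J")
      case True
      have "\<rho> y < d" using symD(9)[OF S M(2) True xy] M(3) by simp
      moreover have "\<rho> y \<in> ends x y" using relI[OF S True] by (auto simp: ends_def)
      moreover have "\<rho> ` (J \<inter> {x..y}) = {\<rho> y..d}"
        using sym_on_segment[OF S M(2) True] calculation M(3) xy
        by (simp add: Int_absorb1 closed_segment_eq_real_ivl)
      ultimately show ?thesis using that[OF M(1)] M True by blast
    next
      case False
      have "\<rho> ` (J \<inter> closed_segment x y) = {v \<in> I. -1 * \<rho> x \<le> -1 * v}"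
        by (rule max_symmetry_image[OF M(1,2) xyI(2) False]) (use xy in auto)
      then have "\<rho> ` (J \<inter> {x..y}) = I \<inter> {..d}" using M(3) by (auto simp: segment_xy)
      then show ?thesis using that[OF M(1)] M False by blast
    qed
  qed
qed

text \<open>If two ends \<open>d < d'\<close> were both near \<open>c\<close>, the translate
  starting at \<open>d\<close> could not pass \<open>d'\<close> and would be squeezed into
  \<open>[d, d']\<close>; it would carry two fixed interior parameters close to \<open>c\<close>,
  against satedness.\<close>

lemma ends_isolated:
  assumes c: "c \<in> I"
  obtains \<epsilon> where "\<epsilon> > 0" "\<And>d d'. d \<in> ends x y \<Longrightarrow> d' \<in> ends x y \<Longrightarrow> \<bar>d - c\<bar> < \<epsilon> \<Longrightarrow> \<bar>d' - c\<bar> < \<epsilon> \<Longrightarrow> d = d'"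
proof -
  have "{x..y} \<subseteq> I" using between_xy by auto
  then obtain s1 s2 where s: "x < s1" "s1 < s2" "s2 < y" "\<gamma> s1 \<noteq> \<gamma> s2" "\<gamma> s1 \<noteq> \<gamma> c" "\<gamma> s2 \<noteq> \<gamma> c"
    by (rule three_values[OF xy])
  obtain \<epsilon> where \<epsilon>: "\<epsilon> > 0"
    "\<And>g u v. g \<in> carrier G \<Longrightarrow> u \<in> I \<Longrightarrow> v \<in> I \<Longrightarrow> \<bar>u - c\<bar> < \<epsilon> \<Longrightarrow> \<bar>v - c\<bar> < \<epsilon> \<Longrightarrow>
      act g (\<gamma> s1) = \<gamma> u \<Longrightarrow> act g (\<gamma> s2) = \<gamma> v \<Longrightarrow> False"
    using sated_bound[OF c s(4-6)] by blast
  have False if dd: "d \<in> ends x y" "d' \<in> ends x y" "\<bar>d - c\<bar> < \<epsilon>" "\<bar>d' - c\<bar> < \<epsilon>" "d < d'" for d d'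
  proof (rule right_translate[OF dd(1)])
    fix g f J \<rho> assume M: "max_symmetry g f J \<rho>"
      and *: "x \<in> J \<and> y \<in> J \<and> (\<exists>d'\<in>ends x y. d < d' \<and> \<rho> ` (J \<inter> {x..y}) = {d..d'}) \<or>
        \<not> (x \<in> J \<and> y \<in> J) \<and> \<rho> ` (J \<inter> {x..y}) = I \<inter> {d..}"
    note S = max_symmetryD[OF M]
    have sub: "\<rho> ` (J \<inter> {x..y}) \<subseteq> {d..d'}"
    proof (rule ccontr)
      assume "\<not> ?thesis"
      moreover have "\<rho> ` (J \<inter> {x..y}) \<subseteq> {d..}" using * by auto
      ultimately obtain p where p: "p \<in> \<rho> ` (J \<inter> {x..y})" "d' < p" by force
      have "d \<in> \<rho> ` (J \<inter> {x..y})" using * subsetD[OF ends_in_I dd(1)] by auto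
      then show False using translate_interior[OF S _ p(1) dd(5) p(2)] dd(2) by blast
    qed
    \<comment> \<open>The other alternative fills \<open>I\<close> to the right of \<open>d\<close>,
      hence reaches beyond \<open>d'\<close>.\<close>
    have "x \<in> J \<and> y \<in> J"
    proof (rule ccontr)
      assume "\<not> ?thesis"
      then have "\<rho> ` (J \<inter> {x..y}) = I \<inter> {d..}" using * by blast
      moreover obtain r where "r > 0" "ball d' r \<subseteq> I" using open_I dd(2) ends_in_I openE by blast
      then have "d' + r/2 \<in> I" "d' + r/2 > d'" by (auto simp: subset_iff dist_real_def)
      ultimately show False using sub dd(5) by force
    qed
    then have J: "s1 \<in> J" "s2 \<in> J" using sym_between[OF S, of x y] s by auto
    then have "s1 \<in> J \<inter> {x..y}" "s2 \<in> J \<inter> {x..y}" using s by auto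
    then have "\<rho> s1 \<in> {d..d'}" "\<rho> s2 \<in> {d..d'}" using sub by blast+
    then have "\<bar>\<rho> s1 - c\<bar> < \<epsilon>" "\<bar>\<rho> s2 - c\<bar> < \<epsilon>" using dd(3,4) by (auto simp: abs_less_iff)
    then show False
      using \<epsilon>(2)[of g "\<rho> s1" "\<rho> s2"] symD(1)[OF S] symD(10,13)[OF S J(1)] symD(10,13)[OF S J(2)] dd by auto
  qed
  then have "d = d'" if "d \<in> ends x y" "d' \<in> ends x y" "\<bar>d - c\<bar> < \<epsilon>" "\<bar>d' - c\<bar> < \<epsilon>" for d d'
    using that by (meson linorder_neqE_linordered_idom)
  then show thesis using that \<epsilon>(1) by blast
qed

lemma ends_finite:
  assumes "p \<in> I" "q \<in> I" shows "finite (ends x y \<inter> {p..q})"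
proof (rule ccontr)
  assume inf: "infinite (ends x y \<inter> {p..q})"
  obtain c where c: "c \<in> {p..q}" "c islimpt (ends x y \<inter> {p..q})"
    using Heine_Borel_imp_Bolzano_Weierstrass[OF compact_Icc[of p q] inf] by blast
  have "c \<in> I" using I_between[OF assms] c(1) by auto
  then obtain \<epsilon> where \<epsilon>: "\<epsilon> > 0" "\<And>d d'. d \<in> ends x y \<Longrightarrow> d' \<in> ends x y \<Longrightarrow> \<bar>d - c\<bar> < \<epsilon> \<Longrightarrow> \<bar>d' - c\<bar> < \<epsilon> \<Longrightarrow> d = d'"
    using ends_isolated by blast
  have inf2: "infinite (ends x y \<inter> {p..q} \<inter> ball c \<epsilon>)" using c(2) \<epsilon>(1) islimpt_eq_infinite_ball by blast
  then obtain d where d: "d \<in> ends x y \<inter> {p..q} \<inter> ball c \<epsilon>" using infinite_imp_nonempty[OF inf2] by blast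
  have "ends x y \<inter> {p..q} \<inter> ball c \<epsilon> \<subseteq> {d}"
    using \<epsilon>(2)[of _ d] d by (auto simp: dist_real_def abs_minus_commute)
  then show False using inf2 finite_subset by blast
qed

end
end

section \<open>Enumerating a locally finite set by integers\<close>

text \<open>The enumeration inverts the rank function, which counts the elements of \<open>E\<close>
  in \<open>[y, e]\<close>, so that \<open>y\<close> has index 1. Ranks take all values from 1 up to
  any given rank, because the predecessor of \<open>e\<close> has rank one less. The bound
  \<open>h\<close> is \<open>Pinf\<close> if infinitely many elements lie to the right of
  \<open>y\<close>.\<close>

lemma enumerate_right:
  fixes E :: "real set"
  assumes y: "y \<in> E" and fin: "\<And>q. q \<in> E \<Longrightarrow> finite (E \<inter> {y..q})"
  obtains h :: "int extended" and a :: "int \<Rightarrow> real" where "0 < h" "a 1 = y"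
    "strict_mono_on {k. 1 \<le> k \<and> Fin k \<le> h} a" "a ` {k. 1 \<le> k \<and> Fin k \<le> h} = E \<inter> {y..}"
proof -
  define X where "X = E \<inter> {y..}"
  define r where "r e = int (card (E \<inter> {y..e}))" for e
  have yX: "y \<in> X" using y by (auto simp: X_def)
  have mono: "r e < r e'" if "e \<in> X" "e' \<in> X" "e < e'" for e e'
  proof -
    have "E \<inter> {y..e} \<subseteq> E \<inter> {y..e'}" using that by auto
    moreover have "e' \<in> E \<inter> {y..e'}" "e' \<notin> E \<inter> {y..e}" using that by (auto simp: X_def)
    ultimately have "E \<inter> {y..e} \<subset> E \<inter> {y..e'}" by blast
    then show ?thesis using psubset_card_mono[of "E \<inter> {y..e'}" "E \<inter> {y..e}"] fin that by (auto simp: X_def r_def)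
  qed
  have inj: "inj_on r X" by (rule linorder_inj_onI) (use mono in fastforce)+
  have ry: "r y = 1"
  proof -
    have "E \<inter> {y..y} = {y}" using y by auto
    then show ?thesis by (simp add: r_def)
  qed
  have r1: "1 \<le> r e" if e: "e \<in> X" for e
  proof (cases "e = y")
    case False
    then have "y < e" using e by (auto simp: X_def)
    then show ?thesis using mono[OF yX e] ry by simp
  qed (simp add: ry)
  have pred: "\<exists>e'\<in>X. r e' = r e - 1" if e: "e \<in> X" "1 < r e" for e
  proof -
    let ?F = "E \<inter> {y..e} - {e}"
    have fF: "finite ?F" using fin e by (auto simp: X_def)
    have ye: "y < e" using e ry by (cases "e = y") (auto simp: X_def)
    then have "y \<in> ?F" using y by simp
    define e' where "e' = Max ?F"
    have e': "e' \<in> ?F" unfolding e'_def by (rule Max_in[OF fF]) (use \<open>y \<in> ?F\<close> in blast)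
    have ge: "z \<le> e'" if "z \<in> ?F" for z unfolding e'_def using Max_ge[OF fF that] .
    have "E \<inter> {y..e'} = ?F"
    proof (intro Set.set_eqI iffI)
      show "z \<in> ?F" if "z \<in> E \<inter> {y..e'}" for z using e' that by auto
      show "z \<in> E \<inter> {y..e'}" if "z \<in> ?F" for z using ge[OF that] that by auto
    qed
    moreover have "card ?F = card (E \<inter> {y..e}) - 1" using e by (simp add: X_def)
    ultimately have "r e' = r e - 1" using e(2) by (simp add: r_def of_nat_diff)
    then show ?thesis using e' by (intro bexI[of _ e']) (auto simp: X_def)
  qed
  have down: "\<exists>e\<in>X. r e = j" if "1 \<le> j" "j \<le> r e0" "e0 \<in> X" for j e0
    using that(2,1)
  proof (induction j rule: int_le_induct)
    case base
    then show ?case using that(3) by blast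
  next
    case (step i)
    then obtain e where "e \<in> X" "r e = i" by auto
    then show ?case using pred[of e] step(3) by auto
  qed
  define h :: "int extended" where "h = (if finite X then Fin (int (card X)) else Pinf)"
  let ?K = "{k. 1 \<le> k \<and> Fin k \<le> h}"
  have K: "r ` X = ?K"
  proof (cases "finite X")
    case True
    have top: "r (Max X) = int (card X)"
    proof -
      have "E \<inter> {y..Max X} = X" using Max_ge[OF True] Max_in[OF True] yX by (auto simp: X_def)
      then show ?thesis by (simp add: r_def)
    qed
    have MX: "Max X \<in> X" using Max_in[OF True] yX by blast
    have "r e \<le> int (card X)" for e
    proof -
      have "E \<inter> {y..e} \<subseteq> X" by (auto simp: X_def)
      then show ?thesis using card_mono[OF True] by (simp add: r_def)
    qed
    then show ?thesis using r1 down[OF _ _ MX] top True by (fastforce simp: h_def)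
  next
    case False
    then have inf: "infinite (r ` X)" using inj finite_imageD by blast
    have "\<exists>e\<in>X. k \<le> r e" for k
    proof (rule ccontr)
      assume "\<not> ?thesis"
      then have "r ` X \<subseteq> {1..k}" using r1 by force
      then show False using inf finite_subset by blast
    qed
    then show ?thesis using r1 down False by (fastforce simp: h_def)
  qed
  define a where "a = the_inv_into X r"
  have ar: "a (r e) = e" if "e \<in> X" for e unfolding a_def using the_inv_into_f_f[OF inj that] .
  show thesis
  proof (rule that)
    have "Fin 1 \<le> h" using K ry yX by force
    then show "0 < h" by (cases h) (auto simp: zero_extended_def)
    show "a 1 = y" using ar[OF yX] ry by simp
    show "strict_mono_on ?K a"
    proof (rule strict_mono_onI)
      fix k l assume kl: "k \<in> ?K" "l \<in> ?K" "k < l"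
      then obtain e e' where e: "e \<in> X" "k = r e" "e' \<in> X" "l = r e'" using K by blast
      then have "e < e'" using kl(3) mono[of e' e] by (metis less_asym linorder_neqE)
      then show "a k < a l" using ar e by simp
    qed
    show "a ` ?K = E \<inter> {y..}" unfolding K[symmetric] X_def[symmetric] using ar by (force simp: image_image)
  qed
qed

lemma index_set_mem:
  assumes "lo < 0" "0 < (hi :: int extended)"
  shows "1 \<in> index_set lo hi" "-1 \<in> index_set lo hi"
proof -
  show "1 \<in> index_set lo hi"
    using assms by (cases lo; cases hi) (auto simp: index_set_def zero_extended_def)
  show "-1 \<in> index_set lo hi"
    using assms by (cases lo; cases hi) (auto simp: index_set_def zero_extended_def)
qed

lemma index_set_between:
  assumes "lo < 0" "0 < (hi :: int extended)" "k \<in> index_set lo hi"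
  shows "1 \<le> j \<Longrightarrow> j \<le> k \<Longrightarrow> j \<in> index_set lo hi" "j \<le> -1 \<Longrightarrow> k \<le> j \<Longrightarrow> j \<in> index_set lo hi"
proof -
  show "j \<in> index_set lo hi" if "1 \<le> j" "j \<le> k"
    using assms that by (cases lo; cases hi) (auto simp: index_set_def zero_extended_def)
  show "j \<in> index_set lo hi" if "j \<le> -1" "k \<le> j"
    using assms that by (cases lo; cases hi) (auto simp: index_set_def zero_extended_def)
qed

lemma index_set_Suc:
  assumes "lo < 0" "0 < (hi :: int extended)" "k \<in> index_set lo hi"
  shows "0 < k \<Longrightarrow> hi \<noteq> Fin k \<Longrightarrow> k + 1 \<in> index_set lo hi" "k < 0 \<Longrightarrow> lo \<noteq> Fin k \<Longrightarrow> k - 1 \<in> index_set lo hi"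
proof -
  show "k + 1 \<in> index_set lo hi" if "0 < k" "hi \<noteq> Fin k"
    using assms that by (cases lo; cases hi) (auto simp: index_set_def zero_extended_def)
  show "k - 1 \<in> index_set lo hi" if "k < 0" "lo \<noteq> Fin k"
    using assms that by (cases lo; cases hi) (auto simp: index_set_def zero_extended_def)
qed

lemma index_set_last:
  "hi = Fin k \<Longrightarrow> j \<in> index_set lo hi \<Longrightarrow> j \<le> k" "lo = Fin k \<Longrightarrow> j \<in> index_set lo hi \<Longrightarrow> k \<le> j"
  by (auto simp: index_set_def)

text \<open>An increasing enumeration of \<open>E\<close> with \<open>a 1 = y\<close> takes the value \<open>e \<ge> y\<close> at the number of
  elements of \<open>E\<close> in \<open>[y, e]\<close>, so it is unique.\<close>

lemma index_set_rank:
  fixes a :: "int \<Rightarrow> real"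
  assumes lh: "lo < 0" "0 < (hi :: int extended)" and mono: "strict_mono_on (index_set lo hi) a"
    and k: "k \<in> index_set lo hi"
  shows "0 < k \<Longrightarrow> int (card (a ` index_set lo hi \<inter> {a 1..a k})) = k"
    and "k < 0 \<Longrightarrow> int (card (a ` index_set lo hi \<inter> {a k..a (-1)})) = - k"
proof -
  let ?S = "index_set lo hi"
  have le: "a i \<le> a j \<longleftrightarrow> i \<le> j" if "i \<in> ?S" "j \<in> ?S" for i j
    using strict_mono_on_leD[OF mono] strict_mono_onD[OF mono] that by (meson leD leI)
  have inj: "inj_on a T" if "T \<subseteq> ?S" for T
    using inj_on_subset[OF strict_mono_on_imp_inj_on[OF mono] that] .
  show "int (card (a ` ?S \<inter> {a 1..a k})) = k" if "0 < k"
  proof -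
    have sub: "{1..k} \<subseteq> ?S" using index_set_between(1)[OF lh k] by auto
    have "a ` ?S \<inter> {a 1..a k} = a ` {1..k}"
      using sub le index_set_mem(1)[OF lh] k by (auto simp: image_iff)
    then show ?thesis using card_image[OF inj[OF sub]] that by simp
  qed
  show "int (card (a ` ?S \<inter> {a k..a (-1)})) = - k" if "k < 0"
  proof -
    have sub: "{k..-1} \<subseteq> ?S" using index_set_between(2)[OF lh k] by auto
    have "a ` ?S \<inter> {a k..a (-1)} = a ` {k..-1}"
      using sub le index_set_mem(2)[OF lh] k by (auto simp: image_iff)
    then show ?thesis using card_image[OF inj[OF sub]] that by simp
  qed
qed

lemma index_set_enumeration_unique:
  fixes a a' :: "int \<Rightarrow> real"
  assumes 1: "lo < 0" "0 < (hi :: int extended)" "strict_mono_on (index_set lo hi) a"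
    and 2: "lo' < 0" "0 < (hi' :: int extended)" "strict_mono_on (index_set lo' hi') a'"
    and eq: "a ` index_set lo hi = a' ` index_set lo' hi'" "a 1 = a' 1" "a (-1) = a' (-1)"
  shows "index_set lo hi = index_set lo' hi'" "\<And>k. k \<in> index_set lo hi \<Longrightarrow> a k = a' k"
proof -
  \<comment> \<open>Quantified over both families, so that it yields the two inclusions between the
    index sets.\<close>
  have main: "k \<in> index_set lo' hi' \<and> a' k = a k"
    if 1: "lo < 0" "0 < (hi :: int extended)" "strict_mono_on (index_set lo hi) a"
    and 2: "lo' < 0" "0 < (hi' :: int extended)" "strict_mono_on (index_set lo' hi') a'"
    and eq: "a ` index_set lo hi = a' ` index_set lo' hi'" "a 1 = a' 1" "a (-1) = a' (-1)"
    and k: "k \<in> index_set lo hi" for lo hi lo' hi' k and a a' :: "int \<Rightarrow> real"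
  proof -
    obtain j where j: "j \<in> index_set lo' hi'" "a k = a' j" using eq k by blast
    have k0: "k \<noteq> 0" "j \<noteq> 0" using k j by (auto simp: index_set_def)
    have pos: "0 < i \<longleftrightarrow> b 1 \<le> b i" if "l < 0" "0 < (h :: int extended)" "strict_mono_on (index_set l h) b" "i \<in> index_set l h"
      for l h i and b :: "int \<Rightarrow> real"
    proof -
      have "i \<noteq> 0" using that(4) by (auto simp: index_set_def)
      then show ?thesis
        using strict_mono_onD[OF that(3,4) index_set_mem(1)[OF that(1,2)]]
          strict_mono_on_leD[OF that(3) index_set_mem(1)[OF that(1,2)] that(4)] by force
    qed
    have same: "0 < k \<longleftrightarrow> 0 < j" using pos[OF 1 k] pos[OF 2 j(1)] eq(2) j(2) by simp
    have "k = j"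
    proof (cases "0 < k")
      case True
      have "k = int (card (a ` index_set lo hi \<inter> {a 1..a k}))"
        using index_set_rank(1)[OF 1 k True] by (rule sym)
      also have "\<dots> = int (card (a' ` index_set lo' hi' \<inter> {a' 1..a' j}))"
        unfolding eq(1,2) j(2) ..
      also have "\<dots> = j" using index_set_rank(1)[OF 2 j(1)] True same by blast
      finally show ?thesis .
    next
      case False
      then have neg: "k < 0" "j < 0" using k0 same by linarith+
      have "k = - int (card (a ` index_set lo hi \<inter> {a k..a (-1)}))"
        using index_set_rank(2)[OF 1 k neg(1)] by linarith
      also have "\<dots> = - int (card (a' ` index_set lo' hi' \<inter> {a' j..a' (-1)}))"
        unfolding eq(1,3) j(2) ..
      also have "\<dots> = j" using index_set_rank(2)[OF 2 j(1) neg(2)] by linarith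
      finally show ?thesis .
    qed
    then show ?thesis using j by simp
  qed
  show "index_set lo hi = index_set lo' hi'"
    using main[OF 1 2 eq] main[OF 2 1 eq[symmetric]] by blast
  show "a k = a' k" if "k \<in> index_set lo hi" for k using main[OF 1 2 eq that] by simp
qed

text \<open>Since the bounds lie on different sides of 0, a strictly smaller upper bound is some
  \<open>Fin m\<close> with \<open>m\<close> positive, and \<open>m + 1\<close> then distinguishes
  the two sets; lower bounds are treated dually with \<open>m - 1\<close>.\<close>

lemma index_set_bounds_unique:
  assumes "lo < 0" "0 < (hi :: int extended)" "lo' < 0" "0 < (hi' :: int extended)" "index_set lo hi = index_set lo' hi'"
  shows "lo = lo'" "hi = hi'"
proof -
  have A: "\<not> h < h'" if lh: "l < 0" "0 < h" "l' < 0" "0 < h'" "index_set l h = index_set l' h'" for l h l' h' :: "int extended"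
  proof
    assume "h < h'"
    then obtain m where m: "h = Fin m" using lh(2) by (cases h) (auto simp: zero_extended_def)
    then have "m + 1 \<in> index_set l' h'" using \<open>h < h'\<close> lh
      by (cases h'; cases l') (auto simp: index_set_def zero_extended_def)
    then have "m + 1 \<in> index_set l h" using lh by simp
    then show False using m by (auto simp: index_set_def)
  qed
  have B: "\<not> l' < l" if lh: "l < 0" "0 < h" "l' < 0" "0 < h'" "index_set l h = index_set l' h'" for l h l' h' :: "int extended"
  proof
    assume "l' < l"
    then obtain m where m: "l = Fin m" using lh(1) by (cases l) (auto simp: zero_extended_def)
    then have "m - 1 \<in> index_set l' h'" using \<open>l' < l\<close> lh
      by (cases h'; cases l') (auto simp: index_set_def zero_extended_def)
    then have "m - 1 \<in> index_set l h" using lh by simp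
    then show False using m by (auto simp: index_set_def)
  qed
  show "lo = lo'"
    using linorder_less_linear[of lo lo'] B[OF assms] B[OF assms(3,4,1,2) assms(5)[symmetric]] by blast
  show "hi = hi'"
    using linorder_less_linear[of hi hi'] A[OF assms] A[OF assms(3,4,1,2) assms(5)[symmetric]] by blast
qed

text \<open>Two one-sided enumerations, of \<open>E\<close> from \<open>y\<close> upwards and of its
  negative from \<open>- x\<close> upwards, are joined with opposite signs of the index; 0 is left
  out for the gap between \<open>x\<close> and \<open>y\<close>.\<close>

lemma enumerate_both:
  fixes E :: "real set"
  assumes E: "x \<in> E" "y \<in> E" "x < y" "\<And>e. e \<in> E \<Longrightarrow> e \<le> x \<or> y \<le> e"
    and fin: "\<And>p q. p \<in> E \<Longrightarrow> q \<in> E \<Longrightarrow> finite (E \<inter> {p..q})"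
  obtains lo hi :: "int extended" and a where "lo < 0" "0 < hi" "a 1 = y" "a (-1) = x"
    "strict_mono_on (index_set lo hi) a" "a ` index_set lo hi = E"
proof -
  obtain h :: "int extended" and b where b: "0 < h" "b 1 = y"
    "strict_mono_on {k. 1 \<le> k \<and> Fin k \<le> h} b" "b ` {k. 1 \<le> k \<and> Fin k \<le> h} = E \<inter> {y..}"
    by (rule enumerate_right[OF E(2) fin[OF E(2)]])
  have fin': "finite (uminus ` E \<inter> {- x..q})" if q: "q \<in> uminus ` E" for q
  proof -
    have "uminus ` E \<inter> {- x..q} = uminus ` (E \<inter> {- q..x})" by force
    moreover have "- q \<in> E" using q by force
    ultimately show ?thesis using fin[of "- q" x] E by simp
  qed
  obtain h' :: "int extended" and b' where b': "0 < h'" "b' 1 = - x"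
    "strict_mono_on {k. 1 \<le> k \<and> Fin k \<le> h'} b'" "b' ` {k. 1 \<le> k \<and> Fin k \<le> h'} = uminus ` E \<inter> {- x..}"
    by (rule enumerate_right[OF imageI[OF E(1)] fin'])
  define lo :: "int extended" where "lo = (case h' of Fin m \<Rightarrow> Fin (- m) | _ \<Rightarrow> Minf)"
  define a where "a k = (if 0 < k then b k else - b' (- k))" for k
  have lo: "lo < 0" using b'(1) by (cases h') (auto simp: lo_def zero_extended_def)
  have lo_iff: "lo \<le> Fin k \<longleftrightarrow> Fin (- k) \<le> h'" for k using b'(1) by (cases h') (auto simp: lo_def zero_extended_def)
  have split: "index_set lo h = {k. 1 \<le> k \<and> Fin k \<le> h} \<union> uminus ` {k. 1 \<le> k \<and> Fin k \<le> h'}"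
  proof (intro Set.set_eqI iffI)
    fix k assume k: "k \<in> index_set lo h"
    show "k \<in> {k. 1 \<le> k \<and> Fin k \<le> h} \<union> uminus ` {k. 1 \<le> k \<and> Fin k \<le> h'}"
    proof (cases "0 < k")
      case True
      then show ?thesis using k by (simp add: index_set_def)
    next
      case False
      then have "- k \<in> {k. 1 \<le> k \<and> Fin k \<le> h'}" using k by (simp add: index_set_def lo_iff)
      then have "- (- k) \<in> uminus ` {k. 1 \<le> k \<and> Fin k \<le> h'}" by (rule imageI)
      then show ?thesis by simp
    qed
  next
    fix k assume "k \<in> {k. 1 \<le> k \<and> Fin k \<le> h} \<union> uminus ` {k. 1 \<le> k \<and> Fin k \<le> h'}"
    then show "k \<in> index_set lo h"
    proof
      assume "k \<in> {k. 1 \<le> k \<and> Fin k \<le> h}"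
      then show ?thesis using b'(1) by (cases h') (simp_all add: index_set_def lo_iff zero_extended_def)
    next
      assume "k \<in> uminus ` {k. 1 \<le> k \<and> Fin k \<le> h'}"
      then obtain j where "k = - j" "1 \<le> j" "Fin j \<le> h'" by blast
      then show ?thesis using b(1) by (cases h) (simp_all add: index_set_def lo_iff zero_extended_def)
    qed
  qed
  have right: "b k \<in> E \<inter> {y..}" if "1 \<le> k" "Fin k \<le> h" for k using b(4) that by blast
  have left: "- b' k \<in> E \<inter> {..x}" if "1 \<le> k" "Fin k \<le> h'" for k
  proof -
    have "b' k \<in> uminus ` E \<inter> {- x..}" using b'(4) that by blast
    then show ?thesis by auto
  qed
  have mono: "strict_mono_on (index_set lo h) a"
  proof (rule strict_mono_onI)
    fix i j assume ij: "i \<in> index_set lo h" "j \<in> index_set lo h" "i < j"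
    have i: "i \<noteq> 0" "Fin (- i) \<le> h'" "Fin i \<le> h" and j: "j \<noteq> 0" "Fin (- j) \<le> h'" "Fin j \<le> h"
      using ij(1,2) by (auto simp: index_set_def lo_iff)
    consider "0 < i" "0 < j" | "i < 0" "0 < j" | "i < 0" "j < 0" using i(1) j(1) ij(3) by linarith
    then show "a i < a j"
    proof cases
      case 1 then show ?thesis using strict_mono_onD[OF b(3), of i j] i j ij(3) by (simp add: a_def)
    next
      case 2 then show ?thesis using left[of "- i"] right[of j] i j E(3) by (simp add: a_def)
    next
      case 3 then show ?thesis using strict_mono_onD[OF b'(3), of "- j" "- i"] i j ij(3) by (simp add: a_def)
    qed
  qed
  have "a ` index_set lo h = b ` {k. 1 \<le> k \<and> Fin k \<le> h} \<union> uminus ` b' ` {k. 1 \<le> k \<and> Fin k \<le> h'}"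
  proof -
    have "a ` {k. 1 \<le> k \<and> Fin k \<le> h} = b ` {k. 1 \<le> k \<and> Fin k \<le> h}"
      by (rule image_cong) (simp_all add: a_def)
    moreover have "a ` uminus ` {k. 1 \<le> k \<and> Fin k \<le> h'} = uminus ` b' ` {k. 1 \<le> k \<and> Fin k \<le> h'}"
      unfolding image_image by (rule image_cong) (simp_all add: a_def)
    ultimately show ?thesis unfolding split image_Un by simp
  qed
  also have "\<dots> = E \<inter> {y..} \<union> E \<inter> {..x}"
  proof -
    have "uminus ` E \<inter> {- x..} = uminus ` (E \<inter> {..x})" by force
    then have "uminus ` (uminus ` E \<inter> {- x..}) = E \<inter> {..x}" by (simp add: image_image)
    then show ?thesis unfolding b(4) b'(4) by simp
  qed
  also have "\<dots> = E" using E(4) by auto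
  finally have "a ` index_set lo h = E" .
  then show thesis using that[OF lo b(1), of a] mono b(2) b'(2) by (simp add: a_def)
qed

text \<open>The separating division point is \<open>a j\<close> if \<open>j\<close> is positive and
  otherwise \<open>a k\<close>, with \<open>k\<close> negative. Pieces with positive index extend to
  the right of their division point and those with negative index to the left, so these are the
  inner end points.\<close>

lemma piece_order:
  fixes a :: "int \<Rightarrow> real"
  assumes lh: "lo < 0" "0 < hi" and mono: "strict_mono_on (index_set lo hi) a"
    and kj: "k \<in> insert 0 (index_set lo hi)" "j \<in> insert 0 (index_set lo hi)" "k < j"
  obtains m where "m \<in> a ` index_set lo hi" "piece I lo hi a k \<subseteq> {..m}" "piece I lo hi a j \<subseteq> {m..}"
proof -
  note lem = strict_mono_on_leD[OF mono]
  note one = index_set_mem[OF lh]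
  show thesis
  proof (cases "0 < j")
    case True
    then have j: "j \<in> index_set lo hi" using kj by auto
    have "piece I lo hi a k \<subseteq> {..a j}"
    proof -
      consider "k = 0" | "k < 0" | "0 < k" by linarith
      then show ?thesis
      proof cases
        case 1 then show ?thesis using lem[OF one(1) j] True by (auto simp: piece_def)
      next
        case 2
        then have "k \<in> index_set lo hi" using kj by auto
        then show ?thesis using lem[of k j] j kj 2 by (auto simp: piece_def split: if_splits)
      next
        case 3
        then have k: "k \<in> index_set lo hi" using kj by auto
        then have "hi \<noteq> Fin k" using index_set_last(1)[OF _ j] kj(3) by fastforce
        moreover have "k + 1 \<in> index_set lo hi" using index_set_Suc(1)[OF lh k 3 calculation] .
        ultimately show ?thesis using lem[of "k + 1" j] j kj 3 by (auto simp: piece_def)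
      qed
    qed
    moreover have "piece I lo hi a j \<subseteq> {a j..}" using True by (auto simp: piece_def)
    ultimately show ?thesis using that j by blast
  next
    case False
    then have k: "k \<in> index_set lo hi" "k < 0" using kj by auto
    have "piece I lo hi a j \<subseteq> {a k..}"
    proof (cases "j = 0")
      case True then show ?thesis using lem[OF k(1) one(2)] k by (auto simp: piece_def)
    next
      case False
      then have j: "j \<in> index_set lo hi" "j < 0" using kj \<open>\<not> 0 < j\<close> by auto
      have "lo \<noteq> Fin j" using index_set_last(2)[OF _ k(1)] kj(3) by fastforce
      moreover have "j - 1 \<in> index_set lo hi" using index_set_Suc(2)[OF lh j calculation] .
      ultimately show ?thesis using lem[of k "j - 1"] j k kj by (auto simp: piece_def)
    qed
    moreover have "piece I lo hi a k \<subseteq> {..a k}" using k by (auto simp: piece_def)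
    ultimately show ?thesis using that k(1) by blast
  qed
qed

section \<open>Tiling the parameter interval by translates\<close>

context local_symmetries begin

lemma max_symmetry_id: "max_symmetry \<one> 1 I id"
  by (auto simp: max_symmetry_def sym_id)

text \<open>The data behind a decomposition relative to \<open>[x, y]\<close>, with maximal
  symmetries in place of restricted maps, so that comparison by maximality stays available. Among
  the indices, exactly those that equal a finite bound belong to symmetries whose domain misses
  \<open>x\<close> or \<open>y\<close>. Index 0 carries the identity on all of
  \<open>I\<close>.\<close>

definition decomposes where
  "decomposes x y lo hi a g f J \<rho> \<longleftrightarrow>
    lo < 0 \<and> 0 < hi \<and> a 1 = y \<and> a (-1) = x \<and> strict_mono_on (index_set lo hi) a \<and>
    a ` index_set lo hi = ends x y \<and> I = (\<Union>k\<in>insert 0 (index_set lo hi). piece I lo hi a k) \<and>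
    g 0 = \<one> \<and> J 0 = I \<and> \<rho> 0 = id \<and>
    (\<forall>k\<in>insert 0 (index_set lo hi). max_symmetry (g k) (f k) (J k) (\<rho> k) \<and>
      piece I lo hi a k = \<rho> k ` (J k \<inter> {x..y}) \<and>
      (x \<in> J k \<and> y \<in> J k \<longleftrightarrow> \<not> (0 < k \<and> hi = Fin k) \<and> \<not> (k < 0 \<and> lo = Fin k)) \<and>
      (0 < k \<longrightarrow> f k = 1 \<and> x \<in> J k \<and> \<rho> k x = a k \<or> f k = -1 \<and> y \<in> J k \<and> \<rho> k y = a k) \<and>
      (k < 0 \<longrightarrow> f k = 1 \<and> y \<in> J k \<and> \<rho> k y = a k \<or> f k = -1 \<and> x \<in> J k \<and> \<rho> k x = a k))"

text \<open>The ends are locally finite, hence enumerable with \<open>a 1 = y\<close> and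
  \<open>a (-1) = x\<close>, and for positive \<open>k\<close> the translate starting at
  \<open>a k\<close> fills the gap to the next end because no end lies inside a translate; on the
  left the picture is reversed.\<close>

lemma decomposes_exists:
  assumes B: "maxint {x..y}" and xy: "x < y"
  obtains lo hi a g f J \<rho> where "decomposes x y lo hi a g f J \<rho>"
proof -
  note xyI = xyI[OF B xy]
  have gap: "e \<le> x \<or> y \<le> e" if "e \<in> ends x y" for e
    using interior_not_end[OF B xy rel_id, of e] between_xy[OF B xy, of e] that by force
  have fin: "finite (ends x y \<inter> {p..q})" if "p \<in> ends x y" "q \<in> ends x y" for p q
    using ends_finite[OF B xy] ends_in_I that by blast
  obtain lo hi :: "int extended" and a where lh: "lo < 0" "0 < hi" and a: "a 1 = y" "a (-1) = x"
    and mono: "strict_mono_on (index_set lo hi) a" and img: "a ` index_set lo hi = ends x y"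
    using enumerate_both[OF ends_xy[OF B xy] xy gap fin] by metis
  let ?S = "index_set lo hi"
  have le: "a i \<le> a j \<longleftrightarrow> i \<le> j" if "i \<in> ?S" "j \<in> ?S" for i j
    using strict_mono_on_leD[OF mono] strict_mono_onD[OF mono] that by (meson leD leI)
  have aI: "a k \<in> I" "a k \<in> ends x y" if "k \<in> ?S" for k using img ends_in_I that by blast+
  have beyond: "\<exists>p\<in>I. a k < p" "\<exists>p\<in>I. p < a k" if k: "k \<in> ?S" for k
  proof -
    obtain r where "r > 0" "ball (a k) r \<subseteq> I" using open_I aI(1)[OF k] openE by blast
    then have "a k + r/2 \<in> I" "a k - r/2 \<in> I" by (auto simp: subset_iff dist_real_def)
    then show "\<exists>p\<in>I. a k < p" "\<exists>p\<in>I. p < a k" using \<open>r > 0\<close>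
      by (smt (verit) field_sum_of_halves)+
  qed
  define Q where "Q k g f J \<rho> \<longleftrightarrow> max_symmetry g f J \<rho> \<and> piece I lo hi a k = \<rho> ` (J \<inter> {x..y}) \<and>
      (x \<in> J \<and> y \<in> J \<longleftrightarrow> \<not> (0 < k \<and> hi = Fin k) \<and> \<not> (k < 0 \<and> lo = Fin k)) \<and>
      (0 < k \<longrightarrow> f = 1 \<and> x \<in> J \<and> \<rho> x = a k \<or> f = -1 \<and> y \<in> J \<and> \<rho> y = a k) \<and>
      (k < 0 \<longrightarrow> f = 1 \<and> y \<in> J \<and> \<rho> y = a k \<or> f = -1 \<and> x \<in> J \<and> \<rho> x = a k)" for k g f J \<rho>
  have Q0: "Q 0 \<one> 1 I id"
    using max_symmetry_id xyI a between_xy[OF B xy] by (auto simp: Q_def piece_def)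
  have Qpos: "\<exists>g f J \<rho>. Q k g f J \<rho>" if k: "k \<in> ?S" "0 < k" for k
  proof (rule right_translate[OF B xy aI(2)[OF k(1)]])
    fix g f J \<rho> assume M: "max_symmetry g f J \<rho>"
      and st: "f = 1 \<and> x \<in> J \<and> \<rho> x = a k \<or> f = -1 \<and> y \<in> J \<and> \<rho> y = a k"
      and im: "x \<in> J \<and> y \<in> J \<and> (\<exists>d'\<in>ends x y. a k < d' \<and> \<rho> ` (J \<inter> {x..y}) = {a k..d'}) \<or>
        \<not> (x \<in> J \<and> y \<in> J) \<and> \<rho> ` (J \<inter> {x..y}) = I \<inter> {a k..}"
    note tr = translate_interior[OF B xy max_symmetryD[OF M]]
    have "piece I lo hi a k = \<rho> ` (J \<inter> {x..y}) \<and> (x \<in> J \<and> y \<in> J \<longleftrightarrow> hi \<noteq> Fin k)"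
    proof (cases "hi = Fin k")
      \<comment> \<open>There is no further end for the translate to stop at, so it runs through the
        rest of \<open>I\<close>.\<close>
      case True
      have "\<not> (\<exists>d'\<in>ends x y. a k < d')"
        using le[OF _ k(1)] index_set_last(1)[OF True] img by (force simp: not_less[symmetric])
      then show ?thesis using im True k by (auto simp: piece_def)
    next
      case False
      have k1: "k + 1 \<in> ?S" using index_set_Suc(1)[OF lh k False] .
      have ak: "a k < a (k + 1)" using strict_mono_onD[OF mono k(1) k1] by simp
      \<comment> \<open>Otherwise the translate would exhaust \<open>I\<close> to the right and have
        the end \<open>a (k + 1)\<close> inside it.\<close>
      have inJ: "x \<in> J \<and> y \<in> J"
      proof (rule ccontr)
        assume "\<not> ?thesis"
        then have im: "\<rho> ` (J \<inter> {x..y}) = I \<inter> {a k..}" using im by blast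
        obtain p where "p \<in> I" "a (k + 1) < p" using beyond(1)[OF k1] by blast
        then show False using tr[of "a k" p "a (k + 1)"] im ak aI[OF k1] aI[OF k(1)] by auto
      qed
      then obtain d where d: "d \<in> ends x y" "a k < d" "\<rho> ` (J \<inter> {x..y}) = {a k..d}" using im by blast
      have "\<not> a (k + 1) < d" using tr[of "a k" d "a (k + 1)"] d ak aI(2)[OF k1] by auto
      moreover obtain j where j: "j \<in> ?S" "d = a j" using d(1) img by blast
      then have "k + 1 \<le> j" using d(2) le[OF j(1) k(1)] by auto
      then have "a (k + 1) \<le> d" using le[OF k1 j(1)] j(2) by simp
      ultimately show ?thesis using d(3) inJ False k by (simp add: piece_def)
    qed
    then have "Q k g f J \<rho>" using M st k by (simp add: Q_def)
    then show ?thesis by blast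
  qed
  have Qneg: "\<exists>g f J \<rho>. Q k g f J \<rho>" if k: "k \<in> ?S" "k < 0" for k
  proof (rule left_translate[OF B xy aI(2)[OF k(1)]])
    fix g f J \<rho> assume M: "max_symmetry g f J \<rho>"
      and st: "f = 1 \<and> y \<in> J \<and> \<rho> y = a k \<or> f = -1 \<and> x \<in> J \<and> \<rho> x = a k"
      and im: "x \<in> J \<and> y \<in> J \<and> (\<exists>d'\<in>ends x y. d' < a k \<and> \<rho> ` (J \<inter> {x..y}) = {d'..a k}) \<or>
        \<not> (x \<in> J \<and> y \<in> J) \<and> \<rho> ` (J \<inter> {x..y}) = I \<inter> {..a k}"
    note tr = translate_interior[OF B xy max_symmetryD[OF M]]
    have "piece I lo hi a k = \<rho> ` (J \<inter> {x..y}) \<and> (x \<in> J \<and> y \<in> J \<longleftrightarrow> lo \<noteq> Fin k)"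
    proof (cases "lo = Fin k")
      case True
      have "\<not> (\<exists>d'\<in>ends x y. d' < a k)"
        using le[OF k(1)] index_set_last(2)[OF True] img by (force simp: not_less[symmetric])
      then show ?thesis using im True k by (auto simp: piece_def)
    next
      case False
      have k1: "k - 1 \<in> ?S" using index_set_Suc(2)[OF lh k False] .
      have ak: "a (k - 1) < a k" using strict_mono_onD[OF mono k1 k(1)] by simp
      have inJ: "x \<in> J \<and> y \<in> J"
      proof (rule ccontr)
        assume "\<not> ?thesis"
        then have im: "\<rho> ` (J \<inter> {x..y}) = I \<inter> {..a k}" using im by blast
        obtain p where "p \<in> I" "p < a (k - 1)" using beyond(2)[OF k1] by blast
        then show False using tr[of p "a k" "a (k - 1)"] im ak aI[OF k1] aI[OF k(1)] by auto
      qed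
      then obtain d where d: "d \<in> ends x y" "d < a k" "\<rho> ` (J \<inter> {x..y}) = {d..a k}" using im by blast
      have "\<not> d < a (k - 1)" using tr[of d "a k" "a (k - 1)"] d ak aI(2)[OF k1] by auto
      moreover obtain j where j: "j \<in> ?S" "d = a j" using d(1) img by blast
      then have "j \<le> k - 1" using d(2) le[OF k(1) j(1)] by auto
      then have "d \<le> a (k - 1)" using le[OF j(1) k1] j(2) by simp
      ultimately show ?thesis using d(3) inJ False k by (simp add: piece_def)
    qed
    then have "Q k g f J \<rho>" using M st k by (simp add: Q_def)
    then show ?thesis by blast
  qed
  have "\<forall>k\<in>?S. \<exists>g f J \<rho>. Q k g f J \<rho>"
  proof
    fix k assume k: "k \<in> ?S"
    then have "k \<noteq> 0" by (simp add: index_set_def)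
    then have "0 < k \<or> k < 0" by linarith
    then show "\<exists>g f J \<rho>. Q k g f J \<rho>" using Qpos[OF k] Qneg[OF k] by blast
  qed
  then obtain g f J \<rho> where Q: "\<And>k. k \<in> ?S \<Longrightarrow> Q k (g k) (f k) (J k) (\<rho> k)" by metis
  \<comment> \<open>The choice above covers only the index set, which omits 0; the identity is put
    there.\<close>
  define g' f' J' \<rho>' where "g' = g(0 := \<one>)" and "f' = f(0 := 1)" and "J' = J(0 := I)" and "\<rho>' = \<rho>(0 := id)"
  have Q': "Q k (g' k) (f' k) (J' k) (\<rho>' k)" if "k \<in> insert 0 ?S" for k
  proof (cases "k = 0")
    case True then show ?thesis using Q0 by (simp add: g'_def f'_def J'_def \<rho>'_def)
  next
    case False then show ?thesis using Q that by (simp add: g'_def f'_def J'_def \<rho>'_def)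
  qed
  have sub: "piece I lo hi a k \<subseteq> I" if "k \<in> insert 0 ?S" for k
    using Q'[OF that] symD(7)[OF max_symmetryD] unfolding Q_def by blast
  have cover: "t \<in> (\<Union>k\<in>insert 0 ?S. piece I lo hi a k)" if t: "t \<in> I" for t
  proof -
    consider "x \<le> t" "t \<le> y" | "y < t" | "t < x" by linarith
    then show ?thesis
    proof cases
      case 1 then show ?thesis using a by (auto simp: piece_def)
    next
      case 2
      \<comment> \<open>The piece containing \<open>t\<close> begins at the largest end not
        exceeding \<open>t\<close>, which exists by local finiteness.\<close>
      let ?F = "ends x y \<inter> {y..t}"
      have fF: "finite ?F" "?F \<noteq> {}" using ends_finite[OF B xy xyI(2) t] ends_xy[OF B xy] 2 by auto
      have m: "Max ?F \<in> ?F" "\<And>e. e \<in> ?F \<Longrightarrow> e \<le> Max ?F" using Max_in[OF fF] Max_ge[OF fF(1)] by auto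
      obtain k where k: "k \<in> ?S" "a k = Max ?F" using m(1) img by (metis IntE imageE)
      have "1 \<le> k" using le[OF index_set_mem(1)[OF lh] k(1)] a k m(1) by auto
      have "t \<in> piece I lo hi a k"
      proof (cases "hi = Fin k")
        case True then show ?thesis using k t m(1) \<open>1 \<le> k\<close> by (auto simp: piece_def)
      next
        case False
        have k1: "k + 1 \<in> ?S" using index_set_Suc(1)[OF lh k(1) _ False] \<open>1 \<le> k\<close> by simp
        have "a k < a (k + 1)" using strict_mono_onD[OF mono k(1) k1] by simp
        then have "t < a (k + 1)" using m k aI(2)[OF k1] by force
        then show ?thesis using False k m(1) \<open>1 \<le> k\<close> by (auto simp: piece_def)
      qed
      then show ?thesis using k(1) by blast
    next
      case 3
      let ?F = "ends x y \<inter> {t..x}"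
      have fF: "finite ?F" "?F \<noteq> {}" using ends_finite[OF B xy t xyI(1)] ends_xy[OF B xy] 3 by auto
      have m: "Min ?F \<in> ?F" "\<And>e. e \<in> ?F \<Longrightarrow> Min ?F \<le> e" using Min_in[OF fF] Min_le[OF fF(1)] by auto
      obtain k where k: "k \<in> ?S" "a k = Min ?F" using m(1) img by (metis IntE imageE)
      have "k \<le> -1" using le[OF k(1) index_set_mem(2)[OF lh]] a k m(1) by auto
      have "t \<in> piece I lo hi a k"
      proof (cases "lo = Fin k")
        case True then show ?thesis using k t m(1) \<open>k \<le> -1\<close> by (auto simp: piece_def)
      next
        case False
        have k1: "k - 1 \<in> ?S" using index_set_Suc(2)[OF lh k(1) _ False] \<open>k \<le> -1\<close> by simp
        have "a (k - 1) < a k" using strict_mono_onD[OF mono k1 k(1)] by simp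
        then have "a (k - 1) < t" using m k aI(2)[OF k1] by force
        then show ?thesis using False k m(1) \<open>k \<le> -1\<close> by (auto simp: piece_def)
      qed
      then show ?thesis using k(1) by blast
    qed
  qed
  have "decomposes x y lo hi a g' f' J' \<rho>'"
    unfolding decomposes_def
  proof (intro conjI ballI)
    show "I = (\<Union>k\<in>insert 0 ?S. piece I lo hi a k)" using sub cover by blast
    show "g' 0 = \<one>" "J' 0 = I" "\<rho>' 0 = id" by (simp_all add: g'_def J'_def \<rho>'_def)
  qed (use lh a mono img Q' in \<open>auto simp: Q_def\<close>)
  then show thesis using that by blast
qed

context
  fixes x y :: real and lo hi a g f J \<rho>
  assumes B: "maxint {x..y}" and xy: "x < y" and dec: "decomposes x y lo hi a g f J \<rho>"
begin

lemma decD: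
  shows "lo < 0" "0 < hi" "a 1 = y" "a (-1) = x" "strict_mono_on (index_set lo hi) a"
    "a ` index_set lo hi = ends x y" "I = (\<Union>k\<in>insert 0 (index_set lo hi). piece I lo hi a k)"
    "g 0 = \<one>" "J 0 = I" "\<rho> 0 = id"
  using dec unfolding decomposes_def by blast+

lemma dec_piece:
  assumes "k \<in> insert 0 (index_set lo hi)"
  shows "max_symmetry (g k) (f k) (J k) (\<rho> k)" "piece I lo hi a k = \<rho> k ` (J k \<inter> {x..y})"
    "x \<in> J k \<and> y \<in> J k \<longleftrightarrow> \<not> (0 < k \<and> hi = Fin k) \<and> \<not> (k < 0 \<and> lo = Fin k)"
    "0 < k \<Longrightarrow> f k = 1 \<and> x \<in> J k \<and> \<rho> k x = a k \<or> f k = -1 \<and> y \<in> J k \<and> \<rho> k y = a k"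
    "k < 0 \<Longrightarrow> f k = 1 \<and> y \<in> J k \<and> \<rho> k y = a k \<or> f k = -1 \<and> x \<in> J k \<and> \<rho> k x = a k"
  using dec assms unfolding decomposes_def by blast+

lemma dec_pieces_disjoint:
  assumes kj: "k \<in> insert 0 (index_set lo hi)" "j \<in> insert 0 (index_set lo hi)"
    and t: "t \<in> piece I lo hi a k" "t \<in> piece I lo hi a j" "t \<notin> ends x y"
  shows "k = j"
proof -
  have F: False if "k \<in> insert 0 (index_set lo hi)" "j \<in> insert 0 (index_set lo hi)" "k < j"
    "t \<in> piece I lo hi a k" "t \<in> piece I lo hi a j" for k j
  proof -
    obtain m where m: "m \<in> a ` index_set lo hi" "piece I lo hi a k \<subseteq> {..m}" "piece I lo hi a j \<subseteq> {m..}"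
      using piece_order[OF decD(1,2,5) \<open>k \<in> _\<close> \<open>j \<in> _\<close> \<open>k < j\<close>] by metis
    then have "t = m" using \<open>t \<in> piece I lo hi a k\<close> \<open>t \<in> piece I lo hi a j\<close> by force
    then show False using m(1) decD(6) t(3) by simp
  qed
  show ?thesis using F[OF kj _ t(1,2)] F[OF kj(2,1) _ t(2,1)] by (meson linorder_neqE)
qed

lemma sym_inside:
  assumes S: "S g' e J' \<rho>'" and sub: "J' \<subseteq> {x..y}" and t: "t \<in> J'"
  shows "x < t" "t < y" "\<rho>' t \<notin> ends x y"
proof -
  obtain r where r: "r > 0" "ball t r \<subseteq> J'" using symD(3)[OF S] t openE by blast
  then have "t + r/2 \<in> J'" "t - r/2 \<in> J'" by (auto simp: subset_iff dist_real_def)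
  then show xt: "x < t" "t < y" using sub r(1) by force+
  show "\<rho>' t \<notin> ends x y" using interior_not_end[OF B xy relI[OF S t] xt] .
qed

text \<open>At one parameter \<open>t\<close> the value \<open>\<rho>' t\<close> lies in some piece,
  hence equals \<open>\<rho> k s\<close>. Both \<open>t\<close> and \<open>s\<close> are interior,
  so \<open>SF\<close> gives \<open>t = s\<close>, and composition with the inverse of
  \<open>\<rho> k\<close> places \<open>g'\<close> in the class of \<open>g k\<close>; maximality of
  \<open>\<rho> k\<close> extends the agreement to \<open>J'\<close>.\<close>

lemma dec_match:
  assumes S: "S g' e J' \<rho>'" and sub: "J' \<subseteq> {x..y}"
  obtains k where "k \<in> insert 0 (index_set lo hi)" "inv (g k) \<otimes> g' \<in> stab" "J' \<subseteq> J k"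
    "\<And>t. t \<in> J' \<Longrightarrow> \<rho> k t = \<rho>' t"
proof -
  obtain t where t: "t \<in> J'" using symD(5)[OF S] by blast
  note tt = sym_inside[OF S sub t]
  obtain k where k: "k \<in> insert 0 (index_set lo hi)" "\<rho>' t \<in> piece I lo hi a k"
    using decD(7) symD(13)[OF S t] by blast
  note P = dec_piece[OF k(1)]
  obtain s where s: "s \<in> J k" "x \<le> s" "s \<le> y" "\<rho>' t = \<rho> k s" using k(2) P(2) by auto
  have Rs: "rel (g k) (f k) s (\<rho>' t)" using relI[OF max_symmetryD[OF P(1)] s(1)] s(4) by simp
  then have "s \<noteq> x" "s \<noteq> y" using tt(3) by (auto simp: ends_def)
  then have "x < s" "s < y" using s by auto
  moreover have R: "rel (inv (g k) \<otimes> g') (e * f k) t s"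
    using rel_compose[OF relI[OF S t] rel_inverse[OF Rs]] .
  ultimately have "t = s" using SF_D[OF xyI(3)[OF B xy] R] tt by auto
  then have st: "inv (g k) \<otimes> g' \<in> stab"
    using SF_fix_stab(1)[OF xyI(3)[OF B xy], of "inv (g k) \<otimes> g'" _ t] R tt by auto
  have tk: "t \<in> J k" "\<rho> k t = \<rho>' t" using s(1,4) \<open>t = s\<close> by simp_all
  show thesis
    by (rule that[OF k(1) st max_symmetry_mono[OF P(1) S st tk(1) t tk(2)]])
qed

lemma dec_index_unique:
  assumes "k \<in> insert 0 (index_set lo hi)" "j \<in> insert 0 (index_set lo hi)"
    and "t \<in> J k" "t \<in> J j" "\<rho> k t = \<rho> j t" "x < t" "t < y"
  shows "k = j"
proof (rule dec_pieces_disjoint[OF assms(1,2)])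
  show "\<rho> k t \<in> piece I lo hi a k"
    unfolding dec_piece(2)[OF assms(1)] by (rule imageI) (use assms in auto)
  show "\<rho> k t \<in> piece I lo hi a j"
    unfolding dec_piece(2)[OF assms(2)] assms(5) by (rule imageI) (use assms in auto)
  show "\<rho> k t \<notin> ends x y"
    using interior_not_end[OF B xy relI[OF max_symmetryD[OF dec_piece(1)[OF assms(1)]] assms(3)]] assms by blast
qed

text \<open>The neighbouring translates are attached at \<open>y\<close> and at \<open>x\<close> by
  a shift or a reflection. A stabilizer element admits no reflection, and if it shifted one end
  point to the other, \<open>I\<close> would be free.\<close>

lemma dec_neighbours_nontrivial:
  assumes nf: "\<not> free I" shows "g 1 \<notin> stab" "g (-1) \<notin> stab"
proof -
  note one = index_set_mem[OF decD(1,2)]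
  have fr: "free {x..y}" using SF_imp_free xyI(3)[OF B xy] by blast
  have no: False if st: "h \<in> stab" and "rel h 1 x y \<or> rel h 1 y x \<or> rel h (-1) u u" for h u
    using that(2) stab_decreasing[OF st] stab_shift_free[OF st] nf fr xy segment_xy[OF B xy] by (metis less_irrefl)
  show "g 1 \<notin> stab"
    using dec_piece(4)[of 1] relI[OF max_symmetryD[OF dec_piece(1)[of 1]]] one decD(3) no by force
  show "g (-1) \<notin> stab"
    using dec_piece(5)[of "-1"] relI[OF max_symmetryD[OF dec_piece(1)[of "-1"]]] one decD(4) no by force
qed

text \<open>\<open>\<rho> 1\<close> starts at \<open>a 1 = y\<close>, so a decreasing one would fix
  \<open>y\<close>, which a shift from \<open>x\<close> to \<open>y\<close> excludes; similarly at
  \<open>x\<close>.\<close>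

lemma dec_neighbours_increasing:
  assumes "rel h 1 x y" shows "f 1 = 1" "f (-1) = 1"
proof -
  note one = index_set_mem[OF decD(1,2)]
  note no = shift_excludes_reflection[OF B xy assms]
  show "f 1 = 1"
    using dec_piece(4)[of 1] relI[OF max_symmetryD[OF dec_piece(1)[of 1]], of y] one decD(3) no by force
  show "f (-1) = 1"
    using dec_piece(5)[of "-1"] relI[OF max_symmetryD[OF dec_piece(1)[of "-1"]], of x] one decD(4) no by force
qed

text \<open>An increasing \<open>\<rho> 1\<close> would send \<open>x\<close> to
  \<open>a 1 = y\<close>, and an increasing \<open>\<rho> (-1)\<close> would send \<open>y\<close>
  to \<open>a (-1) = x\<close>.\<close>

lemma dec_neighbours_decreasing:
  assumes "\<And>h. \<not> rel h 1 x y" shows "f 1 = -1" "f (-1) = -1"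
proof -
  note one = index_set_mem[OF decD(1,2)]
  have no: "\<not> rel h 1 y x" for h using assms rel_inverse by blast
  show "f 1 = -1"
    using dec_piece(4)[of 1] relI[OF max_symmetryD[OF dec_piece(1)[of 1]], of x] one decD(3) assms by force
  show "f (-1) = -1"
    using dec_piece(5)[of "-1"] relI[OF max_symmetryD[OF dec_piece(1)[of "-1"]], of y] one decD(4) no by force
qed

text \<open>A reflection at any point of \<open>I\<close> can be moved into \<open>[x, y]\<close> by one of the \<open>\<rho> k\<close>.\<close>

lemma shift_excludes_all_reflections:
  assumes "rel h 1 x y" shows "\<not> rel h' (-1) z z"
proof
  assume R: "rel h' (-1) z z"
  obtain k where k: "k \<in> insert 0 (index_set lo hi)" "z \<in> piece I lo hi a k"
    using decD(7) relD(3)[OF R] by blast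
  note P = dec_piece[OF k(1)]
  obtain s where s: "s \<in> J k" "x \<le> s" "s \<le> y" "z = \<rho> k s" using k(2) P(2) by auto
  have Rs: "rel (g k) (f k) s z" using relI[OF max_symmetryD[OF P(1)] s(1)] s(4) by simp
  have "f k * (-1 * f k) = -1" using relD(2)[OF Rs] by auto
  then have R': "rel (inv (g k) \<otimes> h' \<otimes> g k) (-1) s s"
    using rel_compose[OF Rs rel_compose[OF R rel_inverse[OF Rs]]] by simp
  have "s \<notin> interior {x..y}" using reflection_outside[OF xyI(3)[OF B xy] R'] .
  then have "s = x \<or> s = y" using s by auto
  then show False using R' shift_excludes_reflection[OF B xy assms] by blast
qed

end
end

section \<open>Real-analytic functions and curves\<close>

text \<open>Encoded by a holomorphic extension near \<open>t\<close>, so that composition, inversion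
  and the identity theorem come from complex analysis;
  \<open>real_analytic_at_power_series_iff\<close> relates it to power series.\<close>

definition real_analytic_at :: "(real \<Rightarrow> real) \<Rightarrow> real \<Rightarrow> bool" where
  "real_analytic_at f t \<longleftrightarrow> (\<exists>H. H analytic_on {complex_of_real t} \<and>
     (\<forall>\<^sub>F x in nhds t. H (complex_of_real x) = complex_of_real (f x)))"

lemma real_analytic_at_cong:
  assumes "real_analytic_at f t" "\<forall>\<^sub>F x in nhds t. f x = g x"
  shows "real_analytic_at g t"
proof -
  obtain H where H: "H analytic_on {complex_of_real t}"
    "\<forall>\<^sub>F x in nhds t. H (complex_of_real x) = complex_of_real (f x)"
    using assms(1) by (auto simp: real_analytic_at_def)
  have "\<forall>\<^sub>F x in nhds t. H (complex_of_real x) = complex_of_real (g x)"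
    using H(2) assms(2) by eventually_elim simp
  then show ?thesis using H(1) by (auto simp: real_analytic_at_def)
qed

lemma analytic_on_nhds:
  assumes "H analytic_on {z :: complex}"
  obtains r where "r > 0" "H holomorphic_on ball z r"
  using assms by (auto simp: analytic_on_def)

lemma real_analytic_at_obtain:
  assumes "real_analytic_at f t"
  obtains H r where "r > 0" "H holomorphic_on ball (complex_of_real t) r"
    "\<And>x. \<bar>x - t\<bar> < r \<Longrightarrow> H (complex_of_real x) = complex_of_real (f x)"
proof -
  obtain H where H: "H analytic_on {complex_of_real t}"
    "\<forall>\<^sub>F x in nhds t. H (complex_of_real x) = complex_of_real (f x)"
    using assms by (auto simp: real_analytic_at_def)
  obtain r where r: "r > 0" "H holomorphic_on ball (complex_of_real t) r" using analytic_on_nhds[OF H(1)] .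
  obtain d where d: "d > 0" "\<And>x. dist x t < d \<Longrightarrow> H (complex_of_real x) = complex_of_real (f x)"
    using H(2) by (auto simp: eventually_nhds_metric)
  show thesis
  proof (rule that[of "min r d" H])
    show "H holomorphic_on ball (complex_of_real t) (min r d)"
      by (rule holomorphic_on_subset[OF r(2)]) auto
  qed (use r d in \<open>auto simp: dist_real_def\<close>)
qed

lemma dist_complex_of_real: "dist (complex_of_real x) (complex_of_real t) = \<bar>x - t\<bar>"
  by (simp add: dist_norm flip: of_real_diff)

lemma real_analytic_atI:
  assumes "r > 0" "H holomorphic_on ball (complex_of_real t) r"
    "\<And>x. \<bar>x - t\<bar> < r \<Longrightarrow> H (complex_of_real x) = complex_of_real (f x)"
  shows "real_analytic_at f t"
  unfolding real_analytic_at_def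
  using assms by (auto simp: analytic_on_def eventually_nhds_metric dist_real_def)

lemma real_analytic_at_nhds:
  assumes "real_analytic_at f t" shows "\<forall>\<^sub>F s in nhds t. real_analytic_at f s"
proof -
  obtain H r where r: "r > 0" "H holomorphic_on ball (complex_of_real t) r"
    "\<And>x. \<bar>x - t\<bar> < r \<Longrightarrow> H (complex_of_real x) = complex_of_real (f x)"
    by (rule real_analytic_at_obtain[OF assms]) (rule that, assumption+)
  have "real_analytic_at f s" if s: "\<bar>s - t\<bar> < r" for s
  proof (rule real_analytic_atI[of "r - \<bar>s - t\<bar>" H])
    show "H holomorphic_on ball (complex_of_real s) (r - \<bar>s - t\<bar>)"
    proof (rule holomorphic_on_subset[OF r(2)], rule subsetI)
      fix z assume "z \<in> ball (complex_of_real s) (r - \<bar>s - t\<bar>)"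
      then show "z \<in> ball (complex_of_real t) r"
        using dist_triangle[of "complex_of_real t" z "complex_of_real s"] dist_complex_of_real[of s t]
        by (simp add: dist_commute)
    qed
  qed (use s r in auto)
  then show ?thesis using r(1) by (auto simp: eventually_nhds_metric dist_real_def)
qed

text \<open>Along the real axis the extension has a vector derivative whose real part is the
  derivative of \<open>f\<close> and whose imaginary part vanishes, \<open>f\<close> being
  real.\<close>

lemma real_analytic_at_deriv:
  assumes "real_analytic_at f t"
  shows "(f has_real_derivative deriv f t) (at t)"
    and "H analytic_on {complex_of_real t} \<Longrightarrow> \<forall>\<^sub>F x in nhds t. H (complex_of_real x) = complex_of_real (f x) \<Longrightarrow>
      deriv H (complex_of_real t) = complex_of_real (deriv f t)"
proof -
  have main: "(f has_real_derivative Re (deriv H (complex_of_real t))) (at t) \<and> Im (deriv H (complex_of_real t)) = 0"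
    if H: "H analytic_on {complex_of_real t}" "\<forall>\<^sub>F x in nhds t. H (complex_of_real x) = complex_of_real (f x)" for H
  proof -
    obtain r where r: "r > 0" "H holomorphic_on ball (complex_of_real t) r" using analytic_on_nhds[OF H(1)] .
    let ?D = "deriv H (complex_of_real t)"
    have "(H has_field_derivative ?D) (at (complex_of_real t))"
      using holomorphic_derivI[OF r(2)] r(1) by auto
    then have v: "((\<lambda>x. H (complex_of_real x)) has_vector_derivative ?D) (at t)"
      by (rule has_vector_derivative_real_field)
    have Re: "((\<lambda>x. Re (H (complex_of_real x))) has_real_derivative Re ?D) (at t)"
      using bounded_linear.has_vector_derivative[OF bounded_linear_Re v]
      by (simp add: has_real_derivative_iff_has_vector_derivative)
    have Im: "((\<lambda>x. Im (H (complex_of_real x))) has_real_derivative Im ?D) (at t)"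
      using bounded_linear.has_vector_derivative[OF bounded_linear_Im v]
      by (simp add: has_real_derivative_iff_has_vector_derivative)
    have eq1: "\<forall>\<^sub>F x in nhds t. Re (H (complex_of_real x)) = f x" using H(2) by eventually_elim simp
    have eq2: "\<forall>\<^sub>F x in nhds t. Im (H (complex_of_real x)) = 0" using H(2) by eventually_elim simp
    have "(f has_real_derivative Re ?D) (at t)"
      using Re DERIV_cong_ev[OF refl eq1 refl] by simp
    moreover have "((\<lambda>x. 0) has_real_derivative Im ?D) (at t)"
      using Im DERIV_cong_ev[OF refl eq2 refl] by simp
    then have "Im ?D = 0" using DERIV_unique[OF _ DERIV_const] by blast
    ultimately show ?thesis by blast
  qed
  obtain H0 where H0: "H0 analytic_on {complex_of_real t}" "\<forall>\<^sub>F x in nhds t. H0 (complex_of_real x) = complex_of_real (f x)"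
    using assms by (auto simp: real_analytic_at_def)
  show 1: "(f has_real_derivative deriv f t) (at t)" using main[OF H0] DERIV_imp_deriv by metis
  show "deriv H (complex_of_real t) = complex_of_real (deriv f t)"
    if H: "H analytic_on {complex_of_real t}" "\<forall>\<^sub>F x in nhds t. H (complex_of_real x) = complex_of_real (f x)"
    using main[OF H] DERIV_unique[OF 1] by (auto simp: complex_eq_iff)
qed

lemma real_analytic_at_isCont: "real_analytic_at f t \<Longrightarrow> isCont f t"
  using real_analytic_at_deriv(1) DERIV_isCont by blast

lemma real_analytic_at_tendsto: "real_analytic_at f t \<Longrightarrow> (f \<longlongrightarrow> f t) (nhds t)"
  using real_analytic_at_isCont unfolding isCont_def tendsto_at_iff_tendsto_nhds by blast

lemma real_analytic_at_compose:
  assumes f: "real_analytic_at f t" and g: "real_analytic_at g (f t)"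
  shows "real_analytic_at (\<lambda>x. g (f x)) t"
proof -
  obtain H where H: "H analytic_on {complex_of_real t}" "\<forall>\<^sub>F x in nhds t. H (complex_of_real x) = complex_of_real (f x)"
    using f by (auto simp: real_analytic_at_def)
  obtain K where K: "K analytic_on {complex_of_real (f t)}" "\<forall>\<^sub>F y in nhds (f t). K (complex_of_real y) = complex_of_real (g y)"
    using g by (auto simp: real_analytic_at_def)
  have "H (complex_of_real t) = complex_of_real (f t)" using eventually_nhds_x_imp_x[OF H(2)] .
  then have "K \<circ> H analytic_on {complex_of_real t}"
    by (intro analytic_on_compose_gen[OF H(1) K(1)]) auto
  moreover have "\<forall>\<^sub>F x in nhds t. K (complex_of_real (f x)) = complex_of_real (g (f x))"
    by (rule eventually_compose_filterlim[OF K(2) real_analytic_at_tendsto[OF f]])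
  then have "\<forall>\<^sub>F x in nhds t. (K \<circ> H) (complex_of_real x) = complex_of_real (g (f x))"
    using H(2) by eventually_elim simp
  ultimately show ?thesis unfolding real_analytic_at_def by blast
qed

lemma deriv_compose_real:
  assumes f: "real_analytic_at f t" and g: "real_analytic_at g (f t)"
  shows "deriv (\<lambda>x. g (f x)) t = deriv g (f t) * deriv f t"
  using DERIV_chain2[OF real_analytic_at_deriv(1)[OF g] real_analytic_at_deriv(1)[OF f]]
  by (rule DERIV_imp_deriv)

text \<open>The holomorphic extensions agree on a set accumulating at the centre of a common disc,
  so they agree on the disc. The set \<open>W\<close> is arbitrary because agreement may be known
  only on one side of \<open>t\<close>.\<close>

lemma real_analytic_at_local_identity:
  assumes f: "real_analytic_at f t" and g: "real_analytic_at g t"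
    and ev: "\<forall>\<^sub>F x in at t within W. f x = g x" and W: "t islimpt W"
  shows "\<forall>\<^sub>F x in nhds t. f x = g x"
proof -
  obtain H r where H: "r > 0" "H holomorphic_on ball (complex_of_real t) r"
    "\<And>x. \<bar>x - t\<bar> < r \<Longrightarrow> H (complex_of_real x) = complex_of_real (f x)"
    by (rule real_analytic_at_obtain[OF f]) (rule that, assumption+)
  obtain K q where K: "q > 0" "K holomorphic_on ball (complex_of_real t) q"
    "\<And>x. \<bar>x - t\<bar> < q \<Longrightarrow> K (complex_of_real x) = complex_of_real (g x)"
    by (rule real_analytic_at_obtain[OF g]) (rule that, assumption+)
  obtain d where d: "d > 0" "\<And>x. x \<in> W \<Longrightarrow> x \<noteq> t \<Longrightarrow> dist x t < d \<Longrightarrow> f x = g x"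
    using ev by (auto simp: eventually_at)
  define e where "e = min d (min r q)"
  have e: "e > 0" "e \<le> d" "e \<le> r" "e \<le> q" using d H K by (auto simp: e_def)
  let ?B = "ball (complex_of_real t) e"
  let ?U = "complex_of_real ` {x \<in> W. x \<noteq> t \<and> \<bar>x - t\<bar> < e}"
  have hol: "(\<lambda>z. H z - K z) holomorphic_on ?B"
    by (intro holomorphic_intros holomorphic_on_subset[OF H(2)] holomorphic_on_subset[OF K(2)] subset_ball e)
  have lim: "complex_of_real t islimpt ?U"
    unfolding islimpt_approachable
  proof (intro allI impI)
    fix \<epsilon> :: real assume "\<epsilon> > 0"
    then have "min \<epsilon> e > 0" using e by simp
    then obtain x where "x \<in> W" "x \<noteq> t" "dist x t < min \<epsilon> e" using W unfolding islimpt_approachable by blast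
    then show "\<exists>z\<in>?U. z \<noteq> complex_of_real t \<and> dist z (complex_of_real t) < \<epsilon>"
      by (intro bexI[of _ "complex_of_real x"]) (auto simp: dist_complex_of_real dist_real_def)
  qed
  have zero: "H z - K z = 0" if "z \<in> ?B" for z
  proof (rule analytic_continuation[OF hol open_ball connected_ball _ _ lim _ that])
    show "?U \<subseteq> ?B" by (auto simp: dist_real_def abs_minus_commute)
    show "complex_of_real t \<in> ?B" using e by simp
    show "H w - K w = 0" if w: "w \<in> ?U" for w
    proof -
      obtain x where x: "w = complex_of_real x" "x \<in> W" "x \<noteq> t" "\<bar>x - t\<bar> < e" using w by auto
      then show ?thesis using H(3)[of x] K(3)[of x] d(2)[of x] e by (simp add: dist_real_def)
    qed
  qed
  have "f x = g x" if "dist x t < e" for x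
  proof -
    have "complex_of_real x \<in> ?B" using that by (simp add: dist_complex_of_real dist_real_def abs_minus_commute)
    from zero[OF this] show ?thesis using H(3)[of x] K(3)[of x] that e by (simp add: dist_real_def)
  qed
  then show ?thesis using e(1) by (auto simp: eventually_nhds_metric)
qed

text \<open>The set of parameters at which the germs agree is open by definition and closed by the
  local identity theorem.\<close>

lemma real_analytic_identity:
  assumes J: "open J" "connected J" and f: "\<And>t. t \<in> J \<Longrightarrow> real_analytic_at f t"
    and g: "\<And>t. t \<in> J \<Longrightarrow> real_analytic_at g t"
    and W: "open W" "W \<noteq> {}" "W \<subseteq> J" "\<And>t. t \<in> W \<Longrightarrow> f t = g t" and t: "t \<in> J"
  shows "f t = g t"
proof -
  define Z where "Z = {t \<in> J. \<forall>\<^sub>F x in nhds t. f x = g x}"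
  have "open Z"
  proof (rule Topological_Spaces.openI)
    fix z assume z: "z \<in> Z"
    then obtain U where "open U" "z \<in> U" "\<forall>x\<in>U. f x = g x" by (auto simp: Z_def eventually_nhds)
    then show "\<exists>T. open T \<and> z \<in> T \<and> T \<subseteq> Z"
      using J(1) z by (intro exI[of _ "J \<inter> U"]) (auto simp: Z_def eventually_nhds)
  qed
  then have op: "openin (top_of_set J) Z" by (intro open_subset) (auto simp: Z_def)
  have "closedin (top_of_set J) Z"
    unfolding closedin_limpt
  proof (intro conjI allI impI)
    fix x assume x: "x islimpt Z \<and> x \<in> J"
    have "\<forall>\<^sub>F s in at x within Z. f s = g s"
      by (auto simp: eventually_at_filter Z_def intro!: always_eventually dest: eventually_nhds_x_imp_x)
    then have "\<forall>\<^sub>F s in nhds x. f s = g s"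
      using real_analytic_at_local_identity[OF f g] x by blast
    then show "x \<in> Z" using x by (simp add: Z_def)
  qed (auto simp: Z_def)
  then have "Z = {} \<or> Z = J" using op J(2) connected_clopen by blast
  moreover have "W \<subseteq> Z" using W by (auto simp: Z_def eventually_nhds)
  ultimately have "t \<in> Z" using W(2) t by blast
  then show ?thesis by (auto simp: Z_def dest: eventually_nhds_x_imp_x)
qed

text \<open>The extension has nonzero derivative, so it has a local holomorphic inverse
  \<open>K\<close>. On the open set of values of \<open>f\<close> near \<open>t\<close> this inverse
  is real, since \<open>K\<close> sends \<open>f x\<close> back to \<open>x\<close>.\<close>

lemma real_analytic_at_inverse:
  assumes f: "real_analytic_at f t" and d: "deriv f t \<noteq> 0"
  obtains k where "real_analytic_at k (f t)" "\<forall>\<^sub>F x in nhds t. k (f x) = x" "\<forall>\<^sub>F y in nhds (f t). f (k y) = y"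
proof -
  obtain H r where H: "r > 0" "H holomorphic_on ball (complex_of_real t) r"
    "\<And>x. \<bar>x - t\<bar> < r \<Longrightarrow> H (complex_of_real x) = complex_of_real (f x)"
    by (rule real_analytic_at_obtain[OF f]) (rule that, assumption+)
  have "H analytic_on {complex_of_real t}" using H by (auto simp: analytic_on_def)
  moreover have "\<forall>\<^sub>F x in nhds t. H (complex_of_real x) = complex_of_real (f x)"
    using H by (auto simp: eventually_nhds_metric dist_real_def)
  ultimately have "deriv H (complex_of_real t) \<noteq> 0" using real_analytic_at_deriv(2)[OF f] d by simp
  then obtain q where q: "q > 0" "ball (complex_of_real t) q \<subseteq> ball (complex_of_real t) r"
      "open (H ` ball (complex_of_real t) q)" "inj_on H (ball (complex_of_real t) q)"
    using has_complex_derivative_locally_invertible[OF H(2) _ open_ball, of "complex_of_real t"] H(1) by auto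
  have holq: "H holomorphic_on ball (complex_of_real t) q" using holomorphic_on_subset[OF H(2) q(2)] .
  obtain K where K: "K holomorphic_on H ` ball (complex_of_real t) q"
      "\<And>z. z \<in> ball (complex_of_real t) q \<Longrightarrow> K (H z) = z"
    using holomorphic_has_inverse[OF holq open_ball q(4)] by metis
  obtain p where p: "p > 0" "\<And>s. \<bar>s - t\<bar> < p \<Longrightarrow> real_analytic_at f s"
    using real_analytic_at_nhds[OF f] by (auto simp: eventually_nhds_metric dist_real_def)
  define e where "e = min p (min q r)"
  have e: "e > 0" "e \<le> p" "e \<le> q" "e \<le> r" using p q H by (auto simp: e_def)
  have inB: "complex_of_real x \<in> ball (complex_of_real t) q" if "x \<in> ball t e" for x
    using that e by (simp add: dist_complex_of_real dist_real_def abs_minus_commute)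
  have Hf: "H (complex_of_real x) = complex_of_real (f x)" if "x \<in> ball t e" for x
    using H(3)[of x] that e by (simp add: dist_real_def abs_minus_commute)
  have KH: "K (complex_of_real (f x)) = complex_of_real x" if "x \<in> ball t e" for x
    using K(2)[OF inB[OF that]] Hf[OF that] by simp
  have inj: "inj_on f (ball t e)"
    using KH by (metis inj_onI of_real_eq_iff)
  have cont: "continuous_on (ball t e) f"
    using p(2) e real_analytic_at_isCont
    by (intro continuous_at_imp_continuous_on ballI) (auto simp: dist_real_def abs_minus_commute)
  have op: "open (f ` ball t e)" using invariance_of_domain[OF cont open_ball inj] .
  have tB: "t \<in> ball t e" using e by simp
  define k where "k y = Re (K (complex_of_real y))" for y
  have kf: "k (f x) = x" if "x \<in> ball t e" for x using KH[OF that] by (simp add: k_def)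
  show thesis
  proof (rule that[of k])
    have "K analytic_on {complex_of_real (f t)}"
      using K(1) q(3) analytic_on_open inB[OF tB] Hf[OF tB]
      by (metis analytic_on_subset empty_subsetI image_eqI insert_subset)
    moreover have "\<forall>\<^sub>F y in nhds (f t). K (complex_of_real y) = complex_of_real (k y)"
    proof (rule eventually_nhds_in_open[OF op, THEN eventually_mono])
      show "f t \<in> f ` ball t e" using tB by blast
      fix y assume "y \<in> f ` ball t e"
      then show "K (complex_of_real y) = complex_of_real (k y)" using KH by (auto simp: k_def)
    qed
    ultimately show "real_analytic_at k (f t)" unfolding real_analytic_at_def by blast
    show "\<forall>\<^sub>F x in nhds t. k (f x) = x"
      using eventually_nhds_in_open[OF open_ball tB] by eventually_elim (rule kf)
    show "\<forall>\<^sub>F y in nhds (f t). f (k y) = y"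
    proof (rule eventually_nhds_in_open[OF op, THEN eventually_mono])
      show "f t \<in> f ` ball t e" using tB by blast
    qed (use kf in auto)
  qed
qed

section \<open>Power series in one variable and the chart of the real line\<close>

abbreviation line :: "real \<Rightarrow> nat \<Rightarrow> real" where "line \<equiv> (\<lambda>t i. if i = 0 then t else 0)"

lemma inv_line: "inv_into UNIV line (line t) = t"
proof (rule inv_into_f_f)
  show "inj line" by (rule injI) (metis (full_types))
qed simp

text \<open>Multi-indices supported on \<open>{..<1}\<close> are determined by their entry at 0,
  which reduces the sums of \<open>real_analytic_on\<close> to ordinary power series.\<close>

lemma one_variable_has_sum:
  fixes C :: "(nat \<Rightarrow> nat) \<Rightarrow> real"
  shows "((\<lambda>\<alpha>. C \<alpha> * (\<Prod>i<1. (line x i - line t i) ^ \<alpha> i)) has_sum s) {\<alpha>. \<forall>i\<ge>1. \<alpha> i = 0} \<longleftrightarrow>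
    ((\<lambda>k. C (\<lambda>i. if i = 0 then k else 0) * (x - t) ^ k) has_sum s) UNIV"
proof -
  let ?h = "\<lambda>k i. if i = (0::nat) then (k::nat) else 0"
  have "{\<alpha>. \<forall>i\<ge>1. \<alpha> i = 0} = range ?h"
  proof (intro subset_antisym subsetI)
    fix \<alpha> :: "nat \<Rightarrow> nat" assume "\<alpha> \<in> {\<alpha>. \<forall>i\<ge>1. \<alpha> i = 0}"
    then have "\<alpha> = ?h (\<alpha> 0)" by (auto simp: fun_eq_iff)
    then show "\<alpha> \<in> range ?h" by blast
  qed auto
  moreover have "inj ?h" by (rule injI) (metis (full_types))
  ultimately show ?thesis
    using has_sum_reindex[of ?h UNIV "\<lambda>\<alpha>. C \<alpha> * (\<Prod>i<1. (line x i - line t i) ^ \<alpha> i)" s]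
    by (simp add: o_def)
qed

text \<open>From a holomorphic extension, the real parts of the Taylor coefficients serve; absolute
  convergence inside the disc turns the ordered sum into the unordered \<open>has_sum\<close>.
  Conversely, convergence at a single real point \<open>t + s\<close> makes the series holomorphic
  on the complex disc of radius \<open>s\<close>.\<close>

lemma real_analytic_at_power_series_iff:
  assumes T: "open T" "t \<in> T"
  shows "real_analytic_at f t \<longleftrightarrow>
    (\<exists>r>0. \<exists>c. \<forall>x\<in>T. \<bar>x - t\<bar> < r \<longrightarrow> ((\<lambda>k. c k * (x - t) ^ k) has_sum f x) UNIV)"
proof
  assume f: "real_analytic_at f t"
  obtain H r where H: "r > 0" "H holomorphic_on ball (complex_of_real t) r"
    "\<And>x. \<bar>x - t\<bar> < r \<Longrightarrow> H (complex_of_real x) = complex_of_real (f x)"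
    by (rule real_analytic_at_obtain[OF f]) (rule that, assumption+)
  let ?z = "complex_of_real t"
  define a where "a n = (deriv ^^ n) H ?z / fact n" for n
  have ser: "(\<lambda>n. a n * (w - ?z) ^ n) sums H w" if "w \<in> ball ?z r" for w
    unfolding a_def using holomorphic_power_series[OF H(2) that] .
  have "((\<lambda>k. Re (a k) * (x - t) ^ k) has_sum f x) UNIV" if x: "\<bar>x - t\<bar> < r" for x
  proof -
    obtain y where y: "\<bar>x - t\<bar> < y" "y < r" using dense[OF x] by blast
    have "?z + complex_of_real y \<in> ball ?z r" using y by (simp add: dist_norm)
    then have "summable (\<lambda>n. a n * complex_of_real y ^ n)" using sums_summable[OF ser] by fastforce
    moreover have "norm (complex_of_real (x - t)) < norm (complex_of_real y)"
      unfolding norm_of_real using y by linarith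
    ultimately have "summable (\<lambda>n. norm (a n * complex_of_real (x - t) ^ n))"
      by (rule powser_insidea)
    moreover have "complex_of_real x \<in> ball ?z r" using x by (simp add: dist_real_def abs_minus_commute)
    from ser[OF this] have "(\<lambda>n. a n * complex_of_real (x - t) ^ n) sums complex_of_real (f x)"
      using H(3)[OF x] by simp
    ultimately have "((\<lambda>n. a n * complex_of_real (x - t) ^ n) has_sum complex_of_real (f x)) UNIV"
      by (rule norm_summable_imp_has_sum)
    from has_sum_Re[OF this] have "((\<lambda>n. Re (a n * complex_of_real (x - t) ^ n)) has_sum f x) UNIV"
      by (simp only: Re_complex_of_real)
    then show ?thesis by (simp only: of_real_power[symmetric] times_complex.sel Re_complex_of_real Im_complex_of_real mult_zero_right diff_zero)
  qed
  then show "\<exists>r>0. \<exists>c. \<forall>x\<in>T. \<bar>x - t\<bar> < r \<longrightarrow> ((\<lambda>k. c k * (x - t) ^ k) has_sum f x) UNIV"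
    by (intro exI[of _ r] exI[of _ "\<lambda>k. Re (a k)"] conjI H(1) ballI impI)
next
  assume "\<exists>r>0. \<exists>c. \<forall>x\<in>T. \<bar>x - t\<bar> < r \<longrightarrow> ((\<lambda>k. c k * (x - t) ^ k) has_sum f x) UNIV"
  then obtain r c where r: "r > 0" "\<And>x. x \<in> T \<Longrightarrow> \<bar>x - t\<bar> < r \<Longrightarrow> ((\<lambda>k. c k * (x - t) ^ k) has_sum f x) UNIV"
    by blast
  obtain q where q: "q > 0" "ball t q \<subseteq> T" using T openE by blast
  define s where "s = min r q / 2"
  have s: "s > 0" "s < r" "s < q" using r(1) q(1) by (auto simp: s_def)
  have sT: "x \<in> T" if "\<bar>x - t\<bar> \<le> s" for x using that s q(2) by (auto simp: dist_real_def)
  let ?z = "complex_of_real t"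
  have "summable (\<lambda>k. c k * s ^ k)"
    using has_sum_imp_sums[OF r(2)[of "t + s"]] sT[of "t + s"] s by (auto simp: sums_iff)
  then have "summable (\<lambda>k. complex_of_real (c k * s ^ k))" by (rule summable_of_real)
  then have sm: "summable (\<lambda>k. complex_of_real (c k) * complex_of_real s ^ k)" by simp
  define H where "H w = (\<Sum>k. complex_of_real (c k) * (w - ?z) ^ k)" for w
  have "(\<lambda>k. complex_of_real (c k) * (w - ?z) ^ k) sums H w" if "w \<in> ball ?z s" for w
    unfolding H_def using powser_inside[OF sm, of "w - ?z"] that s
    by (auto simp: dist_norm norm_minus_commute intro: summable_sums)
  then have hol: "H holomorphic_on ball ?z s" by (rule power_series_holomorphic)
  show "real_analytic_at f t"
  proof (rule real_analytic_atI[OF s(1) hol])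
    fix x assume x: "\<bar>x - t\<bar> < s"
    then have "(\<lambda>k. c k * (x - t) ^ k) sums f x" using has_sum_imp_sums[OF r(2)[of x]] sT s by auto
    then have "(\<lambda>k. complex_of_real (c k * (x - t) ^ k)) sums complex_of_real (f x)" by (rule sums_of_real)
    then show "H (complex_of_real x) = complex_of_real (f x)" unfolding H_def by (simp add: sums_iff)
  qed
qed

lemma real_analytic_on_line_iff:
  assumes "open T"
  shows "real_analytic_on 1 m (line ` T) (\<lambda>p. F (inv_into UNIV line p)) \<longleftrightarrow>
    (\<forall>t\<in>T. \<forall>j<m. real_analytic_at (\<lambda>s. F s j) t)"
proof -
  have key: "(\<exists>r>0. \<exists>c :: (nat \<Rightarrow> nat) \<Rightarrow> real. \<forall>x\<in>line ` T. (\<forall>i<1. \<bar>x i - line t i\<bar> < r) \<longrightarrow>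
      ((\<lambda>\<alpha>. c \<alpha> * (\<Prod>i<1. (x i - line t i) ^ \<alpha> i)) has_sum F (inv_into UNIV line x) j) {\<alpha>. \<forall>i\<ge>1. \<alpha> i = 0}) \<longleftrightarrow>
      real_analytic_at (\<lambda>s. F s j) t" (is "?L \<longleftrightarrow> _") if t: "t \<in> T" for t j
  proof -
    have "?L \<longleftrightarrow> (\<exists>r>0. \<exists>c :: (nat \<Rightarrow> nat) \<Rightarrow> real. \<forall>x\<in>T. \<bar>x - t\<bar> < r \<longrightarrow>
      ((\<lambda>k. c (\<lambda>i. if i = 0 then k else 0) * (x - t) ^ k) has_sum F x j) UNIV)"
      unfolding ball_simps one_variable_has_sum inv_line by simp
    also have "\<dots> \<longleftrightarrow> (\<exists>r>0. \<exists>c. \<forall>x\<in>T. \<bar>x - t\<bar> < r \<longrightarrow> ((\<lambda>k. c k * (x - t) ^ k) has_sum F x j) UNIV)"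
    proof (intro ex_cong1 conj_cong refl iffI)
      fix r assume "\<exists>c :: nat \<Rightarrow> real. \<forall>x\<in>T. \<bar>x - t\<bar> < r \<longrightarrow> ((\<lambda>k. c k * (x - t) ^ k) has_sum F x j) UNIV"
      then obtain c :: "nat \<Rightarrow> real" where "\<forall>x\<in>T. \<bar>x - t\<bar> < r \<longrightarrow> ((\<lambda>k. c k * (x - t) ^ k) has_sum F x j) UNIV" by blast
      then show "\<exists>c :: (nat \<Rightarrow> nat) \<Rightarrow> real. \<forall>x\<in>T. \<bar>x - t\<bar> < r \<longrightarrow>
          ((\<lambda>k. c (\<lambda>i. if i = 0 then k else 0) * (x - t) ^ k) has_sum F x j) UNIV"
        by (intro exI[of _ "\<lambda>\<alpha>. c (\<alpha> 0)"]) simp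
    next
      fix r assume "\<exists>c :: (nat \<Rightarrow> nat) \<Rightarrow> real. \<forall>x\<in>T. \<bar>x - t\<bar> < r \<longrightarrow>
          ((\<lambda>k. c (\<lambda>i. if i = 0 then k else 0) * (x - t) ^ k) has_sum F x j) UNIV"
      then obtain c :: "(nat \<Rightarrow> nat) \<Rightarrow> real" where "\<forall>x\<in>T. \<bar>x - t\<bar> < r \<longrightarrow>
          ((\<lambda>k. c (\<lambda>i. if i = 0 then k else 0) * (x - t) ^ k) has_sum F x j) UNIV" by (rule exE)
      then show "\<exists>c :: nat \<Rightarrow> real. \<forall>x\<in>T. \<bar>x - t\<bar> < r \<longrightarrow> ((\<lambda>k. c k * (x - t) ^ k) has_sum F x j) UNIV"
        by (rule exI[of _ "\<lambda>k. c (\<lambda>i. if i = 0 then k else 0)"])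
    qed
    also have "\<dots> \<longleftrightarrow> real_analytic_at (\<lambda>s. F s j) t"
      using real_analytic_at_power_series_iff[OF assms t] by simp
    finally show ?thesis .
  qed
  show ?thesis
    unfolding real_analytic_on_def
  proof (intro iffI ballI allI impI)
    fix t j assume *: "\<forall>p\<in>line ` T. \<forall>j<m. \<exists>r>0. \<exists>c :: (nat \<Rightarrow> nat) \<Rightarrow> real. \<forall>x\<in>line ` T. (\<forall>i<1. \<bar>x i - p i\<bar> < r) \<longrightarrow>
      ((\<lambda>\<alpha>. c \<alpha> * (\<Prod>i<1. (x i - p i) ^ \<alpha> i)) has_sum F (inv_into UNIV line x) j) {\<alpha>. \<forall>i\<ge>1. \<alpha> i = 0}"
      and t: "t \<in> T" "j < m"
    show "real_analytic_at (\<lambda>s. F s j) t"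
      using bspec[OF * imageI[OF t(1)], THEN spec, THEN mp, OF t(2)] by (rule iffD1[OF key[OF t(1)]])
  next
    fix p j assume *: "\<forall>t\<in>T. \<forall>j<m. real_analytic_at (\<lambda>s. F s j) t" and p: "p \<in> line ` T" and j: "j < m"
    obtain t where t: "t \<in> T" "p = line t" using p by (rule imageE)
    show "\<exists>r>0. \<exists>c :: (nat \<Rightarrow> nat) \<Rightarrow> real. \<forall>x\<in>line ` T. (\<forall>i<1. \<bar>x i - p i\<bar> < r) \<longrightarrow>
      ((\<lambda>\<alpha>. c \<alpha> * (\<Prod>i<1. (x i - p i) ^ \<alpha> i)) has_sum F (inv_into UNIV line x) j) {\<alpha>. \<forall>i\<ge>1. \<alpha> i = 0}"
      unfolding t(2) by (rule iffD2[OF key[OF t(1)]]) (use * t(1) j in blast)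
  qed
qed

lemma prod_power_derivative_zero:
  fixes h :: "nat \<Rightarrow> complex \<Rightarrow> complex"
  assumes "\<And>i. i < n \<Longrightarrow> (h i has_field_derivative 0) (at z)"
  shows "((\<lambda>z. \<Prod>i<n. h i z ^ \<alpha> i) has_field_derivative 0) (at z)"
  using assms
proof (induction n)
  case (Suc n)
  have 1: "((\<lambda>z. \<Prod>i<n. h i z ^ \<alpha> i) has_field_derivative 0) (at z)" using Suc by simp
  have 2: "((\<lambda>z. h n z ^ \<alpha> n) has_field_derivative 0) (at z)"
    using DERIV_power[OF Suc.prems[of n], of "\<alpha> n"] by simp
  show ?case using DERIV_mult[OF 1 2] by simp
qed simp

text \<open>Each coordinate of the curve is extended holomorphically and inserted into the
  multivariate series; by the Weierstrass M-test the sum \<open>F\<close> is a uniform limit of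
  holomorphic functions. Differentiating term by term yields the second claim, a substitute for the
  chain rule: zero velocity is mapped to zero velocity.\<close>

lemma real_analytic_on_curve:
  assumes R: "real_analytic_on n m S f" and S: "openin (Euclidean_space n) S"
    and X: "\<forall>\<^sub>F t in nhds t0. X t \<in> S" "\<And>i. i < n \<Longrightarrow> real_analytic_at (\<lambda>t. X t i) t0" and j: "j < m"
  shows "real_analytic_at (\<lambda>t. f (X t) j) t0"
    and "(\<And>i. i < n \<Longrightarrow> deriv (\<lambda>t. X t i) t0 = 0) \<Longrightarrow> deriv (\<lambda>t. f (X t) j) t0 = 0"
proof -
  define p where "p = X t0"
  let ?A = "{\<alpha> :: nat \<Rightarrow> nat. \<forall>i\<ge>n. \<alpha> i = 0}"
  let ?z = "complex_of_real t0"
  have pS: "p \<in> S" using eventually_nhds_x_imp_x[OF X(1)] by (simp add: p_def)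
  obtain r c where r: "r > 0" "\<And>x. x \<in> S \<Longrightarrow> (\<And>i. i < n \<Longrightarrow> \<bar>x i - p i\<bar> < r) \<Longrightarrow>
      ((\<lambda>\<alpha>. c \<alpha> * (\<Prod>i<n. (x i - p i) ^ \<alpha> i)) has_sum f x j) ?A"
    using R pS j unfolding real_analytic_on_def by blast
  have p0: "p i = 0" if "i \<ge> n" for i
    using openin_subset[OF S] pS that by (auto simp: topspace_Euclidean_space)
  \<comment> \<open>At the point \<open>p\<close> with each of its first \<open>n\<close>
    coordinates raised by \<open>s\<close> the series converges, hence absolutely, and this
    dominates all terms while the coordinates stay within \<open>s\<close> of
    \<open>p\<close>.\<close>
  obtain s where s: "0 < s" "s < r" "(\<lambda>i. if i < n then p i + s else 0) \<in> S"
  proof -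
    let ?q = "\<lambda>s i. if i < n then p i + s else 0"
    have "continuous_map euclideanreal (Euclidean_space n) ?q"
      by (subst continuous_map_componentwise_Euclidean_space) (auto intro: continuous_intros)
    then have "open {s. ?q s \<in> S}" using openin_continuous_map_preimage[OF _ S] by fastforce
    moreover have "?q 0 = p" using p0 by (auto simp: fun_eq_iff)
    then have "0 \<in> {s. ?q s \<in> S}" using pS by simp
    ultimately obtain e where e: "e > 0" "ball 0 e \<subseteq> {s. ?q s \<in> S}" using openE by blast
    have "min e r / 2 \<in> {s. ?q s \<in> S}" using e r(1) by (intro subsetD[OF e(2)]) (auto simp: dist_real_def)
    then show thesis using that[of "min e r / 2"] e r(1) by auto
  qed
  have "(\<lambda>\<alpha>. c \<alpha> * (\<Prod>i<n. s ^ \<alpha> i)) summable_on ?A"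
    using r(2)[OF s(3)] s has_sum_imp_summable by fastforce
  then have "(\<lambda>\<alpha>. norm (c \<alpha> * (\<Prod>i<n. s ^ \<alpha> i))) summable_on ?A"
    by (rule iffD1[OF summable_on_iff_abs_summable_on_real])
  moreover have "norm (c \<alpha> * (\<Prod>i<n. s ^ \<alpha> i)) = \<bar>c \<alpha>\<bar> * (\<Prod>i<n. s ^ \<alpha> i)" for \<alpha>
    using s(1) by (simp add: abs_mult abs_of_nonneg prod_nonneg)
  ultimately have M: "(\<lambda>\<alpha>. \<bar>c \<alpha>\<bar> * (\<Prod>i<n. s ^ \<alpha> i)) summable_on ?A" by simp
  have "\<forall>i. \<exists>H. i < n \<longrightarrow> H analytic_on {?z} \<and> (\<forall>\<^sub>F t in nhds t0. H (complex_of_real t) = complex_of_real (X t i))"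
    using X(2) unfolding real_analytic_at_def by blast
  then obtain H where H: "\<And>i. i < n \<Longrightarrow> H i analytic_on {?z}"
      "\<And>i. i < n \<Longrightarrow> \<forall>\<^sub>F t in nhds t0. H i (complex_of_real t) = complex_of_real (X t i)" by metis
  have H0: "H i ?z = complex_of_real (p i)" if "i < n" for i
    using eventually_nhds_x_imp_x[OF H(2)[OF that]] by (simp add: p_def)
  have "\<forall>\<^sub>F z in nhds ?z. \<forall>i\<in>{..<n}. H i field_differentiable at z \<and> norm (H i z - complex_of_real (p i)) < s"
  proof (rule eventually_ball_finite, simp, rule ballI)
    fix i assume "i \<in> {..<n}"
    then have i: "i < n" by simp
    obtain q where q: "q > 0" "H i holomorphic_on ball ?z q" using analytic_on_nhds[OF H(1)[OF i]] .
    have "\<forall>\<^sub>F z in nhds ?z. H i field_differentiable at z"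
      using eventually_nhds_in_open[OF open_ball, of ?z ?z q] q
      by (auto elim!: eventually_mono simp: holomorphic_on_open field_differentiable_def)
    moreover have "isCont (H i) ?z"
      using q by (auto intro: field_differentiable_imp_continuous_at simp: holomorphic_on_open field_differentiable_def)
    then have "\<forall>\<^sub>F z in nhds ?z. dist (H i z) (H i ?z) < s"
      using s(1) by (auto simp: eventually_nhds_metric continuous_at_eps_delta)
    ultimately show "\<forall>\<^sub>F z in nhds ?z. H i field_differentiable at z \<and> norm (H i z - complex_of_real (p i)) < s"
      by eventually_elim (simp add: dist_norm H0[OF i])
  qed
  then obtain e where e: "e > 0" "\<And>z i. dist z ?z < e \<Longrightarrow> i < n \<Longrightarrow> H i field_differentiable at z"
      "\<And>z i. dist z ?z < e \<Longrightarrow> i < n \<Longrightarrow> norm (H i z - complex_of_real (p i)) < s"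
    by (auto simp: eventually_nhds_metric)
  define d where "d = e / 2"
  have d: "d > 0" "d < e" using e(1) by (auto simp: d_def)
  define T where "T \<alpha> z = complex_of_real (c \<alpha>) * (\<Prod>i<n. (H i z - complex_of_real (p i)) ^ \<alpha> i)" for \<alpha> z
  have Tdiff: "T \<alpha> field_differentiable at z" if "dist z ?z < e" for \<alpha> z
  proof -
    have "T \<alpha> holomorphic_on ball ?z e" unfolding T_def
      by (intro holomorphic_intros) (use e(2) in \<open>auto simp: holomorphic_on_def dist_commute intro: field_differentiable_at_within\<close>)
    then show ?thesis using that by (auto simp: holomorphic_on_open field_differentiable_def dist_commute)
  qed
  have bound: "norm (T \<alpha> z) \<le> \<bar>c \<alpha>\<bar> * (\<Prod>i<n. s ^ \<alpha> i)" if "z \<in> cball ?z d" for \<alpha> z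
    unfolding T_def norm_mult prod_norm[symmetric] norm_power norm_of_real
    by (intro mult_left_mono prod_mono conjI power_mono)
      (use e(3)[of z] that d in \<open>auto simp: dist_commute less_imp_le\<close>)
  define F where "F z = (\<Sum>\<^sub>\<infinity>\<alpha>\<in>?A. T \<alpha> z)" for z
  have ul: "uniform_limit (cball ?z d) (\<lambda>Y z. \<Sum>\<alpha>\<in>Y. T \<alpha> z) F (finite_subsets_at_top ?A)"
    unfolding F_def by (rule Weierstrass_m_test_general[OF bound M])
  have diff: "\<forall>\<^sub>F Y in finite_subsets_at_top ?A. continuous_on (cball ?z d) (\<lambda>z. \<Sum>\<alpha>\<in>Y. T \<alpha> z) \<and>
      (\<forall>w\<in>ball ?z d. ((\<lambda>z. \<Sum>\<alpha>\<in>Y. T \<alpha> z) has_field_derivative (\<Sum>\<alpha>\<in>Y. deriv (T \<alpha>) w)) (at w))"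
  proof (intro always_eventually allI conjI ballI)
    fix Y
    show "continuous_on (cball ?z d) (\<lambda>z. \<Sum>\<alpha>\<in>Y. T \<alpha> z)"
      by (intro continuous_intros continuous_at_imp_continuous_on ballI field_differentiable_imp_continuous_at Tdiff)
        (use d in \<open>auto simp: dist_commute\<close>)
    show "((\<lambda>z. \<Sum>\<alpha>\<in>Y. T \<alpha> z) has_field_derivative (\<Sum>\<alpha>\<in>Y. deriv (T \<alpha>) w)) (at w)" if "w \<in> ball ?z d" for w
      by (intro DERIV_sum field_differentiable_derivI Tdiff) (use that d in \<open>auto simp: dist_commute\<close>)
  qed
  obtain F' where F': "\<And>w. w \<in> ball ?z d \<Longrightarrow> (F has_field_derivative F' w) (at w) \<and>
      ((\<lambda>Y. \<Sum>\<alpha>\<in>Y. deriv (T \<alpha>) w) \<longlongrightarrow> F' w) (finite_subsets_at_top ?A)"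
    by (rule has_complex_derivative_uniform_limit[OF diff ul finite_subsets_at_top_neq_bot d(1)]) blast
  have "F holomorphic_on ball ?z d" unfolding holomorphic_on_open[OF open_ball] using F' by blast
  then have Fan: "F analytic_on {?z}" using d(1) by (auto simp: analytic_on_def)
  have Feq: "\<forall>\<^sub>F t in nhds t0. F (complex_of_real t) = complex_of_real (f (X t) j)"
  proof -
    have "\<forall>\<^sub>F t in nhds t0. \<forall>i\<in>{..<n}. H i (complex_of_real t) = complex_of_real (X t i)"
      by (rule eventually_ball_finite) (use H(2) in auto)
    moreover have "\<forall>\<^sub>F t in nhds t0. \<bar>t - t0\<bar> < e"
      using e(1) by (auto simp: eventually_nhds_metric dist_real_def)
    ultimately show ?thesis using X(1)
    proof eventually_elim
      case (elim t)
      have "\<bar>X t i - p i\<bar> < r" if i: "i < n" for i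
      proof -
        have "norm (complex_of_real (X t i - p i)) < s"
          using e(3)[of "complex_of_real t" i] elim i by (simp add: dist_real_def)
        then show ?thesis using s(2) by (simp only: norm_of_real)
      qed
      then have "((\<lambda>\<alpha>. c \<alpha> * (\<Prod>i<n. (X t i - p i) ^ \<alpha> i)) has_sum f (X t) j) ?A" using r(2) elim by blast
      then have "((\<lambda>\<alpha>. complex_of_real (c \<alpha> * (\<Prod>i<n. (X t i - p i) ^ \<alpha> i))) has_sum complex_of_real (f (X t) j)) ?A"
        by (rule has_sum_of_real)
      moreover have "complex_of_real (c \<alpha> * (\<Prod>i<n. (X t i - p i) ^ \<alpha> i)) = T \<alpha> (complex_of_real t)" for \<alpha>
        using elim by (simp add: T_def)
      ultimately have "((\<lambda>\<alpha>. T \<alpha> (complex_of_real t)) has_sum complex_of_real (f (X t) j)) ?A" by simp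
      then show ?case unfolding F_def by (rule infsumI)
    qed
  qed
  show ra: "real_analytic_at (\<lambda>t. f (X t) j) t0" unfolding real_analytic_at_def using Fan Feq by blast
  show "deriv (\<lambda>t. f (X t) j) t0 = 0" if z: "\<And>i. i < n \<Longrightarrow> deriv (\<lambda>t. X t i) t0 = 0"
  proof -
    have "deriv (T \<alpha>) ?z = 0" for \<alpha>
    proof -
      have "((\<lambda>w. H i w - complex_of_real (p i)) has_field_derivative 0) (at ?z)" if i: "i < n" for i
      proof -
        have "deriv (H i) ?z = 0" using real_analytic_at_deriv(2)[OF X(2)[OF i] H(1,2)[OF i]] z[OF i] by simp
        moreover have "(H i has_field_derivative deriv (H i) ?z) (at ?z)"
          using e(2)[of ?z i] i e(1) by (intro field_differentiable_derivI) auto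
        ultimately have "(H i has_field_derivative 0) (at ?z)" by simp
        from DERIV_diff[OF this DERIV_const[of "complex_of_real (p i)"]] show ?thesis by simp
      qed
      then have "((\<lambda>w. \<Prod>i<n. (H i w - complex_of_real (p i)) ^ \<alpha> i) has_field_derivative 0) (at ?z)"
        by (rule prod_power_derivative_zero)
      from DERIV_cmult[OF this, where c = "complex_of_real (c \<alpha>)"]
      have "(T \<alpha> has_field_derivative 0) (at ?z)" by (simp add: T_def[abs_def])
      then show ?thesis by (rule DERIV_imp_deriv)
    qed
    then have "((\<lambda>Y :: (nat \<Rightarrow> nat) set. 0) \<longlongrightarrow> F' ?z) (finite_subsets_at_top ?A)"
      using conjunct2[OF F'[of ?z]] d(1) by simp
    then have "F' ?z = 0" by (rule tendsto_unique[OF finite_subsets_at_top_neq_bot _ tendsto_const])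
    moreover have "(F has_field_derivative F' ?z) (at ?z)" using F'[of ?z] d(1) by simp
    ultimately have "deriv F ?z = 0" using DERIV_imp_deriv by metis
    then show ?thesis using real_analytic_at_deriv(2)[OF ra Fan Feq] by simp
  qed
qed

section \<open>Charts and analytic curves in a manifold\<close>

lemma chartD:
  assumes "analytic_atlas n A" "(U, u) \<in> A"
  shows "open U" "openin (Euclidean_space n) (u ` U)" "inj_on u U" "\<And>x i. x \<in> U \<Longrightarrow> n \<le> i \<Longrightarrow> u x i = 0"
    "\<And>W. open W \<Longrightarrow> W \<subseteq> U \<Longrightarrow> openin (Euclidean_space n) (u ` W)"
proof -
  show U: "open U" "openin (Euclidean_space n) (u ` U)" using assms by (auto simp: analytic_atlas_def)
  have hom: "homeomorphic_map (top_of_set U) (subtopology (Euclidean_space n) (u ` U)) u"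
    using assms by (auto simp: analytic_atlas_def)
  then show "inj_on u U" using homeomorphic_imp_injective_map by fastforce
  show "u x i = 0" if "x \<in> U" "n \<le> i" for x i
    using openin_subset[OF U(2)] that by (auto simp: topspace_Euclidean_space image_subset_iff)
  show "openin (Euclidean_space n) (u ` W)" if W: "open W" "W \<subseteq> U" for W
  proof -
    have "openin (top_of_set U) W" using W by (simp add: open_subset)
    then have "openin (subtopology (Euclidean_space n) (u ` U)) (u ` W)"
      using homeomorphic_imp_open_map[OF hom] by (simp add: open_map_def)
    then show ?thesis using U(2) openin_trans_full by blast
  qed
qed

lemma chart_exists:
  assumes "analytic_atlas n A" obtains U u where "(U, u) \<in> A" "x \<in> U"
proof -
  have "x \<in> (\<Union>(U, u)\<in>A. U)" using assms by (simp add: analytic_atlas_def)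
  then show thesis using that by auto
qed

definition analytic_curve_at ::
    "nat \<Rightarrow> 'm::topological_space chart set \<Rightarrow> (real \<Rightarrow> 'm) \<Rightarrow> real \<Rightarrow> bool" where
  "analytic_curve_at n A \<gamma> t \<longleftrightarrow> isCont \<gamma> t \<and>
    (\<forall>(V, v)\<in>A. \<gamma> t \<in> V \<longrightarrow> (\<forall>j<n. real_analytic_at (\<lambda>s. v (\<gamma> s) j) t))"

definition regular_at ::
    "nat \<Rightarrow> 'm::topological_space chart set \<Rightarrow> (real \<Rightarrow> 'm) \<Rightarrow> real \<Rightarrow> bool" where
  "regular_at n A \<gamma> t \<longleftrightarrow> (\<forall>(V, v)\<in>A. \<gamma> t \<in> V \<longrightarrow> (\<exists>j<n. deriv (\<lambda>s. v (\<gamma> s) j) t \<noteq> 0))"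

lemma analytic_curve_atD:
  assumes "analytic_curve_at n A \<gamma> t"
  shows "isCont \<gamma> t" "(V, v) \<in> A \<Longrightarrow> \<gamma> t \<in> V \<Longrightarrow> j < n \<Longrightarrow> real_analytic_at (\<lambda>s. v (\<gamma> s) j) t"
    "(\<gamma> \<longlongrightarrow> \<gamma> t) (nhds t)"
  using assms by (auto simp: analytic_curve_at_def isCont_def tendsto_at_iff_tendsto_nhds)

lemma analytic_curve_at_cong:
  assumes ev: "\<forall>\<^sub>F s in nhds t. \<gamma> s = \<delta> s" and \<gamma>: "analytic_curve_at n A \<gamma> t"
  shows "analytic_curve_at n A \<delta> t"
  unfolding analytic_curve_at_def
proof (intro conjI ballI impI allI, safe)
  show "isCont \<delta> t" using analytic_curve_atD(1)[OF \<gamma>] isCont_cong[OF ev] by simp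
  fix V v j assume "(V, v) \<in> A" "\<delta> t \<in> V" "j < n"
  then have "real_analytic_at (\<lambda>s. v (\<gamma> s) j) t"
    using analytic_curve_atD(2)[OF \<gamma>] eventually_nhds_x_imp_x[OF ev] by simp
  then show "real_analytic_at (\<lambda>s. v (\<delta> s) j) t"
    by (rule real_analytic_at_cong) (use ev in eventually_elim, simp)
qed

lemma regular_at_cong:
  fixes \<gamma> \<delta> :: "real \<Rightarrow> 'm::topological_space"
  assumes ev: "\<forall>\<^sub>F s in nhds t. \<gamma> s = \<delta> s" and \<gamma>: "regular_at n A \<gamma> t"
  shows "regular_at n A \<delta> t"
proof -
  have eq: "deriv (\<lambda>s. v (\<gamma> s) j) t = deriv (\<lambda>s. v (\<delta> s) j) t" for v :: "'m \<Rightarrow> nat \<Rightarrow> real" and j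
    by (rule deriv_cong_ev) (use ev in \<open>auto elim: eventually_mono\<close>)
  show ?thesis
    unfolding regular_at_def
  proof safe
    fix V and v :: "'m \<Rightarrow> nat \<Rightarrow> real" assume V: "(V, v) \<in> A" "\<delta> t \<in> V"
    then have "\<gamma> t \<in> V" using eventually_nhds_x_imp_x[OF ev] by simp
    then obtain j where "j < n" "deriv (\<lambda>s. v (\<gamma> s) j) t \<noteq> 0" using \<gamma> V(1) unfolding regular_at_def by blast
    then show "\<exists>j<n. deriv (\<lambda>s. v (\<delta> s) j) t \<noteq> 0" using eq[of v j] by auto
  qed
qed

lemma analytic_map_line_iff:
  assumes A: "\<And>V v. (V, v) \<in> A \<Longrightarrow> open V" and J: "open J"
  shows "analytic_map 1 real_atlas n A J \<gamma> \<longleftrightarrow> (\<forall>t\<in>J. analytic_curve_at n A \<gamma> t)"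
proof -
  have key: "real_analytic_on 1 n (line ` (J \<inter> \<gamma> -` V)) (\<lambda>p. v (\<gamma> (inv_into UNIV line p))) \<longleftrightarrow>
      (\<forall>t\<in>J. \<gamma> t \<in> V \<longrightarrow> (\<forall>j<n. real_analytic_at (\<lambda>s. v (\<gamma> s) j) t))"
    if "continuous_on J \<gamma>" "(V, v) \<in> A" for V v
  proof -
    have "open (J \<inter> \<gamma> -` V)" using continuous_open_preimage[OF that(1) J A[OF that(2)]] .
    from real_analytic_on_line_iff[OF this, of n "\<lambda>s. v (\<gamma> s)"] show ?thesis by blast
  qed
  show ?thesis
  proof
    assume *: "analytic_map 1 real_atlas n A J \<gamma>"
    then have c: "continuous_on J \<gamma>" by (simp add: analytic_map_def)
    show "\<forall>t\<in>J. analytic_curve_at n A \<gamma> t"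
      unfolding analytic_curve_at_def
    proof (intro ballI conjI, safe)
      fix t assume t: "t \<in> J"
      show "isCont \<gamma> t" using c J t continuous_on_eq_continuous_at by blast
      fix V v j assume v: "(V, v) \<in> A" "\<gamma> t \<in> V" "j < n"
      have "real_analytic_on 1 n (line ` (J \<inter> \<gamma> -` V)) (\<lambda>p. v (\<gamma> (inv_into UNIV line p)))"
        using * v(1) by (auto simp: analytic_map_def real_atlas_def)
      then show "real_analytic_at (\<lambda>s. v (\<gamma> s) j) t" using key[OF c v(1)] t v by blast
    qed
  next
    assume *: "\<forall>t\<in>J. analytic_curve_at n A \<gamma> t"
    then have c: "continuous_on J \<gamma>"
      using analytic_curve_atD(1) by (intro continuous_at_imp_continuous_on) blast
    have "real_analytic_on 1 n (line ` (J \<inter> \<gamma> -` V)) (\<lambda>p. v (\<gamma> (inv_into UNIV line p)))" if "(V, v) \<in> A" for V v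
      using key[OF c that] * analytic_curve_atD(2) that by blast
    then show "analytic_map 1 real_atlas n A J \<gamma>" using c by (auto simp: analytic_map_def real_atlas_def)
  qed
qed

lemma open_immersion_iff:
  assumes "\<And>V v. (V, v) \<in> A \<Longrightarrow> open V"
  shows "open_immersion n A J \<gamma> \<longleftrightarrow> open_interval J \<and> (\<forall>t\<in>J. analytic_curve_at n A \<gamma> t \<and> regular_at n A \<gamma> t)"
proof (cases "open_interval J")
  case True
  then have "open J" by (simp add: open_interval_def)
  have "analytic_map 1 real_atlas n A J \<gamma> \<longleftrightarrow> (\<forall>t\<in>J. analytic_curve_at n A \<gamma> t)"
    by (rule analytic_map_line_iff[OF _ \<open>open J\<close>]) (rule assms)
  then show ?thesis
    unfolding open_immersion_def regular_at_def by (simp only: ball_conj_distrib)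
qed (simp add: open_immersion_def)

lemma real_atlas_open: "(V, v) \<in> real_atlas \<Longrightarrow> open V" by (simp add: real_atlas_def)

lemma analytic_curve_at_real: "analytic_curve_at 1 real_atlas \<sigma> t \<longleftrightarrow> real_analytic_at \<sigma> t"
proof -
  have "(\<forall>j<(1::nat). real_analytic_at (\<lambda>s. line (\<sigma> s) j) t) \<longleftrightarrow> real_analytic_at \<sigma> t" by simp
  then show ?thesis
    unfolding analytic_curve_at_def real_atlas_def using real_analytic_at_isCont by auto
qed

lemma regular_at_real: "regular_at 1 real_atlas \<sigma> t \<longleftrightarrow> deriv \<sigma> t \<noteq> 0"
  by (auto simp: regular_at_def real_atlas_def)

lemma open_immersion_real_iff:
  "open_immersion 1 real_atlas J \<sigma> \<longleftrightarrow> open_interval J \<and> (\<forall>t\<in>J. real_analytic_at \<sigma> t \<and> deriv \<sigma> t \<noteq> 0)"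
proof -
  have "open_immersion 1 real_atlas J \<sigma> \<longleftrightarrow>
      open_interval J \<and> (\<forall>t\<in>J. analytic_curve_at 1 real_atlas \<sigma> t \<and> regular_at 1 real_atlas \<sigma> t)"
    by (rule open_immersion_iff) (rule real_atlas_open)
  then show ?thesis by (simp only: analytic_curve_at_real regular_at_real)
qed

lemma analytic_map_real_iff:
  assumes "open J"
  shows "analytic_map 1 real_atlas 1 real_atlas J \<sigma> \<longleftrightarrow> (\<forall>t\<in>J. real_analytic_at \<sigma> t)"
proof -
  have "analytic_map 1 real_atlas 1 real_atlas J \<sigma> \<longleftrightarrow> (\<forall>t\<in>J. analytic_curve_at 1 real_atlas \<sigma> t)"
    by (rule analytic_map_line_iff[OF _ assms]) (rule real_atlas_open)
  then show ?thesis by (simp only: analytic_curve_at_real)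
qed

context
  fixes n :: nat and A :: "'m::t2_space chart set"
  assumes atlas: "analytic_atlas n A"
begin

text \<open>In charts, the composition is an instance of \<open>real_analytic_on_curve\<close>. The
  second part serves to prove regularity of the image curve by going back with an inverse
  map.\<close>

lemma analytic_curve_at_map:
  assumes h: "analytic_map n A n A UNIV h" and \<gamma>: "analytic_curve_at n A \<gamma> t"
  shows "analytic_curve_at n A (\<lambda>s. h (\<gamma> s)) t"
    and "(V, v) \<in> A \<Longrightarrow> h (\<gamma> t) \<in> V \<Longrightarrow> (U, u) \<in> A \<Longrightarrow> \<gamma> t \<in> U \<Longrightarrow>
      (\<And>i. i < n \<Longrightarrow> deriv (\<lambda>s. u (\<gamma> s) i) t = 0) \<Longrightarrow> j < n \<Longrightarrow> deriv (\<lambda>s. v (h (\<gamma> s)) j) t = 0"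
proof -
  have hc: "continuous_on UNIV h" using h by (simp add: analytic_map_def)
  have main: "real_analytic_at (\<lambda>s. v (h (\<gamma> s)) j) t \<and>
      ((\<forall>i<n. deriv (\<lambda>s. u (\<gamma> s) i) t = 0) \<longrightarrow> deriv (\<lambda>s. v (h (\<gamma> s)) j) t = 0)"
    if V: "(V, v) \<in> A" "h (\<gamma> t) \<in> V" and U: "(U, u) \<in> A" "\<gamma> t \<in> U" and j: "j < n" for V v U u j
  proof -
    let ?W = "U \<inter> UNIV \<inter> h -` V" and ?f = "\<lambda>p. v (h (inv_into U u p))"
    have R: "real_analytic_on n n (u ` ?W) ?f" using h V U unfolding analytic_map_def by blast
    have opW: "open ?W"
      using continuous_open_preimage[OF hc open_UNIV chartD(1)[OF atlas V(1)]] chartD(1)[OF atlas U(1)]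
      by (simp add: open_Int)
    have op: "openin (Euclidean_space n) (u ` ?W)" using chartD(5)[OF atlas U(1) opW] by blast
    have ev: "\<forall>\<^sub>F s in nhds t. \<gamma> s \<in> ?W"
      using topological_tendstoD[OF analytic_curve_atD(3)[OF \<gamma>] opW] U V by simp
    have X: "\<forall>\<^sub>F s in nhds t. u (\<gamma> s) \<in> u ` ?W" using ev by eventually_elim (rule imageI)
    have ra: "\<And>i. i < n \<Longrightarrow> real_analytic_at (\<lambda>s. u (\<gamma> s) i) t" using analytic_curve_atD(2)[OF \<gamma> U] .
    have eq: "\<forall>\<^sub>F s in nhds t. ?f (u (\<gamma> s)) j = v (h (\<gamma> s)) j"
      using ev by eventually_elim (simp add: inv_into_f_f[OF chartD(3)[OF atlas U(1)]])
    note C = real_analytic_on_curve[OF R op X ra j]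
    have "deriv (\<lambda>s. ?f (u (\<gamma> s)) j) t = deriv (\<lambda>s. v (h (\<gamma> s)) j) t"
      by (rule deriv_cong_ev[OF eq refl])
    then show ?thesis using real_analytic_at_cong[OF C(1) eq] C(2) by simp
  qed
  obtain U0 u0 where U: "(U0, u0) \<in> A" "\<gamma> t \<in> U0" using chart_exists[OF atlas] .
  have "isCont h (\<gamma> t)" using hc by (simp add: continuous_on_eq_continuous_at)
  then have "isCont (\<lambda>s. h (\<gamma> s)) t" using analytic_curve_atD(1)[OF \<gamma>] by (rule isCont_o2[rotated])
  then show "analytic_curve_at n A (\<lambda>s. h (\<gamma> s)) t"
    unfolding analytic_curve_at_def using main[OF _ _ U] by blast
  show "deriv (\<lambda>s. v (h (\<gamma> s)) j) t = 0" if "(V, v) \<in> A" "h (\<gamma> t) \<in> V" "(U, u) \<in> A" "\<gamma> t \<in> U"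
    "\<And>i. i < n \<Longrightarrow> deriv (\<lambda>s. u (\<gamma> s) i) t = 0" "j < n"
    using main[OF that(1-4) that(6)] that(5) by blast
qed

text \<open>If the image curve had zero velocity, so would its image under \<open>h'\<close>, which
  is \<open>\<gamma>\<close> again. This avoids derivatives of maps between manifolds.\<close>

lemma regular_at_map:
  assumes h: "analytic_map n A n A UNIV h" "analytic_map n A n A UNIV h'" "\<And>x. h' (h x) = x"
    and \<gamma>: "analytic_curve_at n A \<gamma> t" "regular_at n A \<gamma> t"
  shows "regular_at n A (\<lambda>s. h (\<gamma> s)) t"
  unfolding regular_at_def
proof (safe, rule ccontr)
  fix V v assume V: "(V, v) \<in> A" "h (\<gamma> t) \<in> V" and "\<not> (\<exists>j<n. deriv (\<lambda>s. v (h (\<gamma> s)) j) t \<noteq> 0)"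
  then have z: "\<And>i. i < n \<Longrightarrow> deriv (\<lambda>s. v (h (\<gamma> s)) i) t = 0" by blast
  obtain U u where U: "(U, u) \<in> A" "\<gamma> t \<in> U" using chart_exists[OF atlas] .
  have "deriv (\<lambda>s. u (h' (h (\<gamma> s))) j) t = 0" if "j < n" for j
    by (rule analytic_curve_at_map(2)[OF h(2) analytic_curve_at_map(1)[OF h(1) \<gamma>(1)] U(1) _ V z that])
      (use U h(3) in simp)
  then show False using \<gamma>(2) U h(3) unfolding regular_at_def by fastforce
qed

text \<open>The limits along \<open>W\<close> agree as the manifold is Hausdorff, so both curves lie
  in one chart near \<open>t\<close> and the identity theorem applies to every coordinate.\<close>

lemma curve_local_identity:
  assumes \<alpha>: "analytic_curve_at n A \<alpha> t" and \<beta>: "analytic_curve_at n A \<beta> t"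
    and ev: "\<forall>\<^sub>F s in at t within W. \<alpha> s = \<beta> s" and W: "t islimpt W"
  shows "\<forall>\<^sub>F s in nhds t. \<alpha> s = \<beta> s"
proof -
  have nt: "at t within W \<noteq> bot" using W by (simp add: trivial_limit_within)
  have la: "(\<alpha> \<longlongrightarrow> \<alpha> t) (at t within W)" "(\<beta> \<longlongrightarrow> \<beta> t) (at t within W)"
    using analytic_curve_atD(1)[OF \<alpha>] analytic_curve_atD(1)[OF \<beta>] continuous_at_imp_continuous_at_within
    unfolding continuous_within by blast+
  have "(\<beta> \<longlongrightarrow> \<alpha> t) (at t within W)" using la(1) tendsto_cong[OF ev] by simp
  then have eqt: "\<alpha> t = \<beta> t" using tendsto_unique[OF nt _ la(2)] by blast
  obtain V v where V: "(V, v) \<in> A" "\<alpha> t \<in> V" using chart_exists[OF atlas] .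
  have "\<forall>\<^sub>F s in nhds t. v (\<alpha> s) i = v (\<beta> s) i" if i: "i < n" for i
    by (rule real_analytic_at_local_identity[OF analytic_curve_atD(2)[OF \<alpha> V i] analytic_curve_atD(2)[OF \<beta> V(1) _ i] _ W])
      (use ev V(2) eqt in \<open>auto elim: eventually_mono\<close>)
  then have "\<forall>\<^sub>F s in nhds t. \<forall>i\<in>{..<n}. v (\<alpha> s) i = v (\<beta> s) i" by (intro eventually_ball_finite) auto
  moreover have "\<forall>\<^sub>F s in nhds t. \<alpha> s \<in> V" "\<forall>\<^sub>F s in nhds t. \<beta> s \<in> V"
    using topological_tendstoD[OF analytic_curve_atD(3)[OF \<alpha>] chartD(1)[OF atlas V(1)] V(2)]
      topological_tendstoD[OF analytic_curve_atD(3)[OF \<beta>] chartD(1)[OF atlas V(1)]] V(2) eqt by simp_all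
  ultimately show ?thesis
  proof eventually_elim
    case (elim s)
    have "v (\<alpha> s) i = v (\<beta> s) i" for i
      using elim chartD(4)[OF atlas V(1)] by (cases "i < n") auto
    then have "v (\<alpha> s) = v (\<beta> s)" by blast
    then show ?case using inj_onD[OF chartD(3)[OF atlas V(1)]] elim by blast
  qed
qed

lemma curve_identity:
  assumes J: "open J" "connected J" and \<alpha>: "\<And>t. t \<in> J \<Longrightarrow> analytic_curve_at n A \<alpha> t"
    and \<beta>: "\<And>t. t \<in> J \<Longrightarrow> analytic_curve_at n A \<beta> t"
    and W: "open W" "W \<noteq> {}" "W \<subseteq> J" "\<And>t. t \<in> W \<Longrightarrow> \<alpha> t = \<beta> t" and t: "t \<in> J"
  shows "\<alpha> t = \<beta> t"
proof -
  define Z where "Z = {t \<in> J. \<forall>\<^sub>F x in nhds t. \<alpha> x = \<beta> x}"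
  have "open Z"
  proof (rule Topological_Spaces.openI)
    fix z assume z: "z \<in> Z"
    then obtain U where "open U" "z \<in> U" "\<forall>x\<in>U. \<alpha> x = \<beta> x" by (auto simp: Z_def eventually_nhds)
    then show "\<exists>T. open T \<and> z \<in> T \<and> T \<subseteq> Z"
      using J(1) z by (intro exI[of _ "J \<inter> U"]) (auto simp: Z_def eventually_nhds)
  qed
  then have op: "openin (top_of_set J) Z" by (intro open_subset) (auto simp: Z_def)
  have "closedin (top_of_set J) Z"
    unfolding closedin_limpt
  proof (intro conjI allI impI)
    fix x assume x: "x islimpt Z \<and> x \<in> J"
    have "\<forall>\<^sub>F s in at x within Z. \<alpha> s = \<beta> s"
      by (auto simp: eventually_at_filter Z_def intro!: always_eventually dest: eventually_nhds_x_imp_x)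
    then have "\<forall>\<^sub>F s in nhds x. \<alpha> s = \<beta> s"
      using curve_local_identity[OF \<alpha> \<beta>] x by blast
    then show "x \<in> Z" using x by (simp add: Z_def)
  qed (auto simp: Z_def)
  then have "Z = {} \<or> Z = J" using op J(2) connected_clopen by blast
  moreover have "W \<subseteq> Z"
  proof
    fix w assume w: "w \<in> W"
    then have "\<forall>\<^sub>F x in nhds w. \<alpha> x = \<beta> x" using W(1,4) by (auto simp: eventually_nhds)
    then show "w \<in> Z" using w W(3) by (auto simp: Z_def)
  qed
  ultimately have "t \<in> Z" using W(2) t by blast
  then show ?thesis by (auto simp: Z_def dest: eventually_nhds_x_imp_x)
qed

text \<open>Some chart coordinate has nonzero derivative along the curve; its analytic local inverse
  \<open>k\<close> reads the parameter off the point. Local injectivity and the analyticity of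
  reparametrizations both rest on it.\<close>

lemma local_coordinate:
  assumes \<gamma>: "analytic_curve_at n A \<gamma> d" "regular_at n A \<gamma> d"
  obtains V v j k where "(V, v) \<in> A" "\<gamma> d \<in> V" "j < n" "real_analytic_at k (v (\<gamma> d) j)" "k (v (\<gamma> d) j) = d"
    "\<forall>\<^sub>F s in nhds d. k (v (\<gamma> s) j) = s"
proof -
  obtain V v where V: "(V, v) \<in> A" "\<gamma> d \<in> V" using chart_exists[OF atlas] .
  have "\<exists>j<n. deriv (\<lambda>s. v (\<gamma> s) j) d \<noteq> 0" using \<gamma>(2) V unfolding regular_at_def by blast
  then obtain j where j: "j < n" "deriv (\<lambda>s. v (\<gamma> s) j) d \<noteq> 0" by blast
  obtain k where k: "real_analytic_at k (v (\<gamma> d) j)" "\<forall>\<^sub>F x in nhds d. k (v (\<gamma> x) j) = x"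
    by (rule real_analytic_at_inverse[OF analytic_curve_atD(2)[OF \<gamma>(1) V j(1)] j(2)]) (rule that)
  show thesis by (rule that[OF V j(1) k(1) eventually_nhds_x_imp_x[OF k(2)] k(2)])
qed

lemma regular_locally_injective:
  assumes \<gamma>: "analytic_curve_at n A \<gamma> d" "regular_at n A \<gamma> d"
  obtains r where "r > 0" "inj_on \<gamma> (ball d r)"
proof -
  obtain V v j k where "(V, v) \<in> A" "\<gamma> d \<in> V" "j < n" "real_analytic_at k (v (\<gamma> d) j)"
      "k (v (\<gamma> d) j) = d" and k: "\<forall>\<^sub>F s in nhds d. k (v (\<gamma> s) j) = s" by (rule local_coordinate[OF \<gamma>])
  obtain r where r: "r > 0" "\<forall>s. dist s d < r \<longrightarrow> k (v (\<gamma> s) j) = s"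
    using k unfolding eventually_nhds_metric by blast
  have "inj_on \<gamma> (ball d r)"
  proof (rule inj_onI)
    fix a b assume "a \<in> ball d r" "b \<in> ball d r" "\<gamma> a = \<gamma> b"
    then show "a = b" using r(2)[rule_format, of a] r(2)[rule_format, of b] by (metis dist_commute mem_ball)
  qed
  then show thesis using that r(1) by blast
qed

lemma analytic_curve_at_reparam:
  assumes \<gamma>: "analytic_curve_at n A \<gamma> (\<rho> t)" and \<rho>: "real_analytic_at \<rho> t"
  shows "analytic_curve_at n A (\<lambda>s. \<gamma> (\<rho> s)) t"
  unfolding analytic_curve_at_def
proof (intro conjI, safe)
  show "isCont (\<lambda>s. \<gamma> (\<rho> s)) t"
    using real_analytic_at_isCont[OF \<rho>] analytic_curve_atD(1)[OF \<gamma>] by (rule isCont_o2)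
  show "real_analytic_at (\<lambda>s. v (\<gamma> (\<rho> s)) j) t" if "(V, v) \<in> A" "\<gamma> (\<rho> t) \<in> V" "j < n" for V v j
    using real_analytic_at_compose[OF \<rho> analytic_curve_atD(2)[OF \<gamma> that]] .
qed

text \<open>A reparametrization between two immersed curves continues analytically across a limit point of its domain:
  a regular coordinate of \<open>\<gamma>\<close> at \<open>d\<close> expresses it by coordinates of \<open>\<alpha>\<close>.\<close>

lemma reparam_extend:
  assumes \<alpha>: "analytic_curve_at n A \<alpha> c" "regular_at n A \<alpha> c"
    and \<gamma>: "analytic_curve_at n A \<gamma> d" "regular_at n A \<gamma> d"
    and W: "c islimpt W" and ev: "\<forall>\<^sub>F s in at c within W. \<alpha> s = \<gamma> (\<rho> s)" and lim: "(\<rho> \<longlongrightarrow> d) (at c within W)"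
  obtains \<rho>1 where "real_analytic_at \<rho>1 c" "\<rho>1 c = d" "deriv \<rho>1 c \<noteq> 0"
    "\<forall>\<^sub>F s in at c within W. \<rho>1 s = \<rho> s" "\<forall>\<^sub>F s in nhds c. \<alpha> s = \<gamma> (\<rho>1 s)"
proof -
  have nt: "at c within W \<noteq> bot" using W by (simp add: trivial_limit_within)
  have "(\<alpha> \<longlongrightarrow> \<alpha> c) (at c within W)"
    using analytic_curve_atD(1)[OF \<alpha>(1)] continuous_at_imp_continuous_at_within unfolding continuous_within by blast
  then have "((\<lambda>s. \<gamma> (\<rho> s)) \<longlongrightarrow> \<alpha> c) (at c within W)" using tendsto_cong[OF ev] by simp
  moreover have "((\<lambda>s. \<gamma> (\<rho> s)) \<longlongrightarrow> \<gamma> d) (at c within W)"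
    using analytic_curve_atD(3)[OF \<gamma>(1)] lim by (rule filterlim_compose)
  ultimately have eq: "\<alpha> c = \<gamma> d" using tendsto_unique[OF nt] by blast
  obtain V v j k where V: "(V, v) \<in> A" "\<gamma> d \<in> V" "j < n" and k: "real_analytic_at k (v (\<gamma> d) j)"
      "k (v (\<gamma> d) j) = d" "\<forall>\<^sub>F s in nhds d. k (v (\<gamma> s) j) = s" by (rule local_coordinate[OF \<gamma>])
  define \<rho>1 where "\<rho>1 s = k (v (\<alpha> s) j)" for s
  have ra: "real_analytic_at \<rho>1 c" unfolding \<rho>1_def
    by (rule real_analytic_at_compose[OF analytic_curve_atD(2)[OF \<alpha>(1) V(1) _ V(3)]]) (use eq V k in simp_all)
  have \<rho>1c: "\<rho>1 c = d" using k(2) eq by (simp add: \<rho>1_def)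
  have "\<forall>\<^sub>F s in at c within W. k (v (\<gamma> (\<rho> s)) j) = \<rho> s"
    using eventually_compose_filterlim[OF k(3) lim] .
  then have ev1: "\<forall>\<^sub>F s in at c within W. \<rho>1 s = \<rho> s" using ev by eventually_elim (simp add: \<rho>1_def)
  have \<gamma>': "analytic_curve_at n A \<gamma> (\<rho>1 c)" using \<gamma>(1) \<rho>1c by simp
  have ev2: "\<forall>\<^sub>F s in nhds c. \<alpha> s = \<gamma> (\<rho>1 s)"
    by (rule curve_local_identity[OF \<alpha>(1) analytic_curve_at_reparam[OF \<gamma>' ra] _ W])
      (use ev ev1 in eventually_elim, simp)
  \<comment> \<open>Otherwise \<open>\<alpha>\<close>, which near \<open>c\<close> is
    \<open>\<gamma>\<close> after \<open>\<rho>1\<close>, would have zero velocity at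
    \<open>c\<close>.\<close>
  have "deriv \<rho>1 c \<noteq> 0"
  proof
    assume z: "deriv \<rho>1 c = 0"
    have V\<alpha>: "\<alpha> c \<in> V" using eq V(2) by simp
    have "deriv (\<lambda>s. v (\<alpha> s) i) c = 0" if i: "i < n" for i
    proof -
      have "deriv (\<lambda>s. v (\<alpha> s) i) c = deriv (\<lambda>s. v (\<gamma> (\<rho>1 s)) i) c"
        by (rule deriv_cong_ev) (use ev2 in \<open>auto elim: eventually_mono\<close>)
      also have "\<dots> = 0"
        using deriv_compose_real[OF ra, of "\<lambda>s. v (\<gamma> s) i"] analytic_curve_atD(2)[OF \<gamma>' V(1) _ i] V(2) \<rho>1c z by simp
      finally show ?thesis .
    qed
    then show False using \<alpha>(2) V(1) V\<alpha> unfolding regular_at_def by blast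
  qed
  then show thesis using that[OF ra \<rho>1c _ ev1 ev2] by blast
qed

text \<open>The case \<open>W = UNIV\<close> of \<open>reparam_extend\<close>, with continuity
  providing the limit: continuity alone already makes a reparametrization between immersed curves
  analytic.\<close>

lemma reparam_analytic:
  assumes \<alpha>: "analytic_curve_at n A \<alpha> c" "regular_at n A \<alpha> c"
    and \<gamma>: "analytic_curve_at n A \<gamma> (\<rho> c)" "regular_at n A \<gamma> (\<rho> c)"
    and ev: "\<forall>\<^sub>F s in nhds c. \<alpha> s = \<gamma> (\<rho> s)" and cont: "isCont \<rho> c"
  shows "real_analytic_at \<rho> c" "deriv \<rho> c \<noteq> 0"
proof -
  obtain \<rho>1 where *: "real_analytic_at \<rho>1 c" "\<rho>1 c = \<rho> c" "deriv \<rho>1 c \<noteq> 0"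
    "\<forall>\<^sub>F s in at c within UNIV. \<rho>1 s = \<rho> s"
    by (rule reparam_extend[OF \<alpha> \<gamma>, of UNIV])
      (use ev cont in \<open>auto simp: isCont_def islimpt_UNIV eventually_at_filter elim: eventually_mono\<close>)
  have ev: "\<forall>\<^sub>F s in nhds c. \<rho>1 s = \<rho> s"
    using *(4) unfolding eventually_at_filter by eventually_elim (use *(2) in auto)
  show "real_analytic_at \<rho> c" using real_analytic_at_cong[OF *(1) ev] .
  show "deriv \<rho> c \<noteq> 0" using *(3) deriv_cong_ev[OF ev refl] by simp
qed

end

section \<open>Immersions between intervals and their maximal extensions\<close>

lemma open_immersion_real_inj:
  assumes "open_immersion 1 real_atlas K \<sigma>" shows "inj_on \<sigma> K"
proof (rule linorder_inj_onI)
  fix a b assume ab: "a < b" "a \<in> K" "b \<in> K"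
  have K: "connected K" and D: "\<And>t. t \<in> K \<Longrightarrow> real_analytic_at \<sigma> t \<and> deriv \<sigma> t \<noteq> 0"
    using iffD1[OF open_immersion_real_iff assms] unfolding open_interval_def interval_def by blast+
  have sub: "{a..b} \<subseteq> K" using connected_contains_Icc[OF K] ab by blast
  show "\<sigma> a \<noteq> \<sigma> b"
  proof
    assume eq: "\<sigma> a = \<sigma> b"
    have "continuous_on {a..b} \<sigma>"
      using sub D real_analytic_at_isCont by (intro continuous_at_imp_continuous_on) blast
    moreover have "\<And>x. a < x \<Longrightarrow> x < b \<Longrightarrow> \<sigma> differentiable (at x)"
      using sub D real_analytic_at_deriv(1) by (meson atLeastAtMost_iff less_imp_le real_differentiable_def subsetD)
    ultimately obtain z where z: "a < z" "z < b" "(\<sigma> has_real_derivative 0) (at z)"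
      using Rolle[OF ab(1) eq] by blast
    then have "z \<in> K" using sub by auto
    then show False using D DERIV_imp_deriv[OF z(3)] by blast
  qed
qed auto

lemma injective_sign:
  fixes \<rho> :: "real \<Rightarrow> real"
  assumes "connected J" "continuous_on J \<rho>" "inj_on \<rho> J"
  obtains e where "e = 1 \<or> e = -1" "\<forall>s\<in>J. \<forall>t\<in>J. s < t \<longrightarrow> e * \<rho> s < e * \<rho> t"
proof -
  have "strict_mono_on J \<rho> \<or> strict_antimono_on J \<rho>"
    using injective_eq_monotone_map[of J \<rho>] assms by (simp add: is_interval_connected_1)
  then show thesis
  proof
    assume "strict_mono_on J \<rho>"
    then show thesis using that[of 1] by (auto simp: strict_mono_on_def)
  next
    assume "strict_antimono_on J \<rho>"
    then show thesis using that[of "-1"] by (auto simp: monotone_on_def)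
  qed
qed

lemma half_open_not_compact:
  assumes "half_open_interval D" shows "\<not> compact D"
proof
  assume c: "compact D"
  obtain I a where I: "open_interval I" "a \<in> I" "D = I \<inter> {a..} \<or> D = I \<inter> {..a}"
    using assms by (auto simp: half_open_interval_def)
  have op: "open I" using I(1) by (simp add: open_interval_def)
  have ne: "D \<noteq> {}" using I by auto
  show False using I(3)
  proof
    assume D: "D = I \<inter> {a..}"
    obtain m where m: "m \<in> D" "\<And>t. t \<in> D \<Longrightarrow> t \<le> m" using compact_attains_sup[OF c ne] by blast
    obtain r where r: "r > 0" "ball m r \<subseteq> I" using op m(1) D openE by blast
    then have "m + r/2 \<in> I" by (auto simp: subset_iff dist_real_def)
    then have "m + r/2 \<in> D" using D m(1) r(1) by auto
    then show False using m(2) r(1) by fastforce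
  next
    assume D: "D = I \<inter> {..a}"
    obtain m where m: "m \<in> D" "\<And>t. t \<in> D \<Longrightarrow> m \<le> t" using compact_attains_inf[OF c ne] by blast
    obtain r where r: "r > 0" "ball m r \<subseteq> I" using op m(1) D openE by blast
    then have "m - r/2 \<in> I" by (auto simp: subset_iff dist_real_def)
    then have "m - r/2 \<in> D" using D m(1) r(1) by auto
    then show False using m(2) r(1) by fastforce
  qed
qed

text \<open>The union of all immersive extensions, consistent by the identity theorem. Besides being
  maximal it contains every other extension, which makes \<open>extends_to\<close> checkable by
  exhibiting any extension.\<close>

lemma maximal_extension_exists:
  assumes "open_immersion 1 real_atlas J \<rho>"
  obtains K \<sigma> where "maximal_extension J \<rho> K \<sigma>"
    "\<forall>K' \<sigma>'. immersive_extension J \<rho> K' \<sigma>' \<longrightarrow> (\<forall>t\<in>K'. t \<in> K \<and> \<sigma> t = \<sigma>' t)"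
proof -
  define F where "F = {(K, \<sigma>). immersive_extension J \<rho> K \<sigma>}"
  define K where "K = (\<Union>(K', \<sigma>')\<in>F. K')"
  define \<sigma> where "\<sigma> t = (SOME v. \<exists>(K', \<sigma>')\<in>F. t \<in> K' \<and> v = \<sigma>' t)" for t
  have J: "open J" "connected J" "J \<noteq> {}"
    using iffD1[OF open_immersion_real_iff assms] by (auto simp: open_interval_iff)
  have F0: "(J, \<rho>) \<in> F" using assms by (auto simp: F_def immersive_extension_def)
  have FD: "J \<subseteq> K'" "open K'" "connected K'" "\<And>t. t \<in> J \<Longrightarrow> \<sigma>' t = \<rho> t"
      "\<And>t. t \<in> K' \<Longrightarrow> real_analytic_at \<sigma>' t" "\<And>t. t \<in> K' \<Longrightarrow> deriv \<sigma>' t \<noteq> 0"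
    if "(K', \<sigma>') \<in> F" for K' \<sigma>'
  proof -
    have *: "J \<subseteq> K'" "open_immersion 1 real_atlas K' \<sigma>'" "\<forall>t\<in>J. \<sigma>' t = \<rho> t"
      using that by (auto simp: F_def immersive_extension_def)
    note ** = iffD1[OF open_immersion_real_iff *(2)]
    show "J \<subseteq> K'" "open K'" "connected K'" "\<And>t. t \<in> J \<Longrightarrow> \<sigma>' t = \<rho> t"
      "\<And>t. t \<in> K' \<Longrightarrow> real_analytic_at \<sigma>' t" "\<And>t. t \<in> K' \<Longrightarrow> deriv \<sigma>' t \<noteq> 0"
      using * ** by (auto simp: open_interval_iff)
  qed
  have agree: "\<sigma>1 t = \<sigma>2 t" if 1: "(K1, \<sigma>1) \<in> F" and 2: "(K2, \<sigma>2) \<in> F" and t: "t \<in> K1" "t \<in> K2" for K1 \<sigma>1 K2 \<sigma>2 t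
  proof (rule real_analytic_identity[of "K1 \<inter> K2" \<sigma>1 \<sigma>2 J t])
    show "open (K1 \<inter> K2)" "connected (K1 \<inter> K2)"
      using FD(2,3)[OF 1] FD(2,3)[OF 2] connected_Int_real by auto
    show "J \<subseteq> K1 \<inter> K2" using FD(1)[OF 1] FD(1)[OF 2] by blast
    show "\<And>t. t \<in> J \<Longrightarrow> \<sigma>1 t = \<sigma>2 t" using FD(4)[OF 1] FD(4)[OF 2] by simp
  qed (use FD(5)[OF 1] FD(5)[OF 2] J t in auto)
  have \<sigma>: "\<sigma> t = \<sigma>' t" if "(K', \<sigma>') \<in> F" "t \<in> K'" for K' \<sigma>' t
  proof -
    have "\<exists>v. \<exists>(K', \<sigma>')\<in>F. t \<in> K' \<and> v = \<sigma>' t" using that by auto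
    then have "\<exists>(K', \<sigma>')\<in>F. t \<in> K' \<and> \<sigma> t = \<sigma>' t" unfolding \<sigma>_def by (rule someI_ex)
    then obtain K2 \<sigma>2 where 2: "(K2, \<sigma>2) \<in> F" "t \<in> K2" "\<sigma> t = \<sigma>2 t" by auto
    show ?thesis using agree[OF 2(1) that(1) 2(2) that(2)] 2(3) by simp
  qed
  have KF: "K = \<Union>(fst ` F)" by (auto simp: K_def)
  have opK: "open K" unfolding KF using FD(2) by fastforce
  have cK: "connected K" unfolding KF
  proof (rule connected_Union)
    show "connected s" if "s \<in> fst ` F" for s using that FD(3) by fastforce
    show "\<Inter>(fst ` F) \<noteq> {}" using FD(1) J(3) by fastforce
  qed
  have sub: "K' \<subseteq> K" if "(K', \<sigma>') \<in> F" for K' \<sigma>' using that by (auto simp: K_def)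
  have ra: "real_analytic_at \<sigma> t \<and> deriv \<sigma> t \<noteq> 0" if t: "t \<in> K" for t
  proof -
    obtain K' \<sigma>' where F': "(K', \<sigma>') \<in> F" "t \<in> K'" using t by (auto simp: K_def)
    have ev: "\<forall>\<^sub>F s in nhds t. \<sigma>' s = \<sigma> s"
      using eventually_nhds_in_open[OF FD(2)[OF F'(1)] F'(2)] by eventually_elim (simp add: \<sigma>[OF F'(1)])
    have "deriv \<sigma>' t = deriv \<sigma> t" by (rule deriv_cong_ev[OF ev refl])
    then show ?thesis using real_analytic_at_cong[OF FD(5)[OF F'] ev] FD(6)[OF F'] by simp
  qed
  have "K \<noteq> {}" using sub[OF F0] J(3) by blast
  then have imm: "open_immersion 1 real_atlas K \<sigma>"
    using opK cK ra by (intro iffD2[OF open_immersion_real_iff]) (auto simp: open_interval_iff)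
  have ext: "immersive_extension J \<rho> K \<sigma>"
    unfolding immersive_extension_def using sub[OF F0] imm \<sigma>[OF F0] by auto
  have "maximal_extension J \<rho> K \<sigma>"
    unfolding maximal_extension_def
  proof (intro conjI ext allI impI)
    fix K' \<sigma>' assume *: "immersive_extension K \<sigma> K' \<sigma>'"
    then have 1: "K \<subseteq> K'" "open_immersion 1 real_atlas K' \<sigma>'" "\<And>t. t \<in> K \<Longrightarrow> \<sigma>' t = \<sigma> t"
      unfolding immersive_extension_def by blast+
    have 2: "J \<subseteq> K" "\<And>t. t \<in> J \<Longrightarrow> \<sigma> t = \<rho> t" using ext unfolding immersive_extension_def by blast+
    have "\<sigma>' t = \<rho> t" if "t \<in> J" for t using 1(3)[OF subsetD[OF 2(1) that]] 2(2)[OF that] by simp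
    then have "immersive_extension J \<rho> K' \<sigma>'"
      unfolding immersive_extension_def using 1(1,2) 2(1) by blast
    then have "K' \<subseteq> K" using sub by (auto simp: F_def)
    then show "K' = K" using * by (auto simp: immersive_extension_def)
  qed
  then show thesis
  proof (rule that, intro allI impI ballI)
    fix K' \<sigma>' t assume "immersive_extension J \<rho> K' \<sigma>'" "t \<in> K'"
    then have F': "(K', \<sigma>') \<in> F" by (simp add: F_def)
    show "t \<in> K \<and> \<sigma> t = \<sigma>' t" using subsetD[OF sub[OF F'] \<open>t \<in> K'\<close>] \<sigma>[OF F' \<open>t \<in> K'\<close>] by blast
  qed
qed

text \<open>An immersive extension defined on \<open>X\<close> is contained in the maximal one, so
  the exhibited map itself need not be shown maximal.\<close>

lemma extends_toI:
  assumes "open_immersion 1 real_atlas J \<rho>" "open_immersion 1 real_atlas J0 \<rho>0" "J \<subseteq> J0"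
    "\<And>t. t \<in> J \<Longrightarrow> \<rho>0 t = \<rho> t" "X \<subseteq> J0" "\<And>t. t \<in> X \<Longrightarrow> \<rho>0 t = \<mu> t"
  shows "extends_to J \<rho> X \<mu>"
proof -
  obtain K \<sigma> where K: "maximal_extension J \<rho> K \<sigma>"
    "\<forall>K' \<sigma>'. immersive_extension J \<rho> K' \<sigma>' \<longrightarrow> (\<forall>t\<in>K'. t \<in> K \<and> \<sigma> t = \<sigma>' t)"
    by (rule maximal_extension_exists[OF assms(1)]) (rule that, assumption+)
  have "immersive_extension J \<rho> J0 \<rho>0" using assms by (auto simp: immersive_extension_def)
  then have "\<forall>t\<in>J0. t \<in> K \<and> \<sigma> t = \<rho>0 t" using K(2) by blast
  then have "X \<subseteq> K" "\<forall>t\<in>X. \<sigma> t = \<mu> t" using assms(5,6) by auto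
  then show ?thesis unfolding extends_to_def using K(1) by blast
qed

lemma extends_toD:
  assumes "extends_to J \<rho> X \<mu>"
  obtains K \<sigma> where "open_immersion 1 real_atlas K \<sigma>" "J \<subseteq> K" "X \<subseteq> K"
    "\<And>t. t \<in> J \<Longrightarrow> \<sigma> t = \<rho> t" "\<And>t. t \<in> X \<Longrightarrow> \<sigma> t = \<mu> t"
proof -
  obtain K \<sigma> where K: "maximal_extension J \<rho> K \<sigma>" "X \<subseteq> K" "\<forall>t\<in>X. \<sigma> t = \<mu> t"
    using assms unfolding extends_to_def by blast
  have "J \<subseteq> K" "open_immersion 1 real_atlas K \<sigma>" "\<forall>t\<in>J. \<sigma> t = \<rho> t"
    using K(1) unfolding maximal_extension_def immersive_extension_def by blast+
  then show thesis using that[of K \<sigma>] K(2,3) by simp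
qed

section \<open>The analytic action satisfies the assumptions on local symmetries\<close>

locale analytic_setting = group_action G UNIV act
  for G :: "('g, 'r) monoid_scheme" (structure) and act :: "'g \<Rightarrow> 'm::t2_space \<Rightarrow> 'm" +
  fixes n :: nat and A :: "'m chart set" and I :: "real set" and \<gamma> :: "real \<Rightarrow> 'm"
  assumes atlas: "analytic_atlas n A"
    and act_analytic: "\<And>g. g \<in> carrier G \<Longrightarrow> analytic_map n A n A UNIV (act g)"
    and sated: "sated G act"
    and immersion: "open_immersion n A I \<gamma>"
begin

lemma open_immersion_A_iff:
  "open_immersion n A J \<delta> \<longleftrightarrow> open_interval J \<and> (\<forall>t\<in>J. analytic_curve_at n A \<delta> t \<and> regular_at n A \<delta> t)"
  by (rule open_immersion_iff) (rule chartD(1)[OF atlas])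

lemma curve: "t \<in> I \<Longrightarrow> analytic_curve_at n A \<gamma> t" "t \<in> I \<Longrightarrow> regular_at n A \<gamma> t"
  and interval_I: "open_interval I"
  using immersion by (auto simp: open_immersion_A_iff)

lemma translated_curve:
  assumes g: "g \<in> carrier G" and t: "t \<in> I"
  shows "analytic_curve_at n A (\<lambda>s. act g (\<gamma> s)) t" "regular_at n A (\<lambda>s. act g (\<gamma> s)) t"
proof -
  have grp: "group G" by (rule group_hom.axioms(1)[OF group_hom])
  have ig: "inv g \<in> carrier G" by (rule group.inv_closed[OF grp g])
  show "analytic_curve_at n A (\<lambda>s. act g (\<gamma> s)) t"
    by (rule analytic_curve_at_map(1)[OF atlas act_analytic[OF g] curve(1)[OF t]])
  show "regular_at n A (\<lambda>s. act g (\<gamma> s)) t"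
    by (rule regular_at_map[OF atlas act_analytic[OF g] act_analytic[OF ig] _ curve[OF t]])
      (rule orbit_sym_aux[OF g UNIV_I refl])
qed

text \<open>\<open>reparam_extend\<close> continues \<open>\<rho>\<close> by an analytic
  \<open>\<rho>1\<close> with nonzero derivative. A local inverse makes \<open>\<rho>1\<close>
  injective near \<open>c\<close>, hence monotone, and its sign is that of \<open>\<rho>\<close>
  because the two agree on an interval of \<open>J\<close> near \<open>c\<close>.\<close>

lemma symmetry_extend_analytic:
  assumes S: "local_symmetry G act I \<gamma> g e J \<rho>" and c: "c \<in> I" "c \<in> closure J" "c \<notin> J"
    and d: "d \<in> I" and lim: "(\<rho> \<longlongrightarrow> d) (at c within J)"
  shows "\<exists>J' \<rho>'. local_symmetry G act I \<gamma> g e J' \<rho>' \<and> c \<in> J' \<and> (\<forall>t\<in>J \<inter> J'. \<rho>' t = \<rho> t)"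
proof -
  have g: "g \<in> carrier G" and e: "e = 1 \<or> e = -1" and J: "open J"
    and mono: "\<And>s t. s \<in> J \<Longrightarrow> t \<in> J \<Longrightarrow> s < t \<Longrightarrow> e * \<rho> s < e * \<rho> t"
    and eq: "\<And>t. t \<in> J \<Longrightarrow> act g (\<gamma> t) = \<gamma> (\<rho> t)"
    using S by (auto simp: local_symmetry_def open_interval_iff)
  have opI: "open I" using interval_I by (simp add: open_interval_iff)
  have W: "c islimpt J" using c(2,3) by (simp add: closure_def)
  have "\<forall>\<^sub>F s in at c within J. act g (\<gamma> s) = \<gamma> (\<rho> s)"
    by (auto simp: eventually_at_filter eq intro!: always_eventually)
  then obtain \<rho>1 where 1: "real_analytic_at \<rho>1 c" "\<rho>1 c = d" "deriv \<rho>1 c \<noteq> 0"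
    "\<forall>\<^sub>F s in at c within J. \<rho>1 s = \<rho> s" "\<forall>\<^sub>F s in nhds c. act g (\<gamma> s) = \<gamma> (\<rho>1 s)"
    by (rule reparam_extend[OF atlas translated_curve[OF g c(1)] curve[OF d] W _ lim])
  obtain k where k: "\<forall>\<^sub>F x in nhds c. k (\<rho>1 x) = x"
    by (rule real_analytic_at_inverse[OF 1(1,3)])
  have "\<forall>\<^sub>F s in nhds c. \<rho>1 s \<in> I"
    using topological_tendstoD[OF real_analytic_at_tendsto[OF 1(1)] opI] 1(2) d by simp
  moreover have "\<forall>\<^sub>F s in nhds c. s \<in> J \<longrightarrow> s \<noteq> c \<longrightarrow> \<rho>1 s = \<rho> s"
    using 1(4) unfolding eventually_at_filter by (auto elim: eventually_mono)
  ultimately have "\<forall>\<^sub>F s in nhds c. \<rho>1 s \<in> I \<and> (s \<in> J \<longrightarrow> s \<noteq> c \<longrightarrow> \<rho>1 s = \<rho> s) \<and> k (\<rho>1 s) = s \<and>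
      act g (\<gamma> s) = \<gamma> (\<rho>1 s) \<and> real_analytic_at \<rho>1 s \<and> s \<in> I"
    using k 1(5) real_analytic_at_nhds[OF 1(1)] eventually_nhds_in_open[OF opI c(1)]
    by eventually_elim simp
  then obtain r where r: "r > 0" "\<And>s. s \<in> ball c r \<Longrightarrow> \<rho>1 s \<in> I \<and> (s \<in> J \<longrightarrow> s \<noteq> c \<longrightarrow> \<rho>1 s = \<rho> s) \<and>
      k (\<rho>1 s) = s \<and> act g (\<gamma> s) = \<gamma> (\<rho>1 s) \<and> real_analytic_at \<rho>1 s \<and> s \<in> I"
    unfolding eventually_nhds_metric by (metis dist_commute mem_ball)
  have agree: "\<rho>1 s = \<rho> s" if "s \<in> J" "s \<in> ball c r" for s using r(2)[OF that(2)] that(1) c(3) by auto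
  have inj: "inj_on \<rho>1 (ball c r)" using r(2) by (metis inj_onI)
  have cont: "continuous_on (ball c r) \<rho>1"
    using r(2) real_analytic_at_isCont by (intro continuous_at_imp_continuous_on) blast
  obtain e' where e': "e' = 1 \<or> e' = -1" "\<forall>s\<in>ball c r. \<forall>t\<in>ball c r. s < t \<longrightarrow> e' * \<rho>1 s < e' * \<rho>1 t"
    by (rule injective_sign[OF connected_ball cont inj]) (rule that, assumption+)
  obtain u where u: "u \<in> J" "u \<in> ball c r"
    using c(2) r(1) closure_iff_nhds_not_empty[of c J] by (metis centre_in_ball disjoint_iff open_ball subset_refl)
  obtain q where q: "q > 0" "ball u q \<subseteq> J \<inter> ball c r" using open_Int[OF J open_ball] u openE by blast
  then have u2: "u + q/2 \<in> J" "u + q/2 \<in> ball c r" by (auto simp: subset_iff dist_real_def)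
  have "e * \<rho> u < e * \<rho> (u + q/2)" using mono[OF u(1) u2(1)] q(1) by simp
  moreover have "e' * \<rho> u < e' * \<rho> (u + q/2)"
    using e'(2)[rule_format, OF u(2) u2(2)] q(1) agree[OF u] agree[OF u2] by simp
  ultimately have "e' = e" using e e'(1) by auto
  have "local_symmetry G act I \<gamma> g e (ball c r) \<rho>1"
    unfolding local_symmetry_def
  proof (intro conjI g e cont ballI impI)
    show "open_interval (ball c r)" using r(1) by (simp add: open_interval_iff)
    show "ball c r \<subseteq> I" "\<rho>1 ` ball c r \<subseteq> I" using r(2) by blast+
    show "e * \<rho>1 s < e * \<rho>1 t" if "s \<in> ball c r" "t \<in> ball c r" "s < t" for s t
      using e'(2)[rule_format, OF that] \<open>e' = e\<close> by simp
    show "act g (\<gamma> t) = \<gamma> (\<rho>1 t)" if "t \<in> ball c r" for t using r(2)[OF that] by blast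
  qed
  moreover have "c \<in> ball c r" using r(1) by simp
  ultimately show ?thesis using agree by blast
qed

sublocale local_symmetries G act I \<gamma>
proof unfold_locales
  have opI: "open I" "connected I" using interval_I by (auto simp: open_interval_iff)
  show "open_interval I" by (rule interval_I)
  show "continuous_on I \<gamma>"
    using analytic_curve_atD(1)[OF curve(1)] by (intro continuous_at_imp_continuous_on) blast
  show "\<exists>r>0. inj_on \<gamma> (ball t r \<inter> I)" if t: "t \<in> I" for t
  proof -
    obtain r where "r > 0" "inj_on \<gamma> (ball t r)" by (rule regular_locally_injective[OF atlas curve[OF t]])
    then show ?thesis using inj_on_subset[of \<gamma> "ball t r" "ball t r \<inter> I"] by blast
  qed
  show "act g (\<gamma> u) = \<gamma> u"
    if "g \<in> carrier G" "open_interval J" "J \<subseteq> I" "\<And>t. t \<in> J \<Longrightarrow> act g (\<gamma> t) = \<gamma> t" "u \<in> I" for g J u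
    by (rule curve_identity[OF atlas opI translated_curve(1)[OF that(1)] curve(1), of J])
      (use that in \<open>auto simp: open_interval_iff\<close>)
  show "\<exists>J' \<rho>'. local_symmetry G act I \<gamma> g e J' \<rho>' \<and> c \<in> J' \<and> (\<forall>t\<in>J \<inter> J'. \<rho>' t = \<rho> t)"
    if "local_symmetry G act I \<gamma> g e J \<rho>" "c \<in> I" "c \<in> closure J" "c \<notin> J" "d \<in> I" "(\<rho> \<longlongrightarrow> d) (at c within J)"
    for g e J \<rho> c d
    by (rule symmetry_extend_analytic[OF that])
  show "sated G act" by (rule sated)
qed

lemma sym_analytic:
  assumes S: "S g e J \<rho>" and t: "t \<in> J"
  shows "real_analytic_at \<rho> t" "deriv \<rho> t \<noteq> 0"
proof -
  have ev: "\<forall>\<^sub>F s in nhds t. act g (\<gamma> s) = \<gamma> (\<rho> s)"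
    using eventually_nhds_in_open[OF symD(3)[OF S] t] by eventually_elim (rule symD(10)[OF S])
  have cont: "isCont \<rho> t" using symD(3,8)[OF S] t continuous_on_eq_continuous_at by blast
  note R = reparam_analytic[OF atlas translated_curve[OF symD(1)[OF S] symD(12)[OF S t]]
      curve[OF symD(13)[OF S t]] ev cont]
  show "real_analytic_at \<rho> t" "deriv \<rho> t \<noteq> 0" by (rule R)+
qed

lemma sym_immersion: "S g e J \<rho> \<Longrightarrow> open_immersion 1 real_atlas J \<rho>"
  by (intro iffD2[OF open_immersion_real_iff] conjI ballI sym_analytic symD(11))

lemma analytic_immersion_restrict:
  assumes "interval D" "D \<subseteq> I"
  shows "analytic_immersion n A D \<gamma>" "g \<in> carrier G \<Longrightarrow> analytic_immersion n A D (\<lambda>t. act g (\<gamma> t))"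
proof -
  show "analytic_immersion n A D \<gamma>"
    unfolding analytic_immersion_def using assms immersion by blast
  show "analytic_immersion n A D (\<lambda>t. act g (\<gamma> t))" if "g \<in> carrier G"
  proof -
    have "open_immersion n A I (\<lambda>t. act g (\<gamma> t))"
      unfolding open_immersion_A_iff using interval_I translated_curve[OF that] by blast
    then show ?thesis unfolding analytic_immersion_def using assms by blast
  qed
qed

end

section \<open>The notions of the theorem in terms of local symmetries\<close>

context analytic_setting begin

text \<open>From an overlap, \<open>\<rho>\<close> is \<open>g \<cdot> \<gamma>\<close> followed by
  the inverse of the embedding \<open>\<gamma>\<close> on \<open>J'\<close>. For the converse the
  symmetry is restricted to a ball so small that its values stay where \<open>\<gamma>\<close> is
  injective, which makes both curves embeddings.\<close>

lemma overlap_iff: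
  assumes D: "D \<subseteq> I" and g: "g \<in> carrier G"
  shows "overlap n A D (\<lambda>t. act g (\<gamma> t)) D \<gamma> \<longleftrightarrow> (\<exists>e J \<rho>. S g e J \<rho> \<and> J \<subseteq> D \<and> \<rho> ` J \<subseteq> D)"
proof
  assume "overlap n A D (\<lambda>t. act g (\<gamma> t)) D \<gamma>"
  then obtain J J' where J: "open_interval J" "J \<subseteq> D" "open_interval J'" "J' \<subseteq> D"
      "analytic_embedding n A J (\<lambda>t. act g (\<gamma> t))" "analytic_embedding n A J' \<gamma>"
      "(\<lambda>t. act g (\<gamma> t)) ` J = \<gamma> ` J'"
    unfolding overlap_def by blast
  obtain J0 \<delta> h where h: "J' \<subseteq> J0" "homeomorphism J0 (\<delta> ` J0) \<delta> h" "\<forall>t\<in>J'. \<delta> t = \<gamma> t"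
    using J(6) unfolding analytic_embedding_def by blast
  obtain J1 \<delta>1 h1 where h1: "J \<subseteq> J1" "homeomorphism J1 (\<delta>1 ` J1) \<delta>1 h1" "\<forall>t\<in>J. \<delta>1 t = act g (\<gamma> t)"
    using J(5) unfolding analytic_embedding_def by blast
  define \<rho> where "\<rho> t = h (act g (\<gamma> t))" for t
  have hd: "h (\<gamma> s) = s" if "s \<in> J'" for s
    using h(2) h(3)[rule_format, OF that] subsetD[OF h(1) that] unfolding homeomorphism_def by metis
  have \<rho>: "\<rho> t \<in> J' \<and> act g (\<gamma> t) = \<gamma> (\<rho> t)" if "t \<in> J" for t
  proof -
    have "act g (\<gamma> t) \<in> \<gamma> ` J'" using J(7) that by blast
    then obtain s where "s \<in> J'" "act g (\<gamma> t) = \<gamma> s" by blast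
    then show ?thesis using hd[of s] by (simp add: \<rho>_def)
  qed
  have opJ: "open J" "connected J" "J \<noteq> {}" using J(1) by (auto simp: open_interval_iff)
  have JI: "J \<subseteq> I" "J' \<subseteq> I" using J(2,4) D by auto
  have "continuous_on J (\<lambda>t. act g (\<gamma> t))"
    using analytic_curve_atD(1)[OF translated_curve(1)[OF g]] JI(1)
    by (intro continuous_at_imp_continuous_on ballI) (meson subsetD)
  moreover have "continuous_on (\<delta> ` J0) h" using h(2) by (simp add: homeomorphism_def)
  moreover have "act g (\<gamma> t) \<in> \<delta> ` J0" if "t \<in> J" for t
    using \<rho>[OF that] h(3)[rule_format, of "\<rho> t"] subsetD[OF h(1), of "\<rho> t"] by (metis imageI)
  ultimately have cont: "continuous_on J \<rho>"
    unfolding \<rho>_def by (intro continuous_on_compose2[of "\<delta> ` J0" h J "\<lambda>t. act g (\<gamma> t)"]) auto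
  have inj: "inj_on \<rho> J"
  proof (rule inj_onI)
    fix a b assume ab: "a \<in> J" "b \<in> J" "\<rho> a = \<rho> b"
    then have "\<delta>1 a = \<delta>1 b" using \<rho>[OF ab(1)] \<rho>[OF ab(2)] h1(3) by simp
    then have "h1 (\<delta>1 a) = h1 (\<delta>1 b)" by simp
    moreover have "h1 (\<delta>1 a) = a" "h1 (\<delta>1 b) = b"
      using h1(2) subsetD[OF h1(1) ab(1)] subsetD[OF h1(1) ab(2)] unfolding homeomorphism_def by auto
    ultimately show "a = b" by simp
  qed
  obtain e where e: "e = 1 \<or> e = -1" "\<forall>s\<in>J. \<forall>t\<in>J. s < t \<longrightarrow> e * \<rho> s < e * \<rho> t"
    by (rule injective_sign[OF opJ(2) cont inj]) (rule that, assumption+)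
  have "S g e J \<rho>"
    by (rule symI[OF g e(1) opJ JI(1) _ cont]) (use \<rho> JI(2) e(2) in auto)
  moreover have "\<rho> ` J \<subseteq> D" using \<rho> J(4) by blast
  ultimately show "\<exists>e J \<rho>. S g e J \<rho> \<and> J \<subseteq> D \<and> \<rho> ` J \<subseteq> D" using J(2) by blast
next
  assume "\<exists>e J \<rho>. S g e J \<rho> \<and> J \<subseteq> D \<and> \<rho> ` J \<subseteq> D"
  then obtain e J \<rho> where S: "S g e J \<rho>" "J \<subseteq> D" "\<rho> ` J \<subseteq> D" by blast
  note SD = symD[OF S(1)]
  obtain t where t: "t \<in> J" using SD(5) by blast
  \<comment> \<open>A continuous injection on a compact ball is a homeomorphism onto its image, and
    this passes to the open ball.\<close>
  have emb: "analytic_embedding n A K \<delta>"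
    if K: "open_interval K" "K \<subseteq> ball c r" and c: "open_immersion n A (ball c r) \<delta>" "r < r'" "inj_on \<delta> (cball c r)"
      "continuous_on (cball c r) \<delta>" for K \<delta> c r r'
  proof -
    obtain h where "homeomorphism (cball c r) (\<delta> ` cball c r) \<delta> h"
      using homeomorphism_compact[OF compact_cball c(4) refl c(3)] by blast
    then have "homeomorphism (ball c r) (\<delta> ` ball c r) \<delta> h"
      by (rule homeomorphism_of_subsets) auto
    then show ?thesis
      unfolding analytic_embedding_def using K c(1) by (auto simp: open_interval_def)
  qed
  have contg: "continuous_on X (\<lambda>t. act g (\<gamma> t))" if "X \<subseteq> I" for X
    using analytic_curve_atD(1)[OF translated_curve(1)[OF g]] that
    by (intro continuous_at_imp_continuous_on ballI) (meson subsetD)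
  have immb: "open_immersion n A (ball c r) \<gamma>" "open_immersion n A (ball c r) (\<lambda>t. act g (\<gamma> t))"
    if "ball c r \<subseteq> I" "0 < r" for c r
    unfolding open_immersion_A_iff using that curve translated_curve[OF g] by (auto simp: open_interval_iff)
  let ?d = "\<rho> t"
  obtain r1 where r1: "r1 > 0" "inj_on \<gamma> (ball ?d r1)"
    by (rule regular_locally_injective[OF atlas curve[OF SD(13)[OF t]]])
  obtain r2 where r2: "r2 > 0" "ball ?d r2 \<subseteq> I" using open_I SD(13)[OF t] openE by blast
  define r where "r = min r1 r2 / 2"
  have r: "r > 0" "cball ?d r \<subseteq> ball ?d r1" "cball ?d r \<subseteq> I"
    using r1(1) r2 by (auto simp: r_def subset_iff)
  have "open (J \<inter> \<rho> -` ball ?d r)" by (rule continuous_open_preimage[OF SD(8,3) open_ball])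
  moreover have "t \<in> J \<inter> \<rho> -` ball ?d r" using t r(1) by simp
  ultimately obtain q0 where q0: "q0 > 0" "ball t q0 \<subseteq> J \<inter> \<rho> -` ball ?d r" using openE by blast
  define q where "q = q0 / 2"
  have q: "q > 0" "cball t q \<subseteq> J" "\<rho> ` cball t q \<subseteq> ball ?d r"
    using q0 by (auto simp: q_def subset_iff)
  let ?K = "ball t q"
  have KJ: "?K \<subseteq> J" using q(2) ball_subset_cball by blast
  have K: "open_interval ?K" using q(1) by (simp add: open_interval_iff)
  have SK: "S g e ?K \<rho>" by (rule sym_restrict[OF S(1) K KJ])
  have "inj_on (\<lambda>t. act g (\<gamma> t)) (cball t q)"
  proof (rule inj_onI)
    fix a b assume ab: "a \<in> cball t q" "b \<in> cball t q" "act g (\<gamma> a) = act g (\<gamma> b)"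
    then have J: "a \<in> J" "b \<in> J" using q(2) by blast+
    then have "\<gamma> (\<rho> a) = \<gamma> (\<rho> b)" using ab(3) SD(10)[OF J(1)] SD(10)[OF J(2)] by simp
    moreover have "\<rho> a \<in> ball ?d r1" "\<rho> b \<in> ball ?d r1" using q(3) ab r(2) ball_subset_cball by blast+
    ultimately have "\<rho> a = \<rho> b" using inj_onD[OF r1(2)] by blast
    then show "a = b" using inj_onD[OF sym_inj[OF S(1)]] J by blast
  qed
  note inj1 = this
  have cI: "cball t q \<subseteq> I" by (rule order_trans[OF q(2) SD(6)])
  have bI: "ball t q \<subseteq> I" by (rule order_trans[OF ball_subset_cball cI])
  have 1: "analytic_embedding n A ?K (\<lambda>t. act g (\<gamma> t))"
    by (rule emb[OF K subset_refl immb(2)[OF bI q(1)] _ inj1 contg[OF cI], where r' = "q + 1"]) simp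
  have 2: "analytic_embedding n A (\<rho> ` ?K) \<gamma>"
  proof (rule emb[OF sym_open_image[OF SK], where c = "?d" and r = r and r' = "r + 1"])
    show "\<rho> ` ?K \<subseteq> ball ?d r" by (rule order_trans[OF image_mono[OF ball_subset_cball] q(3)])
    show "open_immersion n A (ball ?d r) \<gamma>" by (rule immb(1)[OF order_trans[OF ball_subset_cball r(3)] r(1)])
    show "inj_on \<gamma> (cball ?d r)" by (rule inj_on_subset[OF r1(2) r(2)])
    show "continuous_on (cball ?d r) \<gamma>" by (rule continuous_on_subset[OF continuous_curve r(3)])
  qed simp
  have im: "(\<lambda>t. act g (\<gamma> t)) ` ?K = \<gamma> ` \<rho> ` ?K"
    unfolding image_image using SD(10) KJ by (intro image_cong refl) blast
  have sub: "?K \<subseteq> D" "\<rho> ` ?K \<subseteq> D"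
    by (rule order_trans[OF KJ S(2)], rule order_trans[OF image_mono[OF KJ] S(3)])
  show "overlap n A D (\<lambda>t. act g (\<gamma> t)) D \<gamma>"
    unfolding overlap_def
    by (rule exI[of _ ?K], rule exI[of _ "\<rho> ` ?K"], rule conjI[OF K conjI[OF sub(1) conjI[OF sym_open_image[OF SK]
      conjI[OF sub(2) conjI[OF 1 conjI[OF 2 im]]]]]])
qed

lemma stabilizer_restrict:
  assumes "interval D" "D \<subseteq> I" shows "curve_stabilizer G act D \<gamma> = stab"
proof
  show "stab \<subseteq> curve_stabilizer G act D \<gamma>" using assms(2) by (auto simp: curve_stabilizer_def)
  show "curve_stabilizer G act D \<gamma> \<subseteq> stab"
  proof
    fix g assume g: "g \<in> curve_stabilizer G act D \<gamma>"
    obtain s where "s \<in> interior D" using assms(1) by (auto simp: interval_def)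
    then obtain r where r: "r > 0" "ball s r \<subseteq> D" using mem_interior by blast
    have "act g (\<gamma> u) = \<gamma> u" if "u \<in> I" for u
      by (rule fix_extend[of g "ball s r"])
        (use g r assms(2) that in \<open>auto simp: curve_stabilizer_def open_interval_iff\<close>)
    then show "g \<in> stab" using g by (auto simp: curve_stabilizer_def)
  qed
qed

text \<open>Overlaps correspond to pairs of related interior points, and by the identity theorem the
  stabilizer of a restriction is that of the whole curve.\<close>

lemma free_segment_iff:
  assumes D: "interval D" "D \<subseteq> I"
  shows "free_segment n A G act D \<gamma> \<longleftrightarrow> free D"
proof -
  have "(\<exists>e J \<rho>. S g e J \<rho> \<and> J \<subseteq> D \<and> \<rho> ` J \<subseteq> D) \<longleftrightarrow>
      (\<exists>e s t. rel g e s t \<and> s \<in> interior D \<and> t \<in> interior D)" for g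
  proof
    assume "\<exists>e J \<rho>. S g e J \<rho> \<and> J \<subseteq> D \<and> \<rho> ` J \<subseteq> D"
    then obtain e J \<rho> where S: "S g e J \<rho>" "J \<subseteq> D" "\<rho> ` J \<subseteq> D" by blast
    obtain t where t: "t \<in> J" using symD(5)[OF S(1)] by blast
    have "J \<subseteq> interior D" by (rule interior_maximal[OF S(2) symD(3)[OF S(1)]])
    moreover have "\<rho> ` J \<subseteq> interior D"
      by (rule interior_maximal[OF S(3)]) (use sym_open_image[OF S(1)] in \<open>simp add: open_interval_iff\<close>)
    ultimately have "t \<in> interior D" "\<rho> t \<in> interior D" using t by blast+
    then show "\<exists>e s t. rel g e s t \<and> s \<in> interior D \<and> t \<in> interior D" using relI[OF S(1) t] by blast
  next
    assume "\<exists>e s t. rel g e s t \<and> s \<in> interior D \<and> t \<in> interior D"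
    then obtain e s t where R: "rel g e s t" "s \<in> interior D" "t \<in> interior D" by blast
    then obtain J \<rho> where S: "S g e J \<rho>" "s \<in> J" "\<rho> s = t" by (auto simp: rel_def)
    have "open (J \<inter> interior D \<inter> (J \<inter> \<rho> -` interior D))"
      by (rule open_Int[OF open_Int[OF symD(3)[OF S(1)] open_interior] continuous_open_preimage[OF symD(8,3)[OF S(1)] open_interior]])
    moreover have "s \<in> J \<inter> interior D \<inter> (J \<inter> \<rho> -` interior D)" using R S by simp
    ultimately obtain r where r: "r > 0" "ball s r \<subseteq> J \<inter> interior D \<inter> (J \<inter> \<rho> -` interior D)" using openE by blast
    have "S g e (ball s r) \<rho>"
      by (rule sym_restrict[OF S(1)]) (use r in \<open>auto simp: open_interval_iff\<close>)
    moreover have "ball s r \<subseteq> D" "\<rho> ` ball s r \<subseteq> D" using r(2) interior_subset[of D] by auto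
    ultimately show "\<exists>e J \<rho>. S g e J \<rho> \<and> J \<subseteq> D \<and> \<rho> ` J \<subseteq> D" by blast
  qed
  note key = this
  show ?thesis
  proof
    assume fs: "free_segment n A G act D \<gamma>"
    show "free D"
      unfolding free_def
    proof (intro allI impI)
      fix g e s t assume R: "rel g e s t \<and> s \<in> interior D \<and> t \<in> interior D"
      then have g: "g \<in> carrier G" using relD(1) by blast
      have "overlap n A D (\<lambda>t. act g (\<gamma> t)) D \<gamma>"
        unfolding overlap_iff[OF D(2) g] key using R by blast
      then have "g \<in> curve_stabilizer G act D \<gamma>" using fs g unfolding free_segment_def by blast
      then show "g \<in> stab" unfolding stabilizer_restrict[OF D] .
    qed
  next
    assume fr: "free D"
    show "free_segment n A G act D \<gamma>"
      unfolding free_segment_def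
    proof (intro conjI ballI impI analytic_immersion_restrict(1)[OF D])
      fix g assume g: "g \<in> carrier G" and "overlap n A D (\<lambda>t. act g (\<gamma> t)) D \<gamma>"
      then have "\<exists>e s t. rel g e s t \<and> s \<in> interior D \<and> t \<in> interior D"
        unfolding overlap_iff[OF D(2) g] key by blast
      then show "g \<in> curve_stabilizer G act D \<gamma>"
        unfolding stabilizer_restrict[OF D] using fr unfolding free_def by blast
    qed
  qed
qed

text \<open>As \<open>I\<close> is not free, \<open>free\<close> and \<open>SF\<close> agree on
  every subinterval. The nonempty interior demanded of a free interval passes from \<open>B\<close>
  to any larger one.\<close>

lemma maximal_interval_iff:
  assumes nf: "\<not> free I"
  shows "maximal_interval n A G act I \<gamma> B \<longleftrightarrow> maxint B"
proof -
  have fi: "free_interval n A G act I \<gamma> X \<longleftrightarrow> connected X \<and> interior X \<noteq> {} \<and> X \<subseteq> I \<and> SF X" for X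
  proof (cases "interval X \<and> X \<subseteq> I")
    case True
    then have "free_segment n A G act X \<gamma> \<longleftrightarrow> free X" using free_segment_iff by blast
    moreover have "free X \<longleftrightarrow> SF X"
      using True free_imp_SF[OF _ _ nf, of X] SF_imp_free[of X] unfolding interval_def by blast
    ultimately show ?thesis using True unfolding free_interval_def interval_def by blast
  qed (auto simp: free_interval_def interval_def)
  show ?thesis
  proof
    assume m: "maximal_interval n A G act I \<gamma> B"
    then have 1: "connected B \<and> interior B \<noteq> {} \<and> B \<subseteq> I \<and> SF B" unfolding maximal_interval_def fi by (rule conjunct1)
    have "B' = B" if b: "connected B' \<and> B' \<subseteq> I \<and> SF B' \<and> B \<subseteq> B'" for B'
    proof (rule ccontr)
      assume "B' \<noteq> B"
      then have "B \<subset> B'" using b by (simp add: psubset_eq)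
      moreover have "interior B' \<noteq> {}" using interior_mono[of B B'] b 1 by auto
      ultimately have "free_interval n A G act I \<gamma> B' \<and> B \<subset> B'" unfolding fi using b by simp
      then show False using m unfolding maximal_interval_def by meson
    qed
    then show "maxint B" unfolding maxint_def using 1 by simp
  next
    assume m: "maxint B"
    note mD = maxintD[OF m]
    show "maximal_interval n A G act I \<gamma> B"
      unfolding maximal_interval_def fi
    proof (intro conjI mD(1-4) notI)
      assume "\<exists>B'. (connected B' \<and> interior B' \<noteq> {} \<and> B' \<subseteq> I \<and> SF B') \<and> B \<subset> B'"
      then obtain B' where b: "connected B'" "B' \<subseteq> I" "SF B'" "B \<subset> B'" by (elim exE conjE)
      have "B' = B" by (rule mD(5)[OF b(1-3)]) (use b(4) in \<open>simp add: psubset_eq\<close>)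
      then show False using b(4) by simp
    qed
  qed
qed

section \<open>Symmetries as analytic diffeomorphisms\<close>

lemma matching_symmetry:
  assumes S: "S g e J \<rho>" and K: "interval K" "K \<subseteq> J" "K \<subseteq> D'" "\<rho> ` K \<subseteq> D"
    and D: "interval D'" "D' \<subseteq> I" "interval D" "D \<subseteq> I"
  shows "matching n A D' (\<lambda>t. act g (\<gamma> t)) D \<gamma> K \<rho>"
proof -
  note SD = symD[OF S]
  have inj: "inj_on \<rho> K" by (rule inj_on_subset[OF sym_inj[OF S] K(2)])
  have "interval (\<rho> ` K)"
  proof -
    have "connected (\<rho> ` K)"
      using K(1) by (intro connected_continuous_image continuous_on_subset[OF SD(8) K(2)]) (simp add: interval_def)
    moreover obtain s where s: "s \<in> interior K" using K(1) by (auto simp: interval_def)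
    then obtain r where r: "r > 0" "ball s r \<subseteq> K" using mem_interior by blast
    have "S g e (ball s r) \<rho>" by (rule sym_restrict[OF S]) (use r K(2) in \<open>auto simp: open_interval_iff\<close>)
    then have "open (\<rho> ` ball s r)" using sym_open_image by (simp add: open_interval_iff)
    then have "\<rho> ` ball s r \<subseteq> interior (\<rho> ` K)" using r(2) by (intro interior_maximal image_mono)
    then have "interior (\<rho> ` K) \<noteq> {}" using r(1) by fastforce
    ultimately show ?thesis by (simp add: interval_def)
  qed
  note ivl = this
  have 1: "analytic_map 1 real_atlas 1 real_atlas J \<rho>"
    by (rule iffD2[OF analytic_map_real_iff[OF SD(3)]]) (use sym_analytic(1)[OF S] in simp)
  have op: "open (\<rho> ` J)" using sym_open_image[OF S] by (simp add: open_interval_iff)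
  have 2: "analytic_map 1 real_atlas 1 real_atlas (\<rho> ` J) (inv_into J \<rho>)"
    by (rule iffD2[OF analytic_map_real_iff[OF op]]) (use sym_analytic(1)[OF sym_inverse[OF S]] in simp)
  have 3: "bij_betw \<rho> J (\<rho> ` J)" "bij_betw \<rho> K (\<rho> ` K)" using sym_inj[OF S] inj by (simp_all add: bij_betw_def)
  have oJ: "open_interval J" using SD(3-5) by (simp add: open_interval_iff)
  have d: "analytic_diffeo \<rho> K (\<rho> ` K)"
    unfolding analytic_diffeo_def
    by (rule conjI[OF K(1) conjI[OF ivl conjI[OF 3(2)]]], rule exI[of _ J], rule exI[of _ "\<rho> ` J"], rule exI[of _ \<rho>])
      (rule conjI[OF oJ conjI[OF sym_open_image[OF S] conjI[OF K(2) conjI[OF image_mono[OF K(2)] conjI[OF 3(1)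
        conjI[OF 1 conjI[OF 2 ballI[OF refl]]]]]]]])
  show ?thesis
    unfolding matching_def
    by (rule conjI[OF analytic_immersion_restrict(2)[OF D(1,2) SD(1)] conjI[OF analytic_immersion_restrict(1)[OF D(3,4)]
      conjI[OF K(3) conjI[OF K(4) conjI[OF d ballI[OF SD(10)[OF subsetD[OF K(2)]]]]]]]])
qed

text \<open>Symmetries live on open intervals, so a diffeomorphism on an arbitrary interval
  \<open>K\<close> is recorded as a symmetry on the interior, together with monotonicity and
  continuity on all of \<open>K\<close> for use at end points.\<close>

lemma diffeo_symmetry:
  assumes g: "g \<in> carrier G" and K: "interval K" "K \<subseteq> I" "\<mu> ` K \<subseteq> I" and d: "analytic_diffeo \<mu> K K'"
    and eq: "\<forall>t\<in>K. act g (\<gamma> t) = \<gamma> (\<mu> t)"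
  obtains e where "S g e (interior K) \<mu>" "e = 1 \<or> e = -1" "\<forall>s\<in>K. \<forall>t\<in>K. s < t \<longrightarrow> e * \<mu> s < e * \<mu> t"
    "continuous_on K \<mu>"
proof -
  obtain J \<sigma> where J: "K \<subseteq> J" "analytic_map 1 real_atlas 1 real_atlas J \<sigma>" "\<forall>t\<in>K. \<sigma> t = \<mu> t"
    and inj: "inj_on \<mu> K"
    using d unfolding analytic_diffeo_def bij_betw_def by blast
  have "continuous_on J \<sigma>" using J(2) unfolding analytic_map_def by (rule conjunct1)
  then have "continuous_on K \<sigma>" by (rule continuous_on_subset[OF _ J(1)])
  moreover have "continuous_on K \<mu> = continuous_on K \<sigma>" by (rule continuous_on_cong) (simp_all add: J(3))
  ultimately have cont: "continuous_on K \<mu>" by simp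
  have conn: "connected K" and ne: "interior K \<noteq> {}" using K(1) by (simp_all add: interval_def)
  obtain e where e: "e = 1 \<or> e = -1" "\<forall>s\<in>K. \<forall>t\<in>K. s < t \<longrightarrow> e * \<mu> s < e * \<mu> t"
    by (rule injective_sign[OF conn cont inj]) (rule that, assumption+)
  have sub: "interior K \<subseteq> K" by (rule interior_subset)
  have "convex K" by (rule iffD1[OF is_interval_convex_1 iffD2[OF is_interval_connected_1 conn]])
  then have ci: "connected (interior K)" by (intro convex_connected convex_interior)
  have S: "S g e (interior K) \<mu>"
  proof (rule symI[OF g e(1) open_interior ci ne order_trans[OF sub K(2)] _ continuous_on_subset[OF cont sub]])
    show "\<mu> t \<in> I" if "t \<in> interior K" for t using K(3) subsetD[OF sub that] by (simp add: image_subset_iff)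
    show "e * \<mu> s < e * \<mu> t" if "s \<in> interior K" "t \<in> interior K" "s < t" for s t
      using e(2) subsetD[OF sub that(1)] subsetD[OF sub that(2)] that(3) by simp
    show "act g (\<gamma> t) = \<gamma> (\<mu> t)" if "t \<in> interior K" for t using eq subsetD[OF sub that] by simp
  qed
  show thesis by (rule that[OF S e cont])
qed

lemma extends_to_symmetry:
  assumes S: "S g e J \<rho>" and S': "S g' e' J' \<rho>'" and J: "J \<subseteq> J'" "\<And>t. t \<in> J \<Longrightarrow> \<rho>' t = \<rho> t"
    and X: "X \<subseteq> J'"
  shows "extends_to J \<rho> X \<rho>'"
  by (rule extends_toI[OF sym_immersion[OF S] sym_immersion[OF S'] J X refl])

lemma ray_interval:
  fixes t :: real
  assumes "open J" "connected J" "t \<in> J"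
  shows "interval (J \<inter> {..t})" "interval (J \<inter> {t..})"
proof -
  obtain r where r: "r > 0" "ball t r \<subseteq> J" using assms(1,3) openE by blast
  have 1: "{t - r<..<t} \<subseteq> J \<inter> {..t}" "{t<..<t + r} \<subseteq> J \<inter> {t..}"
    using r(2) by (auto simp: ball_eq_greaterThanLessThan subset_iff)
  have 2: "t - r/2 \<in> interior (J \<inter> {..t})" "t + r/2 \<in> interior (J \<inter> {t..})"
    using interior_maximal[OF 1(1) open_greaterThanLessThan] interior_maximal[OF 1(2) open_greaterThanLessThan] r(1)
    by (auto simp: subset_iff)
  have 3: "connected (J \<inter> {..t})" "connected (J \<inter> {t..})"
    using connected_Int_real[OF assms(2) convex_connected[OF convex_real_interval(2)]]
      connected_Int_real[OF assms(2) convex_connected[OF convex_real_interval(1)]] by simp_all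
  show "interval (J \<inter> {..t})" "interval (J \<inter> {t..})" using 2 3 unfolding interval_def by auto
qed

lemma ray_half_open:
  assumes "t \<in> I"
  shows "half_open_interval (I \<inter> {..t})" "half_open_interval (I \<inter> {t..})"
  using assms interval_I unfolding half_open_interval_def by blast+

lemma sym_diffeo:
  assumes S: "S g e J \<rho>" shows "analytic_diffeo \<rho> J (\<rho> ` J)"
proof -
  have i: "interval J" "interval I" using symD(11)[OF S] interval_I by (simp_all add: open_interval_def)
  have "matching n A I (\<lambda>t. act g (\<gamma> t)) I \<gamma> J \<rho>"
    by (rule matching_symmetry[OF S i(1) subset_refl symD(6,7)[OF S] i(2) subset_refl i(2) subset_refl])
  then show ?thesis unfolding matching_def by (elim conjE)
qed

lemma diffeo_open_symmetry:
  assumes "g \<in> carrier G" "open_interval J" "J \<subseteq> I" "open_interval J'" "J' \<subseteq> I" "analytic_diffeo \<rho> J J'"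
    "\<forall>t\<in>J. act g (\<gamma> t) = \<gamma> (\<rho> t)"
  obtains e where "S g e J \<rho>"
proof -
  have J: "interval J" "interior J = J" using assms(2) by (simp_all add: open_interval_def interior_open)
  have "\<rho> ` J = J'" using assms(6) by (simp add: analytic_diffeo_def bij_betw_def)
  then have im: "\<rho> ` J \<subseteq> I" using assms(5) by simp
  obtain e where "S g e (interior J) \<rho>"
    by (rule diffeo_symmetry[OF assms(1) J(1) assms(3) im assms(6,7)])
  then show thesis using J(2) that by simp
qed

section \<open>The decomposition at a reflection point\<close>

text \<open>The witness is the left half of the maximal reflection; \<open>reflection_domain\<close>
  supplies the boundary alternative and \<open>reflection_match\<close> the classification of all
  symmetries.\<close>

lemma tau_decomposition_exists:
  assumes \<tau>: "\<tau> \<in> I" and M: "max_symmetry g (-1) J \<rho>" "\<tau> \<in> J" "\<rho> \<tau> = \<tau>"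
    and mx: "\<And>B. maxint B \<longleftrightarrow> B = I \<inter> {..\<tau>} \<or> B = I \<inter> {\<tau>..}" and nf: "\<not> free I"
  shows "tau_decomposition n A G act I \<gamma> \<tau> (stab_class G act I \<gamma> g)"
proof -
  note S = max_symmetryD[OF M(1)]
  note SD = symD[OF S]
  let ?K = "J \<inter> {..\<tau>}"
  have SF: "SF (I \<inter> {..\<tau>})" "SF (I \<inter> {\<tau>..})" using mx by (auto intro: maxintD(4))
  note dom = reflection_domain[OF \<tau> M]
  note rays = ray_interval[OF open_I connected_I \<tau>]
  have "?K \<subseteq> I \<inter> {..\<tau>}" using SD(6) by auto
  then have mat: "matching n A (I \<inter> {..\<tau>}) (\<lambda>t. act g (\<gamma> t)) (I \<inter> {\<tau>..}) \<gamma> ?K \<rho>"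
    by (intro matching_symmetry[OF S ray_interval(1)[OF SD(3,4) M(2)] _ _ dom(2) rays(1) _ rays(2)]) auto
  have lead: "leads_to n A (I \<inter> {..\<tau>}) (\<lambda>t. act g (\<gamma> t)) (I \<inter> {\<tau>..}) \<gamma> ?K \<rho>"
    unfolding leads_to_def leads_to_at_boundary_def
    by (intro disjI1 conjI mat exI[of _ I] exI[of _ \<tau>] interval_I \<tau> refl M(3) dom(1)) (simp add: M(2))
  have g: "g \<notin> stab" using stab_decreasing relI[OF S M(2)] by blast
  have wh: "stab_class G act I \<gamma> g' = stab_class G act I \<gamma> \<one> \<and> extends_to J' \<rho>' (I \<inter> {..\<tau>}) id \<or>
      stab_class G act I \<gamma> g' = stab_class G act I \<gamma> g \<and> extends_to J' \<rho>' ?K \<rho>"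
    if g': "g' \<in> carrier G" and h: "open_interval J'" "J' \<subseteq> I \<inter> {..\<tau>}" "open_interval J''" "J'' \<subseteq> I"
      "analytic_diffeo \<rho>' J' J''" "\<forall>t\<in>J'. act g' (\<gamma> t) = \<gamma> (\<rho>' t)" for g' J' J'' \<rho>'
  proof -
    have JI: "J' \<subseteq> I" using h(2) by simp
    obtain e where S': "S g' e J' \<rho>'" by (rule diffeo_open_symmetry[OF g' h(1) JI h(3-6)])
    show ?thesis
      using reflection_match[OF \<tau> M SF S' h(2)]
    proof
      assume 1: "g' \<in> stab \<and> (\<forall>t\<in>J'. \<rho>' t = t)"
      have "extends_to J' \<rho>' (I \<inter> {..\<tau>}) id"
        by (rule extends_to_symmetry[OF S' sym_id JI]) (use 1 in auto)
      then show ?thesis using 1 stab_class_one_iff[OF g'] by simp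
    next
      assume 1: "inv g \<otimes> g' \<in> stab \<and> J' \<subseteq> J \<and> (\<forall>t\<in>J'. \<rho> t = \<rho>' t)"
      have "extends_to J' \<rho>' ?K \<rho>"
        by (rule extends_to_symmetry[OF S' S]) (use 1 in auto)
      then show ?thesis using 1 stab_class_eq_iff[OF SD(1) g'] by simp
    qed
  qed
  show ?thesis
    unfolding tau_decomposition_def maximal_interval_iff[OF nf]
  proof (intro conjI \<tau> allI mx bexI[of _ g] refl exI[of _ ?K] exI[of _ \<rho>] lead SD(1))
    show "stab_class G act I \<gamma> g \<noteq> stab_class G act I \<gamma> \<one>" using g stab_class_one_iff[OF SD(1)] by simp
    show "\<forall>g'\<in>carrier G. \<forall>J' J'' \<rho>'.
          open_interval J' \<and> J' \<subseteq> I \<inter> {..\<tau>} \<and> open_interval J'' \<and> J'' \<subseteq> I \<and>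
          analytic_diffeo \<rho>' J' J'' \<and> (\<forall>t\<in>J'. act g' (\<gamma> t) = \<gamma> (\<rho>' t)) \<longrightarrow>
          stab_class G act I \<gamma> g' = stab_class G act I \<gamma> \<one> \<and> extends_to J' \<rho>' (I \<inter> {..\<tau>}) id \<or>
          stab_class G act I \<gamma> g' = stab_class G act I \<gamma> g \<and> extends_to J' \<rho>' ?K \<rho>"
      by (intro ballI allI impI, elim conjE) (rule wh)
  qed
qed

text \<open>The maximal intervals determine \<open>\<tau>\<close>. For the class, the map of the
  second decomposition is fed into the classification clause of the first; its class being
  nontrivial, it must fall under the second alternative.\<close>

lemma tau_decomposition_unique:
  assumes T: "tau_decomposition n A G act I \<gamma> \<tau> c" "tau_decomposition n A G act I \<gamma> \<tau>' c'"
  shows "\<tau> = \<tau>'" "c = c'"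
proof -
  note t1 = T(1)[unfolded tau_decomposition_def] and t2 = T(2)[unfolded tau_decomposition_def]
  have \<tau>: "\<tau> \<in> I" "\<tau>' \<in> I" using conjunct1[OF t1] conjunct1[OF t2] .
  have "I \<inter> {..\<tau>} = I \<inter> {..\<tau>'} \<or> I \<inter> {..\<tau>} = I \<inter> {\<tau>'..}"
    by (rule iffD1[OF spec[OF conjunct1[OF conjunct2[OF t2]]] iffD2[OF spec[OF conjunct1[OF conjunct2[OF t1]]] disjI1[OF refl]]])
  then show eq: "\<tau> = \<tau>'"
  proof
    assume "I \<inter> {..\<tau>} = I \<inter> {..\<tau>'}"
    then have "\<tau> \<in> I \<inter> {..\<tau>'}" "\<tau>' \<in> I \<inter> {..\<tau>}" using \<tau> by auto
    then show ?thesis by simp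
  next
    \<comment> \<open>A left ray cannot equal a right ray: it would contain a point of
      \<open>I\<close> slightly left of \<open>\<tau>'\<close>.\<close>
    assume e: "I \<inter> {..\<tau>} = I \<inter> {\<tau>'..}"
    obtain r where r: "r > 0" "ball \<tau>' r \<subseteq> I" using open_I \<tau>(2) openE by blast
    then have u: "\<tau>' - r/2 \<in> I" by (auto simp: subset_iff dist_real_def)
    have "\<tau>' \<in> I \<inter> {..\<tau>}" using e \<tau>(2) by auto
    then have "\<tau>' - r/2 \<in> I \<inter> {..\<tau>}" using u r(1) by auto
    then show ?thesis using e r(1) by auto
  qed
  obtain g K \<mu> where g: "g \<in> carrier G" "c' = stab_class G act I \<gamma> g" "c' \<noteq> stab_class G act I \<gamma> \<one>"
    and lead: "leads_to n A (I \<inter> {..\<tau>'}) (\<lambda>t. act g (\<gamma> t)) (I \<inter> {\<tau>'..}) \<gamma> K \<mu>"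
    using conjunct2[OF conjunct2[OF t2]] by (elim bexE conjE exE) (rule that, assumption+)
  obtain K0 \<mu>0 where wh: "\<forall>g'\<in>carrier G. \<forall>J J' \<rho>.
          open_interval J \<and> J \<subseteq> I \<inter> {..\<tau>} \<and> open_interval J' \<and> J' \<subseteq> I \<and>
          analytic_diffeo \<rho> J J' \<and> (\<forall>t\<in>J. act g' (\<gamma> t) = \<gamma> (\<rho> t)) \<longrightarrow>
          stab_class G act I \<gamma> g' = stab_class G act I \<gamma> \<one> \<and> extends_to J \<rho> (I \<inter> {..\<tau>}) id \<or>
          stab_class G act I \<gamma> g' = c \<and> extends_to J \<rho> K0 \<mu>0"
    using conjunct2[OF conjunct2[OF t1]] by (elim bexE conjE exE) (rule that, assumption)
  have "\<not> compact (I \<inter> {..\<tau>'})" by (rule half_open_not_compact[OF ray_half_open(1)[OF \<tau>(2)]])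
  then have mat: "matching n A (I \<inter> {..\<tau>'}) (\<lambda>t. act g (\<gamma> t)) (I \<inter> {\<tau>'..}) \<gamma> K \<mu>"
    using lead unfolding leads_to_def leads_to_at_boundary_def leads_to_from_compact_def by argo
  have m: "K \<subseteq> I \<inter> {..\<tau>'}" "\<mu> ` K \<subseteq> I \<inter> {\<tau>'..}" "analytic_diffeo \<mu> K (\<mu> ` K)" "\<forall>t\<in>K. act g (\<gamma> t) = \<gamma> (\<mu> t)"
    using mat unfolding matching_def by - (elim conjE, assumption)+
  have K: "interval K" using m(3) unfolding analytic_diffeo_def by (rule conjunct1)
  have KI: "K \<subseteq> I" "\<mu> ` K \<subseteq> I" using m(1,2) by auto
  obtain e where S: "S g e (interior K) \<mu>" by (rule diffeo_symmetry[OF g(1) K KI m(3,4)])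
  have "interior K \<subseteq> I \<inter> {..\<tau>}" using m(1) interior_subset[of K] eq by auto
  then have pre: "open_interval (interior K) \<and> interior K \<subseteq> I \<inter> {..\<tau>} \<and> open_interval (\<mu> ` interior K) \<and>
      \<mu> ` interior K \<subseteq> I \<and> analytic_diffeo \<mu> (interior K) (\<mu> ` interior K) \<and>
      (\<forall>t\<in>interior K. act g (\<gamma> t) = \<gamma> (\<mu> t))"
    using symD(11,7)[OF S] sym_open_image[OF S] sym_diffeo[OF S] symD(10)[OF S] by simp
  have "stab_class G act I \<gamma> g = stab_class G act I \<gamma> \<one> \<or> stab_class G act I \<gamma> g = c"
    using bspec[OF wh g(1), THEN spec[of _ "interior K"], THEN spec[of _ "\<mu> ` interior K"], THEN spec[of _ \<mu>], THEN mp, OF pre]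
    by (elim disjE conjE) simp_all
  then show "c = c'" using g(2,3) by auto
qed

lemma tau_decomposition_not_compact:
  assumes T: "tau_decomposition n A G act I \<gamma> \<tau> c" and B: "compact_maximal_interval n A G act I \<gamma> B"
  shows False
proof -
  note t = T[unfolded tau_decomposition_def] and b = B[unfolded compact_maximal_interval_def]
  have "B = I \<inter> {..\<tau>} \<or> B = I \<inter> {\<tau>..}"
    by (rule iffD1[OF spec[OF conjunct1[OF conjunct2[OF t]]] conjunct2[OF b]])
  then show False
    using half_open_not_compact[of B] ray_half_open[OF conjunct1[OF t]] conjunct1[OF b] by auto
qed

section \<open>Existence of the decomposition for a compact maximal interval\<close>

lemma immersion_between:
  assumes "open_immersion 1 real_atlas K \<sigma>" "w \<in> K" "u \<in> K" "s \<in> closed_segment w u"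
  shows "\<sigma> s \<in> closed_segment (\<sigma> w) (\<sigma> u)"
proof -
  note K = iffD1[OF open_immersion_real_iff assms(1)]
  have cK: "connected K" using K by (simp add: open_interval_iff)
  have "convex K" by (rule iffD1[OF is_interval_convex_1 iffD2[OF is_interval_connected_1 cK]])
  then have sub: "closed_segment w u \<subseteq> K" by (rule closed_segment_subset[OF assms(2,3)])
  have "continuous_on K \<sigma>"
    by (intro continuous_at_imp_continuous_on ballI real_analytic_at_isCont) (use K in blast)
  then have "\<sigma> ` closed_segment w u = closed_segment (\<sigma> w) (\<sigma> u)"
    by (intro continuous_injective_image_segment_1 continuous_on_subset[OF _ sub]
        inj_on_subset[OF open_immersion_real_inj[OF assms(1)] sub])
  then show ?thesis using assms(4) by blast
qed

lemma piece_cong: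
  assumes lh: "lo < 0" "0 < hi" and k: "k \<in> insert 0 (index_set lo hi)"
    and eq: "\<And>j. j \<in> index_set lo hi \<Longrightarrow> a j = b j"
  shows "piece I lo hi a k = piece I lo hi b k"
proof (cases "k = 0")
  case True
  then show ?thesis using eq[OF index_set_mem(1)[OF lh]] eq[OF index_set_mem(2)[OF lh]] by (simp add: piece_def)
next
  case False
  then have k: "k \<in> index_set lo hi" using k by simp
  note Suc = index_set_Suc[OF lh k]
  show ?thesis
    using False eq[OF k] eq[OF Suc(1)] eq[OF Suc(2)] by (auto simp: piece_def)
qed

lemma segment_interval:
  fixes x y :: real
  shows "x < y \<Longrightarrow> interval {x..y}"
  by (simp add: interval_def)

text \<open>The two compact cases of the relation correspond to complete and incomplete translates:
  if the domain misses \<open>x\<close> or \<open>y\<close>, the piece is an outermost one, a ray of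
  \<open>I\<close>, and the domain within \<open>[x, y]\<close> is half-open at the missing
  end.\<close>

lemma dec_leads_to:
  assumes B: "maxint {x..y}" and xy: "x < y" and dec: "decomposes x y lo hi a g f J \<rho>"
    and k: "k \<in> index_set lo hi"
  shows "leads_to_from_compact n A {x..y} (\<lambda>t. act (g k) (\<gamma> t)) (piece I lo hi a k) \<gamma> (J k \<inter> {x..y}) (\<rho> k)"
proof -
  note D = decD[OF B xy dec]
  have k': "k \<in> insert 0 (index_set lo hi)" using k by simp
  note P = dec_piece[OF B xy dec k']
  note S = max_symmetryD[OF P(1)]
  note SD = symD[OF S]
  have k0: "k \<noteq> 0" using k by (simp add: index_set_def)
  have xyI': "{x..y} \<subseteq> I" by (rule maxintD(3)[OF B])
  have mat: "matching n A {x..y} (\<lambda>t. act (g k) (\<gamma> t)) (piece I lo hi a k) \<gamma> (J k \<inter> {x..y}) (\<rho> k)"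
    if K: "interval (J k \<inter> {x..y})"
  proof -
    have i: "interval I" using interval_I by (simp add: open_interval_def)
    have "\<rho> k ` (J k \<inter> {x..y}) \<subseteq> I" using SD(7) by auto
    then have "matching n A {x..y} (\<lambda>t. act (g k) (\<gamma> t)) I \<gamma> (J k \<inter> {x..y}) (\<rho> k)"
      by (intro matching_symmetry[OF S K _ _ _ segment_interval[OF xy] xyI' i subset_refl]) auto
    then have "interval (piece I lo hi a k)" unfolding matching_def analytic_diffeo_def P(2) by (elim conjE)
    moreover have "piece I lo hi a k \<subseteq> I" using SD(7) unfolding P(2) by auto
    ultimately show ?thesis
      by (intro matching_symmetry[OF S K _ _ _ segment_interval[OF xy] xyI']) (auto simp: P(2))
  qed
  have one: "x \<in> J k \<or> y \<in> J k" using k0 P(4,5) by (cases "0 < k") auto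
  show ?thesis
  proof (cases "x \<in> J k \<and> y \<in> J k")
    case True
    then have K: "J k \<inter> {x..y} = {x..y}" using sym_between[OF S, of x y] by auto
    have "compact (piece I lo hi a k)"
      unfolding P(2) K by (rule compact_continuous_image[OF continuous_on_subset[OF SD(8)] compact_Icc]) (use K in blast)
    then show ?thesis
      unfolding leads_to_from_compact_def
      using mat[unfolded K, OF segment_interval[OF xy]] P(2)[unfolded K] K by simp
  next
    case False
    then have last: "0 < k \<and> hi = Fin k \<or> k < 0 \<and> lo = Fin k" using P(3) by blast
    have "a k \<in> I" using k D(6) ends_in_I by blast
    moreover have "piece I lo hi a k = I \<inter> {a k..} \<or> piece I lo hi a k = I \<inter> {..a k}"
      using last by (auto simp: piece_def)
    ultimately have h: "half_open_interval (piece I lo hi a k)" using ray_half_open by metis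
    have K: "J k \<inter> {x..y} = J k \<inter> {x..} \<and> x \<in> J k \<and> y \<notin> J k \<or> J k \<inter> {x..y} = J k \<inter> {..y} \<and> y \<in> J k \<and> x \<notin> J k"
    proof (cases "x \<in> J k")
      case True
      then have "y \<notin> J k" using False by blast
      have "t \<le> y" if "t \<in> J k" for t
      proof (rule ccontr)
        assume "\<not> t \<le> y"
        then have "y \<in> J k" using sym_between[OF S True that, of y] xy by simp
        then show False using \<open>y \<notin> J k\<close> by simp
      qed
      then show ?thesis using True \<open>y \<notin> J k\<close> by auto
    next
      case x: False
      then have y: "y \<in> J k" using one by blast
      have "x \<le> t" if "t \<in> J k" for t
      proof (rule ccontr)
        assume "\<not> x \<le> t"
        then have "x \<in> J k" using sym_between[OF S that y, of x] xy by simp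
        then show False using x by simp
      qed
      then show ?thesis using x y by auto
    qed
    then have K12: "half_open_interval (J k \<inter> {x..y}) \<and> interval (J k \<inter> {x..y})"
    proof (elim disjE conjE)
      assume e: "J k \<inter> {x..y} = J k \<inter> {x..}" and x: "x \<in> J k"
      show ?thesis
        unfolding e half_open_interval_def
        by (rule conjI[OF _ ray_interval(2)[OF SD(3,4) x]], rule exI[of _ "J k"], rule exI[of _ x])
          (simp add: SD(11) x)
    next
      assume e: "J k \<inter> {x..y} = J k \<inter> {..y}" and y: "y \<in> J k"
      show ?thesis
        unfolding e half_open_interval_def
        by (rule conjI[OF _ ray_interval(1)[OF SD(3,4) y]], rule exI[of _ "J k"], rule exI[of _ y])
          (simp add: SD(11) y)
    qed
    note K1 = conjunct1[OF K12] and K2 = conjunct2[OF K12]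
    have K3: "J k \<inter> {x..y} \<subset> {x..y}"
    proof (rule psubsetI[OF Int_lower2], rule notI)
      assume e: "J k \<inter> {x..y} = {x..y}"
      have "x \<in> J k \<inter> {x..y}" "y \<in> J k \<inter> {x..y}" unfolding e using xy by simp_all
      then show False using False by simp
    qed
    have "Inf {x..y} = x" "Sup {x..y} = y" using xy by simp_all
    then have K4: "Inf {x..y} \<in> J k \<inter> {x..y} \<or> Sup {x..y} \<in> J k \<inter> {x..y}" using one xy by simp
    have "compact {x..y} \<and> J k \<inter> {x..y} \<subset> {x..y} \<and> half_open_interval (J k \<inter> {x..y}) \<and>
        half_open_interval (piece I lo hi a k) \<and> piece I lo hi a k = \<rho> k ` (J k \<inter> {x..y}) \<and>
        (Inf {x..y} \<in> J k \<inter> {x..y} \<or> Sup {x..y} \<in> J k \<inter> {x..y})"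
      by (rule conjI[OF compact_Icc], rule conjI[OF K3], rule conjI[OF K1], rule conjI[OF h], rule conjI[OF P(2) K4])
    then show ?thesis
      unfolding leads_to_from_compact_def by (rule conjI[OF mat[OF K2] disjI2])
  qed
qed

text \<open>\<open>dec_match\<close> provides an index for a given symmetry. Uniqueness is subtler,
  since a second index \<open>m\<close> is only known through an analytic \<open>\<sigma>\<close>
  that agrees with \<open>\<rho> m\<close> on its part of \<open>[x, y]\<close> and with
  \<open>\<rho>'\<close> on \<open>J'\<close>, and these sets could be disjoint a priori. Following
  \<open>\<rho> m\<close> along \<open>\<sigma>\<close> shows that they meet, and pieces share only
  ends.\<close>

lemma dec_A_decomposition:
  assumes B: "maxint {x..y}" and xy: "x < y" and dec: "decomposes x y lo hi a g f J \<rho>" and nf: "\<not> free I"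
  shows "A_decomposition n A G act I \<gamma> {x..y} lo hi (restrict a (index_set lo hi))
      (restrict (\<lambda>k. stab_class G act I \<gamma> (g k)) (index_set lo hi))"
proof -
  note D = decD[OF B xy dec]
  note P = dec_piece[OF B xy dec]
  let ?i = "index_set lo hi" and ?a = "restrict a (index_set lo hi)"
    and ?c = "restrict (\<lambda>k. stab_class G act I \<gamma> (g k)) (index_set lo hi)"
  note one = index_set_mem[OF D(1,2)]
  have pc: "piece I lo hi ?a k = piece I lo hi a k" if "k \<in> insert 0 ?i" for k
    by (rule piece_cong[OF D(1,2) that]) simp
  have S: "S (g k) (f k) (J k) (\<rho> k)" if "k \<in> insert 0 ?i" for k by (rule max_symmetryD[OF P(1)[OF that]])
  have gc: "g k \<in> carrier G" if "k \<in> insert 0 ?i" for k by (rule symD(1)[OF S[OF that]])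
  have xyI': "{x..y} \<subseteq> I" by (rule maxintD(3)[OF B])
  have lead: "g k \<in> carrier G \<and> ?c k = stab_class G act I \<gamma> (g k) \<and>
      leads_to n A {x..y} (\<lambda>t. act (g k) (\<gamma> t)) (piece I lo hi ?a k) \<gamma> (J k \<inter> {x..y}) (\<rho> k)" if k: "k \<in> ?i" for k
    using dec_leads_to[OF B xy dec k] gc[of k] pc[of k] k unfolding leads_to_def by simp
  have wh: "\<exists>!k. k \<in> insert 0 ?i \<and> stab_class G act I \<gamma> g' = stab_class G act I \<gamma> (g k) \<and>
      extends_to J' \<rho>' (J k \<inter> {x..y}) (\<rho> k)"
    if g': "g' \<in> carrier G" and h: "open_interval J'" "J' \<subseteq> {x..y}" "open_interval J''" "J'' \<subseteq> I"
      "analytic_diffeo \<rho>' J' J''" "\<forall>t\<in>J'. act g' (\<gamma> t) = \<gamma> (\<rho>' t)" for g' J' J'' \<rho>'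
  proof -
    have JI: "J' \<subseteq> I" using h(2) xyI' by simp
    obtain e where S': "S g' e J' \<rho>'" by (rule diffeo_open_symmetry[OF g' h(1) JI h(3-6)])
    obtain k where k: "k \<in> insert 0 ?i" "inv (g k) \<otimes> g' \<in> stab" "J' \<subseteq> J k" "\<forall>t\<in>J'. \<rho> k t = \<rho>' t"
      by (rule dec_match[OF B xy dec S' h(2)]) (rule that, auto)
    have ek: "extends_to J' \<rho>' (J k \<inter> {x..y}) (\<rho> k)"
      by (rule extends_to_symmetry[OF S' S[OF k(1)] k(3)]) (use k(4) in auto)
    have ck: "stab_class G act I \<gamma> g' = stab_class G act I \<gamma> (g k)"
      using k(2) stab_class_eq_iff[OF gc[OF k(1)] g'] by simp
    show ?thesis
    proof (rule ex1I[of _ k])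
      show "k \<in> insert 0 ?i \<and> stab_class G act I \<gamma> g' = stab_class G act I \<gamma> (g k) \<and>
          extends_to J' \<rho>' (J k \<inter> {x..y}) (\<rho> k)" using k(1) ck ek by blast
    next
      fix m assume m: "m \<in> insert 0 ?i \<and> stab_class G act I \<gamma> g' = stab_class G act I \<gamma> (g m) \<and>
          extends_to J' \<rho>' (J m \<inter> {x..y}) (\<rho> m)"
      then have mi: "m \<in> insert 0 ?i" and em: "extends_to J' \<rho>' (J m \<inter> {x..y}) (\<rho> m)" by simp_all
      note SD = symD[OF S[OF mi]]
      obtain K \<sigma> where K: "open_immersion 1 real_atlas K \<sigma>" "J' \<subseteq> K" "J m \<inter> {x..y} \<subseteq> K"
          "\<forall>t\<in>J'. \<sigma> t = \<rho>' t" "\<forall>t\<in>J m \<inter> {x..y}. \<sigma> t = \<rho> m t"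
        by (rule extends_toD[OF em]) (rule that, auto)
      obtain u where u: "u \<in> J'" using symD(5)[OF S'] by blast
      have ui: "x < u" "u < y" by (rule sym_inside[OF B xy dec S' h(2) u])+
      have "\<exists>w. w \<in> J m \<and> x \<le> w \<and> w \<le> y"
      proof (cases "m = 0")
        case True
        then show ?thesis using D(9) xyI(1)[OF B xy] xy by force
      next
        case False
        then have "x \<in> J m \<or> y \<in> J m" using P(4,5)[OF mi] by (cases "0 < m") auto
        then show ?thesis using xy by (metis order.refl less_imp_le)
      qed
      then obtain w where w: "w \<in> J m" "x \<le> w" "w \<le> y" by blast
      have wK: "w \<in> K" "\<sigma> w = \<rho> m w" using w K(3,5) by auto
      have uK: "u \<in> K" "\<sigma> u = \<rho>' u" using u K(2,4) by auto
      have mm: "min (\<rho> m w) (\<rho>' u) \<in> I" "max (\<rho> m w) (\<rho>' u) \<in> I"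
        using SD(13)[OF w(1)] symD(13)[OF S' u] by (auto simp: min_def max_def)
      \<comment> \<open>Between \<open>w\<close> and \<open>u\<close> the values of
        \<open>\<rho> m\<close> coincide with those of the monotone \<open>\<sigma>\<close>, so they
        stay in a compact part of \<open>I\<close> and maximality carries the domain to
        \<open>u\<close>.\<close>
      have uJ: "u \<in> J m"
      proof (rule max_symmetry_walk[OF P(1)[OF mi] w(1) symD(12)[OF S' u] mm])
        fix s assume s: "s \<in> J m" "s \<in> closed_segment w u"
        have "s \<in> {x..y}" using s(2) w ui by (auto simp: closed_segment_eq_real_ivl split: if_splits)
        then have "\<sigma> s = \<rho> m s" using K(5) s(1) by blast
        then have "\<rho> m s \<in> closed_segment (\<rho> m w) (\<rho>' u)"
          using immersion_between[OF K(1) wK(1) uK(1) s(2)] wK(2) uK(2) by simp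
        then show "min (\<rho> m w) (\<rho>' u) \<le> \<rho> m s \<and> \<rho> m s \<le> max (\<rho> m w) (\<rho>' u)"
          by (auto simp: closed_segment_eq_real_ivl split: if_splits)
      qed
      have "\<rho> m u = \<rho> k u" using K(5) uJ ui uK(2) k(4) u by auto
      then show "m = k" using dec_index_unique[OF B xy dec mi k(1) uJ _ _ ui] k(3) u by auto
    qed
  qed
  show ?thesis
    unfolding A_decomposition_def
  proof (intro conjI D(1,2) exI[of _ g] exI[of _ "\<lambda>k. J k \<inter> {x..y}"] exI[of _ \<rho>] restrict_extensional D(8,10))
    show "?a ` ?i \<subseteq> I" using D(6) ends_in_I[of x y] by auto
    show "strict_mono_on ?i ?a" using D(5) by (auto simp: strict_mono_on_def)
    show "{x..y} = {?a (-1)..?a 1}" using one D(3,4) by simp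
    show "?c (-1) \<noteq> stab_class G act I \<gamma> \<one>" "?c 1 \<noteq> stab_class G act I \<gamma> \<one>"
      using one dec_neighbours_nontrivial[OF B xy dec nf] stab_class_one_iff[OF gc] by simp_all
    show "I = (\<Union>k\<in>insert 0 ?i. piece I lo hi ?a k)"
      by (rule trans[OF D(7) SUP_cong[OF refl pc[symmetric]]])
    show "J 0 \<inter> {x..y} = {x..y}" using D(9) xyI' by auto
    show "\<forall>k\<in>?i. g k \<in> carrier G \<and> ?c k = stab_class G act I \<gamma> (g k) \<and>
        leads_to n A {x..y} (\<lambda>t. act (g k) (\<gamma> t)) (piece I lo hi ?a k) \<gamma> (J k \<inter> {x..y}) (\<rho> k)"
      using lead by (intro ballI)
    show "\<forall>g'\<in>carrier G. \<forall>J' J'' \<rho>'.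
        open_interval J' \<and> J' \<subseteq> {x..y} \<and> open_interval J'' \<and> J'' \<subseteq> I \<and>
        analytic_diffeo \<rho>' J' J'' \<and> (\<forall>t\<in>J'. act g' (\<gamma> t) = \<gamma> (\<rho>' t)) \<longrightarrow>
        (\<exists>!k. k \<in> insert 0 ?i \<and> stab_class G act I \<gamma> g' = stab_class G act I \<gamma> (g k) \<and>
           extends_to J' \<rho>' (J k \<inter> {x..y}) (\<rho> k))"
      by (intro ballI allI impI, elim conjE) (rule wh)
  qed
qed

section \<open>Uniqueness of the decomposition for a compact maximal interval\<close>

lemma leads_to_symmetry:
  assumes h: "h \<in> carrier G" and xyI': "{x..y} \<subseteq> I" and DI: "D \<subseteq> I"
    and L: "leads_to_from_compact n A {x..y} (\<lambda>t. act h (\<gamma> t)) D \<gamma> K \<mu>"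
  obtains e where "S h e (interior K) \<mu>" "e = 1 \<or> e = -1" "\<forall>s\<in>K. \<forall>t\<in>K. s < t \<longrightarrow> e * \<mu> s < e * \<mu> t"
    "continuous_on K \<mu>" "interval K" "K \<subseteq> {x..y}" "D = \<mu> ` K" "K = {x..y} \<or> half_open_interval D"
proof -
  have m: "K \<subseteq> {x..y}" "analytic_diffeo \<mu> K (\<mu> ` K)" "\<forall>t\<in>K. act h (\<gamma> t) = \<gamma> (\<mu> t)"
    using L unfolding leads_to_from_compact_def matching_def by - (elim conjE, assumption)+
  have D: "D = \<mu> ` K" and alt: "K = {x..y} \<or> half_open_interval D"
    using conjunct2[OF L[unfolded leads_to_from_compact_def]] by auto
  have K: "interval K" using m(2) unfolding analytic_diffeo_def by (rule conjunct1)
  have KI: "K \<subseteq> I" "\<mu> ` K \<subseteq> I" using m(1) xyI' D DI by auto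
  obtain e where "S h e (interior K) \<mu>" "e = 1 \<or> e = -1" "\<forall>s\<in>K. \<forall>t\<in>K. s < t \<longrightarrow> e * \<mu> s < e * \<mu> t"
    "continuous_on K \<mu>"
    by (rule diffeo_symmetry[OF h K KI m(2,3)])
  then show thesis by (rule that) (rule K m(1) D alt)+
qed

text \<open>The boundary case has a half-open source, which is not compact.\<close>

lemma leads_to_compact_source:
  assumes "leads_to n A {x..y} \<gamma>' D \<gamma> K \<mu>"
  shows "leads_to_from_compact n A {x..y} \<gamma>' D \<gamma> K \<mu>"
proof -
  have "\<not> leads_to_at_boundary n A {x..y} \<gamma>' D \<gamma> K \<mu>"
  proof
    assume "leads_to_at_boundary n A {x..y} \<gamma>' D \<gamma> K \<mu>"
    then have "half_open_interval {x..y}"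
      unfolding leads_to_at_boundary_def half_open_interval_def by blast
    then show False using half_open_not_compact compact_Icc by blast
  qed
  then show ?thesis using assms unfolding leads_to_def by blast
qed

text \<open>The values on the open interval stay in \<open>[p, q]\<close>, so the maximal symmetry
  extending \<open>\<mu>\<close> is defined at \<open>x\<close> and \<open>y\<close>; continuity
  identifies its values there with those of \<open>\<mu>\<close>.\<close>

lemma compact_symmetry_ends:
  assumes S: "S h e {x<..<y} \<mu>" and xy: "x < y" "{x..y} \<subseteq> I" and c: "continuous_on {x..y} \<mu>"
    and pq: "p \<in> I" "q \<in> I" "\<mu> ` {x..y} \<subseteq> {p..q}"
  shows "rel h e x (\<mu> x)" "rel h e y (\<mu> y)"
proof -
  let ?m = "(x + y) / 2"
  have m: "?m \<in> {x<..<y}" using xy(1) by simp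
  obtain J \<rho> where M: "max_symmetry h e J \<rho>" "?m \<in> J" "\<rho> ?m = \<mu> ?m" by (rule rel_max[OF relI[OF S m]])
  note SJ = max_symmetryD[OF M(1)]
  have st: "inv h \<otimes> h \<in> stab"
    using stab_class_eq_iff[OF symD(1)[OF S] symD(1)[OF S]] by blast
  have sub: "{x<..<y} \<subseteq> J" and eq: "\<And>t. t \<in> {x<..<y} \<Longrightarrow> \<rho> t = \<mu> t"
    by (rule max_symmetry_mono(1)[OF M(1) S st M(2) m M(3)], rule max_symmetry_mono(2)[OF M(1) S st M(2) m M(3)])
  have end_in: "c \<in> J" if c: "c = x \<or> c = y" for c
  proof (rule ccontr)
    assume nc: "c \<notin> J"
    have "c \<in> J"
    proof (rule max_symmetry_walk[OF M(1,2) _ pq(1,2)])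
      show "c \<in> I" using c xy by auto
      fix s assume s: "s \<in> J" "s \<in> closed_segment ?m c"
      have "s \<noteq> c" using s(1) nc by blast
      then have "s \<in> {x<..<y}" using s(2) c xy(1) by (auto simp: closed_segment_eq_real_ivl split: if_splits)
      then have "s \<in> {x..y}" by simp
      then have "\<mu> s \<in> {p..q}" by (rule subsetD[OF pq(3) imageI])
      moreover have "\<rho> s = \<mu> s" by (rule eq[OF \<open>s \<in> {x<..<y}\<close>])
      ultimately show "p \<le> \<rho> s \<and> \<rho> s \<le> q" by simp
    qed
    then show False using nc by blast
  qed
  have J: "{x..y} \<subseteq> J" using sym_between[OF SJ end_in[of x] end_in[of y]] by auto
  have cl: "closure {x<..<y} = {x..y}" using xy(1) by simp
  have "continuous_on (closure {x<..<y}) (\<lambda>t. \<rho> t - \<mu> t)"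
    unfolding cl by (intro continuous_on_diff c continuous_on_subset[OF symD(8)[OF SJ] J])
  then have e: "\<rho> t - \<mu> t = 0" if "t \<in> {x..y}" for t
    by (rule continuous_constant_on_closure[where S = "{x<..<y}"]) (use eq that cl in auto)
  have "rel h e x (\<rho> x)" "rel h e y (\<rho> y)" using relI[OF SJ] end_in by blast+
  then show "rel h e x (\<mu> x)" "rel h e y (\<mu> y)" using e[of x] e[of y] xy(1) by simp_all
qed

text \<open>A compact target excludes the half-open case, so \<open>\<mu>\<close> is defined on all
  of \<open>[x, y]\<close> and its monotonicity sends end points to end points.\<close>

lemma compact_piece_ends:
  assumes h: "h \<in> carrier G" and xy: "x < y" "{x..y} \<subseteq> I" and pq: "p < q" "{p..q} \<subseteq> I"
    and L: "leads_to_from_compact n A {x..y} (\<lambda>t. act h (\<gamma> t)) {p..q} \<gamma> K \<mu>"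
  shows "p \<in> ends x y" "q \<in> ends x y"
proof -
  obtain e where S: "S h e (interior K) \<mu>" and e: "e = 1 \<or> e = -1"
    and mono: "\<forall>s\<in>K. \<forall>t\<in>K. s < t \<longrightarrow> e * \<mu> s < e * \<mu> t" and c: "continuous_on K \<mu>"
    and D: "{p..q} = \<mu> ` K" and alt: "K = {x..y} \<or> half_open_interval {p..q}"
    by (rule leads_to_symmetry[OF h xy(2) pq(2) L])
  have K: "K = {x..y}" using alt half_open_not_compact compact_Icc by blast
  have pqI: "p \<in> I" "q \<in> I" using pq by auto
  have SK: "S h e {x<..<y} \<mu>" using S unfolding K by simp
  have im: "\<mu> ` {x..y} \<subseteq> {p..q}" using D unfolding K by simp
  note R = compact_symmetry_ends[OF SK xy c[unfolded K] pqI im]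
  have le: "e * \<mu> x \<le> e * \<mu> t \<and> e * \<mu> t \<le> e * \<mu> y" if "t \<in> {x..y}" for t
    using mono[rule_format, of x t] mono[rule_format, of t y] that xy(1) unfolding K
    by (cases "t = x"; cases "t = y") (auto simp: less_imp_le)
  note D' = D[unfolded K]
  have "p \<in> {p..q}" "q \<in> {p..q}" using pq(1) by simp_all
  then have pq': "p \<in> \<mu> ` {x..y}" "q \<in> \<mu> ` {x..y}" unfolding D' .
  obtain s where s: "p = \<mu> s" "s \<in> {x..y}" using pq'(1) by (rule imageE)
  obtain t where t: "q = \<mu> t" "t \<in> {x..y}" using pq'(2) by (rule imageE)
  note st = s(2) t(2) s(1) t(1)
  have "\<mu> x \<in> \<mu> ` {x..y}" "\<mu> y \<in> \<mu> ` {x..y}" using xy(1) by simp_all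
  then have b: "p \<le> \<mu> x" "\<mu> x \<le> q" "p \<le> \<mu> y" "\<mu> y \<le> q" unfolding D'[symmetric] by simp_all
  have "p = \<mu> x \<and> q = \<mu> y \<or> p = \<mu> y \<and> q = \<mu> x"
    using e le[OF st(1)] le[OF st(2)] b st(3,4) by auto
  then show "p \<in> ends x y" "q \<in> ends x y" using R unfolding ends_def by auto
qed

text \<open>The division points of any decomposition are exactly the \<open>ends\<close>, hence
  bounds and points are forced by the uniqueness of enumerations. The class at each index is read
  off from the piece into which the symmetry maps.\<close>

lemma A_decomposition_unique:
  assumes B: "maxint {x..y}" and xy: "x < y" and dec: "decomposes x y lo hi a g f J \<rho>"
    and T: "A_decomposition n A G act I \<gamma> {x..y} lo' hi' a' c'"
  shows "lo' = lo" "hi' = hi" "a' = restrict a (index_set lo hi)"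
    "c' = restrict (\<lambda>k. stab_class G act I \<gamma> (g k)) (index_set lo hi)"
proof -
  note D = decD[OF B xy dec]
  note P = dec_piece[OF B xy dec]
  let ?i = "index_set lo hi" and ?i' = "index_set lo' hi'"
  have xyI': "{x..y} \<subseteq> I" by (rule maxintD(3)[OF B])
  have T1: "lo' < 0" "0 < hi'" "a' \<in> extensional ?i'" "c' \<in> extensional ?i'" "a' ` ?i' \<subseteq> I"
      "strict_mono_on ?i' a'" "{x..y} = {a' (-1)..a' 1}" "I = (\<Union>k\<in>insert 0 ?i'. piece I lo' hi' a' k)"
    using T unfolding A_decomposition_def by - (elim conjE, assumption)+
  have "\<exists>g' K \<mu>. \<forall>k\<in>?i'. g' k \<in> carrier G \<and> c' k = stab_class G act I \<gamma> (g' k) \<and>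
      leads_to n A {x..y} (\<lambda>t. act (g' k) (\<gamma> t)) (piece I lo' hi' a' k) \<gamma> (K k) (\<mu> k)"
    using T unfolding A_decomposition_def by (elim conjE exE) (intro exI, assumption)
  then obtain g' K \<mu> where T20: "\<forall>k\<in>?i'. g' k \<in> carrier G \<and> c' k = stab_class G act I \<gamma> (g' k) \<and>
      leads_to n A {x..y} (\<lambda>t. act (g' k) (\<gamma> t)) (piece I lo' hi' a' k) \<gamma> (K k) (\<mu> k)"
    by (elim exE) (rule that)
  have T2: "g' k \<in> carrier G" "c' k = stab_class G act I \<gamma> (g' k)"
      "leads_to n A {x..y} (\<lambda>t. act (g' k) (\<gamma> t)) (piece I lo' hi' a' k) \<gamma> (K k) (\<mu> k)" if "k \<in> ?i'" for k
    using bspec[OF T20 that] by simp_all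
  note L = leads_to_compact_source[OF T2(3)]
  note one = index_set_mem[OF T1(1,2)]
  note Suc' = index_set_Suc[OF T1(1,2)]
  have mono: "a' i < a' j" if "i \<in> ?i'" "j \<in> ?i'" "i < j" for i j using T1(6) that by (auto simp: strict_mono_on_def)
  have aI: "a' k \<in> I" if "k \<in> ?i'" for k using T1(5) that by blast
  have ax: "a' (-1) = x" "a' 1 = y" using T1(7) xy by (auto simp: Icc_eq_Icc)
  have pI: "piece I lo' hi' a' k \<subseteq> I" if "k \<in> ?i'" for k using T1(8) that by blast
  \<comment> \<open>Apart from \<open>x\<close> and \<open>y\<close> themselves, each division point
    is the outer end of the neighbouring piece closer to \<open>[x, y]\<close>, which is compact
    since it is not the last one.\<close>
  have e1: "a' k \<in> ends x y" if k: "k \<in> ?i'" for k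
  proof -
    have k0: "k \<noteq> 0" using k by (simp add: index_set_def)
    consider "k = 1 \<or> k = -1" | "1 < k" | "k < -1" using k0 by linarith
    then show ?thesis
    proof cases
      case 1
      then show ?thesis using ax ends_xy[OF B xy] by auto
    next
      case 2
      have j: "k - 1 \<in> ?i'" using index_set_between(1)[OF T1(1,2) k, of "k - 1"] 2 by simp
      have "hi' \<noteq> Fin (k - 1)" using index_set_last(1)[of hi' "k - 1" k] k by fastforce
      then have p: "piece I lo' hi' a' (k - 1) = {a' (k - 1)..a' k}" using 2 by (simp add: piece_def)
      show ?thesis
        by (rule compact_piece_ends(2)[OF T2(1)[OF j] xy xyI' mono[OF j k] _ L[OF j, unfolded p]])
          (use pI[OF j] p in auto)
    next
      case 3
      have j: "k + 1 \<in> ?i'" using index_set_between(2)[OF T1(1,2) k, of "k + 1"] 3 by simp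
      have "lo' \<noteq> Fin (k + 1)" using index_set_last(2)[of lo' "k + 1" k] k by fastforce
      then have p: "piece I lo' hi' a' (k + 1) = {a' k..a' (k + 1)}" using 3 by (simp add: piece_def)
      show ?thesis
        by (rule compact_piece_ends(1)[OF T2(1)[OF j] xy xyI' mono[OF k j] _ L[OF j, unfolded p]])
          (use pI[OF j] p in auto)
    qed
  qed
  \<comment> \<open>On a piece that is a ray of \<open>I\<close>, openness of \<open>I\<close>
    supplies the point on the unbounded side.\<close>
  have inner: "\<exists>d1\<in>piece I lo' hi' a' k. \<exists>d2\<in>piece I lo' hi' a' k. d1 < d \<and> d < d2"
    if k: "k \<in> ?i'" and d: "d \<in> piece I lo' hi' a' k" "d \<notin> a' ` ?i'" for k d
  proof -
    have k0: "k \<noteq> 0" using k by (simp add: index_set_def)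
    have dI: "d \<in> I" using pI[OF k] d(1) by blast
    obtain r where r: "r > 0" "ball d r \<subseteq> I" using open_I dI openE by blast
    then have dr: "d - r/2 \<in> I" "d + r/2 \<in> I" by (auto simp: subset_iff dist_real_def)
    have dk: "d \<noteq> a' k" using d(2) k by blast
    consider "k < 0" "lo' = Fin k" | "k < 0" "lo' \<noteq> Fin k" | "0 < k" "hi' = Fin k" | "0 < k" "hi' \<noteq> Fin k"
      using k0 by linarith
    then show ?thesis
    proof cases
      case 1
      then have p: "piece I lo' hi' a' k = I \<inter> {..a' k}" by (simp add: piece_def)
      show ?thesis unfolding p
        by (intro bexI[of _ "d - r/2"] bexI[of _ "a' k"]) (use d(1) dk dr r(1) aI[OF k] in \<open>auto simp: p\<close>)
    next
      case 2
      then have p: "piece I lo' hi' a' k = {a' (k - 1)..a' k}" by (simp add: piece_def)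
      have j: "k - 1 \<in> ?i'" using Suc'(2)[OF k] 2 by simp
      have "d \<noteq> a' (k - 1)" using d(2) j by blast
      then show ?thesis unfolding p
        by (intro bexI[of _ "a' (k - 1)"] bexI[of _ "a' k"]) (use d(1) dk mono[OF j k] in \<open>auto simp: p\<close>)
    next
      case 3
      then have p: "piece I lo' hi' a' k = I \<inter> {a' k..}" by (simp add: piece_def)
      show ?thesis unfolding p
        by (intro bexI[of _ "a' k"] bexI[of _ "d + r/2"]) (use d(1) dk dr r(1) aI[OF k] in \<open>auto simp: p\<close>)
    next
      case 4
      then have p: "piece I lo' hi' a' k = {a' k..a' (k + 1)}" by (simp add: piece_def)
      have j: "k + 1 \<in> ?i'" using Suc'(1)[OF k] 4 by simp
      have "d \<noteq> a' (k + 1)" using d(2) j by blast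
      then show ?thesis unfolding p
        by (intro bexI[of _ "a' k"] bexI[of _ "a' (k + 1)"]) (use d(1) dk mono[OF k j] in \<open>auto simp: p\<close>)
    qed
  qed
  \<comment> \<open>An end that is no division point would be the image of a parameter strictly
    between \<open>x\<close> and \<open>y\<close>, and those are never related to ends.\<close>
  have e2: "d \<in> a' ` ?i'" if dE: "d \<in> ends x y" for d
  proof (rule ccontr)
    assume nd: "d \<notin> a' ` ?i'"
    have dI: "d \<in> I" using dE ends_in_I by blast
    then obtain k where k: "k \<in> insert 0 ?i'" "d \<in> piece I lo' hi' a' k" using T1(8) by blast
    show False
    proof (cases "k = 0")
      case True
      then have "d \<in> {x..y}" using k(2) T1(7) by (simp add: piece_def)
      moreover have "d \<noteq> x" "d \<noteq> y" using nd one ax by auto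
      ultimately have "x < d" "d < y" by auto
      then show False using interior_not_end[OF B xy rel_id[OF dI]] dE by blast
    next
      case False
      then have ki: "k \<in> ?i'" using k(1) by simp
      obtain e where S: "S (g' k) e (interior (K k)) (\<mu> k)" and e: "e = 1 \<or> e = -1"
        and mn: "\<forall>s\<in>K k. \<forall>t\<in>K k. s < t \<longrightarrow> e * \<mu> k s < e * \<mu> k t"
        and K: "interval (K k)" "K k \<subseteq> {x..y}" "piece I lo' hi' a' k = \<mu> k ` K k"
        by (rule leads_to_symmetry[OF T2(1)[OF ki] xyI' pI[OF ki] L[OF ki]])
      obtain d1 d2 where d12: "d1 \<in> \<mu> k ` K k" "d2 \<in> \<mu> k ` K k" "d1 < d" "d < d2"
        using inner[OF ki k(2) nd] K(3) by auto
      then obtain s1 s2 s where s: "s1 \<in> K k" "s2 \<in> K k" "s \<in> K k" "\<mu> k s1 < \<mu> k s" "\<mu> k s < \<mu> k s2" "d = \<mu> k s"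
        using k(2) K(3) by auto
      have lt: "u < v" if "u \<in> K k" "v \<in> K k" "e * \<mu> k u < e * \<mu> k v" for u v
        using mn[rule_format, OF that(2,1)] that(3) by (cases u v rule: linorder_cases) auto
      have "s1 < s \<and> s < s2 \<or> s2 < s \<and> s < s1"
        using e s(4,5) lt[OF s(1,3)] lt[OF s(3,2)] lt[OF s(2,3)] lt[OF s(3,1)] by auto
      then obtain u v where uv: "u \<in> K k" "v \<in> K k" "u < s" "s < v"
        using s(1,2) by (elim disjE conjE) (rule that, assumption+)+
      have cK: "connected (K k)" using K(1) by (simp add: interval_def)
      have "{u<..<v} \<subseteq> K k"
      proof
        fix w assume w: "w \<in> {u<..<v}"
        show "w \<in> K k" by (rule connected_real_between[OF cK uv(1,2)]) (use w in simp_all)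
      qed
      then have "{u<..<v} \<subseteq> interior (K k)" by (rule interior_maximal[OF _ open_greaterThanLessThan])
      moreover have "s \<in> {u<..<v}" using uv(3,4) by simp
      ultimately have si: "s \<in> interior (K k)" by (rule subsetD)
      have R: "rel (g' k) e s d" using relI[OF S si] s(6) by simp
      have "s \<in> interior {x..y}" by (rule subsetD[OF interior_mono[OF K(2)] si])
      then have "x < s" "s < y" by simp_all
      then have "d \<notin> ends x y" by (rule interior_not_end[OF B xy R])
      then show False using dE by (rule notE)
    qed
  qed
  have img: "a ` ?i = a' ` ?i'" unfolding D(6) using e1 e2 by blast
  have q: "a 1 = a' 1" "a (-1) = a' (-1)" using D(3,4) ax by simp_all
  have idx: "?i = ?i'" by (rule index_set_enumeration_unique(1)[OF D(1,2,5) T1(1,2,6) img q])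
  have aeq: "a k = a' k" if "k \<in> ?i" for k
    by (rule index_set_enumeration_unique(2)[OF D(1,2,5) T1(1,2,6) img q that])
  show lo: "lo' = lo" and hi: "hi' = hi" using index_set_bounds_unique[OF D(1,2) T1(1,2) idx] by simp_all
  show "a' = restrict a ?i"
    by (rule extensionalityI[OF T1(3)[folded idx] restrict_extensional]) (simp add: aeq)
  show "c' = restrict (\<lambda>k. stab_class G act I \<gamma> (g k)) ?i"
  proof (rule extensionalityI[OF T1(4)[folded idx] restrict_extensional])
    fix k assume k: "k \<in> ?i"
    then have ki: "k \<in> ?i'" and k': "k \<in> insert 0 ?i" using idx by auto
    obtain e where S: "S (g' k) e (interior (K k)) (\<mu> k)"
      and K: "K k \<subseteq> {x..y}" "piece I lo' hi' a' k = \<mu> k ` K k"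
      by (rule leads_to_symmetry[OF T2(1)[OF ki] xyI' pI[OF ki] L[OF ki]])
    have iK: "interior (K k) \<subseteq> {x..y}" using interior_subset[of "K k"] K(1) by blast
    obtain m where m: "m \<in> insert 0 ?i" "inv (g m) \<otimes> g' k \<in> stab" "interior (K k) \<subseteq> J m"
        "\<forall>t\<in>interior (K k). \<rho> m t = \<mu> k t"
      by (rule dec_match[OF B xy dec S iK]) (rule that, auto)
    obtain t where t: "t \<in> interior (K k)" using symD(5)[OF S] by blast
    have "\<mu> k t \<in> \<rho> m ` (J m \<inter> {x..y})" using m(3,4) t iK by (metis Int_iff imageI subsetD)
    then have 1: "\<mu> k t \<in> piece I lo hi a m" using P(2)[OF m(1)] by simp
    have "\<mu> k t \<in> piece I lo' hi' a' k" unfolding K(2) using t interior_subset by blast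
    then have 2: "\<mu> k t \<in> piece I lo hi a k" unfolding lo hi using piece_cong[OF D(1,2) k', of a a'] aeq by simp
    have "m = k" by (rule dec_pieces_disjoint[OF B xy dec m(1) k' 1 2 sym_inside(3)[OF B xy dec S iK t]])
    then have "stab_class G act I \<gamma> (g' k) = stab_class G act I \<gamma> (g k)"
      using m(2) stab_class_eq_iff[OF symD(1)[OF max_symmetryD[OF P(1)[OF k']]] T2(1)[OF ki]] by simp
    then show "c' k = restrict (\<lambda>k. stab_class G act I \<gamma> (g k)) ?i k" using T2(2)[OF ki] k by simp
  qed
qed

section \<open>Positive and negative intervals\<close>

lemma compact_maximal_interval_iff:
  assumes nf: "\<not> free I"
  shows "compact_maximal_interval n A G act I \<gamma> B \<longleftrightarrow> (\<exists>x y. x < y \<and> B = {x..y} \<and> maxint B)"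
proof
  assume "compact_maximal_interval n A G act I \<gamma> B"
  then have B: "compact B" "maxint B" unfolding compact_maximal_interval_def maximal_interval_iff[OF nf] by blast+
  have "\<not> SF I" using SF_imp_free nf by blast
  from maxint_shape[OF B(2) this] show "\<exists>x y. x < y \<and> B = {x..y} \<and> maxint B"
    using B half_open_not_compact ray_half_open by metis
qed (auto simp: compact_maximal_interval_def maximal_interval_iff[OF nf])

text \<open>The sign is decided by the existence of a shift from \<open>x\<close> to
  \<open>y\<close>: with one, both neighbours are attached increasingly; without one, both
  decreasingly.\<close>

lemma compact_interval_sign_exists:
  assumes nf: "\<not> free I" and B: "maxint {x..y}" and xy: "x < y"
  shows "positive_interval n A G act I \<gamma> {x..y} \<or> negative_interval n A G act I \<gamma> {x..y}"
proof -
  obtain lo hi a g f J \<rho> where dec: "decomposes x y lo hi a g f J \<rho>" by (rule decomposes_exists[OF B xy])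
  note D = decD[OF B xy dec]
  note one = index_set_mem[OF D(1,2)]
  let ?i = "index_set lo hi" and ?a = "restrict a (index_set lo hi)"
    and ?c = "restrict (\<lambda>k. stab_class G act I \<gamma> (g k)) (index_set lo hi)"
  note ex = dec_A_decomposition[OF B xy dec nf]
  have cm: "compact_maximal_interval n A G act I \<gamma> {x..y}" unfolding compact_maximal_interval_iff[OF nf] using B xy by blast
  have kk: "g k \<in> carrier G \<and> ?c k = stab_class G act I \<gamma> (g k) \<and> S (g k) (f k) (J k) (\<rho> k) \<and>
      leads_to_from_compact n A {x..y} (\<lambda>t. act (g k) (\<gamma> t)) (piece I lo hi ?a k) \<gamma> (J k \<inter> {x..y}) (\<rho> k)"
    if k: "k = -1 \<or> k = 1" for k
  proof -
    have ki: "k \<in> ?i" using one k by blast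
    have S: "S (g k) (f k) (J k) (\<rho> k)" by (rule max_symmetryD[OF dec_piece(1)[OF B xy dec insertI2[OF ki]]])
    have "piece I lo hi ?a k = piece I lo hi a k" by (rule piece_cong[OF D(1,2) insertI2[OF ki]]) simp
    then show ?thesis using dec_leads_to[OF B xy dec ki] S symD(1)[OF S] ki by simp
  qed
  show ?thesis
  proof (cases "\<exists>h. rel h 1 x y")
    case True
    then obtain h where h: "rel h 1 x y" by blast
    note f = dec_neighbours_increasing[OF B xy dec h]
    have "\<exists>g'\<in>carrier G. ?c k = stab_class G act I \<gamma> g' \<and>
        leads_to_pos n A {x..y} (\<lambda>t. act g' (\<gamma> t)) (piece I lo hi ?a k) \<gamma>" if k: "k \<in> {-1, 1}" for k
    proof -
      have k': "k = -1 \<or> k = 1" using k by blast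
      have S: "S (g k) 1 (J k) (\<rho> k)" using kk[OF k'] f k' by auto
      have "strict_mono_on (J k \<inter> {x..y}) (\<rho> k)" using symD(9)[OF S] by (auto simp: strict_mono_on_def)
      then show ?thesis unfolding leads_to_pos_def using kk[OF k'] by blast
    qed
    then show ?thesis unfolding positive_interval_def using cm ex by blast
  next
    case False
    then have nh: "\<not> rel h 1 x y" for h by blast
    note f = dec_neighbours_decreasing[OF B xy dec nh]
    have "\<exists>g'\<in>carrier G. ?c k = stab_class G act I \<gamma> g' \<and>
        leads_to_neg n A {x..y} (\<lambda>t. act g' (\<gamma> t)) (piece I lo hi ?a k) \<gamma>" if k: "k \<in> {-1, 1}" for k
    proof -
      have k': "k = -1 \<or> k = 1" using k by blast
      have S: "S (g k) (-1) (J k) (\<rho> k)" using kk[OF k'] f k' by auto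
      have "strict_antimono_on (J k \<inter> {x..y}) (\<rho> k)" using symD(9)[OF S] by (auto simp: monotone_on_def)
      then show ?thesis unfolding leads_to_neg_def using kk[OF k'] by blast
    qed
    then show ?thesis unfolding negative_interval_def using cm ex by blast
  qed
qed

lemma monotone_sign:
  fixes e :: real and \<mu> :: "real \<Rightarrow> real"
  assumes "interval K" "\<forall>s\<in>K. \<forall>t\<in>K. s < t \<longrightarrow> e * \<mu> s < e * \<mu> t" "e = 1 \<or> e = -1"
  shows "strict_mono_on K \<mu> \<Longrightarrow> e = 1" "strict_antimono_on K \<mu> \<Longrightarrow> e = -1"
proof -
  obtain u where "u \<in> interior K" using assms(1) by (auto simp: interval_def)
  then obtain r where r: "r > 0" "ball u r \<subseteq> K" using mem_interior by blast
  have uv: "u \<in> K" "u + r/2 \<in> K" "u < u + r/2" using r by (auto simp: subset_iff dist_real_def)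
  have m: "e * \<mu> u < e * \<mu> (u + r/2)" using assms(2) uv by blast
  show "e = 1" if "strict_mono_on K \<mu>"
    using assms(3)
  proof
    assume e: "e = -1"
    have False using m strict_mono_onD[OF that uv] unfolding e by linarith
    then show ?thesis ..
  qed
  show "e = -1" if "strict_antimono_on K \<mu>"
    using assms(3)
  proof
    assume e: "e = 1"
    have False using m monotone_onD[OF that uv] unfolding e by linarith
    then show ?thesis ..
  qed
qed

text \<open>Positivity is given through some decomposition, whose map is known only on a part
  \<open>K\<close> of \<open>[x, y]\<close> with an unspecified least point. The map takes values
  arbitrarily close to \<open>y\<close> from above, and \<open>increasing_limit_at_start\<close>
  turns this into a shift from \<open>x\<close> to \<open>y\<close>.\<close>

lemma positive_interval_shift:
  assumes nf: "\<not> free I" and P: "positive_interval n A G act I \<gamma> {x..y}" and xy: "x < y" and B: "maxint {x..y}"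
  obtains h where "rel h 1 x y"
proof -
  obtain lo hi a c where T: "A_decomposition n A G act I \<gamma> {x..y} lo hi a c"
    and lp: "\<exists>g\<in>carrier G. c 1 = stab_class G act I \<gamma> g \<and> leads_to_pos n A {x..y} (\<lambda>t. act g (\<gamma> t)) (piece I lo hi a 1) \<gamma>"
    using P unfolding positive_interval_def by blast
  have T1: "lo < 0" "0 < hi" "strict_mono_on (index_set lo hi) a" "{x..y} = {a (-1)..a 1}"
      "I = (\<Union>k\<in>insert 0 (index_set lo hi). piece I lo hi a k)"
    using T unfolding A_decomposition_def by - (elim conjE, assumption)+
  note one = index_set_mem[OF T1(1,2)]
  have a1: "a 1 = y" using T1(4) xy by (auto simp: Icc_eq_Icc)
  let ?D = "piece I lo hi a 1"
  have DI: "?D \<subseteq> I" using T1(5) one by blast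
  have xyI': "{x..y} \<subseteq> I" by (rule maxintD(3)[OF B])
  have yI: "y \<in> I" "x \<in> I" using xyI' xy by auto
  have "y \<in> ?D \<and> (\<forall>d\<in>?D. y \<le> d)"
  proof (cases "hi = Fin 1")
    case True
    then have "?D = I \<inter> {y..}" using a1 by (simp add: piece_def)
    then show ?thesis using yI by auto
  next
    case False
    then have "1 + 1 \<in> index_set lo hi" using index_set_Suc(1)[OF T1(1,2) one(1)] by simp
    then have "a 1 < a (1 + 1)" using T1(3) one(1) unfolding strict_mono_on_def by simp
    moreover have "?D = {y..a (1 + 1)}" using False a1 by (simp add: piece_def)
    ultimately show ?thesis using a1 by auto
  qed
  then have yD: "y \<in> ?D" and ymin: "\<And>d. d \<in> ?D \<Longrightarrow> y \<le> d" by blast+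
  obtain h K \<mu> where h: "h \<in> carrier G" and L: "leads_to_from_compact n A {x..y} (\<lambda>t. act h (\<gamma> t)) ?D \<gamma> K \<mu>"
    and mo: "strict_mono_on K \<mu>"
    using lp unfolding leads_to_pos_def by blast
  obtain e where S: "S h e (interior K) \<mu>" and e: "e = 1 \<or> e = -1"
    and mn: "\<forall>s\<in>K. \<forall>t\<in>K. s < t \<longrightarrow> e * \<mu> s < e * \<mu> t" and c: "continuous_on K \<mu>"
    and K: "interval K" "K \<subseteq> {x..y}" "?D = \<mu> ` K"
    by (rule leads_to_symmetry[OF h xyI' DI L])
  have "e = 1" by (rule monotone_sign(1)[OF K(1) mn e mo])
  then have S1: "S h 1 (interior K) \<mu>" using S by simp
  \<comment> \<open>The preimage of the least point \<open>y\<close> of the piece is the least point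
    of \<open>K\<close>; parameters just right of it are interior and have values just above
    \<open>y\<close>.\<close>
  obtain s0 where s0: "s0 \<in> K" "\<mu> s0 = y" using yD K(3) by auto
  have s0min: "s0 \<le> s" if "s \<in> K" for s
  proof (rule ccontr)
    assume "\<not> s0 \<le> s"
    then have "\<mu> s < \<mu> s0" using strict_mono_onD[OF mo that s0(1)] by simp
    then show False using ymin[of "\<mu> s"] K(3) that s0(2) by auto
  qed
  obtain s1 where s1: "s1 \<in> interior K" using K(1) by (auto simp: interval_def)
  then obtain r where r: "r > 0" "ball s1 r \<subseteq> K" using mem_interior by blast
  have "s1 - r/2 \<in> K" using r by (auto simp: subset_iff dist_real_def)
  then have s01: "s0 < s1" using s0min r(1) by fastforce
  have s1K: "s1 \<in> K" using s1 interior_subset by blast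
  have cK: "connected K" using K(1) by (simp add: interval_def)
  have "{s0<..<s1} \<subseteq> K" using connected_real_between[OF cK s0(1) s1K] by auto
  then have int: "{s0<..<s1} \<subseteq> interior K" by (rule interior_maximal[OF _ open_greaterThanLessThan])
  obtain J \<rho> where M: "max_symmetry h 1 J \<rho>" "s1 \<in> J" "\<rho> s1 = \<mu> s1" by (rule rel_max[OF relI[OF S1 s1]])
  have st: "inv h \<otimes> h \<in> stab" using stab_class_eq_iff[OF h h] by blast
  have sub: "interior K \<subseteq> J" and eq: "\<And>t. t \<in> interior K \<Longrightarrow> \<rho> t = \<mu> t"
    by (rule max_symmetry_mono(1)[OF M(1) S1 st M(2) s1 M(3)], rule max_symmetry_mono(2)[OF M(1) S1 st M(2) s1 M(3)])
  have "rel h 1 x y"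
  proof (rule increasing_limit_at_start[OF maxintD(4)[OF B] xy yI(2,1) M(1)])
    fix \<delta> :: real assume \<delta>: "\<delta> > 0"
    obtain \<eta> where \<eta>: "\<eta> > 0" "\<forall>s\<in>K. dist s s0 < \<eta> \<longrightarrow> dist (\<mu> s) (\<mu> s0) < \<delta>"
      using c s0(1) \<delta> unfolding continuous_on_iff by blast
    define s where "s = s0 + min \<eta> (s1 - s0) / 2"
    have s: "s0 < s" "s < s1" "dist s s0 < \<eta>" using \<eta>(1) s01 by (auto simp: s_def dist_real_def min_def field_simps)
    have si: "s \<in> interior K" using int s by auto
    then have sK: "s \<in> K" using interior_subset by blast
    have sxy: "x < s" "s < y"
      using interior_mono[OF K(2)] si by auto
    have "\<mu> s < y + \<delta>" using \<eta>(2) sK s(3) s0(2) by (force simp: dist_real_def)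
    moreover have "y \<le> \<mu> s" using ymin K(3) sK by blast
    ultimately show "\<exists>s\<in>J. x < s \<and> s < y \<and> y \<le> \<rho> s \<and> \<rho> s < y + \<delta>"
      using sub si eq[OF si] sxy by auto
  qed
  then show thesis by (rule that)
qed

text \<open>A decreasing symmetry has a fixed point, so a single neighbour attached decreasingly
  suffices.\<close>

lemma negative_interval_reflection:
  assumes P: "negative_interval n A G act I \<gamma> {x..y}" and B: "maxint {x..y}"
  obtains h z where "rel h (-1) z z"
proof -
  obtain lo hi a c where T: "A_decomposition n A G act I \<gamma> {x..y} lo hi a c"
    and lp: "\<exists>g\<in>carrier G. c 1 = stab_class G act I \<gamma> g \<and> leads_to_neg n A {x..y} (\<lambda>t. act g (\<gamma> t)) (piece I lo hi a 1) \<gamma>"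
    using P unfolding negative_interval_def by blast
  have T1: "lo < 0" "0 < hi" "I = (\<Union>k\<in>insert 0 (index_set lo hi). piece I lo hi a k)"
    using T unfolding A_decomposition_def by - (elim conjE, assumption)+
  have DI: "piece I lo hi a 1 \<subseteq> I" using T1(3) index_set_mem[OF T1(1,2)] by blast
  obtain h K \<mu> where h: "h \<in> carrier G"
    and L: "leads_to_from_compact n A {x..y} (\<lambda>t. act h (\<gamma> t)) (piece I lo hi a 1) \<gamma> K \<mu>"
    and mo: "strict_antimono_on K \<mu>"
    using lp unfolding leads_to_neg_def by blast
  obtain e where S: "S h e (interior K) \<mu>" and e: "e = 1 \<or> e = -1"
    and mn: "\<forall>s\<in>K. \<forall>t\<in>K. s < t \<longrightarrow> e * \<mu> s < e * \<mu> t" and K: "interval K"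
    by (rule leads_to_symmetry[OF h maxintD(3)[OF B] DI L])
  have "e = -1" by (rule monotone_sign(2)[OF K mn e mo])
  moreover obtain s where "s \<in> interior K" using K by (auto simp: interval_def)
  ultimately have "rel h (-1) s (\<mu> s)" using relI[OF S] by simp
  then show thesis by (rule decreasing_fixed_point) (rule that)
qed

text \<open>Positivity and negativity exclude each other even for different compact maximal
  intervals: the former yields a shift along one of them, the latter a reflection at some point of
  \<open>I\<close>, and a shift along one compact maximal interval forbids reflections
  everywhere.\<close>

theorem decomposition_dichotomy:
  assumes nf: "\<not> free I" and B0: "maxint B0"
  shows "((\<exists>!(\<tau>, c). tau_decomposition n A G act I \<gamma> \<tau> c) \<longleftrightarrow>
          \<not> (\<exists>B. compact_maximal_interval n A G act I \<gamma> B)) \<and>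
         ((\<exists>B. compact_maximal_interval n A G act I \<gamma> B) \<longrightarrow>
           (positive_curve n A G act I \<gamma> \<longleftrightarrow> \<not> negative_curve n A G act I \<gamma>) \<and>
           (\<forall>B. compact_maximal_interval n A G act I \<gamma> B \<longrightarrow>
             (\<exists>!(lo, hi, a, c). A_decomposition n A G act I \<gamma> B lo hi a c)))"
proof (intro conjI impI allI)
  have nSF: "\<not> SF I" using SF_imp_free nf by blast
  note cm = compact_maximal_interval_iff[OF nf]
  show "(\<exists>!(\<tau>, c). tau_decomposition n A G act I \<gamma> \<tau> c) \<longleftrightarrow>
      \<not> (\<exists>B. compact_maximal_interval n A G act I \<gamma> B)"
  proof
    assume "\<exists>!(\<tau>, c). tau_decomposition n A G act I \<gamma> \<tau> c"
    then obtain \<tau> c where "tau_decomposition n A G act I \<gamma> \<tau> c" by auto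
    then show "\<not> (\<exists>B. compact_maximal_interval n A G act I \<gamma> B)" using tau_decomposition_not_compact by blast
  next
    assume "\<not> (\<exists>B. compact_maximal_interval n A G act I \<gamma> B)"
    then have nc: "\<not> maxint {x..y}" if "x < y" for x y using cm that by blast
    obtain \<tau> g J \<rho> where r: "\<tau> \<in> I" "max_symmetry g (-1) J \<rho>" "\<tau> \<in> J" "\<rho> \<tau> = \<tau>"
      "\<forall>B. maxint B \<longleftrightarrow> B = I \<inter> {..\<tau>} \<or> B = I \<inter> {\<tau>..}"
      by (rule reflection_case[OF nSF B0 nc], assumption) (rule that, assumption+, blast)
    note ex = tau_decomposition_exists[OF r(1-4) r(5)[rule_format] nf]
    show "\<exists>!(\<tau>, c). tau_decomposition n A G act I \<gamma> \<tau> c"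
    proof (rule ex1I[of _ "(\<tau>, stab_class G act I \<gamma> g)"])
      show "case (\<tau>, stab_class G act I \<gamma> g) of (\<tau>, c) \<Rightarrow> tau_decomposition n A G act I \<gamma> \<tau> c" using ex by simp
      fix p assume p: "case p of (\<tau>, c) \<Rightarrow> tau_decomposition n A G act I \<gamma> \<tau> c"
      show "p = (\<tau>, stab_class G act I \<gamma> g)"
        using tau_decomposition_unique[OF _ ex] p by (cases p) auto
    qed
  qed
  assume ex: "\<exists>B. compact_maximal_interval n A G act I \<gamma> B"
  show "positive_curve n A G act I \<gamma> \<longleftrightarrow> \<not> negative_curve n A G act I \<gamma>"
  proof
    assume "positive_curve n A G act I \<gamma>"
    then obtain B1 where B1: "positive_interval n A G act I \<gamma> B1" unfolding positive_curve_def by (rule exE)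
    have "compact_maximal_interval n A G act I \<gamma> B1" by (rule conjunct1[OF B1[unfolded positive_interval_def]])
    then obtain x y where 1: "x < y" "B1 = {x..y}" "maxint {x..y}"
      unfolding cm by (elim exE conjE) (rule that, assumption+, simp)
    note p1 = B1[unfolded 1(2)]
    obtain h where h: "rel h 1 x y" by (rule positive_interval_shift[OF nf p1 1(1,3)])
    obtain lo hi a g f J \<rho> where dec: "decomposes x y lo hi a g f J \<rho>" by (rule decomposes_exists[OF 1(3,1)])
    show "\<not> negative_curve n A G act I \<gamma>"
    proof
      assume "negative_curve n A G act I \<gamma>"
      then obtain B2 where B2: "negative_interval n A G act I \<gamma> B2" unfolding negative_curve_def by (rule exE)
      have "compact_maximal_interval n A G act I \<gamma> B2" by (rule conjunct1[OF B2[unfolded negative_interval_def]])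
      then obtain x2 y2 where 2: "B2 = {x2..y2}" "maxint {x2..y2}"
        unfolding cm by (elim exE conjE) (rule that, assumption+, simp)
      obtain h' z where R: "rel h' (-1) z z" by (rule negative_interval_reflection[OF B2[unfolded 2(1)] 2(2)])
      show False by (rule notE[OF shift_excludes_all_reflections[OF 1(3,1) dec h] R])
    qed
  next
    assume nn: "\<not> negative_curve n A G act I \<gamma>"
    obtain B1 where "compact_maximal_interval n A G act I \<gamma> B1" using ex by (rule exE)
    then obtain x y where 1: "x < y" "B1 = {x..y}" "maxint {x..y}"
      unfolding cm by (elim exE conjE) (rule that, assumption+, simp)
    show "positive_curve n A G act I \<gamma>"
      using compact_interval_sign_exists[OF nf 1(3,1)]
    proof
      assume "positive_interval n A G act I \<gamma> {x..y}"
      then show ?thesis unfolding positive_curve_def by (rule exI)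
    next
      assume "negative_interval n A G act I \<gamma> {x..y}"
      then have "negative_curve n A G act I \<gamma>" unfolding negative_curve_def by (rule exI)
      with nn show ?thesis by (rule notE)
    qed
  qed
  fix B assume "compact_maximal_interval n A G act I \<gamma> B"
  then obtain x y where 1: "x < y" "B = {x..y}" "maxint {x..y}"
    unfolding cm by (elim exE conjE) (rule that, assumption+, simp)
  obtain lo hi a g f J \<rho> where dec: "decomposes x y lo hi a g f J \<rho>" by (rule decomposes_exists[OF 1(3,1)])
  let ?t = "(lo, hi, restrict a (index_set lo hi), restrict (\<lambda>k. stab_class G act I \<gamma> (g k)) (index_set lo hi))"
  show "\<exists>!(lo, hi, a, c). A_decomposition n A G act I \<gamma> B lo hi a c"
    unfolding 1(2)
  proof (rule ex1I[of _ ?t])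
    show "case ?t of (lo, hi, a, c) \<Rightarrow> A_decomposition n A G act I \<gamma> {x..y} lo hi a c"
      unfolding prod.case by (rule dec_A_decomposition[OF 1(3,1) dec nf])
    fix p assume p: "case p of (lo, hi, a, c) \<Rightarrow> A_decomposition n A G act I \<gamma> {x..y} lo hi a c"
    obtain lo' hi' a' c' where p': "p = (lo', hi', a', c')" by (cases p) auto
    then have "A_decomposition n A G act I \<gamma> {x..y} lo' hi' a' c'" using p by simp
    from A_decomposition_unique[OF 1(3,1) dec this] show "p = ?t" unfolding p' by simp
  qed
qed

end

section \<open>From the definitions of the theorem to the analytic setting\<close>

text \<open>The extension witnessing the immersion agrees with \<open>\<gamma>\<close> on the open
  set \<open>I\<close>, and analyticity and regularity are local.\<close>

lemma open_immersion_of_analytic_immersion: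
  assumes at: "analytic_atlas n A" and I: "open_interval I" and im: "analytic_immersion n A I \<gamma>"
  shows "open_immersion n A I \<gamma>"
proof -
  obtain J \<delta> where J: "I \<subseteq> J" "open_immersion n A J \<delta>" "\<forall>t\<in>I. \<delta> t = \<gamma> t"
    using im unfolding analytic_immersion_def by blast
  have iff: "open_immersion n A J \<gamma> \<longleftrightarrow> open_interval J \<and> (\<forall>t\<in>J. analytic_curve_at n A \<gamma> t \<and> regular_at n A \<gamma> t)"
    for J and \<gamma> :: "real \<Rightarrow> 'a"
    by (rule open_immersion_iff) (rule chartD(1)[OF at])
  have opI: "open I" using I by (simp add: open_interval_def)
  have "analytic_curve_at n A \<gamma> t \<and> regular_at n A \<gamma> t" if t: "t \<in> I" for t
  proof -
    have ev: "\<forall>\<^sub>F s in nhds t. \<delta> s = \<gamma> s"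
      using eventually_nhds_in_open[OF opI t] by eventually_elim (use J(3) in simp)
    have "analytic_curve_at n A \<delta> t" "regular_at n A \<delta> t" using J(1,2) t unfolding iff by blast+
    then show ?thesis using analytic_curve_at_cong[OF ev] regular_at_cong[OF ev] by blast
  qed
  then show ?thesis unfolding iff using I by blast
qed

theorem theoremC:
  fixes G :: "('g::t2_space, 'r) monoid_scheme" and nG :: nat and AG :: "'g chart set"
    and nM :: nat and AM :: "'m::t2_space chart set"
    and act :: "'g \<Rightarrow> 'm \<Rightarrow> 'm"
    and I :: "real set" and \<gamma> :: "real \<Rightarrow> 'm"
  assumes "lie_group G nG AG"
    and "analytic_atlas nM AM"
    and "group_action G UNIV act"
    and "\<And>x. continuous_on UNIV (\<lambda>g. act g x)"
    and "\<And>g. g \<in> carrier G \<Longrightarrow> analytic_map nM AM nM AM UNIV (act g)"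
    and "sated G act"
    and "open_interval I"
    and "analytic_immersion nM AM I \<gamma>"
    and "free_curve nM AM G act I \<gamma>"
    and "\<not> free_segment nM AM G act I \<gamma>"
  shows "((\<exists>!(\<tau>, c). tau_decomposition nM AM G act I \<gamma> \<tau> c) \<longleftrightarrow>
          \<not> (\<exists>B. compact_maximal_interval nM AM G act I \<gamma> B)) \<and>
         ((\<exists>B. compact_maximal_interval nM AM G act I \<gamma> B) \<longrightarrow>
           (positive_curve nM AM G act I \<gamma> \<longleftrightarrow> \<not> negative_curve nM AM G act I \<gamma>) \<and>
           (\<forall>B. compact_maximal_interval nM AM G act I \<gamma> B \<longrightarrow>
             (\<exists>!(lo, hi, a, c). A_decomposition nM AM G act I \<gamma> B lo hi a c)))"
proof -
  have im: "open_immersion nM AM I \<gamma>"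
    by (rule open_immersion_of_analytic_immersion[OF assms(2,7,8)])
  interpret analytic_setting G act nM AM I \<gamma>
    by (rule analytic_setting.intro[OF assms(3)], rule analytic_setting_axioms.intro[OF assms(2,5,6) im])
  have iI: "interval I" using assms(7) by (simp add: open_interval_def)
  have nf: "\<not> local_symmetries.free G act I \<gamma> I"
    using free_segment_iff[OF iI subset_refl] assms(10) by simp
  obtain D where D: "interval D" "D \<subseteq> I" "free_segment nM AM G act D \<gamma>"
    using assms(9) unfolding free_curve_def by blast
  have cD: "connected D" "interior D \<noteq> {}" using D(1) by (simp_all add: interval_def)
  have "local_symmetries.free G act I \<gamma> D" using D free_segment_iff by blast
  \<comment> \<open>The free piece \<open>D\<close> of the curve satisfies \<open>SF\<close>, which
    provides the maximal interval that the dichotomy starts from.\<close>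
  note SFD = free_imp_SF[OF cD(1) this nf]
  obtain B0 where "maxint B0" by (rule maxint_exists[OF cD D(2) SFD])
  then show ?thesis by (rule decomposition_dichotomy[OF nf])
qed

end
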